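(* Let $\theta>0$ and $1<p<\infty$. Let $u\in\mathcal L_p(G)$ and $f=Lu$. Assume further that $f\in\Lambda_\theta^p(G)$. Then for all $i,j\in I$, $$\Lambda_{\theta+2}^p(u)<\infty,\qquad \Lambda_{\theta+1}^p(X_iu)<\infty,\qquad \Lambda_\theta^p(X_iX_ju)<\infty .$$ Moreover, $-\sum_{i\in I}X_i^2u$ converges to $Lu$ with respect to the seminorm $\Lambda_\theta^p(\cdot)$.
   Context: Setting: $G$ is a compact connected metrizable group with normalized Haar measure $\nu$ and neutral element $e$; $\|\cdot\|_p$ is the norm of $L^p(G)=L^p(G,\nu)$. $(K_\alpha)_{\alpha\in\aleph}$ ($\aleph$ finite or countable) is a descending family of compact normal subgroups with $\bigcap_\alpha K_\alpha=\{e\}$ such that each $G_\alpha=G/K_\alpha$ is a Lie group; $\pi_\alpha:G\to G_\alpha$ is the projection. The Bruhat test functions are $\mathcal B(G)=\{\phi\circ\pi_\alpha:\alpha\in\aleph,\ \phi\in\mathcal C^\infty(G_\alpha)\}$. The Lie algebra $\mathfrak G$ of $G$ is the projective limit of the Lie algebras $\mathfrak G_\alpha$ of $G_\alpha$; its elements act on $\mathcal B(G)$ as left-invariant vector fields by $X(\phi\circ\pi_\alpha)=(d\pi_\alpha(X)\phi)\circ\pi_\alpha$. A projective basis of $\mathfrak G$ is a family $(X_i)_{i\in I}$ ($I$ finite or countable, enumerated as $1,2,\dots$) in $\mathfrak G$ such that for each $\alpha$ there is a finite $I_\alpha\subset I$ with $(d\pi_\alpha(X_i))_{i\in I_\alpha}$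 a basis of $\mathfrak G_\alpha$ and $d\pi_\alpha(X_i)=0$ for $i\notin I_\alpha$. $(\mu_t)_{t>0}$ is a weakly continuous Gaussian convolution semigroup of probability measures on $G$ (i.e. $\mu_t*\mu_s=\mu_{t+s}$; $\mu_t\to\delta_e$ weakly as $t\to0$; $t^{-1}\mu_t(V^c)\to0$ as $t\to0$ for every neighborhood $V$ of $e$) that is symmetric ($\mu_t(A)=\mu_t(A^{-1})$), central ($\mu_t(a^{-1}Aa)=\mu_t(A)$ for all $a\in G$) and non-degenerate ($\operatorname{supp}\mu_t=G$ for all $t>0$). $H_tf(x)=\int_Gf(xy)\,d\mu_t(y)$ is the associated self-adjoint Markov semigroup on $L^2(G,\nu)$ and $-L$ its generator; $L$ is bi-invariant. A projective basis $(X_i)_{i\in I}$ is fixed such that $L=-\sum_{i\in I}X_i^2$ on $\mathcal B(G)$ (such a basis always exists). $\mathcal L_p(G)$ is the completion of $\mathcal B(G)$ with respect to $\|u\|_p+\|Lu\|_p$ (for $1<p<\infty$, the domain of the $L^p$-generator of $(H_t)$). Derivatives $X_iu$, $X_iX_ju$ are understood in the distribution sense against $\mathcal B(G)$. Semigroup Lipschitz seminorm: for $\theta>0$, $\Lambda_\theta^p(f)=\sup_{t>0}t^{n-\theta/2}\big\|\frac{\partial^n}{\partial t^n}H_tf\big\|_p$ where $n$ is the smallest integer strictly greater than $\theta/2$. The space $\Lambda_\theta^p(G)$ is the completion of $\{f\in\mathcal B(G):\Lambda_\theta^p(f)<\infty\}$ with respect to $\|f\|_p+\Lambda_\theta^p(f)$.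 Convergence of the series means $\Lambda_\theta^p\big(Lu+\sum_{i\le m}X_i^2u\big)\to0$ as $m\to\infty$. *)

theory Defs
  imports "HOL-Probability.Probability" "HOL-Algebra.Coset"
begin

section \<open>Topological groups and their quotients\<close>

locale topological_group = group G
  for G :: "('g, 'm) monoid_scheme" (structure) +
  fixes T :: "'g topology"
  assumes topspace_eq: "topspace T = carrier G"
    and continuous_mult: "continuous_map (prod_topology T T) T (\<lambda>(x, y). x \<otimes> y)"
    and continuous_inv: "continuous_map T T (\<lambda>x. inv x)"

definition quotient_topology :: "'a topology \<Rightarrow> ('a \<Rightarrow> 'b) \<Rightarrow> 'b topology" where
  "quotient_topology T q =
     topology (\<lambda>U. U \<subseteq> q ` topspace T \<and> openin T {x \<in> topspace T. q x \<in> U})"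

lemma openin_quotient_topology:
  "openin (quotient_topology T q) U \<longleftrightarrow>
     U \<subseteq> q ` topspace T \<and> openin T {x \<in> topspace T. q x \<in> U}"
proof -
  have "istopology (\<lambda>U. U \<subseteq> q ` topspace T \<and> openin T {x \<in> topspace T. q x \<in> U})"
    unfolding istopology_def
  proof (intro conjI allI impI)
    fix S U
    assume "S \<subseteq> q ` topspace T \<and> openin T {x \<in> topspace T. q x \<in> S}"
      and "U \<subseteq> q ` topspace T \<and> openin T {x \<in> topspace T. q x \<in> U}"
    moreover have "{x \<in> topspace T. q x \<in> S \<inter> U} =
        {x \<in> topspace T. q x \<in> S} \<inter> {x \<in> topspace T. q x \<in> U}" by auto
    ultimately show "S \<inter> U \<subseteq> q ` topspace T" "openin T {x \<in> topspace T. q x \<in> S \<inter> U}"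
      by auto
  next
    fix \<K>
    assume *: "\<forall>U\<in>\<K>. U \<subseteq> q ` topspace T \<and> openin T {x \<in> topspace T. q x \<in> U}"
    then show "\<Union>\<K> \<subseteq> q ` topspace T" by auto
    have "{x \<in> topspace T. q x \<in> \<Union>\<K>} = (\<Union>U\<in>\<K>. {x \<in> topspace T. q x \<in> U})" by auto
    then show "openin T {x \<in> topspace T. q x \<in> \<Union>\<K>}" using * by auto
  qed
  then show ?thesis by (simp add: quotient_topology_def topology_inverse')
qed

abbreviation coset_topology :: "('g, 'm) monoid_scheme \<Rightarrow> 'g topology \<Rightarrow> 'g set \<Rightarrow> 'g set topology"
  where "coset_topology G T K \<equiv> quotient_topology T (\<lambda>x. K #>\<^bsub>G\<^esub> x)"


section \<open>Smooth manifolds and Lie groups\<close>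

text \<open>Smoothness of a real function on an open subset \<open>U\<close> of the library's
  \<open>Euclidean_space d\<close>, whose points are the sequences vanishing from index \<open>d\<close> on:
  all iterated partial derivatives exist and are continuous on \<open>U\<close>.
  The function \<open>F [i\<^sub>1, \<dots>, i\<^sub>k]\<close> is the iterated partial derivative
  in the directions \<open>i\<^sub>k\<close>, then \<open>\<dots>\<close>, then \<open>i\<^sub>1\<close>.\<close>

definition smooth_fun_on :: "nat \<Rightarrow> (nat \<Rightarrow> real) set \<Rightarrow> ((nat \<Rightarrow> real) \<Rightarrow> real) \<Rightarrow> bool" where
  "smooth_fun_on d U f \<longleftrightarrow>
     (\<exists>F :: nat list \<Rightarrow> (nat \<Rightarrow> real) \<Rightarrow> real.
        (\<forall>x\<in>U. F [] x = f x) \<and>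
        (\<forall>w. set w \<subseteq> {..<d} \<longrightarrow>
           continuous_map (subtopology (Euclidean_space d) U) euclideanreal (F w) \<and>
           (\<forall>i<d. \<forall>x\<in>U.
              ((\<lambda>s. F w (x(i := s))) has_real_derivative F (i # w) x) (at (x i)))))"

text \<open>A dimension together with an atlas; a chart is a domain with a coordinate map.\<close>

type_synonym 'a mfd = "nat \<times> ('a set \<times> ('a \<Rightarrow> nat \<Rightarrow> real)) set"

text \<open>Only applied to continuous \<open>h\<close>, for which the domains in coordinates are open.\<close>

definition smooth_map :: "'a mfd \<Rightarrow> 'b mfd \<Rightarrow> ('a \<Rightarrow> 'b) \<Rightarrow> bool" where
  "smooth_map M N h \<longleftrightarrow>
     (\<forall>(U, \<phi>) \<in> snd M. \<forall>(V, \<psi>) \<in> snd N. \<forall>k < fst N.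
        smooth_fun_on (fst M) (\<phi> ` {x \<in> U. h x \<in> V})
          (\<lambda>z. \<psi> (h (the_inv_into U \<phi> z)) k))"

definition smooth_mfd :: "'a topology \<Rightarrow> 'a mfd \<Rightarrow> bool" where
  "smooth_mfd T M \<longleftrightarrow>
     Hausdorff_space T \<and> second_countable T \<and>
     (\<Union>(U, \<phi>) \<in> snd M. U) = topspace T \<and>
     (\<forall>(U, \<phi>) \<in> snd M.
        openin T U \<and> openin (Euclidean_space (fst M)) (\<phi> ` U) \<and>
        homeomorphic_map (subtopology T U) (subtopology (Euclidean_space (fst M)) (\<phi> ` U)) \<phi>) \<and>
     smooth_map M M (\<lambda>x. x)"

definition prod_mfd :: "'a mfd \<Rightarrow> 'b mfd \<Rightarrow> ('a \<times> 'b) mfd" where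
  "prod_mfd M N =
     (fst M + fst N,
      {(U \<times> V, \<lambda>(x, y) k. if k < fst M then \<phi> x k else \<psi> y (k - fst M)) | U \<phi> V \<psi>.
         (U, \<phi>) \<in> snd M \<and> (V, \<psi>) \<in> snd N})"

definition lie_group :: "('a, 'm) monoid_scheme \<Rightarrow> 'a topology \<Rightarrow> 'a mfd \<Rightarrow> bool" where
  "lie_group H T M \<longleftrightarrow>
     topological_group H T \<and> smooth_mfd T M \<and>
     smooth_map (prod_mfd M M) M (\<lambda>(x, y). x \<otimes>\<^bsub>H\<^esub> y) \<and>
     smooth_map M M (\<lambda>x. inv\<^bsub>H\<^esub> x)"

text \<open>Functions are total in HOL.  Smooth functions are normalised to vanish off the carrier \<open>S\<close>,
  so that equality of smooth functions is equality in HOL; composition with a map on \<open>S\<close>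
  is normalised accordingly.\<close>

definition smooth_functions :: "'a set \<Rightarrow> 'a mfd \<Rightarrow> ('a \<Rightarrow> real) set" where
  "smooth_functions S M =
     {f. (\<forall>x. x \<notin> S \<longrightarrow> f x = 0) \<and>
         (\<forall>(U, \<phi>) \<in> snd M. smooth_fun_on (fst M) (\<phi> ` U) (\<lambda>z. f (the_inv_into U \<phi> z)))}"

definition pull :: "'a set \<Rightarrow> ('a \<Rightarrow> 'b) \<Rightarrow> ('b \<Rightarrow> real) \<Rightarrow> 'a \<Rightarrow> real" where
  "pull S q f = (\<lambda>x. if x \<in> S then f (q x) else 0)"

type_synonym 'a operator = "('a \<Rightarrow> real) \<Rightarrow> 'a \<Rightarrow> real"

text \<open>Left-invariant vector fields, as derivations of the algebra of smooth functions that commute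
  with left translations.  They are set to zero off that algebra, so that two of them are equal iff
  they agree on smooth functions.\<close>

definition lie_algebra :: "('a, 'm) monoid_scheme \<Rightarrow> 'a mfd \<Rightarrow> 'a operator set" where
  "lie_algebra H M = (let C = smooth_functions (carrier H) M in
     {D. (\<forall>f\<in>C. D f \<in> C) \<and>
         (\<forall>f. f \<notin> C \<longrightarrow> D f = (\<lambda>x. 0)) \<and>
         (\<forall>f\<in>C. \<forall>g\<in>C. D (\<lambda>x. f x + g x) = (\<lambda>x. D f x + D g x)) \<and>
         (\<forall>c. \<forall>f\<in>C. D (\<lambda>x. c * f x) = (\<lambda>x. c * D f x)) \<and>
         (\<forall>f\<in>C. \<forall>g\<in>C. D (\<lambda>x. f x * g x) = (\<lambda>x. D f x * g x + f x * D g x)) \<and>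
         (\<forall>a\<in>carrier H. \<forall>f\<in>C.
            D (pull (carrier H) (\<lambda>x. a \<otimes>\<^bsub>H\<^esub> x) f) =
            pull (carrier H) (\<lambda>x. a \<otimes>\<^bsub>H\<^esub> x) (D f))})"

definition is_basis_of :: "nat set \<Rightarrow> (nat \<Rightarrow> 'a operator) \<Rightarrow> 'a operator set \<Rightarrow> bool" where
  "is_basis_of J E V \<longleftrightarrow> finite J \<and> (\<forall>i\<in>J. E i \<in> V) \<and>
     (\<forall>c. (\<lambda>f x. \<Sum>i\<in>J. c i * E i f x) = (\<lambda>f x. 0) \<longrightarrow> (\<forall>i\<in>J. c i = 0)) \<and>
     (\<forall>D\<in>V. \<exists>c. D = (\<lambda>f x. \<Sum>i\<in>J. c i * E i f x))"


section \<open>Compact groups as projective limits of Lie groups\<close>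

text \<open>The family of kernels is directed downwards by inclusion, which covers descending sequences.
  The manifold structure \<open>M \<alpha>\<close> on \<open>G/K\<^sub>\<alpha>\<close> is unique up to diffeomorphism by the identity; it is
  carried along as a parameter.\<close>

locale lie_projective_system = topological_group G T
  for G :: "('g, 'm) monoid_scheme" (structure) and T +
  fixes \<A> :: "'i set" and K :: "'i \<Rightarrow> 'g set" and M :: "'i \<Rightarrow> 'g set mfd"
  assumes compact: "compact_space T"
    and connected: "connected_space T"
    and metrizable: "metrizable_space T"
    and countable_index: "countable \<A>"
    and nonempty_index: "\<A> \<noteq> {}"
    and kernel_normal: "\<alpha> \<in> \<A> \<Longrightarrow> K \<alpha> \<lhd> G"
    and kernel_compact: "\<alpha> \<in> \<A> \<Longrightarrow> compactin T (K \<alpha>)"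
    and descending: "\<alpha> \<in> \<A> \<Longrightarrow> \<beta> \<in> \<A> \<Longrightarrow> \<exists>\<gamma>\<in>\<A>. K \<gamma> \<subseteq> K \<alpha> \<inter> K \<beta>"
    and Inter_kernel: "(\<Inter>\<alpha>\<in>\<A>. K \<alpha>) = {\<one>}"
    and quotient_lie: "\<alpha> \<in> \<A> \<Longrightarrow> lie_group (G Mod K \<alpha>) (coset_topology G T (K \<alpha>)) (M \<alpha>)"

abbreviation quotient_smooth ::
  "('g, 'm) monoid_scheme \<Rightarrow> ('i \<Rightarrow> 'g set) \<Rightarrow> ('i \<Rightarrow> 'g set mfd) \<Rightarrow> 'i \<Rightarrow> ('g set \<Rightarrow> real) set"
  where "quotient_smooth G K M \<alpha> \<equiv> smooth_functions (carrier (G Mod K \<alpha>)) (M \<alpha>)"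

abbreviation lift :: "('g, 'm) monoid_scheme \<Rightarrow> 'g set \<Rightarrow> ('g set \<Rightarrow> real) \<Rightarrow> 'g \<Rightarrow> real"
  where "lift G N \<equiv> pull (carrier G) (\<lambda>x. N #>\<^bsub>G\<^esub> x)"

definition test_functions ::
  "('g, 'm) monoid_scheme \<Rightarrow> 'i set \<Rightarrow> ('i \<Rightarrow> 'g set) \<Rightarrow> ('i \<Rightarrow> 'g set mfd) \<Rightarrow> ('g \<Rightarrow> real) set" where
  "test_functions G \<A> K M = {lift G (K \<alpha>) \<phi> | \<alpha> \<phi>. \<alpha> \<in> \<A> \<and> \<phi> \<in> quotient_smooth G K M \<alpha>}"

text \<open>An element \<open>X\<close> of the projective limit of the Lie algebras is the compatible family of its
  images \<open>X \<alpha> = d\<pi>\<^sub>\<alpha>(X)\<close>.  For \<open>K\<^sub>\<beta> \<subseteq> K\<^sub>\<alpha>\<close> the projection \<open>G/K\<^sub>\<beta> \<rightarrow> G/K\<^sub>\<alpha>\<close> is \<open>C \<mapsto> K\<^sub>\<alpha> C\<close>.\<close>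

definition projective_lie_algebra ::
  "('g, 'm) monoid_scheme \<Rightarrow> 'i set \<Rightarrow> ('i \<Rightarrow> 'g set) \<Rightarrow> ('i \<Rightarrow> 'g set mfd)
     \<Rightarrow> ('i \<Rightarrow> 'g set operator) set" where
  "projective_lie_algebra G \<A> K M =
     {X. (\<forall>\<alpha>\<in>\<A>. X \<alpha> \<in> lie_algebra (G Mod K \<alpha>) (M \<alpha>)) \<and>
         (\<forall>\<alpha>\<in>\<A>. \<forall>\<beta>\<in>\<A>. K \<beta> \<subseteq> K \<alpha> \<longrightarrow>
            (\<forall>\<phi> \<in> quotient_smooth G K M \<alpha>.
               X \<beta> (pull (carrier (G Mod K \<beta>)) (\<lambda>C. K \<alpha> <#>\<^bsub>G\<^esub> C) \<phi>) =
               pull (carrier (G Mod K \<beta>)) (\<lambda>C. K \<alpha> <#>\<^bsub>G\<^esub> C) (X \<alpha> \<phi>)))}"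

text \<open>The value does not depend on how \<open>f\<close> is written as a lift, because the family \<open>X\<close> is
  compatible and the kernels are directed.\<close>

definition lie_action ::
  "('g, 'm) monoid_scheme \<Rightarrow> 'i set \<Rightarrow> ('i \<Rightarrow> 'g set) \<Rightarrow> ('i \<Rightarrow> 'g set mfd)
     \<Rightarrow> ('i \<Rightarrow> 'g set operator) \<Rightarrow> 'g operator" where
  "lie_action G \<A> K M X f =
     (THE g. \<exists>\<alpha>\<in>\<A>. \<exists>\<phi> \<in> quotient_smooth G K M \<alpha>.
        f = lift G (K \<alpha>) \<phi> \<and> g = lift G (K \<alpha>) (X \<alpha> \<phi>))"

definition projective_basis ::
  "('g, 'm) monoid_scheme \<Rightarrow> 'i set \<Rightarrow> ('i \<Rightarrow> 'g set) \<Rightarrow> ('i \<Rightarrow> 'g set mfd)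
     \<Rightarrow> nat set \<Rightarrow> (nat \<Rightarrow> 'i \<Rightarrow> 'g set operator) \<Rightarrow> bool" where
  "projective_basis G \<A> K M I X \<longleftrightarrow>
     (\<forall>i\<in>I. X i \<in> projective_lie_algebra G \<A> K M) \<and>
     (\<forall>\<alpha>\<in>\<A>. \<exists>J\<subseteq>I. is_basis_of J (\<lambda>i. X i \<alpha>) (lie_algebra (G Mod K \<alpha>) (M \<alpha>)) \<and>
        (\<forall>i\<in>I - J. X i \<alpha> = (\<lambda>f x. 0)))"


section \<open>Haar measure and Gaussian convolution semigroups\<close>

definition borel_sigma :: "'a topology \<Rightarrow> 'a measure" where
  "borel_sigma T = sigma (topspace T) {U. openin T U}"

definition normalized_haar_measure ::
  "('g, 'm) monoid_scheme \<Rightarrow> 'g topology \<Rightarrow> 'g measure \<Rightarrow> bool" where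
  "normalized_haar_measure G T \<nu> \<longleftrightarrow>
     sets \<nu> = sets (borel_sigma T) \<and> prob_space \<nu> \<and>
     (\<forall>a\<in>carrier G. \<forall>A\<in>sets \<nu>. emeasure \<nu> (a <#\<^bsub>G\<^esub> A) = emeasure \<nu> A)"

definition measure_support :: "'a topology \<Rightarrow> 'a measure \<Rightarrow> 'a set" where
  "measure_support T N = {x \<in> topspace T. \<forall>U. openin T U \<and> x \<in> U \<longrightarrow> emeasure N U > 0}"

locale gaussian_semigroup = topological_group G T
  for G :: "('g, 'm) monoid_scheme" (structure) and T +
  fixes \<mu> :: "real \<Rightarrow> 'g measure"
  assumes sets_eq: "t > 0 \<Longrightarrow> sets (\<mu> t) = sets (borel_sigma T)"
    and prob: "t > 0 \<Longrightarrow> prob_space (\<mu> t)"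
    and convolution: "t > 0 \<Longrightarrow> s > 0 \<Longrightarrow>
          distr (\<mu> t \<Otimes>\<^sub>M \<mu> s) (borel_sigma T) (\<lambda>(x, y). x \<otimes> y) = \<mu> (t + s)"
    and weak_limit: "continuous_map T euclideanreal h \<Longrightarrow>
          ((\<lambda>t. \<integral>x. h x \<partial>\<mu> t) \<longlongrightarrow> h \<one>) (at_right 0)"
    and gaussian: "openin T V \<Longrightarrow> \<one> \<in> V \<Longrightarrow>
          ((\<lambda>t. measure (\<mu> t) (carrier G - V) / t) \<longlongrightarrow> 0) (at_right 0)"

locale symmetric_central_gaussian_semigroup = gaussian_semigroup G T \<mu>
  for G :: "('g, 'm) monoid_scheme" (structure) and T \<mu> +
  assumes symmetric: "t > 0 \<Longrightarrow> A \<in> sets (borel_sigma T) \<Longrightarrow>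
          emeasure (\<mu> t) A = emeasure (\<mu> t) ((\<lambda>x. inv x) ` A)"
    and central: "t > 0 \<Longrightarrow> A \<in> sets (borel_sigma T) \<Longrightarrow> a \<in> carrier G \<Longrightarrow>
          emeasure (\<mu> t) ((inv a <# A) #> a) = emeasure (\<mu> t) A"
    and nondegenerate: "t > 0 \<Longrightarrow> measure_support T (\<mu> t) = carrier G"

definition heat ::
  "('g, 'm) monoid_scheme \<Rightarrow> (real \<Rightarrow> 'g measure) \<Rightarrow> real \<Rightarrow> ('g \<Rightarrow> real) \<Rightarrow> 'g \<Rightarrow> real" where
  "heat G \<mu> t f x = (\<integral>y. f (x \<otimes>\<^bsub>G\<^esub> y) \<partial>\<mu> t)"


section \<open>The generator on \<open>L\<^sup>p\<close>\<close>

text \<open>Elements of \<open>L\<^sup>p\<close> are represented by functions; the norm is \<open>\<infinity>\<close> off \<open>L\<^sup>p\<close>.\<close>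

definition Lp_norm :: "'a measure \<Rightarrow> real \<Rightarrow> ('a \<Rightarrow> real) \<Rightarrow> ennreal" where
  "Lp_norm \<nu> p f =
     (if f \<in> borel_measurable \<nu> \<and> integrable \<nu> (\<lambda>x. \<bar>f x\<bar> powr p)
      then ennreal ((\<integral>x. \<bar>f x\<bar> powr p \<partial>\<nu>) powr (1 / p)) else \<infinity>)"

definition Lp :: "'a measure \<Rightarrow> real \<Rightarrow> ('a \<Rightarrow> real) set" where
  "Lp \<nu> p = {f. Lp_norm \<nu> p f < \<infinity>}"

text \<open>\<open>u\<close> lies in the domain of the \<open>L\<^sup>2\<close>-generator \<open>-L\<close> and \<open>Lu = g\<close>.\<close>

definition L2_laplacian ::
  "('g, 'm) monoid_scheme \<Rightarrow> 'g measure \<Rightarrow> (real \<Rightarrow> 'g measure)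
     \<Rightarrow> ('g \<Rightarrow> real) \<Rightarrow> ('g \<Rightarrow> real) \<Rightarrow> bool" where
  "L2_laplacian G \<nu> \<mu> u g \<longleftrightarrow> u \<in> Lp \<nu> 2 \<and> g \<in> Lp \<nu> 2 \<and>
     ((\<lambda>t. Lp_norm \<nu> 2 (\<lambda>x. (heat G \<mu> t u x - u x) / t - (- g x))) \<longlongrightarrow> 0) (at_right 0)"

text \<open>\<open>u\<close> lies in the completion \<open>\<L>\<^sub>p(G)\<close> of the test functions \<open>B\<close> for \<open>\<parallel>u\<parallel>\<^sub>p + \<parallel>Lu\<parallel>\<^sub>p\<close>, realised
  inside \<open>L\<^sup>p\<close>, and \<open>Lu = f\<close> for the continuous extension of \<open>L\<close> to this completion.\<close>

definition Lp_laplacian ::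
  "('g, 'm) monoid_scheme \<Rightarrow> 'g measure \<Rightarrow> (real \<Rightarrow> 'g measure) \<Rightarrow> ('g \<Rightarrow> real) set \<Rightarrow> real
     \<Rightarrow> ('g \<Rightarrow> real) \<Rightarrow> ('g \<Rightarrow> real) \<Rightarrow> bool" where
  "Lp_laplacian G \<nu> \<mu> B p u f \<longleftrightarrow> u \<in> Lp \<nu> p \<and> f \<in> Lp \<nu> p \<and>
     (\<exists>\<phi> g. (\<forall>k::nat. \<phi> k \<in> B \<and> L2_laplacian G \<nu> \<mu> (\<phi> k) (g k)) \<and>
        (\<lambda>k. Lp_norm \<nu> p (\<lambda>x. \<phi> k x - u x)) \<longlonglongrightarrow> 0 \<and>
        (\<lambda>k. Lp_norm \<nu> p (\<lambda>x. g k x - f x)) \<longlonglongrightarrow> 0)"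


section \<open>Distributions\<close>

text \<open>Distributions are functionals, of which only the values on test functions matter.\<close>

definition regular_distr :: "'a measure \<Rightarrow> ('a \<Rightarrow> real) \<Rightarrow> ('a \<Rightarrow> real) \<Rightarrow> real" where
  "regular_distr \<nu> u = (\<lambda>\<phi>. \<integral>x. u x * \<phi> x \<partial>\<nu>)"

text \<open>The sign comes from integration by parts: left-invariant vector fields are skew-symmetric with
  respect to Haar measure.\<close>

definition distr_deriv :: "'a operator \<Rightarrow> (('a \<Rightarrow> real) \<Rightarrow> real) \<Rightarrow> ('a \<Rightarrow> real) \<Rightarrow> real" where
  "distr_deriv D U = (\<lambda>\<phi>. - U (D \<phi>))"


section \<open>Semigroup Lipschitz seminorms\<close>

definition Lp_time_deriv ::
  "'a measure \<Rightarrow> real \<Rightarrow> (real \<Rightarrow> 'a \<Rightarrow> real) \<Rightarrow> (real \<Rightarrow> 'a \<Rightarrow> real) \<Rightarrow> bool" where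
  "Lp_time_deriv \<nu> p F F' \<longleftrightarrow>
     (\<forall>t>0. ((\<lambda>h. Lp_norm \<nu> p (\<lambda>x. (F (t + h) x - F t x) / h - F' t x)) \<longlongrightarrow> 0) (at 0))"

text \<open>\<open>D t\<close> is the \<open>n\<close>-th derivative in time of \<open>H\<^sub>t f\<close>, for all \<open>t > 0\<close>.\<close>

definition heat_time_deriv ::
  "('g, 'm) monoid_scheme \<Rightarrow> 'g measure \<Rightarrow> (real \<Rightarrow> 'g measure) \<Rightarrow> real \<Rightarrow> nat
     \<Rightarrow> ('g \<Rightarrow> real) \<Rightarrow> (real \<Rightarrow> 'g \<Rightarrow> real) \<Rightarrow> bool" where
  "heat_time_deriv G \<nu> \<mu> p n f D \<longleftrightarrow>
     (\<exists>F. F 0 = (\<lambda>t. heat G \<mu> t f) \<and> (\<forall>k<n. Lp_time_deriv \<nu> p (F k) (F (Suc k))) \<and> F n = D)"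

text \<open>The derivative is unique up to null sets, so the infimum merely selects it; the seminorm
  is \<open>\<infinity>\<close> if the derivative does not exist.\<close>

definition lipschitz_seminorm ::
  "('g, 'm) monoid_scheme \<Rightarrow> 'g measure \<Rightarrow> (real \<Rightarrow> 'g measure) \<Rightarrow> real \<Rightarrow> real
     \<Rightarrow> ('g \<Rightarrow> real) \<Rightarrow> ennreal" where
  "lipschitz_seminorm G \<nu> \<mu> p \<theta> f =
     (let n = (LEAST n::nat. real n > \<theta> / 2) in
      INF D \<in> {D. heat_time_deriv G \<nu> \<mu> p n f D}.
        SUP t \<in> {0<..}. ennreal (t powr (real n - \<theta> / 2)) * Lp_norm \<nu> p (D t))"

text \<open>The completion of the test functions of finite seminorm, realised inside \<open>L\<^sup>p\<close>:
  the \<open>L\<^sup>p\<close>-limits of sequences that are Cauchy for the norm and the seminorm.\<close>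

definition lipschitz_space ::
  "('g, 'm) monoid_scheme \<Rightarrow> 'g measure \<Rightarrow> (real \<Rightarrow> 'g measure) \<Rightarrow> ('g \<Rightarrow> real) set
     \<Rightarrow> real \<Rightarrow> real \<Rightarrow> ('g \<Rightarrow> real) set" where
  "lipschitz_space G \<nu> \<mu> B p \<theta> =
     {f \<in> Lp \<nu> p. \<exists>\<phi>. (\<forall>k::nat. \<phi> k \<in> B \<and> lipschitz_seminorm G \<nu> \<mu> p \<theta> (\<phi> k) < \<infinity>) \<and>
        (\<lambda>k. Lp_norm \<nu> p (\<lambda>x. \<phi> k x - f x)) \<longlonglongrightarrow> 0 \<and>
        (\<forall>\<epsilon>>0. \<exists>N. \<forall>k\<ge>N. \<forall>l\<ge>N.
           lipschitz_seminorm G \<nu> \<mu> p \<theta> (\<lambda>x. \<phi> k x - \<phi> l x) < \<epsilon>)}"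

text \<open>Seminorm of a distribution: that of the (a.e. unique) \<open>L\<^sup>p\<close> function which represents it,
  and \<open>\<infinity>\<close> if there is none.\<close>

definition lipschitz_seminorm_distr ::
  "('g, 'm) monoid_scheme \<Rightarrow> 'g measure \<Rightarrow> (real \<Rightarrow> 'g measure) \<Rightarrow> ('g \<Rightarrow> real) set
     \<Rightarrow> real \<Rightarrow> real \<Rightarrow> (('g \<Rightarrow> real) \<Rightarrow> real) \<Rightarrow> ennreal" where
  "lipschitz_seminorm_distr G \<nu> \<mu> B p \<theta> U =
     (INF v \<in> {v \<in> Lp \<nu> p. \<forall>\<phi>\<in>B. U \<phi> = regular_distr \<nu> v \<phi>}. lipschitz_seminorm G \<nu> \<mu> p \<theta> v)"

end

theory Submission
  imports Defs
begin

text \<open>Since \<open>\<mu> t\<close> is central, \<open>H t\<close> is a limit of convex combinations of left translations, which commute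
  with the left-invariant fields \<open>X i\<close>.  So \<open>h = H s \<phi>\<close> can be treated as a test function, and the integral of
  \<open>(h\<^sup>2 + 2 c s (\<Sum>i. (X i h)\<^sup>2)) powr (p / 2)\<close> with \<open>c = min 1 (p - 1)\<close> does not increase in \<open>s\<close>.  This yields the
  dimension-free bound \<open>(2 c t) powr (- 1 / 2)\<close> for the \<open>L\<^sup>p\<close> norm of the gradient of \<open>H t\<close>, and by duality a
  bound \<open>C / t\<close> for \<open>H t\<close> composed with any partial sum of \<open>\<Sum>i. X i (X i \<phi>)\<close>, uniformly in the partial sum.

  An operator \<open>P\<close> that costs a factor \<open>t powr (- \<kappa>)\<close> maps \<open>u\<close>, where \<open>L u = f\<close>, to a function of order
  \<open>\<theta> + 2 - 2 \<kappa>\<close>: the bounds on the time derivatives of \<open>H t (P f)\<close> are integrated down to the order needed, which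
  also shows that \<open>H t (P u)\<close> converges in \<open>L\<^sup>p\<close> as \<open>t\<close> tends to \<open>0\<close>.  Here \<open>\<kappa>\<close> is \<open>1 / 2\<close> for \<open>X i\<close> and \<open>1\<close> for \<open>X i X j\<close>
  and for the tails of the series.  The tails vanish eventually on test functions and are bounded uniformly, which
  gives convergence of the series.\<close>

section \<open>Complements on \<open>L\<^sup>p\<close> norms\<close>

text \<open>The estimates must not depend on the number of fields, since \<open>I\<close> may be
  infinite and the tails of the series have to be bounded together; bounds for single fields cannot
  simply be added, and the square function of the gradient avoids this. In the monotonicity argument
  the time derivative of Q is \<open>A\<close> applied to Q minus two nonnegative terms, and
  integration by parts turns the former into a multiple of the squared gradient of Q. For p < 2 that
  multiple has the wrong sign, and Cauchy-Schwarz lets the nonnegative terms absorb it as long as c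
  is at most p - 1. The recurring obstacle is that \<open>H s \<phi>\<close> is not known to be a
  test function and that test functions are only known to form an algebra. Hence identities are
  first proved for the approximating operators and for polynomials in test functions, and reach
  \<open>H s\<close> and real powers by bounded convergence. Skew-symmetry of the fields for Haar
  measure is derived from the given form of the generator, and smoothness of pullbacks from
  non-degeneracy.\<close>

definition pnorm :: "'a measure \<Rightarrow> real \<Rightarrow> ('a \<Rightarrow> real) \<Rightarrow> real" where
  "pnorm N p f = (\<integral>x. \<bar>f x\<bar> powr p \<partial>N) powr (1 / p)"

lemma Lp_iff:
  "f \<in> Lp N p \<longleftrightarrow> f \<in> borel_measurable N \<and> integrable N (\<lambda>x. \<bar>f x\<bar> powr p)"
  by (auto simp: Lp_def Lp_norm_def)

lemma Lp_norm_eq: "f \<in> Lp N p \<Longrightarrow> Lp_norm N p f = ennreal (pnorm N p f)"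
  by (simp add: Lp_iff Lp_norm_def pnorm_def)

lemma Lp_norm_not_Lp: "f \<notin> Lp N p \<Longrightarrow> Lp_norm N p f = \<infinity>"
  by (simp add: Lp_iff Lp_norm_def)

lemma pnorm_nonneg [simp]: "0 \<le> pnorm N p f"
  by (simp add: pnorm_def)

lemma pnorm_powr: "p > 0 \<Longrightarrow> pnorm N p f powr p = (\<integral>x. \<bar>f x\<bar> powr p \<partial>N)"
  by (simp add: pnorm_def powr_powr)

lemma Lp_measurable: "f \<in> Lp N p \<Longrightarrow> f \<in> borel_measurable N"
  by (simp add: Lp_iff)

lemma Lp_cong_AE:
  assumes "f \<in> Lp N p" "g \<in> borel_measurable N" "AE x in N. f x = g x"
  shows "g \<in> Lp N p" "pnorm N p g = pnorm N p f"
proof -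
  have [measurable]: "f \<in> borel_measurable N" using assms(1) by (simp add: Lp_iff)
  have ae: "AE x in N. \<bar>f x\<bar> powr p = \<bar>g x\<bar> powr p" using assms(3) by eventually_elim simp
  have "integrable N (\<lambda>x. \<bar>f x\<bar> powr p) \<longleftrightarrow> integrable N (\<lambda>x. \<bar>g x\<bar> powr p)"
    by (rule integrable_cong_AE) (use assms(2) ae in measurable)
  then show "g \<in> Lp N p" using assms by (simp add: Lp_iff)
  have "(\<integral>x. \<bar>g x\<bar> powr p \<partial>N) = (\<integral>x. \<bar>f x\<bar> powr p \<partial>N)"
    by (rule integral_cong_AE) (use assms(2) ae in \<open>auto elim: eventually_mono\<close>)
  then show "pnorm N p g = pnorm N p f" by (simp add: pnorm_def)
qed

lemma pnorm_cong: "(\<And>x. x \<in> space N \<Longrightarrow> f x = g x) \<Longrightarrow> pnorm N p f = pnorm N p g"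
  by (simp add: pnorm_def cong: Bochner_Integration.integral_cong)

lemma Lp_cmult:
  assumes "f \<in> Lp N p"
  shows "(\<lambda>x. c * f x) \<in> Lp N p" "p > 0 \<Longrightarrow> pnorm N p (\<lambda>x. c * f x) = \<bar>c\<bar> * pnorm N p f"
  using assms by (auto simp: Lp_iff abs_mult powr_mult pnorm_def powr_powr)

lemma Lp_minus:
  assumes "f \<in> Lp N p"
  shows "(\<lambda>x. - f x) \<in> Lp N p" "pnorm N p (\<lambda>x. - f x) = pnorm N p f"
  using assms by (auto simp: Lp_iff pnorm_def)

lemma abs_add_powr_le:
  fixes a b :: real
  assumes "1 < p"
  shows "\<bar>a + b\<bar> powr p \<le> 2 powr p * (\<bar>a\<bar> powr p + \<bar>b\<bar> powr p)"
proof -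
  have "\<bar>a + b\<bar> powr p \<le> (2 * max \<bar>a\<bar> \<bar>b\<bar>) powr p"
    by (rule powr_mono2) (use assms in auto)
  also have "\<dots> = 2 powr p * (max \<bar>a\<bar> \<bar>b\<bar>) powr p" by (simp add: powr_mult)
  also have "\<dots> \<le> 2 powr p * (\<bar>a\<bar> powr p + \<bar>b\<bar> powr p)"
    by (intro mult_left_mono) (auto simp: max_def)
  finally show ?thesis .
qed

lemma pnorm_eq_0_AE:
  assumes "f \<in> Lp N p" "pnorm N p f = 0" "p > 0"
  shows "AE x in N. f x = 0"
proof -
  have "(\<integral>x. \<bar>f x\<bar> powr p \<partial>N) = 0" using assms pnorm_powr[of p N f] by simp
  then have "AE x in N. \<bar>f x\<bar> powr p = 0"
    using assms by (subst (asm) integral_nonneg_eq_0_iff_AE) (auto simp: Lp_iff)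
  then show ?thesis by eventually_elim (use assms in simp)
qed

text \<open>Young's inequality applied to the two functions scaled to norm 1; norm 0 is treated
  apart because it cannot be scaled.\<close>

lemma Lp_holder:
  assumes f: "f \<in> Lp N p" and g: "g \<in> Lp N q" and pq: "1 < p" "1 < q" "1 / p + 1 / q = 1"
  shows "integrable N (\<lambda>x. f x * g x)"
    and "(\<integral>x. \<bar>f x * g x\<bar> \<partial>N) \<le> pnorm N p f * pnorm N q g"
    and "\<bar>\<integral>x. f x * g x \<partial>N\<bar> \<le> pnorm N p f * pnorm N q g"
proof -
  have [measurable]: "f \<in> borel_measurable N" "g \<in> borel_measurable N"
    and int: "integrable N (\<lambda>x. \<bar>f x\<bar> powr p)" "integrable N (\<lambda>x. \<bar>g x\<bar> powr q)"
    using f g by (auto simp: Lp_iff)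
  have "\<bar>f x * g x\<bar> \<le> \<bar>f x\<bar> powr p / p + \<bar>g x\<bar> powr q / q" for x
    using Youngs_inequality[OF pq, of "\<bar>f x\<bar>" "\<bar>g x\<bar>"] by (simp add: abs_mult)
  then have bd: "norm (f x * g x) \<le> norm (\<bar>f x\<bar> powr p / p + \<bar>g x\<bar> powr q / q)" for x
    unfolding real_norm_def by (rule order_trans[OF _ abs_ge_self])
  show i: "integrable N (\<lambda>x. f x * g x)"
    by (rule Bochner_Integration.integrable_bound[OF _ _ AE_I2[OF bd]])
       (intro Bochner_Integration.integrable_add integrable_divide int, measurable)
  let ?a = "pnorm N p f" and ?b = "pnorm N q g"
  consider "?a = 0" | "?b = 0" | "?a > 0" "?b > 0"
    using pnorm_nonneg[of N p f] pnorm_nonneg[of N q g] by linarith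
  then show le: "(\<integral>x. \<bar>f x * g x\<bar> \<partial>N) \<le> ?a * ?b"
  proof cases
    case 1
    then have "AE x in N. f x = 0" using pnorm_eq_0_AE[OF f] pq by simp
    then have "(\<integral>x. \<bar>f x * g x\<bar> \<partial>N) = 0" by (intro integral_eq_zero_AE) (auto elim: eventually_mono)
    then show ?thesis using 1 by simp
  next
    case 2
    then have "AE x in N. g x = 0" using pnorm_eq_0_AE[OF g] pq by simp
    then have "(\<integral>x. \<bar>f x * g x\<bar> \<partial>N) = 0" by (intro integral_eq_zero_AE) (auto elim: eventually_mono)
    then show ?thesis using 2 by simp
  next
    case 3
    have bd: "\<bar>f x * g x\<bar> \<le> ?a * ?b * (\<bar>f x\<bar> powr p / (p * ?a powr p) + \<bar>g x\<bar> powr q / (q * ?b powr q))" for x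
    proof -
      have "\<bar>f x * g x\<bar> = ?a * ?b * ((\<bar>f x\<bar> / ?a) * (\<bar>g x\<bar> / ?b))"
        using 3 by (simp add: abs_mult)
      also have "\<dots> \<le> ?a * ?b * ((\<bar>f x\<bar> / ?a) powr p / p + (\<bar>g x\<bar> / ?b) powr q / q)"
        by (intro mult_left_mono Youngs_inequality pq) (use 3 in auto)
      also have "(\<bar>f x\<bar> / ?a) powr p / p = \<bar>f x\<bar> powr p / (p * ?a powr p)" using 3 by (simp add: powr_divide mult.commute)
      also have "(\<bar>g x\<bar> / ?b) powr q / q = \<bar>g x\<bar> powr q / (q * ?b powr q)" using 3 by (simp add: powr_divide mult.commute)
      finally show ?thesis .
    qed
    have "(\<integral>x. \<bar>f x * g x\<bar> \<partial>N)
      \<le> (\<integral>x. ?a * ?b * (\<bar>f x\<bar> powr p / (p * ?a powr p) + \<bar>g x\<bar> powr q / (q * ?b powr q)) \<partial>N)"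
      by (rule integral_mono[OF _ _ bd])
         (intro integrable_abs i integrable_mult_right Bochner_Integration.integrable_add integrable_divide int)+
    also have "\<dots> = ?a * ?b * ((\<integral>x. \<bar>f x\<bar> powr p \<partial>N) / (p * ?a powr p) + (\<integral>x. \<bar>g x\<bar> powr q \<partial>N) / (q * ?b powr q))"
      by (subst integral_mult_right_zero, subst Bochner_Integration.integral_add,
          intro integrable_mult_right integrable_divide int, intro integrable_mult_right integrable_divide int)
         (simp only: integral_mult_right_zero integral_divide_zero)
    also have "\<dots> = ?a * ?b * (1 / p + 1 / q)"
    proof -
      have "(\<integral>x. \<bar>f x\<bar> powr p \<partial>N) = ?a powr p" "(\<integral>x. \<bar>g x\<bar> powr q \<partial>N) = ?b powr q"
        using pq by (simp_all add: pnorm_powr)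
      moreover have "?a powr p \<noteq> 0" "?b powr q \<noteq> 0" using 3 by auto
      ultimately show ?thesis by simp
    qed
    finally show ?thesis using pq by simp
  qed
  show "\<bar>\<integral>x. f x * g x \<partial>N\<bar> \<le> ?a * ?b"
    using integral_abs_bound[of N "\<lambda>x. f x * g x"] le by linarith
qed

text \<open>The duality map of \<open>L\<^sup>p\<close>: an element of \<open>L\<^sup>q\<close> that attains the norm of \<open>f\<close>.\<close>

definition dual_map :: "real \<Rightarrow> real \<Rightarrow> real" where
  "dual_map p x = sgn x * \<bar>x\<bar> powr (p - 1)"

lemma dual_map_measurable [measurable]: "dual_map p \<in> borel_measurable borel"
  unfolding dual_map_def by measurable

lemma abs_dual_map: "1 < p \<Longrightarrow> \<bar>dual_map p x\<bar> = \<bar>x\<bar> powr (p - 1)"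
  by (cases "x = 0") (auto simp: dual_map_def abs_mult)

lemma mult_dual_map: "1 < p \<Longrightarrow> x * dual_map p x = \<bar>x\<bar> powr p"
proof (cases "x = 0")
  case False
  have "x * dual_map p x = \<bar>x\<bar> * \<bar>x\<bar> powr (p - 1)"
    by (simp add: dual_map_def mult.assoc [symmetric] mult_sgn_abs abs_sgn)
  also have "\<dots> = \<bar>x\<bar> powr p" using False by (simp add: powr_mult_base)
  finally show ?thesis .
qed simp

lemma dual_exponent:
  assumes "(1::real) < p" "q = p / (p - 1)"
  shows "1 < q" "1 / p + 1 / q = 1" "(p - 1) * q = p" "p = q / (q - 1)"
proof -
  have p: "p - 1 > 0" using assms by simp
  show "1 < q" "(p - 1) * q = p" using assms p by simp_all
  have "1 / q = (p - 1) / p" using assms by simp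
  then show "1 / p + 1 / q = 1" using p by (simp flip: add_divide_distrib)
  have "q - 1 = 1 / (p - 1)" using assms p by (simp add: divide_simps left_diff_distrib)
  then show "p = q / (q - 1)" using assms p by simp
qed

lemma Lp_dual_map:
  assumes f: "f \<in> Lp N p" and p: "1 < p" and q: "q = p / (p - 1)"
  shows "(\<lambda>x. dual_map p (f x)) \<in> Lp N q"
    and "pnorm N q (\<lambda>x. dual_map p (f x)) = pnorm N p f powr (p - 1)"
    and "(\<integral>x. f x * dual_map p (f x) \<partial>N) = pnorm N p f powr p"
proof -
  note pq = dual_exponent[OF p q]
  have [measurable]: "f \<in> borel_measurable N" using f by (simp add: Lp_iff)
  have e: "\<bar>dual_map p (f x)\<bar> powr q = \<bar>f x\<bar> powr p" for x
    by (simp only: abs_dual_map[OF p] powr_powr pq(3))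
  show "(\<lambda>x. dual_map p (f x)) \<in> Lp N q" using f by (simp add: Lp_iff e)
  have "pnorm N q (\<lambda>x. dual_map p (f x)) = (pnorm N p f powr p) powr (1 / q)"
    using p by (simp add: pnorm_def[of N q] e pnorm_powr)
  also have "\<dots> = pnorm N p f powr (p - 1)"
    using p q by (simp add: powr_powr)
  finally show "pnorm N q (\<lambda>x. dual_map p (f x)) = pnorm N p f powr (p - 1)" .
  show "(\<integral>x. f x * dual_map p (f x) \<partial>N) = pnorm N p f powr p"
    using p by (simp add: mult_dual_map pnorm_powr)
qed

text \<open>One test function suffices because it attains the norm: the left side of
  \<open>le\<close> is the p-th power of the norm of \<open>f\<close>, the right side carries the
  power p - 1, and one factor survives the cancellation.\<close>

lemma pnorm_le_by_dual:
  assumes f: "f \<in> Lp N p" and p: "1 < p" and q: "q = p / (p - 1)" and "c \<ge> 0"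
    and le: "(\<integral>x. f x * dual_map p (f x) \<partial>N) \<le> c * pnorm N q (\<lambda>x. dual_map p (f x))"
  shows "pnorm N p f \<le> c"
proof (cases "pnorm N p f = 0")
  case False
  then have pos: "pnorm N p f > 0" using pnorm_nonneg[of N p f] by linarith
  have "pnorm N p f * pnorm N p f powr (p - 1) \<le> c * pnorm N p f powr (p - 1)"
    using le pos by (simp add: Lp_dual_map[OF f p q] powr_mult_base)
  then show ?thesis using pos by (simp add: mult_le_cancel_right)
qed (use assms in simp)

text \<open>Minkowski's inequality, from Hoelder's by duality.\<close>

lemma Lp_add:
  assumes f: "f \<in> Lp N p" and g: "g \<in> Lp N p" and p: "1 < p"
  shows "(\<lambda>x. f x + g x) \<in> Lp N p"
    and "pnorm N p (\<lambda>x. f x + g x) \<le> pnorm N p f + pnorm N p g"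
proof -
  have "integrable N (\<lambda>x. \<bar>f x + g x\<bar> powr p)"
    by (rule Bochner_Integration.integrable_bound[where f = "\<lambda>x. 2 powr p * (\<bar>f x\<bar> powr p + \<bar>g x\<bar> powr p)"])
       (use f g p in \<open>auto simp: Lp_iff intro!: AE_I2 order_trans[OF abs_add_powr_le]\<close>)
  then show L: "(\<lambda>x. f x + g x) \<in> Lp N p" using f g by (auto simp: Lp_iff)
  define q where "q = p / (p - 1)"
  note pq = dual_exponent[OF p q_def]
  define \<psi> where "\<psi> x = dual_map p (f x + g x)" for x
  have \<psi>: "\<psi> \<in> Lp N q" unfolding \<psi>_def by (rule Lp_dual_map(1)[OF L p q_def])
  note hol = Lp_holder[OF _ \<psi> p pq(1,2)]
  have "(\<integral>x. (f x + g x) * \<psi> x \<partial>N) = (\<integral>x. f x * \<psi> x \<partial>N) + (\<integral>x. g x * \<psi> x \<partial>N)"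
    using hol(1)[OF f] hol(1)[OF g] by (simp add: distrib_right)
  also have "\<dots> \<le> (pnorm N p f + pnorm N p g) * pnorm N q \<psi>"
    using hol(3)[OF f] hol(3)[OF g] unfolding distrib_right by linarith
  finally show "pnorm N p (\<lambda>x. f x + g x) \<le> pnorm N p f + pnorm N p g"
    unfolding \<psi>_def by (intro pnorm_le_by_dual[OF L p q_def] add_nonneg_nonneg pnorm_nonneg)
qed

lemma Lp_diff:
  assumes f: "f \<in> Lp N p" and g: "g \<in> Lp N p" and p: "1 < p"
  shows "(\<lambda>x. f x - g x) \<in> Lp N p"
    and "pnorm N p (\<lambda>x. f x - g x) \<le> pnorm N p f + pnorm N p g"
  using Lp_add[OF f Lp_minus(1)[OF g] p] Lp_minus(2)[OF g] by simp_all

lemma Lp_diff_quotient: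
  "f \<in> Lp N p \<Longrightarrow> g \<in> Lp N p \<Longrightarrow> h \<in> Lp N p \<Longrightarrow> 1 < p \<Longrightarrow> (\<lambda>x. (f x - g x) / r - h x) \<in> Lp N p"
  using Lp_diff(1)[OF Lp_cmult(1)[OF Lp_diff(1), of f N p g "1 / r"]] by simp

lemma pnorm_diff_commute: "pnorm N p (\<lambda>x. f x - g x) = pnorm N p (\<lambda>x. g x - f x)"
  by (simp add: pnorm_def abs_minus_commute)

lemma pnorm_triangle_diff:
  assumes "f \<in> Lp N p" "g \<in> Lp N p" "h \<in> Lp N p" "1 < p"
  shows "pnorm N p (\<lambda>x. f x - h x) \<le> pnorm N p (\<lambda>x. f x - g x) + pnorm N p (\<lambda>x. g x - h x)"
  using Lp_add(2)[OF Lp_diff(1)[OF assms(1,2,4)] Lp_diff(1)[OF assms(2,3,4)] assms(4)] by simp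

lemma pnorm_le_diff:
  assumes "f \<in> Lp N p" "g \<in> Lp N p" "1 < p"
  shows "pnorm N p f \<le> pnorm N p g + pnorm N p (\<lambda>x. f x - g x)"
  using Lp_add(2)[OF assms(2) Lp_diff(1)[OF assms]] assms(3) by simp

lemma abs_pnorm_diff:
  assumes "f \<in> Lp N p" "g \<in> Lp N p" "1 < p"
  shows "\<bar>pnorm N p f - pnorm N p g\<bar> \<le> pnorm N p (\<lambda>x. f x - g x)"
  using pnorm_le_diff[OF assms] pnorm_le_diff[OF assms(2,1,3)] pnorm_diff_commute[of N p f g]
  by linarith

section \<open>Spaces \<open>Lp\<close> over a probability measure\<close>

context prob_space
begin

lemma Lp_bounded:
  assumes "f \<in> borel_measurable M" "\<And>x. x \<in> space M \<Longrightarrow> \<bar>f x\<bar> \<le> c" "p > 0"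
  shows "f \<in> Lp M p" "c \<ge> 0 \<Longrightarrow> pnorm M p f \<le> c"
proof -
  have i: "integrable M (\<lambda>x. \<bar>f x\<bar> powr p)"
    by (rule integrable_const_bound[where B = "\<bar>c\<bar> powr p"])
       (use assms in \<open>auto intro!: AE_I2 powr_mono2 intro: order_trans[OF _ abs_ge_self]\<close>)
  then show "f \<in> Lp M p" using assms by (simp add: Lp_iff)
  assume "c \<ge> 0"
  have "(\<integral>x. \<bar>f x\<bar> powr p \<partial>M) \<le> (\<integral>x. c powr p \<partial>M)"
    by (rule integral_mono[OF i]) (use assms in \<open>auto intro!: powr_mono2\<close>)
  then have "(\<integral>x. \<bar>f x\<bar> powr p \<partial>M) powr (1 / p) \<le> (c powr p) powr (1 / p)"
    by (intro powr_mono2) (use assms prob_space in auto)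
  then show "pnorm M p f \<le> c" using assms \<open>c \<ge> 0\<close> by (simp add: pnorm_def powr_powr)
qed

lemma Lp_imp_integrable:
  assumes "f \<in> Lp M p" "1 < p"
  shows "integrable M f" "(\<integral>x. \<bar>f x\<bar> \<partial>M) \<le> pnorm M p f"
proof -
  note pq = dual_exponent[OF assms(2) refl]
  have o: "(\<lambda>x. 1) \<in> Lp M (p / (p - 1))" "pnorm M (p / (p - 1)) (\<lambda>x. 1) \<le> 1"
    using Lp_bounded[of "\<lambda>x. 1" 1 "p / (p - 1)"] pq by auto
  show "integrable M f" using Lp_holder(1)[OF assms(1) o(1) assms(2) pq(1,2)] by simp
  have "(\<integral>x. \<bar>f x\<bar> \<partial>M) \<le> pnorm M p f * pnorm M (p / (p - 1)) (\<lambda>x. 1)"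
    using Lp_holder(2)[OF assms(1) o(1) assms(2) pq(1,2)] by simp
  also have "\<dots> \<le> pnorm M p f" using o(2) by (simp add: mult_left_le)
  finally show "(\<integral>x. \<bar>f x\<bar> \<partial>M) \<le> pnorm M p f" .
qed

text \<open>On a probability space a Cauchy sequence in \<open>Lp\<close> is Cauchy in L^1, which
  supplies an almost everywhere convergent subsequence; Fatou's lemma then controls the distance of
  the whole sequence to its limit.\<close>

lemma Lp_complete:
  assumes s: "\<And>n. s n \<in> Lp M p" and p: "1 < p"
    and cauchy: "\<And>e. e > 0 \<Longrightarrow> \<exists>N. \<forall>i\<ge>N. \<forall>j\<ge>N. pnorm M p (\<lambda>x. s i x - s j x) < e"
  obtains g where "g \<in> Lp M p" "(\<lambda>n. pnorm M p (\<lambda>x. s n x - g x)) \<longlonglongrightarrow> 0"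
proof -
  have [measurable]: "s n \<in> borel_measurable M" for n using s by (simp add: Lp_iff)
  have d: "(\<lambda>x. s i x - s j x) \<in> Lp M p" for i j by (rule Lp_diff[OF s s p])
  obtain r where r: "strict_mono r" "AE x in M. Cauchy (\<lambda>i. s (r i) x)"
  proof (rule cauchy_L1_AE_cauchy_subseq[of M s])
    show "integrable M (s n)" for n by (rule Lp_imp_integrable[OF s p])
    show "\<exists>N. \<forall>i\<ge>N. \<forall>j\<ge>N. LINT x|M. norm (s i x - s j x) < e" if "e > 0" for e
    proof -
      obtain N where "\<forall>i\<ge>N. \<forall>j\<ge>N. pnorm M p (\<lambda>x. s i x - s j x) < e"
        using cauchy[of e] \<open>e > 0\<close> by blast
      then show ?thesis
        using le_less_trans[OF Lp_imp_integrable(2)[OF d p]] unfolding real_norm_def by blast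
    qed
  qed
  \<comment> \<open>On the null set where the subsequence diverges \<open>lim\<close> takes some
    default value; \<open>g\<close> is measurable all the same.\<close>
  define g where "g x = lim (\<lambda>i. s (r i) x)" for x
  have [measurable]: "g \<in> borel_measurable M" unfolding g_def by measurable
  have lim: "AE x in M. (\<lambda>i. s (r i) x) \<longlonglongrightarrow> g x"
    using r(2) by eventually_elim (simp add: g_def Cauchy_convergent_iff convergent_LIMSEQ_iff)
  have main: "(\<lambda>x. s j x - g x) \<in> Lp M p \<and> pnorm M p (\<lambda>x. s j x - g x) \<le> e"
    if e: "e > 0" and j: "\<And>i. i \<ge> j \<Longrightarrow> pnorm M p (\<lambda>x. s i x - s j x) < e" for e j
  proof -
    have nn: "(\<integral>\<^sup>+x. ennreal (\<bar>s i x - s j x\<bar> powr p) \<partial>M) = ennreal (pnorm M p (\<lambda>x. s i x - s j x) powr p)" for i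
      using d[of i j] p by (simp add: pnorm_powr Lp_iff nn_integral_eq_integral)
    have "(\<integral>\<^sup>+x. ennreal (\<bar>g x - s j x\<bar> powr p) \<partial>M)
        = (\<integral>\<^sup>+x. liminf (\<lambda>i. ennreal (\<bar>s (r i) x - s j x\<bar> powr p)) \<partial>M)"
    proof (rule nn_integral_cong_AE, use lim in eventually_elim)
      fix x assume *: "(\<lambda>i. s (r i) x) \<longlonglongrightarrow> g x"
      have "(\<lambda>i. ennreal (\<bar>s (r i) x - s j x\<bar> powr p)) \<longlonglongrightarrow> ennreal (\<bar>g x - s j x\<bar> powr p)"
        by (rule tendsto_ennrealI, rule tendsto_powr2) (use * p in \<open>auto intro!: tendsto_intros\<close>)
      then show "ennreal (\<bar>g x - s j x\<bar> powr p) = liminf (\<lambda>i. ennreal (\<bar>s (r i) x - s j x\<bar> powr p))"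
        by (intro lim_imp_Liminf[symmetric]) auto
    qed
    also have "\<dots> \<le> liminf (\<lambda>i. \<integral>\<^sup>+x. ennreal (\<bar>s (r i) x - s j x\<bar> powr p) \<partial>M)"
      by (rule nn_integral_liminf) measurable
    also have "\<dots> \<le> ennreal (e powr p)"
    proof (rule Liminf_le)
      show "\<forall>\<^sub>F i in sequentially. (\<integral>\<^sup>+x. ennreal (\<bar>s (r i) x - s j x\<bar> powr p) \<partial>M) \<le> ennreal (e powr p)"
        unfolding nn eventually_sequentially
      proof (intro exI[of _ j] allI impI ennreal_leI powr_mono2)
        fix i assume "j \<le> i"
        then have "j \<le> r i" using seq_suble[OF r(1), of i] by linarith
        then show "pnorm M p (\<lambda>x. s (r i) x - s j x) \<le> e" using j by (simp add: less_imp_le)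
      qed (use p in auto)
    qed simp
    finally have le: "(\<integral>\<^sup>+x. ennreal (\<bar>g x - s j x\<bar> powr p) \<partial>M) \<le> ennreal (e powr p)" .
    have int: "integrable M (\<lambda>x. \<bar>g x - s j x\<bar> powr p)"
      by (rule integrableI_bounded) (use le in \<open>auto intro: le_less_trans\<close>)
    then have "ennreal (\<integral>x. \<bar>g x - s j x\<bar> powr p \<partial>M) \<le> ennreal (e powr p)"
      using le by (simp add: nn_integral_eq_integral)
    then have "pnorm M p (\<lambda>x. s j x - g x) powr p \<le> e powr p"
      using p by (simp add: pnorm_powr abs_minus_commute)
    then have "pnorm M p (\<lambda>x. s j x - g x) \<le> e"
      using powr_less_mono2[of p e "pnorm M p (\<lambda>x. s j x - g x)"] p e by (meson not_le less_imp_le less_trans zero_less_one)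
    moreover have "(\<lambda>x. s j x - g x) \<in> Lp M p" using int by (simp add: Lp_iff abs_minus_commute)
    ultimately show ?thesis by simp
  qed
  have ex: "\<exists>N. \<forall>j\<ge>N. (\<lambda>x. s j x - g x) \<in> Lp M p \<and> pnorm M p (\<lambda>x. s j x - g x) \<le> e" if "e > 0" for e
    using cauchy[OF that] main[OF that] by (meson order_trans)
  show ?thesis
  proof (rule that[of g])
    obtain j where "(\<lambda>x. s j x - g x) \<in> Lp M p" using ex[of 1] by auto
    then show "g \<in> Lp M p" using Lp_diff(1)[OF s[of j] _ p] by fastforce
    show "(\<lambda>n. pnorm M p (\<lambda>x. s n x - g x)) \<longlonglongrightarrow> 0"
    proof (rule LIMSEQ_I)
      fix e :: real assume "e > 0"
      then show "\<exists>N. \<forall>n\<ge>N. norm (pnorm M p (\<lambda>x. s n x - g x) - 0) < e"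
        using ex[of "e / 2"] by (force intro: le_less_trans)
    qed
  qed
qed

end

text \<open>Test the increment with its image under the duality map.\<close>

lemma Lp_mean_value:
  assumes p: "1 < p" and ab: "a \<le> b"
    and c: "\<And>s. a \<le> s \<Longrightarrow> s \<le> b \<Longrightarrow> c s \<in> Lp N p" and c': "\<And>s. a \<le> s \<Longrightarrow> s \<le> b \<Longrightarrow> c' s \<in> Lp N p"
    and cev: "\<And>s. a \<le> s \<Longrightarrow> s \<le> b \<Longrightarrow> \<forall>\<^sub>F h in at 0. c (s + h) \<in> Lp N p"
    and deriv: "\<And>s. a \<le> s \<Longrightarrow> s \<le> b \<Longrightarrow>
        ((\<lambda>h. pnorm N p (\<lambda>x. (c (s + h) x - c s x) / h - c' s x)) \<longlongrightarrow> 0) (at 0)"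
    and g: "\<And>s. a \<le> s \<Longrightarrow> s \<le> b \<Longrightarrow> (g has_real_derivative g' s) (at s)"
    and le: "\<And>s. a \<le> s \<Longrightarrow> s \<le> b \<Longrightarrow> pnorm N p (c' s) \<le> g' s"
  shows "pnorm N p (\<lambda>x. c b x - c a x) \<le> g b - g a"
proof -
  define q where "q = p / (p - 1)"
  note pq = dual_exponent[OF p q_def]
  \<comment> \<open>\<open>g'\<close> dominates a norm, so \<open>g\<close> cannot decrease;
    \<open>pnorm_le_by_dual\<close> needs the bound \<open>g b - g a\<close> to be
    nonnegative.\<close>
  have "mono_on {a..b} g"
  proof (rule mono_onI)
    fix r s assume rs: "r \<in> {a..b}" "s \<in> {a..b}" "r \<le> s"
    show "g r \<le> g s"
    proof (rule DERIV_nonneg_imp_nondecreasing[OF rs(3)])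
      fix x assume "r \<le> x" "x \<le> s"
      then show "\<exists>y. (g has_real_derivative y) (at x) \<and> 0 \<le> y"
        using rs g[of x] order_trans[OF pnorm_nonneg le[of x]] by (intro exI[of _ "g' x"]) auto
    qed
  qed
  then have gab: "0 \<le> g b - g a" using ab by (simp add: mono_on_def)
  define w where "w = (\<lambda>x. c b x - c a x)"
  have w: "w \<in> Lp N p" unfolding w_def by (intro Lp_diff c p ab order_refl)
  define \<psi> where "\<psi> = (\<lambda>x. dual_map p (w x))"
  have \<psi>: "\<psi> \<in> Lp N q" unfolding \<psi>_def by (rule Lp_dual_map[OF w p q_def])
  define k where "k = pnorm N q \<psi>"
  define \<beta> where "\<beta> s = (\<integral>x. c s x * \<psi> x \<partial>N)" for s
  have der: "(\<beta> has_real_derivative (\<integral>x. c' s x * \<psi> x \<partial>N)) (at s)" if s: "a \<le> s" "s \<le> b" for s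
    unfolding DERIV_def
  proof (rule LIM_zero_cancel, rule Lim_null_comparison)
    show "\<forall>\<^sub>F h in at 0. norm ((\<beta> (s + h) - \<beta> s) / h - (\<integral>x. c' s x * \<psi> x \<partial>N))
        \<le> pnorm N p (\<lambda>x. (c (s + h) x - c s x) / h - c' s x) * k"
      using cev[OF s]
    proof eventually_elim
      case (elim h)
      note hol = Lp_holder(1)[OF _ \<psi> p pq(1,2)]
      have m: "(\<lambda>x. (c (s + h) x - c s x) / h - c' s x) \<in> Lp N p"
        by (intro Lp_diff_quotient elim c c' s p)
      have "(\<beta> (s + h) - \<beta> s) / h - (\<integral>x. c' s x * \<psi> x \<partial>N)
          = (\<integral>x. (c (s + h) x * \<psi> x - c s x * \<psi> x) / h - c' s x * \<psi> x \<partial>N)"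
        using hol[OF elim] hol[OF c[OF s]] hol[OF c'[OF s]] by (simp add: \<beta>_def)
      also have "\<dots> = (\<integral>x. ((c (s + h) x - c s x) / h - c' s x) * \<psi> x \<partial>N)"
        by (simp add: left_diff_distrib)
      finally show ?case using Lp_holder(3)[OF m \<psi> p pq(1,2)] by (simp add: k_def)
    qed
    show "((\<lambda>h. pnorm N p (\<lambda>x. (c (s + h) x - c s x) / h - c' s x) * k) \<longlongrightarrow> 0) (at 0)"
      using tendsto_mult_right[OF deriv[OF s], of k] by simp
  qed
  \<comment> \<open>The real function \<open>\<beta>\<close> grows no faster than
    \<open>k * g\<close>, and its increment over the interval is the p-th power of the norm of
    \<open>w\<close>.\<close>
  have "\<beta> b - k * g b \<le> \<beta> a - k * g a"
  proof (rule DERIV_nonpos_imp_nonincreasing[OF ab])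
    fix s assume s: "a \<le> s" "s \<le> b"
    have "(\<integral>x. c' s x * \<psi> x \<partial>N) \<le> pnorm N p (c' s) * k"
      using Lp_holder(3)[OF c'[OF s] \<psi> p pq(1,2)] by (simp add: k_def)
    also have "\<dots> \<le> k * g' s" using le[OF s] by (simp add: k_def mult.commute[of "pnorm N q \<psi>"] mult_right_mono)
    finally show "\<exists>y. ((\<lambda>s. \<beta> s - k * g s) has_real_derivative y) (at s) \<and> y \<le> 0"
      by (intro exI[of _ "(\<integral>x. c' s x * \<psi> x \<partial>N) - k * g' s"])
         (auto intro!: derivative_eq_intros der[OF s] g[OF s])
  qed
  moreover have "\<beta> b - \<beta> a = (\<integral>x. w x * dual_map p (w x) \<partial>N)"
    using Lp_holder(1)[OF c \<psi> p pq(1,2)] ab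
    by (simp add: \<beta>_def w_def \<psi>_def left_diff_distrib)
  ultimately have "(\<integral>x. w x * dual_map p (w x) \<partial>N) \<le> (g b - g a) * pnorm N q (\<lambda>x. dual_map p (w x))"
    by (simp add: k_def \<psi>_def algebra_simps)
  from pnorm_le_by_dual[OF w p q_def gab this] show ?thesis by (simp add: w_def)
qed

section \<open>Symmetric Markov semigroups commuting with an algebra of derivations\<close>

text \<open>Leaving out the indices with \<open>X i \<phi> = 0\<close> makes the sum finite even for
  infinite \<open>I\<close>, so that no infinite sums enter the analysis. With all indices this is
  the generator -L on test functions; with the indices beyond some m it is a tail of the
  series.\<close>

definition sum_of_squares_op :: "nat set \<Rightarrow> (nat \<Rightarrow> 'a operator) \<Rightarrow> 'a operator" where
  "sum_of_squares_op I X \<phi> = (\<lambda>x. \<Sum>i\<in>{i \<in> I. X i \<phi> \<noteq> (\<lambda>x. 0)}. X i (X i \<phi>) x)"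

lemma sum_of_squares_op_eq:
  assumes "finite K" "K \<subseteq> I" "J \<subseteq> I" "\<And>i. i \<in> I - K \<Longrightarrow> X i \<phi> = (\<lambda>x. 0)"
    and "\<And>i. i \<in> I \<Longrightarrow> X i (\<lambda>x. 0) = (\<lambda>x. 0)"
  shows "sum_of_squares_op J X \<phi> = (\<lambda>x. \<Sum>i\<in>J \<inter> K. X i (X i \<phi>) x)"
  unfolding sum_of_squares_op_def
proof (rule ext, rule sum.mono_neutral_left)
  show "{i \<in> J. X i \<phi> \<noteq> (\<lambda>x. 0)} \<subseteq> J \<inter> K" using assms by blast
  show "\<forall>i\<in>J \<inter> K - {i \<in> J. X i \<phi> \<noteq> (\<lambda>x. 0)}. X i (X i \<phi>) x = 0" for x
    using assms by (auto simp: subset_iff)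
qed (use assms in auto)

section \<open>Bounded measurable functions and uniformly bounded sequences\<close>

definition bounded_borel :: "'a measure \<Rightarrow> ('a \<Rightarrow> real) set" where
  "bounded_borel N = {f \<in> borel_measurable N. \<exists>c. \<forall>x\<in>space N. \<bar>f x\<bar> \<le> c}"

lemma bounded_borelI:
  "f \<in> borel_measurable N \<Longrightarrow> (\<And>x. x \<in> space N \<Longrightarrow> \<bar>f x\<bar> \<le> c) \<Longrightarrow> f \<in> bounded_borel N"
  by (auto simp: bounded_borel_def)

lemma bounded_borel_measurable: "f \<in> bounded_borel N \<Longrightarrow> f \<in> borel_measurable N"
  by (simp add: bounded_borel_def)

text \<open>The bound is uniform in the index and in the point, so that bounded convergence applies
  after sums, products and continuous functions of such sequences.\<close>

definition bounded_seqs :: "'a measure \<Rightarrow> (nat \<Rightarrow> 'a \<Rightarrow> real) set" where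
  "bounded_seqs N = {F. (\<forall>n. F n \<in> borel_measurable N) \<and> (\<exists>c. \<forall>n. \<forall>x\<in>space N. \<bar>F n x\<bar> \<le> c)}"

lemma bounded_seqsE:
  assumes "F \<in> bounded_seqs N"
  obtains c where "c \<ge> 0" "\<And>n x. x \<in> space N \<Longrightarrow> \<bar>F n x\<bar> \<le> c"
proof -
  obtain c where "\<forall>n. \<forall>x\<in>space N. \<bar>F n x\<bar> \<le> c" using assms by (auto simp: bounded_seqs_def)
  then show thesis by (intro that[of "max c 0"]) (auto simp: le_max_iff_disj)
qed

lemma bounded_seqsI:
  "(\<And>n. F n \<in> borel_measurable N) \<Longrightarrow> (\<And>n x. x \<in> space N \<Longrightarrow> \<bar>F n x\<bar> \<le> c) \<Longrightarrow> F \<in> bounded_seqs N"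
  by (auto simp: bounded_seqs_def)

lemma bounded_seqs_measurable: "F \<in> bounded_seqs N \<Longrightarrow> F n \<in> borel_measurable N"
  by (auto simp: bounded_seqs_def)

lemma bounded_seqs_const: "f \<in> bounded_borel N \<Longrightarrow> (\<lambda>n. f) \<in> bounded_seqs N"
  by (auto simp: bounded_borel_def bounded_seqs_def)

lemma bounded_seqs_add:
  assumes "F \<in> bounded_seqs N" "G \<in> bounded_seqs N" shows "(\<lambda>n x. F n x + G n x) \<in> bounded_seqs N"
proof -
  obtain c where "c \<ge> 0" "\<And>n x. x \<in> space N \<Longrightarrow> \<bar>F n x\<bar> \<le> c" using bounded_seqsE[OF assms(1)] by blast
  moreover obtain d where "d \<ge> 0" "\<And>n x. x \<in> space N \<Longrightarrow> \<bar>G n x\<bar> \<le> d" using bounded_seqsE[OF assms(2)] by blast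
  ultimately have "\<bar>F n x + G n x\<bar> \<le> c + d" if "x \<in> space N" for n x
    using that by (intro order_trans[OF abs_triangle_ineq] add_mono)
  then show ?thesis
    using assms[THEN bounded_seqs_measurable] by (intro bounded_seqsI[of _ _ "c + d"]) auto
qed

lemma bounded_seqs_mult:
  assumes "F \<in> bounded_seqs N" "G \<in> bounded_seqs N" shows "(\<lambda>n x. F n x * G n x) \<in> bounded_seqs N"
proof -
  obtain c where "c \<ge> 0" "\<And>n x. x \<in> space N \<Longrightarrow> \<bar>F n x\<bar> \<le> c" using bounded_seqsE[OF assms(1)] by blast
  moreover obtain d where "d \<ge> 0" "\<And>n x. x \<in> space N \<Longrightarrow> \<bar>G n x\<bar> \<le> d" using bounded_seqsE[OF assms(2)] by blast
  ultimately show ?thesis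
    using assms[THEN bounded_seqs_measurable]
    by (intro bounded_seqsI[of _ _ "c * d"]) (auto simp: abs_mult intro: mult_mono)
qed

lemma bounded_borel_iff: "f \<in> bounded_borel N \<longleftrightarrow> (\<lambda>n. f) \<in> bounded_seqs N"
  by (auto simp: bounded_borel_def bounded_seqs_def)

lemma bounded_borelE:
  assumes "f \<in> bounded_borel N"
  obtains c where "c \<ge> 0" "\<And>x. x \<in> space N \<Longrightarrow> \<bar>f x\<bar> \<le> c"
  using assms unfolding bounded_borel_iff by (auto elim: bounded_seqsE)

lemma bounded_borel_const [intro]: "(\<lambda>x. c) \<in> bounded_borel N"
  by (auto simp: bounded_borel_def)

lemma bounded_borel_add [intro]:
  "f \<in> bounded_borel N \<Longrightarrow> g \<in> bounded_borel N \<Longrightarrow> (\<lambda>x. f x + g x) \<in> bounded_borel N"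
  and bounded_borel_mult [intro]:
  "f \<in> bounded_borel N \<Longrightarrow> g \<in> bounded_borel N \<Longrightarrow> (\<lambda>x. f x * g x) \<in> bounded_borel N"
  unfolding bounded_borel_iff by (rule bounded_seqs_add bounded_seqs_mult; assumption)+

lemma bounded_borel_cmult [intro]: "f \<in> bounded_borel N \<Longrightarrow> (\<lambda>x. c * f x) \<in> bounded_borel N"
  by (intro bounded_borel_mult bounded_borel_const)

lemma bounded_seqs_cmult: "F \<in> bounded_seqs N \<Longrightarrow> (\<lambda>n x. c * F n x) \<in> bounded_seqs N"
  using bounded_seqs_mult[OF bounded_seqs_const[OF bounded_borel_const]] by fastforce

lemma bounded_borel_minus [intro]: "f \<in> bounded_borel N \<Longrightarrow> (\<lambda>x. - f x) \<in> bounded_borel N"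
  using bounded_borel_cmult[of f N "-1"] by simp

lemma bounded_borel_diff [intro]:
  "f \<in> bounded_borel N \<Longrightarrow> g \<in> bounded_borel N \<Longrightarrow> (\<lambda>x. f x - g x) \<in> bounded_borel N"
  using bounded_borel_add[OF _ bounded_borel_minus] by fastforce

lemma bounded_borel_sum [intro]:
  "(\<And>i. i \<in> A \<Longrightarrow> f i \<in> bounded_borel N) \<Longrightarrow> (\<lambda>x. \<Sum>i\<in>A. f i x) \<in> bounded_borel N"
  by (induction A rule: infinite_finite_induct) auto

lemma bounded_borel_power [intro]:
  "f \<in> bounded_borel N \<Longrightarrow> (\<lambda>x. f x ^ n) \<in> bounded_borel N"
  by (induction n) auto

text \<open>The operators by which \<open>H t\<close> is approximated; in the application these are convex combinations
  of left translations.\<close>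

definition mixing_ops :: "'a measure \<Rightarrow> ('a \<Rightarrow> real) set \<Rightarrow> nat set \<Rightarrow> (nat \<Rightarrow> 'a operator) \<Rightarrow> 'a operator set" where
  "mixing_ops N B I X = {C. (\<forall>\<phi>\<in>B. C \<phi> \<in> B) \<and>
     (\<forall>i\<in>I. \<forall>\<phi>\<in>B. X i (C \<phi>) = C (X i \<phi>)) \<and>
     (\<forall>\<phi>\<in>B. \<forall>\<psi>\<in>B. C (\<lambda>x. \<phi> x + \<psi> x) = (\<lambda>x. C \<phi> x + C \<psi> x)) \<and>
     (\<forall>\<phi>\<in>B. \<forall>c. (\<forall>x\<in>space N. \<bar>\<phi> x\<bar> \<le> c) \<longrightarrow> (\<forall>x\<in>space N. \<bar>C \<phi> x\<bar> \<le> c))}"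

lemma abs_quotient_diff_le:
  fixes a b r :: real
  assumes "r \<noteq> 0" "\<bar>a - r * b\<bar> \<le> K * r\<^sup>2"
  shows "\<bar>a / r - b\<bar> \<le> K * \<bar>r\<bar>"
proof -
  have "a / r - b = (a - r * b) / r" using assms(1) by (simp add: diff_divide_distrib)
  then have "\<bar>a / r - b\<bar> = \<bar>a - r * b\<bar> / \<bar>r\<bar>" by (simp only: abs_divide)
  also have "\<dots> \<le> K * r\<^sup>2 / \<bar>r\<bar>" using assms by (intro divide_right_mono) auto
  also have "K * r\<^sup>2 = K * \<bar>r\<bar> * \<bar>r\<bar>" by (simp add: power2_eq_square mult.assoc)
  also have "\<dots> / \<bar>r\<bar> = K * \<bar>r\<bar>" by (rule nonzero_mult_div_cancel_right) (use assms(1) in simp)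
  finally show ?thesis .
qed

section \<open>Bounded convergence and differentiation under the integral\<close>

context prob_space
begin

lemma integrable_bounded_borel: "f \<in> bounded_borel M \<Longrightarrow> integrable M f"
  by (auto simp: bounded_borel_def intro!: integrable_const_bound AE_I2)

lemma Lp_bounded_borel: "f \<in> bounded_borel M \<Longrightarrow> p > 0 \<Longrightarrow> f \<in> Lp M p"
  using Lp_bounded(1) by (auto simp: bounded_borel_def)

lemma bounded_convergence:
  fixes f :: "nat \<Rightarrow> 'a \<Rightarrow> real"
  assumes "\<And>n. f n \<in> borel_measurable M" "\<And>n x. x \<in> space M \<Longrightarrow> \<bar>f n x\<bar> \<le> K"
    and "\<And>x. x \<in> space M \<Longrightarrow> (\<lambda>n. f n x) \<longlonglongrightarrow> g x"
  shows "(\<lambda>n. \<integral>x. f n x \<partial>M) \<longlonglongrightarrow> (\<integral>x. g x \<partial>M)"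
proof (rule integral_dominated_convergence[where w = "\<lambda>x. K"])
  show "g \<in> borel_measurable M" by (rule borel_measurable_LIMSEQ_real[OF assms(3,1)])
qed (use assms in \<open>auto intro!: AE_I2\<close>)

lemma pnorm_bounded_convergence:
  assumes "\<And>n. f n \<in> borel_measurable M" "\<And>n x. x \<in> space M \<Longrightarrow> \<bar>f n x\<bar> \<le> K"
    and "\<And>x. x \<in> space M \<Longrightarrow> (\<lambda>n. f n x) \<longlonglongrightarrow> g x" and p: "p > 0"
  shows "(\<lambda>n. pnorm M p (f n)) \<longlonglongrightarrow> pnorm M p g"
proof -
  note [measurable] = assms(1)
  have "(\<lambda>n. \<integral>x. \<bar>f n x\<bar> powr p \<partial>M) \<longlonglongrightarrow> (\<integral>x. \<bar>g x\<bar> powr p \<partial>M)"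
  proof (rule bounded_convergence[where K = "K powr p"])
    fix x assume "x \<in> space M"
    then show "(\<lambda>n. \<bar>f n x\<bar> powr p) \<longlonglongrightarrow> \<bar>g x\<bar> powr p"
      using assms(3)[of x] p by (intro tendsto_powr2) (auto intro!: tendsto_intros)
  qed (use assms in \<open>auto intro!: powr_mono2\<close>)
  then show ?thesis unfolding pnorm_def
    by (intro tendsto_powr2) (use p in \<open>auto intro!: tendsto_intros\<close>)
qed

text \<open>The mean value theorem bounds the difference quotients by \<open>K\<close>, so bounded
  convergence applies along every sequence tending to \<open>s\<close>.\<close>

lemma DERIV_integral_bounded:
  fixes F :: "real \<Rightarrow> 'a \<Rightarrow> real"
  assumes s: "a < s" "s < b"
    and meas: "\<And>r. a < r \<Longrightarrow> r < b \<Longrightarrow> F r \<in> bounded_borel M"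
    and der: "\<And>r x. a < r \<Longrightarrow> r < b \<Longrightarrow> x \<in> space M \<Longrightarrow> ((\<lambda>r. F r x) has_real_derivative F' r x) (at r)"
    and bd: "\<And>r x. a < r \<Longrightarrow> r < b \<Longrightarrow> x \<in> space M \<Longrightarrow> \<bar>F' r x\<bar> \<le> K"
  shows "((\<lambda>r. \<integral>x. F r x \<partial>M) has_real_derivative (\<integral>x. F' s x \<partial>M)) (at s)"
  unfolding has_field_derivative_iff tendsto_at_iff_sequentially
proof (intro allI impI)
  fix r :: "nat \<Rightarrow> real" assume r: "\<forall>i. r i \<in> UNIV - {s}" "r \<longlonglongrightarrow> s"
  \<comment> \<open>The bounds hold on the open interval only, so finitely many members of the
    sequence are dropped; \<open>LIMSEQ_offset\<close> restores them at the end.\<close>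
  have "\<forall>\<^sub>F i in sequentially. r i \<in> {a<..<b}"
    by (rule topological_tendstoD[OF r(2)]) (use s in auto)
  then obtain N where N: "\<And>i. i \<ge> N \<Longrightarrow> a < r i \<and> r i < b" by (auto simp: eventually_sequentially)
  define r' where "r' i = r (i + N)" for i
  have r': "a < r' i" "r' i < b" "r' i \<noteq> s" for i using N[of "i + N"] r(1) by (auto simp: r'_def)
  have lim: "r' \<longlonglongrightarrow> s" unfolding r'_def using r(2) by (rule LIMSEQ_ignore_initial_segment)
  have "(\<lambda>i. \<integral>x. (F (r' i) x - F s x) / (r' i - s) \<partial>M) \<longlonglongrightarrow> (\<integral>x. F' s x \<partial>M)"
  proof (rule bounded_convergence[where K = K])
    show "(\<lambda>x. (F (r' i) x - F s x) / (r' i - s)) \<in> borel_measurable M" for i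
      using bounded_borel_measurable[OF meas] r'[of i] s by measurable
    fix x assume x: "x \<in> space M"
    show "(\<lambda>i. (F (r' i) x - F s x) / (r' i - s)) \<longlonglongrightarrow> F' s x"
      using der[OF s x] lim r'(3) unfolding has_field_derivative_iff tendsto_at_iff_sequentially
      by (auto simp: comp_def)
    fix i
    show "\<bar>(F (r' i) x - F s x) / (r' i - s)\<bar> \<le> K"
    proof -
      have "\<exists>z. a < z \<and> z < b \<and> F (r' i) x - F s x = (r' i - s) * F' z x"
      proof (cases "r' i < s")
        case True
        then obtain z where "r' i < z" "z < s" "F s x - F (r' i) x = (s - r' i) * F' z x"
          using MVT2[OF True, of "\<lambda>r. F r x" "\<lambda>r. F' r x"] der x s r'[of i] by force
        then show ?thesis using s r'[of i] by (intro exI[of _ z]) (auto simp: algebra_simps)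
      next
        case False
        then have lt: "s < r' i" using r'(3)[of i] by simp
        then obtain z where "s < z" "z < r' i" "F (r' i) x - F s x = (r' i - s) * F' z x"
          using MVT2[OF lt, of "\<lambda>r. F r x" "\<lambda>r. F' r x"] der x s r'[of i] by force
        then show ?thesis using s r'[of i] by (intro exI[of _ z]) auto
      qed
      then obtain z where "a < z" "z < b" "F (r' i) x - F s x = (r' i - s) * F' z x" by blast
      then show ?thesis using bd[of z, OF _ _ x] r'(3)[of i] by simp
    qed
  qed
  moreover have "(\<lambda>i. \<integral>x. (F (r' i) x - F s x) / (r' i - s) \<partial>M)
      = (\<lambda>i. ((\<integral>x. F (r' i) x \<partial>M) - (\<integral>x. F s x \<partial>M)) / (r' i - s))"
    using integrable_bounded_borel[OF meas] r' s by (simp add: fun_eq_iff)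
  ultimately have "(\<lambda>i. ((\<integral>x. F (r (i + N)) x \<partial>M) - (\<integral>x. F s x \<partial>M)) / (r (i + N) - s)) \<longlonglongrightarrow> (\<integral>x. F' s x \<partial>M)"
    unfolding r'_def by simp
  then show "((\<lambda>y. ((\<integral>x. F y x \<partial>M) - (\<integral>x. F s x \<partial>M)) / (y - s)) \<circ> r) \<longlonglongrightarrow> (\<integral>x. F' s x \<partial>M)"
    unfolding comp_def by (rule LIMSEQ_offset)
qed

end

text \<open>The interface between analysis and group theory: all estimates are derived from these
  assumptions. \<open>H t\<close> acts on functions, not on classes; it is linear at every point on
  bounded functions, but respects differences only almost everywhere on \<open>Lp\<close>, since the
  integral that defines it can diverge at some points. \<open>H_approx\<close> is the only access to
  the commutation of \<open>H t\<close> with the fields. \<open>H_generator\<close> is a first-order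
  expansion in the supremum norm whose error per unit time is the oscillation \<open>e\<close> of
  the semigroup on the image of \<phi> under the generator up to time \<open>r\<close>.\<close>

locale derivation_semigroup = prob_space M for M :: "'a measure" +
  fixes B :: "('a \<Rightarrow> real) set" and I :: "nat set" and X :: "nat \<Rightarrow> 'a operator"
    and H :: "real \<Rightarrow> 'a operator"
  assumes B_bounded: "\<phi> \<in> B \<Longrightarrow> \<phi> \<in> bounded_borel M"
    and B_zero: "\<phi> \<in> B \<Longrightarrow> (\<integral>x. \<phi> x * \<phi> x \<partial>M) = 0 \<Longrightarrow> \<phi> = (\<lambda>x. 0)"
    and B_one: "\<exists>e\<in>B. \<forall>x\<in>space M. e x = 1"
    and B_add: "\<phi> \<in> B \<Longrightarrow> \<psi> \<in> B \<Longrightarrow> (\<lambda>x. \<phi> x + \<psi> x) \<in> B"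
    and B_cmult: "\<phi> \<in> B \<Longrightarrow> (\<lambda>x. c * \<phi> x) \<in> B"
    and B_mult: "\<phi> \<in> B \<Longrightarrow> \<psi> \<in> B \<Longrightarrow> (\<lambda>x. \<phi> x * \<psi> x) \<in> B"
    and X_B: "i \<in> I \<Longrightarrow> \<phi> \<in> B \<Longrightarrow> X i \<phi> \<in> B"
    and X_add: "i \<in> I \<Longrightarrow> \<phi> \<in> B \<Longrightarrow> \<psi> \<in> B \<Longrightarrow> X i (\<lambda>x. \<phi> x + \<psi> x) = (\<lambda>x. X i \<phi> x + X i \<psi> x)"
    and X_cmult: "i \<in> I \<Longrightarrow> \<phi> \<in> B \<Longrightarrow> X i (\<lambda>x. c * \<phi> x) = (\<lambda>x. c * X i \<phi> x)"
    and X_mult: "i \<in> I \<Longrightarrow> \<phi> \<in> B \<Longrightarrow> \<psi> \<in> B \<Longrightarrow>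
          X i (\<lambda>x. \<phi> x * \<psi> x) = (\<lambda>x. X i \<phi> x * \<psi> x + \<phi> x * X i \<psi> x)"
    and X_finite: "\<phi> \<in> B \<Longrightarrow> finite {i \<in> I. X i \<phi> \<noteq> (\<lambda>x. 0)}"
    and X_integral: "i \<in> I \<Longrightarrow> \<phi> \<in> B \<Longrightarrow> (\<integral>x. X i \<phi> x \<partial>M) = 0"
    and H_bounded: "f \<in> bounded_borel M \<Longrightarrow> t \<ge> 0 \<Longrightarrow> H t f \<in> bounded_borel M"
    and H_linear: "f \<in> bounded_borel M \<Longrightarrow> g \<in> bounded_borel M \<Longrightarrow> t \<ge> 0 \<Longrightarrow> x \<in> space M \<Longrightarrow>
          H t (\<lambda>x. a * f x + b * g x) x = a * H t f x + b * H t g x"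
    and H_contract: "f \<in> bounded_borel M \<Longrightarrow> t \<ge> 0 \<Longrightarrow> (\<And>x. x \<in> space M \<Longrightarrow> \<bar>f x\<bar> \<le> c) \<Longrightarrow>
          x \<in> space M \<Longrightarrow> \<bar>H t f x\<bar> \<le> c"
    and H_0: "f \<in> bounded_borel M \<Longrightarrow> x \<in> space M \<Longrightarrow> H 0 f x = f x"
    and H_semigroup: "f \<in> bounded_borel M \<Longrightarrow> s \<ge> 0 \<Longrightarrow> t \<ge> 0 \<Longrightarrow> x \<in> space M \<Longrightarrow>
          H s (H t f) x = H (s + t) f x"
    and H_symmetric: "f \<in> bounded_borel M \<Longrightarrow> g \<in> bounded_borel M \<Longrightarrow> t \<ge> 0 \<Longrightarrow>
          (\<integral>x. H t f x * g x \<partial>M) = (\<integral>x. f x * H t g x \<partial>M)"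
    and H_Lp: "1 < p \<Longrightarrow> f \<in> Lp M p \<Longrightarrow> t \<ge> 0 \<Longrightarrow> H t f \<in> Lp M p"
    and H_Lp_contract: "1 < p \<Longrightarrow> f \<in> Lp M p \<Longrightarrow> t \<ge> 0 \<Longrightarrow> pnorm M p (H t f) \<le> pnorm M p f"
    and H_Lp_diff: "1 < p \<Longrightarrow> f \<in> Lp M p \<Longrightarrow> g \<in> Lp M p \<Longrightarrow> t \<ge> 0 \<Longrightarrow>
          AE x in M. H t (\<lambda>x. f x - g x) x = H t f x - H t g x"
    and H_approx: "finite \<Phi> \<Longrightarrow> \<Phi> \<subseteq> B \<Longrightarrow> t \<ge> 0 \<Longrightarrow> \<exists>C. (\<forall>n::nat. C n \<in> mixing_ops M B I X) \<and>
          (\<forall>\<phi>\<in>\<Phi>. \<forall>x\<in>space M. (\<lambda>n. C n \<phi> x) \<longlonglongrightarrow> H t \<phi> x)"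
    and H_generator: "\<phi> \<in> B \<Longrightarrow> r \<ge> 0 \<Longrightarrow>
          (\<And>s x. 0 \<le> s \<Longrightarrow> s \<le> r \<Longrightarrow> x \<in> space M \<Longrightarrow>
             \<bar>H s (sum_of_squares_op I X \<phi>) x - sum_of_squares_op I X \<phi> x\<bar> \<le> e) \<Longrightarrow>
          x \<in> space M \<Longrightarrow> \<bar>H r \<phi> x - \<phi> x - r * sum_of_squares_op I X \<phi> x\<bar> \<le> r * e"
begin

abbreviation "A \<equiv> sum_of_squares_op I X"

lemma B_eqI:
  assumes "\<phi> \<in> B" "\<psi> \<in> B" "\<And>x. x \<in> space M \<Longrightarrow> \<phi> x = \<psi> x"
  shows "\<phi> = \<psi>"
proof -
  have "(\<lambda>x. \<phi> x + (-1) * \<psi> x) = (\<lambda>x. 0)"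
  proof (rule B_zero)
    show "(\<lambda>x. \<phi> x + (-1) * \<psi> x) \<in> B" using assms by (intro B_add B_cmult)
  qed (use assms in \<open>simp cong: Bochner_Integration.integral_cong\<close>)
  then show ?thesis by (auto simp: fun_eq_iff)
qed

lemma B_measurable: "\<phi> \<in> B \<Longrightarrow> \<phi> \<in> borel_measurable M"
  using B_bounded bounded_borel_measurable by blast

lemma B_nonempty: "(\<lambda>x. 0) \<in> B"
  using B_one B_cmult[of _ 0] by auto

lemma B_minus: "\<phi> \<in> B \<Longrightarrow> (\<lambda>x. - \<phi> x) \<in> B"
  using B_cmult[of \<phi> "-1"] by simp

lemma B_diff: "\<phi> \<in> B \<Longrightarrow> \<psi> \<in> B \<Longrightarrow> (\<lambda>x. \<phi> x - \<psi> x) \<in> B"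
  using B_add[OF _ B_minus] by fastforce

lemma B_sum: "(\<And>i. i \<in> J \<Longrightarrow> f i \<in> B) \<Longrightarrow> (\<lambda>x. \<Sum>i\<in>J. f i x) \<in> B"
  by (induction J rule: infinite_finite_induct) (auto intro: B_add B_nonempty)

lemma X_zero: "i \<in> I \<Longrightarrow> X i (\<lambda>x. 0) = (\<lambda>x. 0)"
  using X_cmult[OF _ B_nonempty, of i 0] by simp

lemma X_minus: "i \<in> I \<Longrightarrow> \<phi> \<in> B \<Longrightarrow> X i (\<lambda>x. - \<phi> x) = (\<lambda>x. - X i \<phi> x)"
  using X_cmult[of i \<phi> "-1"] by simp

lemma X_diff:
  "i \<in> I \<Longrightarrow> \<phi> \<in> B \<Longrightarrow> \<psi> \<in> B \<Longrightarrow> X i (\<lambda>x. \<phi> x - \<psi> x) = (\<lambda>x. X i \<phi> x - X i \<psi> x)"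
  using X_add[of i \<phi> "\<lambda>x. - \<psi> x"] by (simp add: B_minus X_minus)

lemma X_sum:
  "i \<in> I \<Longrightarrow> (\<And>j. j \<in> J \<Longrightarrow> f j \<in> B) \<Longrightarrow> X i (\<lambda>x. \<Sum>j\<in>J. f j x) = (\<lambda>x. \<Sum>j\<in>J. X i (f j) x)"
  by (induction J rule: infinite_finite_induct) (auto simp: X_zero X_add B_sum)

lemma A_eq:
  assumes "\<phi> \<in> B" "finite J" "J \<subseteq> I" "\<And>i. i \<in> I - J \<Longrightarrow> X i \<phi> = (\<lambda>x. 0)"
  shows "A \<phi> = (\<lambda>x. \<Sum>i\<in>J. X i (X i \<phi>) x)"
  using sum_of_squares_op_eq[OF assms(2,3) order_refl assms(4) X_zero] assms(3) by (simp add: Int_absorb1)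

lemma A_B: "\<phi> \<in> B \<Longrightarrow> A \<phi> \<in> B"
  unfolding sum_of_squares_op_def by (intro B_sum X_B) auto

lemma common_support:
  assumes "finite \<Phi>" "\<Phi> \<subseteq> B"
  obtains J where "finite J" "J \<subseteq> I" "\<And>i \<phi>. i \<in> I - J \<Longrightarrow> \<phi> \<in> \<Phi> \<Longrightarrow> X i \<phi> = (\<lambda>x. 0)"
proof (rule that[of "\<Union>\<phi>\<in>\<Phi>. {i \<in> I. X i \<phi> \<noteq> (\<lambda>x. 0)}"])
  show "finite (\<Union>\<phi>\<in>\<Phi>. {i \<in> I. X i \<phi> \<noteq> (\<lambda>x. 0)})" using assms X_finite by blast
qed auto

lemma A_add:
  assumes "\<phi> \<in> B" "\<psi> \<in> B"
  shows "A (\<lambda>x. \<phi> x + \<psi> x) = (\<lambda>x. A \<phi> x + A \<psi> x)"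
proof -
  obtain J where J: "finite J" "J \<subseteq> I" "\<And>i \<eta>. i \<in> I - J \<Longrightarrow> \<eta> \<in> {\<phi>, \<psi>} \<Longrightarrow> X i \<eta> = (\<lambda>x. 0)"
    using common_support[of "{\<phi>, \<psi>}"] assms by auto
  have "A (\<lambda>x. \<phi> x + \<psi> x) = (\<lambda>x. \<Sum>i\<in>J. X i (X i (\<lambda>x. \<phi> x + \<psi> x)) x)"
    by (rule A_eq) (use J assms in \<open>auto simp: X_add intro: B_add\<close>)
  also have "\<dots> = (\<lambda>x. (\<Sum>i\<in>J. X i (X i \<phi>) x) + (\<Sum>i\<in>J. X i (X i \<psi>) x))"
    using J(2) assms by (auto simp: fun_eq_iff X_add X_B sum.distrib[symmetric] subset_iff intro!: sum.cong)
  also have "\<dots> = (\<lambda>x. A \<phi> x + A \<psi> x)"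
    using A_eq[OF assms(1) J(1,2)] A_eq[OF assms(2) J(1,2)] J(3) by simp
  finally show ?thesis .
qed

lemma A_cmult:
  assumes "\<phi> \<in> B"
  shows "A (\<lambda>x. c * \<phi> x) = (\<lambda>x. c * A \<phi> x)"
proof -
  obtain J where J: "finite J" "J \<subseteq> I" "\<And>i \<eta>. i \<in> I - J \<Longrightarrow> \<eta> \<in> {\<phi>} \<Longrightarrow> X i \<eta> = (\<lambda>x. 0)"
    using common_support[of "{\<phi>}"] assms by auto
  have "A (\<lambda>x. c * \<phi> x) = (\<lambda>x. \<Sum>i\<in>J. X i (X i (\<lambda>x. c * \<phi> x)) x)"
    by (rule A_eq) (use J assms in \<open>auto simp: X_cmult intro: B_cmult\<close>)
  also have "\<dots> = (\<lambda>x. c * (\<Sum>i\<in>J. X i (X i \<phi>) x))"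
    using J(2) assms by (auto simp: fun_eq_iff X_cmult X_B sum_distrib_left subset_iff intro!: sum.cong)
  also have "\<dots> = (\<lambda>x. c * A \<phi> x)" using A_eq[OF assms(1) J(1,2)] J(3) by simp
  finally show ?thesis .
qed

lemma integration_by_parts:
  assumes "i \<in> I" "\<phi> \<in> B" "\<psi> \<in> B"
  shows "(\<integral>x. X i \<phi> x * \<psi> x \<partial>M) = - (\<integral>x. \<phi> x * X i \<psi> x \<partial>M)"
proof -
  have "0 = (\<integral>x. X i \<phi> x * \<psi> x + \<phi> x * X i \<psi> x \<partial>M)"
    using X_integral[OF assms(1) B_mult[OF assms(2,3)]] by (simp add: X_mult assms)
  also have "\<dots> = (\<integral>x. X i \<phi> x * \<psi> x \<partial>M) + (\<integral>x. \<phi> x * X i \<psi> x \<partial>M)"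
    using assms by (intro Bochner_Integration.integral_add integrable_bounded_borel B_bounded B_mult X_B)
  finally show ?thesis by simp
qed

lemma H_diff:
  assumes "f \<in> bounded_borel M" "g \<in> bounded_borel M" "t \<ge> 0" "x \<in> space M"
  shows "H t (\<lambda>x. f x - g x) x = H t f x - H t g x"
  using H_linear[OF assms, of 1 "-1"] by simp

lemma H_cmult:
  assumes "f \<in> bounded_borel M" "t \<ge> 0" "x \<in> space M"
  shows "H t (\<lambda>x. c * f x) x = c * H t f x"
  using H_linear[OF assms(1,1,2,3), of c 0] by simp

lemma H_zero: "t \<ge> 0 \<Longrightarrow> x \<in> space M \<Longrightarrow> H t (\<lambda>x. 0) x = 0"
  using H_contract[of "\<lambda>x. 0" t 0 x] by auto

lemma H_sub_contract:
  assumes "f \<in> bounded_borel M" "g \<in> bounded_borel M" "t \<ge> 0" "x \<in> space M"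
    and "\<And>y. y \<in> space M \<Longrightarrow> \<bar>f y - g y\<bar> \<le> c"
  shows "\<bar>H t f x - H t g x\<bar> \<le> c"
  using H_contract[OF bounded_borel_diff[OF assms(1,2)] assms(3,5,4)] H_diff[OF assms(1-4)] by simp

lemma mixing_B: "C \<in> mixing_ops M B I X \<Longrightarrow> \<phi> \<in> B \<Longrightarrow> C \<phi> \<in> B"
  by (auto simp: mixing_ops_def)

lemma mixing_X: "C \<in> mixing_ops M B I X \<Longrightarrow> i \<in> I \<Longrightarrow> \<phi> \<in> B \<Longrightarrow> X i (C \<phi>) = C (X i \<phi>)"
  by (auto simp: mixing_ops_def)

lemma mixing_add: "C \<in> mixing_ops M B I X \<Longrightarrow> \<phi> \<in> B \<Longrightarrow> \<psi> \<in> B \<Longrightarrow>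
    C (\<lambda>x. \<phi> x + \<psi> x) = (\<lambda>x. C \<phi> x + C \<psi> x)"
  by (auto simp: mixing_ops_def)

lemma mixing_bound: "C \<in> mixing_ops M B I X \<Longrightarrow> \<phi> \<in> B \<Longrightarrow> (\<And>x. x \<in> space M \<Longrightarrow> \<bar>\<phi> x\<bar> \<le> c) \<Longrightarrow>
    x \<in> space M \<Longrightarrow> \<bar>C \<phi> x\<bar> \<le> c"
  by (auto simp: mixing_ops_def)

lemma H_approxE:
  assumes "finite \<Phi>" "\<Phi> \<subseteq> B" "t \<ge> 0"
  obtains C :: "nat \<Rightarrow> 'a operator" where "\<And>n. C n \<in> mixing_ops M B I X"
    "\<And>\<phi> x. \<phi> \<in> \<Phi> \<Longrightarrow> x \<in> space M \<Longrightarrow> (\<lambda>n. C n \<phi> x) \<longlonglongrightarrow> H t \<phi> x"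
  using H_approx[OF assms] by auto

lemma H_lipschitz:
  assumes "\<phi> \<in> B" "r \<ge> 0" "x \<in> space M" and c: "\<And>x. x \<in> space M \<Longrightarrow> \<bar>A \<phi> x\<bar> \<le> c"
  shows "\<bar>H r \<phi> x - \<phi> x\<bar> \<le> 3 * c * r"
proof -
  \<comment> \<open>Contractivity bounds the oscillation of \<open>A \<phi>\<close> by
    \<open>2 * c\<close>; the linear term contributes another \<open>c\<close>.\<close>
  have "\<bar>H r \<phi> x - \<phi> x - r * A \<phi> x\<bar> \<le> r * (2 * c)"
  proof (rule H_generator[OF assms(1,2) _ assms(3)])
    fix s :: real and x assume *: "0 \<le> s" "x \<in> space M"
    show "\<bar>H s (A \<phi>) x - A \<phi> x\<bar> \<le> 2 * c"
      using H_contract[OF B_bounded[OF A_B[OF assms(1)]] *(1) c *(2)] c[OF *(2)] by linarith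
  qed
  moreover have "\<bar>r * A \<phi> x\<bar> \<le> r * c" using assms c by (simp add: abs_mult mult_left_mono)
  ultimately show ?thesis by (simp add: abs_le_iff algebra_simps)
qed

lemma H_taylor:
  assumes "\<phi> \<in> B"
  obtains K where "K \<ge> 0" "\<And>t r x. t \<ge> 0 \<Longrightarrow> t + r \<ge> 0 \<Longrightarrow> x \<in> space M \<Longrightarrow>
    \<bar>H (t + r) \<phi> x - H t \<phi> x - r * H t (A \<phi>) x\<bar> \<le> K * r\<^sup>2"
proof -
  have B: "\<phi> \<in> B" "A \<phi> \<in> B" "A (A \<phi>) \<in> B" by (auto intro: A_B assms)
  note bb = this[THEN B_bounded]
  obtain c where c: "c \<ge> 0" "\<And>x. x \<in> space M \<Longrightarrow> \<bar>A (A \<phi>) x\<bar> \<le> c" using bounded_borelE[OF bb(3)] by blast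
  have one: "\<bar>H r \<phi> x - \<phi> x - r * A \<phi> x\<bar> \<le> 3 * c * r\<^sup>2" if "r \<ge> 0" "x \<in> space M" for r :: real and x
  proof -
    have "\<bar>H r \<phi> x - \<phi> x - r * A \<phi> x\<bar> \<le> r * (3 * c * r)"
    proof (rule H_generator[OF B(1) that(1) _ that(2)])
      fix s :: real and x assume *: "0 \<le> s" "s \<le> r" "x \<in> space M"
      have "\<bar>H s (A \<phi>) x - A \<phi> x\<bar> \<le> 3 * c * s" by (rule H_lipschitz) (use B c * in auto)
      also have "\<dots> \<le> 3 * c * r" using c * by (simp add: mult_left_mono)
      finally show "\<bar>H s (A \<phi>) x - A \<phi> x\<bar> \<le> 3 * c * r" .
    qed
    then show ?thesis by (simp add: power2_eq_square algebra_simps)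
  qed
  have two: "\<bar>H (t + r) \<phi> x - H t \<phi> x - r * H t (A \<phi>) x\<bar> \<le> 3 * c * r\<^sup>2"
    if "r \<ge> 0" "t \<ge> 0" "x \<in> space M" for t r :: real and x
  proof -
    have "\<bar>H t (H r \<phi>) x - H t (\<lambda>x. 1 * \<phi> x + r * A \<phi> x) x\<bar> \<le> 3 * c * r\<^sup>2"
      by (rule H_sub_contract) (use one that bb in \<open>auto intro!: H_bounded simp: diff_diff_eq\<close>)
    then show ?thesis using H_semigroup[OF bb(1) that(2,1,3)] H_linear[OF bb(1,2) that(2,3), of 1 r] by (simp add: diff_diff_eq)
  qed
  show thesis
  proof (rule that[of "6 * c"])
    fix t r :: real and x assume *: "t \<ge> 0" "t + r \<ge> 0" "x \<in> space M"
    show "\<bar>H (t + r) \<phi> x - H t \<phi> x - r * H t (A \<phi>) x\<bar> \<le> 6 * c * r\<^sup>2"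
    proof (cases "r \<ge> 0")
      case True
      have "3 * c * r\<^sup>2 \<le> 6 * c * r\<^sup>2" using c by (simp add: mult_right_mono)
      then show ?thesis using two[OF True *(1,3)] by linarith
    next
      \<comment> \<open>For a step backwards expand forwards from \<open>t + r\<close>, then
        exchange the time at which the linear term is taken; this costs another
        \<open>3 * c\<close>.\<close>
      case False
      define d where "d = - r"
      have d: "d \<ge> 0" "t = t + r + d" using False by (auto simp: d_def)
      have 1: "\<bar>H t \<phi> x - H (t + r) \<phi> x - d * H (t + r) (A \<phi>) x\<bar> \<le> 3 * c * d\<^sup>2"
        using two[OF d(1) *(2,3)] d(2) by simp
      have "\<bar>H (t + r) (H d (A \<phi>)) x - H (t + r) (A \<phi>) x\<bar> \<le> 3 * c * d"
        by (rule H_sub_contract) (use * d bb H_lipschitz[OF B(2) d(1) _ c(2)] in \<open>auto intro!: H_bounded\<close>)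
      then have "\<bar>H t (A \<phi>) x - H (t + r) (A \<phi>) x\<bar> \<le> 3 * c * d"
        using H_semigroup[OF bb(2) *(2) d(1) *(3)] d(2) by simp
      then have "d * \<bar>H t (A \<phi>) x - H (t + r) (A \<phi>) x\<bar> \<le> d * (3 * c * d)"
        using d(1) by (rule mult_left_mono)
      then have 2: "\<bar>d * H t (A \<phi>) x - d * H (t + r) (A \<phi>) x\<bar> \<le> 3 * c * d\<^sup>2"
      proof -
        have "\<bar>d * H t (A \<phi>) x - d * H (t + r) (A \<phi>) x\<bar> = d * \<bar>H t (A \<phi>) x - H (t + r) (A \<phi>) x\<bar>"
          using d(1) by (simp only: right_diff_distrib[symmetric] abs_mult abs_of_nonneg)
        also have "\<dots> \<le> d * (3 * c * d)" by fact
        finally show ?thesis by (simp add: power2_eq_square mult_ac)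
      qed
      show ?thesis using 1 2 by (simp add: d_def)
    qed
  qed (use c in simp)
qed

lemma H_DERIV:
  assumes "\<phi> \<in> B" "t > 0" "x \<in> space M"
  shows "((\<lambda>s. H s \<phi> x) has_real_derivative H t (A \<phi>) x) (at t)"
proof -
  obtain K where K: "K \<ge> 0" "\<And>t r x. t \<ge> 0 \<Longrightarrow> t + r \<ge> 0 \<Longrightarrow> x \<in> space M \<Longrightarrow>
    \<bar>H (t + r) \<phi> x - H t \<phi> x - r * H t (A \<phi>) x\<bar> \<le> K * r\<^sup>2" using H_taylor[OF assms(1)] by blast
  show ?thesis unfolding DERIV_def
  proof (rule LIM_zero_cancel, rule Lim_null_comparison)
    show "\<forall>\<^sub>F r in at 0. norm ((H (t + r) \<phi> x - H t \<phi> x) / r - H t (A \<phi>) x) \<le> K * \<bar>r\<bar>"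
      unfolding eventually_at
    proof (intro exI[of _ t] conjI ballI impI)
      fix r :: real assume r: "r \<noteq> 0 \<and> dist r 0 < t"
      show "norm ((H (t + r) \<phi> x - H t \<phi> x) / r - H t (A \<phi>) x) \<le> K * \<bar>r\<bar>"
        unfolding real_norm_def by (rule abs_quotient_diff_le) (use r assms K(2)[of t r x] in auto)
    qed (use assms in auto)
    show "((\<lambda>r. K * \<bar>r\<bar>) \<longlongrightarrow> 0) (at 0)" by (auto intro!: tendsto_eq_intros)
  qed
qed

text \<open>\<open>H t \<psi>\<close> need not lie in \<open>B\<close>, so \<open>X i\<close> cannot
  be applied to it. Each mixing operator preserves \<open>B\<close> and commutes with
  \<open>X i\<close>, so ordinary integration by parts holds for it and survives the limit.\<close>

lemma H_parts:
  assumes "i \<in> I" "\<phi> \<in> B" "\<psi> \<in> B" "t \<ge> 0"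
  shows "(\<integral>x. X i \<phi> x * H t \<psi> x \<partial>M) = - (\<integral>x. \<phi> x * H t (X i \<psi>) x \<partial>M)"
proof -
  have B: "\<psi> \<in> B" "X i \<psi> \<in> B" "X i \<phi> \<in> B" using assms X_B by auto
  obtain C where C: "\<And>n. C n \<in> mixing_ops M B I X"
    "\<And>\<phi> x. \<phi> \<in> {\<psi>, X i \<psi>} \<Longrightarrow> x \<in> space M \<Longrightarrow> (\<lambda>n. C n \<phi> x) \<longlonglongrightarrow> H t \<phi> x"
    using H_approxE[of "{\<psi>, X i \<psi>}" t] B assms(4) by auto
  have lim: "(\<lambda>n. \<integral>x. \<eta> x * C n \<xi> x \<partial>M) \<longlonglongrightarrow> (\<integral>x. \<eta> x * H t \<xi> x \<partial>M)"
    if \<xi>: "\<xi> \<in> {\<psi>, X i \<psi>}" and \<eta>: "\<eta> \<in> B" for \<eta> \<xi>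
  proof -
    have \<xi>B: "\<xi> \<in> B" using \<xi> B by auto
    obtain c where c: "c \<ge> 0" "\<And>x. x \<in> space M \<Longrightarrow> \<bar>\<eta> x\<bar> \<le> c" using bounded_borelE[OF B_bounded[OF \<eta>]] by blast
    obtain d where d: "d \<ge> 0" "\<And>x. x \<in> space M \<Longrightarrow> \<bar>\<xi> x\<bar> \<le> d" using bounded_borelE[OF B_bounded[OF \<xi>B]] by blast
    show ?thesis
    proof (rule bounded_convergence[where K = "c * d"])
      show "(\<lambda>x. \<eta> x * C n \<xi> x) \<in> borel_measurable M" for n
        using B_measurable[OF \<eta>] B_measurable[OF mixing_B[OF C(1) \<xi>B]] by measurable
    qed (use mixing_bound[OF C(1) \<xi>B d(2)] C(2)[OF \<xi>] c in \<open>auto simp: abs_mult intro!: mult_mono tendsto_intros\<close>)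
  qed
  have "(\<lambda>n. \<integral>x. X i \<phi> x * C n \<psi> x \<partial>M) \<longlonglongrightarrow> (\<integral>x. X i \<phi> x * H t \<psi> x \<partial>M)"
    by (rule lim) (use B in auto)
  moreover have "(\<integral>x. X i \<phi> x * C n \<psi> x \<partial>M) = - (\<integral>x. \<phi> x * C n (X i \<psi>) x \<partial>M)" for n
    using integration_by_parts[OF assms(1,2) mixing_B[OF C(1) assms(3)]] by (simp add: mixing_X[OF C(1)] assms)
  moreover have "(\<lambda>n. - (\<integral>x. \<phi> x * C n (X i \<psi>) x \<partial>M)) \<longlonglongrightarrow> - (\<integral>x. \<phi> x * H t (X i \<psi>) x \<partial>M)"
    by (rule tendsto_minus, rule lim) (use assms in auto)
  ultimately show ?thesis by (simp add: LIMSEQ_unique)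
qed

text \<open>The weak form of the generator, in which \<open>A_X_commute\<close> compares the two
  orders of \<open>A\<close> and \<open>X i\<close>.\<close>

lemma integral_generator:
  assumes "\<phi> \<in> B" "\<psi> \<in> B" and r: "\<And>n. 0 < r n" "\<And>n. r n \<le> 1" "r \<longlonglongrightarrow> 0"
  shows "(\<lambda>n. \<integral>x. \<phi> x * ((H (r n) \<psi> x - \<psi> x) / r n) \<partial>M) \<longlonglongrightarrow> (\<integral>x. \<phi> x * A \<psi> x \<partial>M)"
proof -
  obtain K where K: "K \<ge> 0" "\<And>t r x. t \<ge> 0 \<Longrightarrow> t + r \<ge> 0 \<Longrightarrow> x \<in> space M \<Longrightarrow>
    \<bar>H (t + r) \<psi> x - H t \<psi> x - r * H t (A \<psi>) x\<bar> \<le> K * r\<^sup>2" using H_taylor[OF assms(2)] by blast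
  have \<psi>: "\<psi> \<in> bounded_borel M" "A \<psi> \<in> bounded_borel M" using assms by (auto intro: B_bounded A_B)
  have est: "\<bar>(H (r n) \<psi> x - \<psi> x) / r n - A \<psi> x\<bar> \<le> K * r n" if "x \<in> space M" for n x
  proof -
    have "\<bar>(H (r n) \<psi> x - \<psi> x) / r n - A \<psi> x\<bar> \<le> K * \<bar>r n\<bar>"
      by (rule abs_quotient_diff_le)
         (use K(2)[of 0 "r n" x] that r(1)[of n] H_0[OF \<psi>(1) that] H_0[OF \<psi>(2) that] in auto)
    then show ?thesis using r(1)[of n] by simp
  qed
  obtain c where c: "c \<ge> 0" "\<And>x. x \<in> space M \<Longrightarrow> \<bar>\<phi> x\<bar> \<le> c" using bounded_borelE[OF B_bounded[OF assms(1)]] by blast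
  obtain d where d: "d \<ge> 0" "\<And>x. x \<in> space M \<Longrightarrow> \<bar>A \<psi> x\<bar> \<le> d" using bounded_borelE[OF \<psi>(2)] by blast
  show ?thesis
  proof (rule bounded_convergence[where K = "c * (d + K)"])
    show "(\<lambda>x. \<phi> x * ((H (r n) \<psi> x - \<psi> x) / r n)) \<in> borel_measurable M" for n
      using B_measurable[OF assms(1)] B_measurable[OF assms(2)]
        bounded_borel_measurable[OF H_bounded[OF \<psi>(1), of "r n"]] r(1)[of n] by simp
    fix x assume x: "x \<in> space M"
    have "(\<lambda>n. (H (r n) \<psi> x - \<psi> x) / r n - A \<psi> x) \<longlonglongrightarrow> 0"
    proof (rule Lim_null_comparison)
      show "(\<lambda>n. K * r n) \<longlonglongrightarrow> 0" using tendsto_mult_right_zero[OF r(3)] .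
    qed (use est[OF x] in auto)
    then have "(\<lambda>n. (H (r n) \<psi> x - \<psi> x) / r n) \<longlonglongrightarrow> A \<psi> x" by (simp add: LIM_zero_iff)
    then show "(\<lambda>n. \<phi> x * ((H (r n) \<psi> x - \<psi> x) / r n)) \<longlonglongrightarrow> \<phi> x * A \<psi> x"
      by (rule tendsto_mult_left)
    fix n
    have "K * r n \<le> K" using K(1) r(2)[of n] by (simp add: mult_left_le)
    then have "\<bar>(H (r n) \<psi> x - \<psi> x) / r n\<bar> \<le> d + K"
      using est[OF x, of n] d(2)[OF x] by linarith
    then show "\<bar>\<phi> x * ((H (r n) \<psi> x - \<psi> x) / r n)\<bar> \<le> c * (d + K)"
      using c x unfolding abs_mult by (intro mult_mono) auto
  qed
qed

text \<open>Centrality enters here: \<open>H\<close> is a limit of operators that commute with each \<open>X i\<close>, so its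
  generator commutes with \<open>X i\<close> weakly, hence on \<open>B\<close>.\<close>

lemma A_X_commute:
  assumes "i \<in> I" "\<psi> \<in> B"
  shows "A (X i \<psi>) = X i (A \<psi>)"
proof -
  have weak: "(\<integral>x. \<phi> x * (A (X i \<psi>) x - X i (A \<psi>) x) \<partial>M) = 0" if \<phi>: "\<phi> \<in> B" for \<phi>
  proof -
    define r where "r n = inverse (real (Suc n))" for n
    have r: "\<And>n. 0 < r n" "\<And>n. r n \<le> 1" "r \<longlonglongrightarrow> 0"
      unfolding r_def using LIMSEQ_inverse_real_of_nat by (auto simp: field_simps)
    have "(\<integral>x. X i \<phi> x * ((H (r n) \<psi> x - \<psi> x) / r n) \<partial>M)
        = - (\<integral>x. \<phi> x * ((H (r n) (X i \<psi>) x - X i \<psi> x) / r n) \<partial>M)" for n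
    proof -
      have i: "(\<integral>x. \<eta> x * ((H (r n) \<xi> x - \<xi> x) / r n) \<partial>M)
          = ((\<integral>x. \<eta> x * H (r n) \<xi> x \<partial>M) - (\<integral>x. \<eta> x * \<xi> x \<partial>M)) / r n" if "\<eta> \<in> B" "\<xi> \<in> B" for \<eta> \<xi>
      proof -
        have "integrable M (\<lambda>x. \<eta> x * H (r n) \<xi> x)"
          using that r(1)[of n] by (intro integrable_bounded_borel bounded_borel_mult H_bounded B_bounded) auto
        moreover have "integrable M (\<lambda>x. \<eta> x * \<xi> x)"
          using that by (intro integrable_bounded_borel bounded_borel_mult B_bounded)
        moreover have "(\<lambda>x. \<eta> x * ((H (r n) \<xi> x - \<xi> x) / r n)) = (\<lambda>x. (\<eta> x * H (r n) \<xi> x - \<eta> x * \<xi> x) / r n)"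
          by (simp add: right_diff_distrib diff_divide_distrib)
        ultimately show ?thesis by simp
      qed
      have "r n \<ge> 0" using r(1)[of n] by simp
      then show ?thesis
        unfolding i[OF X_B[OF assms(1) \<phi>] assms(2)] i[OF \<phi> X_B[OF assms]]
          H_parts[OF assms(1) \<phi> assms(2) \<open>r n \<ge> 0\<close>] integration_by_parts[OF assms(1) \<phi> assms(2)]
        by (simp add: minus_divide_left)
    qed
    then have "(\<integral>x. X i \<phi> x * A \<psi> x \<partial>M) = - (\<integral>x. \<phi> x * A (X i \<psi>) x \<partial>M)"
      using LIMSEQ_unique[OF integral_generator[OF X_B[OF assms(1) \<phi>] assms(2) r]]
        tendsto_minus[OF integral_generator[OF \<phi> X_B[OF assms] r]] by simp
    then have "(\<integral>x. \<phi> x * A (X i \<psi>) x \<partial>M) = (\<integral>x. \<phi> x * X i (A \<psi>) x \<partial>M)"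
      using integration_by_parts[OF assms(1) \<phi> A_B[OF assms(2)]] by simp
    moreover have "integrable M (\<lambda>x. \<phi> x * A (X i \<psi>) x)" "integrable M (\<lambda>x. \<phi> x * X i (A \<psi>) x)"
      using assms \<phi> by (intro integrable_bounded_borel bounded_borel_mult B_bounded A_B X_B; simp)+
    ultimately show ?thesis by (simp add: right_diff_distrib)
  qed
  \<comment> \<open>The weak identity may be tested with the difference itself, which lies in
    \<open>B\<close>; \<open>B_zero\<close> turns it into an equality of functions.\<close>
  define d where "d = (\<lambda>x. A (X i \<psi>) x - X i (A \<psi>) x)"
  have "d \<in> B" unfolding d_def using assms by (intro B_diff A_B X_B)
  then have "d = (\<lambda>x. 0)" by (intro B_zero) (use weak[of d] in \<open>auto simp: d_def\<close>)
  then show ?thesis by (auto simp: d_def fun_eq_iff)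
qed

end

section \<open>Polynomial approximation with control of derivatives\<close>

lemma polynomial_approx:
  fixes f :: "real \<Rightarrow> real"
  assumes "continuous_on {a..b} f"
  obtains P where "\<And>k. real_polynomial_function (P k)"
    "\<And>k y. y \<in> {a..b} \<Longrightarrow> \<bar>f y - P k y\<bar> < inverse (real (Suc k))"
proof -
  have "\<exists>g. real_polynomial_function g \<and> (\<forall>y\<in>{a..b}. \<bar>f y - g y\<bar> < inverse (real (Suc k)))" for k
    using Stone_Weierstrass_real_polynomial_function[OF compact_Icc assms, of "inverse (real (Suc k))"]
    by (metis inverse_positive_iff_positive of_nat_0_less_iff zero_less_Suc)
  then show thesis using that by metis
qed

text \<open>Real powers of test functions are reached through polynomials, because \<open>B\<close>
  is an algebra. Weierstrass is applied to the derivative and the result is integrated, which makes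
  values and derivatives converge together.\<close>

lemma C1_polynomial_approx:
  fixes \<Psi> \<Psi>' :: "real \<Rightarrow> real"
  assumes R: "0 \<le> R" and cont: "continuous_on {0..R} \<Psi>'"
    and der: "\<And>y. y \<in> {0..R} \<Longrightarrow> (\<Psi> has_real_derivative \<Psi>' y) (at y within {0..R})"
  obtains P P' :: "nat \<Rightarrow> real \<Rightarrow> real" and K :: real where
    "\<And>k. real_polynomial_function (P k)" "\<And>k y. (P k has_real_derivative P' k y) (at y)"
    "\<And>y. y \<in> {0..R} \<Longrightarrow> (\<lambda>k. P k y) \<longlonglongrightarrow> \<Psi> y" "\<And>y. y \<in> {0..R} \<Longrightarrow> (\<lambda>k. P' k y) \<longlonglongrightarrow> \<Psi>' y"
    "\<And>k y. y \<in> {0..R} \<Longrightarrow> \<bar>P k y\<bar> \<le> K" "\<And>k y. y \<in> {0..R} \<Longrightarrow> \<bar>P' k y\<bar> \<le> K"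
proof -
  obtain P' where P': "\<And>k. real_polynomial_function (P' k)"
    "\<And>k y. y \<in> {0..R} \<Longrightarrow> \<bar>\<Psi>' y - P' k y\<bar> < inverse (real (Suc k))" using polynomial_approx[OF cont] by metis
  have "\<exists>a n. P' k = (\<lambda>x. \<Sum>i\<le>n. a i * x ^ i)" for k
    using P'(1)[of k] by (simp add: real_polynomial_function_iff_sum)
  then obtain a n where an: "\<And>k. P' k = (\<lambda>x. \<Sum>i\<le>n k. a k i * x ^ i)" by metis
  \<comment> \<open>The primitive of \<open>P' k\<close> that agrees with \<open>\<Psi>\<close> at
    0.\<close>
  define P where "P k = (\<lambda>x. \<Psi> 0 + (\<Sum>i\<le>n k. (a k i / real (Suc i)) * x ^ Suc i))" for k
  have poly: "real_polynomial_function (P k)" for k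
    unfolding P_def
    by (intro real_polynomial_function.intros(2,3) real_polynomial_function_sum
        real_polynomial_function_power real_polynomial_function.intros(1) bounded_linear_ident finite_atMost
        real_polynomial_function.intros(4))
  have dP: "(P k has_real_derivative P' k y) (at y)" for k y
    unfolding P_def an
    by (rule derivative_eq_intros refl | simp del: of_nat_Suc power_Suc)+
       (auto intro!: sum.cong simp: field_simps simp del: of_nat_Suc)
  have bd': "\<bar>P' k y - \<Psi>' y\<bar> \<le> inverse (real (Suc k))" if "y \<in> {0..R}" for k y
    using P'(2)[OF that, of k] by linarith
  have bd: "\<bar>P k y - \<Psi> y\<bar> \<le> inverse (real (Suc k)) * R" if y: "y \<in> {0..R}" for k y
  proof -
    have "norm ((P k y - \<Psi> y) - (P k 0 - \<Psi> 0)) \<le> inverse (real (Suc k)) * norm (y - 0)"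
    proof (rule field_differentiable_bound[where S = "{0..R}" and f' = "\<lambda>y. P' k y - \<Psi>' y"])
      fix z assume "z \<in> {0..R}"
      then show "((\<lambda>y. P k y - \<Psi> y) has_field_derivative P' k z - \<Psi>' z) (at z within {0..R})"
        by (intro DERIV_diff der has_field_derivative_at_within[OF dP])
      show "norm (P' k z - \<Psi>' z) \<le> inverse (real (Suc k))" using bd'[OF \<open>z \<in> {0..R}\<close>] by simp
    qed (use y R in auto)
    also have "\<dots> \<le> inverse (real (Suc k)) * R" using y by (intro mult_left_mono) auto
    finally show ?thesis by (simp add: P_def)
  qed
  obtain c where c: "\<And>y. y \<in> {0..R} \<Longrightarrow> \<bar>\<Psi>' y\<bar> \<le> c"
    using compact_imp_bounded[OF compact_continuous_image[OF cont compact_Icc]]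
    unfolding bounded_iff ball_simps real_norm_def by blast
  have "continuous_on {0..R} \<Psi>" using der by (rule DERIV_continuous_on)
  then have "bounded (\<Psi> ` {0..R})" by (intro compact_imp_bounded compact_continuous_image) auto
  then obtain d where d: "\<And>y. y \<in> {0..R} \<Longrightarrow> \<bar>\<Psi> y\<bar> \<le> d"
    unfolding bounded_iff ball_simps real_norm_def by blast
  have i1: "inverse (real (Suc k)) \<le> 1" for k by (simp add: field_simps)
  note lim0 = LIMSEQ_inverse_real_of_nat
  show thesis
  proof (rule that[of P P' "max (c + 1) (d + R)"])
    show "(\<lambda>k. P k y) \<longlonglongrightarrow> \<Psi> y" if "y \<in> {0..R}" for y
      by (rule LIM_zero_cancel, rule Lim_null_comparison[OF _ tendsto_mult_left_zero[OF lim0, of R]])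
         (use bd[OF that] in auto)
    show "(\<lambda>k. P' k y) \<longlonglongrightarrow> \<Psi>' y" if "y \<in> {0..R}" for y
      by (rule LIM_zero_cancel, rule Lim_null_comparison[OF _ lim0]) (use bd'[OF that] in auto)
    show "\<bar>P k y\<bar> \<le> max (c + 1) (d + R)" if "y \<in> {0..R}" for k y
    proof -
      have "inverse (real (Suc k)) * R \<le> 1 * R" using R by (intro mult_right_mono i1)
      then show ?thesis using bd[OF that, of k] d[OF that] by linarith
    qed
    show "\<bar>P' k y\<bar> \<le> max (c + 1) (d + R)" if "y \<in> {0..R}" for k y
      using bd'[OF that, of k] i1[of k] c[OF that] by linarith
  qed (fact poly dP)+
qed

lemma bounded_seqs_sum:
  "(\<And>i. i \<in> J \<Longrightarrow> F i \<in> bounded_seqs N) \<Longrightarrow> (\<lambda>n x. \<Sum>i\<in>J. F i n x) \<in> bounded_seqs N"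
  by (induction J rule: infinite_finite_induct)
     (auto intro!: bounded_seqs_add bounded_seqs_const bounded_borel_const)

lemma bounded_seqs_compose:
  assumes "F \<in> bounded_seqs N" "continuous_on UNIV P" shows "(\<lambda>n x. P (F n x)) \<in> bounded_seqs N"
proof -
  obtain c where c: "c \<ge> 0" "\<And>n x. x \<in> space N \<Longrightarrow> \<bar>F n x\<bar> \<le> c" using bounded_seqsE[OF assms(1)] by blast
  have "bounded (P ` {-c..c})"
    by (intro compact_imp_bounded compact_continuous_image continuous_on_subset[OF assms(2)]) auto
  then obtain d where d: "\<And>y. y \<in> {-c..c} \<Longrightarrow> \<bar>P y\<bar> \<le> d"
    unfolding bounded_iff ball_simps real_norm_def by blast
  have "P \<in> borel_measurable borel" using assms(2) by (rule borel_measurable_continuous_onI)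
  then have "(\<lambda>x. P (F n x)) \<in> borel_measurable N" for n
    using measurable_compose[OF bounded_seqs_measurable[OF assms(1)]] by blast
  moreover have "\<bar>P (F n x)\<bar> \<le> d" if "x \<in> space N" for n x
    using d[of "F n x"] c(2)[OF that, of n] by (simp add: abs_le_iff)
  ultimately show ?thesis by (rule bounded_seqsI)
qed

lemma (in prob_space) integral_bounded_seqs_tendsto:
  assumes "F \<in> bounded_seqs M" "\<And>x. x \<in> space M \<Longrightarrow> (\<lambda>n. F n x) \<longlonglongrightarrow> f x"
  shows "(\<lambda>n. \<integral>x. F n x \<partial>M) \<longlonglongrightarrow> (\<integral>x. f x \<partial>M)"
proof -
  obtain c where c: "c \<ge> 0" "\<And>n x. x \<in> space M \<Longrightarrow> \<bar>F n x\<bar> \<le> c" using bounded_seqsE[OF assms(1)] by blast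
  show ?thesis by (rule bounded_convergence[OF bounded_seqs_measurable[OF assms(1)] c(2) assms(2)])
qed

text \<open>Cauchy-Schwarz for the vectors (h, sqrt m a) and (g, sqrt m b).\<close>

lemma sum_cauchy_schwarz_weighted:
  fixes a b :: "'i \<Rightarrow> real"
  assumes "m \<ge> 0"
  shows "(h * g + m * (\<Sum>j\<in>J. a j * b j))\<^sup>2
    \<le> (h * h + m * (\<Sum>j\<in>J. a j * a j)) * (g * g + m * (\<Sum>j\<in>J. b j * b j))"
proof -
  let ?S = "\<Sum>j\<in>J. a j * b j" and ?a = "\<Sum>j\<in>J. a j * a j" and ?b = "\<Sum>j\<in>J. b j * b j"
  have 1: "?S\<^sup>2 \<le> ?a * ?b"
    using Cauchy_Schwarz_ineq_sum[of a b J] by (simp add: power2_eq_square)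
  have "2 * h * g * ?S = (\<Sum>j\<in>J. 2 * (h * b j) * (g * a j))"
    by (simp add: sum_distrib_left algebra_simps)
  also have "\<dots> \<le> (\<Sum>j\<in>J. (h * b j)\<^sup>2 + (g * a j)\<^sup>2)"
    by (intro sum_mono) (rule sum_squares_bound)
  also have "\<dots> = h * h * ?b + g * g * ?a"
    by (simp add: sum.distrib sum_distrib_left power2_eq_square algebra_simps)
  finally have 2: "2 * h * g * ?S \<le> h * h * ?b + g * g * ?a" .
  have "m * (2 * h * g * ?S) \<le> m * (h * h * ?b + g * g * ?a)" using 2 assms by (rule mult_left_mono)
  moreover have "m\<^sup>2 * ?S\<^sup>2 \<le> m\<^sup>2 * (?a * ?b)" using 1 by (intro mult_left_mono) auto
  ultimately show ?thesis by (simp add: power2_eq_square algebra_simps)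
qed

section \<open>The gradient estimate\<close>

text \<open>For \<open>h = H s \<phi>\<close>, \<open>g j = X j h\<close> and \<open>k i j = X i (X j h)\<close> these are \<open>Q = h\<^sup>2 + m \<bar>\<nabla>h\<bar>\<^sup>2\<close>, the derivative
  \<open>X i Q\<close>, and \<open>A Q\<close>, where \<open>a = A h\<close> and \<open>b j = A (X j h)\<close>.\<close>

definition grad_Q where
  "grad_Q m J h g = (\<lambda>x. h x * h x + m * (\<Sum>j\<in>J. g j x * g j x))" for m :: real

definition grad_QX where
  "grad_QX m J h g k i = (\<lambda>x. 2 * (h x * g i x + m * (\<Sum>j\<in>J. g j x * k i j x)))" for m :: real

definition grad_QA where
  "grad_QA m J h g k a b = (\<lambda>x. 2 * (h x * a x + (\<Sum>i\<in>J. g i x * g i x)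
      + m * (\<Sum>j\<in>J. g j x * b j x + (\<Sum>i\<in>J. k i j x * k i j x))))" for m :: real

lemma grad_Q_nonneg: "m \<ge> 0 \<Longrightarrow> grad_Q m J h g x \<ge> 0"
  by (simp add: grad_Q_def sum_nonneg)

text \<open>Up to the factor 2, \<open>grad_QX\<close> is the weighted inner product of the pair (h,
  gradient of h) with its derivative along \<open>X i\<close>. Its square is therefore bounded by
  \<open>grad_Q\<close> times the very squares that occur in \<open>grad_QA\<close>, which is what
  makes absorption possible.\<close>

lemma grad_QX_le:
  assumes "m \<ge> 0" "finite J"
  shows "(\<Sum>i\<in>J. (grad_QX m J h g k i x)\<^sup>2)
    \<le> 4 * grad_Q m J h g x * ((\<Sum>i\<in>J. g i x * g i x) + m * (\<Sum>j\<in>J. \<Sum>i\<in>J. k i j x * k i j x))"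
proof -
  have "(grad_QX m J h g k i x)\<^sup>2 \<le> 4 * grad_Q m J h g x * (g i x * g i x + m * (\<Sum>j\<in>J. k i j x * k i j x))" for i
    using sum_cauchy_schwarz_weighted[OF assms(1), of "h x" "g i x" "\<lambda>j. g j x" "\<lambda>j. k i j x" J]
    unfolding grad_QX_def grad_Q_def power_mult_distrib by (simp only: mult.assoc) simp
  then have "(\<Sum>i\<in>J. (grad_QX m J h g k i x)\<^sup>2)
    \<le> (\<Sum>i\<in>J. 4 * grad_Q m J h g x * (g i x * g i x + m * (\<Sum>j\<in>J. k i j x * k i j x)))" by (rule sum_mono)
  also have "\<dots> = 4 * grad_Q m J h g x * ((\<Sum>i\<in>J. g i x * g i x) + m * (\<Sum>i\<in>J. \<Sum>j\<in>J. k i j x * k i j x))"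
    by (simp only: sum_distrib_left sum.distrib distrib_left)
  also have "(\<Sum>i\<in>J. \<Sum>j\<in>J. k i j x * k i j x) = (\<Sum>j\<in>J. \<Sum>i\<in>J. k i j x * k i j x)" by (rule sum.swap)
  finally show ?thesis .
qed

context derivation_semigroup
begin

lemma B_power:
  assumes "\<phi> \<in> B"
  shows "\<exists>\<psi>\<in>B. (\<forall>x\<in>space M. \<psi> x = \<phi> x ^ n) \<and> (\<forall>i\<in>I. \<forall>x\<in>space M. X i \<psi> x = real n * \<phi> x ^ (n - 1) * X i \<phi> x)"
proof (induction n)
  case 0
  obtain e where e: "e \<in> B" "\<And>x. x \<in> space M \<Longrightarrow> e x = 1" using B_one by blast
  have ee: "(\<lambda>x. e x * e x) = e" by (rule B_eqI) (use e B_mult in auto)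
  \<comment> \<open>On the space \<open>e\<close> equals 1, so the Leibniz rule for
    \<open>e * e = e\<close> gives \<open>X i e = 2 * X i e\<close> there.\<close>
  have "X i e x = 0" if "i \<in> I" "x \<in> space M" for i x
    using fun_cong[OF X_mult[OF that(1) e(1) e(1)], of x] e(2)[OF that(2)] by (simp add: ee)
  then show ?case using e by (intro bexI[of _ e]) auto
next
  case (Suc n)
  then obtain \<psi> where \<psi>: "\<psi> \<in> B" "\<And>x. x \<in> space M \<Longrightarrow> \<psi> x = \<phi> x ^ n"
    "\<And>i x. i \<in> I \<Longrightarrow> x \<in> space M \<Longrightarrow> X i \<psi> x = real n * \<phi> x ^ (n - 1) * X i \<phi> x" by blast
  show ?case
  proof (intro bexI[of _ "\<lambda>x. \<phi> x * \<psi> x"] conjI ballI)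
    fix i x assume ix: "i \<in> I" "x \<in> space M"
    show "X i (\<lambda>x. \<phi> x * \<psi> x) x = real (Suc n) * \<phi> x ^ (Suc n - 1) * X i \<phi> x"
      using ix by (cases n) (auto simp: X_mult[OF ix(1) assms \<psi>(1)] \<psi> algebra_simps)
  qed (auto simp: \<psi> assms intro: B_mult)
qed

lemma B_polynomial:
  assumes P: "real_polynomial_function P" and der: "\<And>y. (P has_real_derivative P' y) (at y)" and \<phi>: "\<phi> \<in> B"
  obtains \<psi> where "\<psi> \<in> B" "\<And>x. x \<in> space M \<Longrightarrow> \<psi> x = P (\<phi> x)"
    "\<And>i x. i \<in> I \<Longrightarrow> x \<in> space M \<Longrightarrow> X i \<psi> x = P' (\<phi> x) * X i \<phi> x"
proof -
  obtain a n where an: "P = (\<lambda>x. \<Sum>k\<le>n. a k * x ^ k)"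
    using P by (auto simp: real_polynomial_function_iff_sum)
  have "(P has_real_derivative (\<Sum>k\<le>n. a k * (real k * y ^ (k - 1)))) (at y)" for y
    unfolding an by (auto intro!: derivative_eq_intros sum.cong)
  then have P': "P' y = (\<Sum>k\<le>n. a k * (real k * y ^ (k - 1)))" for y using DERIV_unique[OF der] by blast
  obtain \<psi> where \<psi>: "\<And>k. \<psi> k \<in> B" "\<And>k x. x \<in> space M \<Longrightarrow> \<psi> k x = \<phi> x ^ k"
    "\<And>k i x. i \<in> I \<Longrightarrow> x \<in> space M \<Longrightarrow> X i (\<psi> k) x = real k * \<phi> x ^ (k - 1) * X i \<phi> x"
    using B_power[OF \<phi>] by metis
  show thesis
  proof (rule that[of "\<lambda>x. \<Sum>k\<le>n. a k * \<psi> k x"])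
    fix i x assume ix: "i \<in> I" "x \<in> space M"
    show "X i (\<lambda>x. \<Sum>k\<le>n. a k * \<psi> k x) x = P' (\<phi> x) * X i \<phi> x"
      using X_sum[OF ix(1), of "{..n}" "\<lambda>k x. a k * \<psi> k x"] ix
      by (simp add: B_cmult \<psi> X_cmult P' sum_distrib_right mult.assoc)
  qed (auto simp: \<psi> an intro!: B_sum B_cmult)
qed

lemma grad_Q_B:
  "\<psi> \<in> B \<Longrightarrow> J \<subseteq> I \<Longrightarrow> grad_Q m J \<psi> (\<lambda>j. X j \<psi>) \<in> B"
  unfolding grad_Q_def by (intro B_add B_mult B_cmult B_sum X_B) auto

lemma X_square: "i \<in> I \<Longrightarrow> \<psi> \<in> B \<Longrightarrow> X i (\<lambda>x. \<psi> x * \<psi> x) = (\<lambda>x. 2 * (\<psi> x * X i \<psi> x))"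
  by (auto simp: X_mult fun_eq_iff)

lemma A_square:
  assumes "\<psi> \<in> B" "finite J" "J \<subseteq> I" "\<And>i. i \<in> I - J \<Longrightarrow> X i \<psi> = (\<lambda>x. 0)"
  shows "A (\<lambda>x. \<psi> x * \<psi> x) = (\<lambda>x. 2 * (\<psi> x * A \<psi> x + (\<Sum>i\<in>J. X i \<psi> x * X i \<psi> x)))"
proof -
  have "A (\<lambda>x. \<psi> x * \<psi> x) = (\<lambda>x. \<Sum>i\<in>J. X i (X i (\<lambda>x. \<psi> x * \<psi> x)) x)"
    by (rule A_eq) (use assms in \<open>auto simp: X_square B_mult\<close>)
  also have "\<dots> = (\<lambda>x. \<Sum>i\<in>J. 2 * (\<psi> x * X i (X i \<psi>) x + X i \<psi> x * X i \<psi> x))"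
  proof (rule ext, rule sum.cong[OF refl])
    fix x i assume "i \<in> J"
    then have i: "i \<in> I" using assms by auto
    have "X i (X i (\<lambda>x. \<psi> x * \<psi> x)) = (\<lambda>x. 2 * X i (\<lambda>x. \<psi> x * X i \<psi> x) x)"
      using i assms by (simp add: X_square X_cmult B_mult X_B)
    then show "X i (X i (\<lambda>x. \<psi> x * \<psi> x)) x = 2 * (\<psi> x * X i (X i \<psi>) x + X i \<psi> x * X i \<psi> x)"
      using i assms by (simp add: X_mult X_B)
  qed
  also have "\<dots> = (\<lambda>x. 2 * (\<psi> x * (\<Sum>i\<in>J. X i (X i \<psi>) x) + (\<Sum>i\<in>J. X i \<psi> x * X i \<psi> x)))"
    by (simp add: sum_distrib_left sum.distrib)
  also have "(\<lambda>x. \<Sum>i\<in>J. X i (X i \<psi>) x) = A \<psi>" by (rule A_eq[symmetric]) fact+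
  then have "(\<lambda>x. 2 * (\<psi> x * (\<Sum>i\<in>J. X i (X i \<psi>) x) + (\<Sum>i\<in>J. X i \<psi> x * X i \<psi> x)))
      = (\<lambda>x. 2 * (\<psi> x * A \<psi> x + (\<Sum>i\<in>J. X i \<psi> x * X i \<psi> x)))" by (simp add: fun_eq_iff)
  finally show ?thesis .
qed

lemma X_grad_Q:
  assumes "\<psi> \<in> B" "J \<subseteq> I" "i \<in> I"
  shows "X i (grad_Q m J \<psi> (\<lambda>j. X j \<psi>)) = grad_QX m J \<psi> (\<lambda>j. X j \<psi>) (\<lambda>i j. X i (X j \<psi>)) i"
proof -
  have B: "\<And>j. j \<in> J \<Longrightarrow> X j \<psi> \<in> B" using assms X_B by auto
  have "X i (grad_Q m J \<psi> (\<lambda>j. X j \<psi>))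
    = (\<lambda>x. X i (\<lambda>x. \<psi> x * \<psi> x) x + m * (\<Sum>j\<in>J. X i (\<lambda>x. X j \<psi> x * X j \<psi> x) x))"
    unfolding grad_Q_def using assms B
    by (subst X_add) (auto intro!: B_mult B_cmult B_sum simp: X_cmult X_sum B_sum B_mult)
  then show ?thesis
    using assms B by (simp add: X_square grad_QX_def fun_eq_iff sum_distrib_left algebra_simps)
qed

lemma A_zero: "A (\<lambda>x. 0) = (\<lambda>x. 0)"
  using A_cmult[OF B_nonempty, of 0] by simp

lemma A_sum:
  "finite J \<Longrightarrow> (\<And>j. j \<in> J \<Longrightarrow> f j \<in> B) \<Longrightarrow> A (\<lambda>x. \<Sum>j\<in>J. f j x) = (\<lambda>x. \<Sum>j\<in>J. A (f j) x)"
  by (induction J rule: finite_induct) (auto simp: A_zero A_add B_sum)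

text \<open>Applied to a square, \<open>A\<close> adds twice the carre du champ to the product rule.
  This is used for \<open>\<psi>\<close> and for each \<open>X j \<psi>\<close>, so \<open>J\<close>
  has to support these derivatives as well.\<close>

lemma A_grad_Q:
  assumes "\<psi> \<in> B" "finite J" "J \<subseteq> I" "\<And>i. i \<in> I - J \<Longrightarrow> X i \<psi> = (\<lambda>x. 0)"
    "\<And>i j. i \<in> I - J \<Longrightarrow> j \<in> J \<Longrightarrow> X i (X j \<psi>) = (\<lambda>x. 0)"
  shows "A (grad_Q m J \<psi> (\<lambda>j. X j \<psi>))
     = grad_QA m J \<psi> (\<lambda>j. X j \<psi>) (\<lambda>i j. X i (X j \<psi>)) (A \<psi>) (\<lambda>j. A (X j \<psi>))"
proof -
  have B: "\<And>j. j \<in> J \<Longrightarrow> X j \<psi> \<in> B" using assms X_B by auto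
  have "A (grad_Q m J \<psi> (\<lambda>j. X j \<psi>))
    = (\<lambda>x. A (\<lambda>x. \<psi> x * \<psi> x) x + m * (\<Sum>j\<in>J. A (\<lambda>x. X j \<psi> x * X j \<psi> x) x))"
    unfolding grad_Q_def using assms(1,2) B
    by (subst A_add) (auto intro!: B_mult B_cmult B_sum simp: A_cmult A_sum B_sum B_mult)
  moreover have "A (\<lambda>x. X j \<psi> x * X j \<psi> x) = (\<lambda>x. 2 * (X j \<psi> x * A (X j \<psi>) x + (\<Sum>i\<in>J. X i (X j \<psi>) x * X i (X j \<psi>) x)))"
    if "j \<in> J" for j
    by (rule A_square) (use that B assms in auto)
  moreover have "A (\<lambda>x. \<psi> x * \<psi> x) = (\<lambda>x. 2 * (\<psi> x * A \<psi> x + (\<Sum>i\<in>J. X i \<psi> x * X i \<psi> x)))"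
    by (rule A_square) fact+
  ultimately show ?thesis by (simp add: grad_QA_def fun_eq_iff sum_distrib_left algebra_simps)
qed

lemma mixing_zero: "C \<in> mixing_ops M B I X \<Longrightarrow> C (\<lambda>x. 0) = (\<lambda>x. 0)"
  using mixing_add[OF _ B_nonempty B_nonempty, of C] by (simp add: fun_eq_iff)

lemma mixing_sum:
  "C \<in> mixing_ops M B I X \<Longrightarrow> (\<And>j. j \<in> J \<Longrightarrow> f j \<in> B) \<Longrightarrow> C (\<lambda>x. \<Sum>j\<in>J. f j x) = (\<lambda>x. \<Sum>j\<in>J. C (f j) x)"
  by (induction J rule: infinite_finite_induct) (auto simp: mixing_zero mixing_add[where \<psi> = "\<lambda>x. \<Sum>j\<in>_. f j x"] B_sum)

text \<open>A mixing operator maps 0 to 0, so an index set that supports \<open>\<psi>\<close> also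
  supports \<open>C \<psi>\<close>, and both sides are sums over the same finite set.\<close>

lemma mixing_A:
  assumes C: "C \<in> mixing_ops M B I X" and \<psi>: "\<psi> \<in> B"
  shows "A (C \<psi>) = C (A \<psi>)"
proof -
  obtain J where J: "finite J" "J \<subseteq> I" "\<And>i \<eta>. i \<in> I - J \<Longrightarrow> \<eta> \<in> {\<psi>} \<Longrightarrow> X i \<eta> = (\<lambda>x. 0)"
    using common_support[of "{\<psi>}"] assms by auto
  have "A (C \<psi>) = (\<lambda>x. \<Sum>i\<in>J. X i (X i (C \<psi>)) x)"
    by (rule A_eq) (use J assms in \<open>auto simp: mixing_X mixing_zero intro: mixing_B\<close>)
  also have "\<dots> = (\<lambda>x. \<Sum>i\<in>J. C (X i (X i \<psi>)) x)"
    using J(2) assms by (intro ext sum.cong) (auto simp: mixing_X X_B subset_iff)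
  also have "\<dots> = C (A \<psi>)"
    using J assms by (subst A_eq[OF \<psi> J(1,2)]) (auto simp: mixing_sum[OF C] X_B subset_iff)
  finally show ?thesis .
qed

lemma mixing_bounded_seqs:
  assumes "\<And>n. C n \<in> mixing_ops M B I X" "\<psi> \<in> B"
  shows "(\<lambda>n. C n \<psi>) \<in> bounded_seqs M"
proof -
  obtain c where "\<And>x. x \<in> space M \<Longrightarrow> \<bar>\<psi> x\<bar> \<le> c" using bounded_borelE[OF B_bounded[OF assms(2)]] by blast
  then show ?thesis
    using mixing_bound[OF assms(1,2)] B_measurable mixing_B[OF assms] by (intro bounded_seqsI[of _ _ c]) auto
qed

text \<open>Since \<open>P\<close> is a polynomial, P(Q) is again a test function with
  \<open>X i\<close> acting by the chain rule, and can serve as the multiplier in an integration by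
  parts.\<close>

lemma polynomial_identity_B:
  fixes m :: real
  assumes P: "real_polynomial_function P" and der: "\<And>y. (P has_real_derivative P' y) (at y)"
    and \<psi>: "\<psi> \<in> B" and J: "finite J" "J \<subseteq> I" "\<And>i. i \<in> I - J \<Longrightarrow> X i \<psi> = (\<lambda>x. 0)"
    "\<And>i j. i \<in> I - J \<Longrightarrow> j \<in> J \<Longrightarrow> X i (X j \<psi>) = (\<lambda>x. 0)"
  defines "Q \<equiv> grad_Q m J \<psi> (\<lambda>j. X j \<psi>)"
  shows "(\<integral>x. P (Q x) * A Q x \<partial>M) = - (\<integral>x. P' (Q x) * (\<Sum>i\<in>J. (X i Q x)\<^sup>2) \<partial>M)"
proof -
  have Q: "Q \<in> B" unfolding Q_def by (rule grad_Q_B[OF \<psi> J(2)])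
  have zero: "X i Q = (\<lambda>x. 0)" if "i \<in> I - J" for i
    unfolding Q_def using X_grad_Q[OF \<psi> J(2), of i m] that J by (auto simp: grad_QX_def)
  obtain \<xi> where \<xi>: "\<xi> \<in> B" "\<And>x. x \<in> space M \<Longrightarrow> \<xi> x = P (Q x)"
    "\<And>i x. i \<in> I \<Longrightarrow> x \<in> space M \<Longrightarrow> X i \<xi> x = P' (Q x) * X i Q x"
    using B_polynomial[OF P der Q] by blast
  have Aq: "A Q = (\<lambda>x. \<Sum>i\<in>J. X i (X i Q) x)" by (rule A_eq[OF Q J(1,2) zero])
  have "(\<integral>x. P (Q x) * A Q x \<partial>M) = (\<integral>x. (\<Sum>i\<in>J. X i (X i Q) x * \<xi> x) \<partial>M)"
    by (rule Bochner_Integration.integral_cong)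
       (simp_all add: \<xi> Aq sum_distrib_left mult.commute)
  also have "\<dots> = (\<Sum>i\<in>J. \<integral>x. X i (X i Q) x * \<xi> x \<partial>M)"
    using J Q \<xi> by (intro Bochner_Integration.integral_sum integrable_bounded_borel B_bounded B_mult X_B) auto
  also have "\<dots> = (\<Sum>i\<in>J. - (\<integral>x. X i Q x * X i \<xi> x \<partial>M))"
    using J(2) Q \<xi> by (intro sum.cong refl integration_by_parts X_B) auto
  also have "\<dots> = - (\<integral>x. (\<Sum>i\<in>J. X i Q x * X i \<xi> x) \<partial>M)"
    using J Q \<xi> by (subst Bochner_Integration.integral_sum)
      (auto intro!: integrable_bounded_borel B_bounded B_mult X_B simp: sum_negf)
  also have "(\<integral>x. (\<Sum>i\<in>J. X i Q x * X i \<xi> x) \<partial>M) = (\<integral>x. P' (Q x) * (\<Sum>i\<in>J. (X i Q x)\<^sup>2) \<partial>M)"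
    using J(2) by (intro Bochner_Integration.integral_cong)
      (auto simp: \<xi> sum_distrib_left power2_eq_square subset_iff algebra_simps intro!: sum.cong)
  finally show ?thesis .
qed

text \<open>Two rounds are enough: \<open>J0\<close> supports \<open>\<phi>\<close>,
  \<open>J1\<close> supports the finitely many derivatives along \<open>J0\<close>, and the
  derivatives along other indices vanish.\<close>

lemma closed_support:
  assumes "\<phi> \<in> B"
  obtains J where "finite J" "J \<subseteq> I" "\<And>i. i \<in> I - J \<Longrightarrow> X i \<phi> = (\<lambda>x. 0)"
    "\<And>i j. i \<in> I - J \<Longrightarrow> j \<in> J \<Longrightarrow> X i (X j \<phi>) = (\<lambda>x. 0)"
proof -
  obtain J0 where J0: "finite J0" "J0 \<subseteq> I" "\<And>i \<eta>. i \<in> I - J0 \<Longrightarrow> \<eta> \<in> {\<phi>} \<Longrightarrow> X i \<eta> = (\<lambda>x. 0)"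
    using common_support[of "{\<phi>}"] assms by auto
  obtain J1 where J1: "finite J1" "J1 \<subseteq> I" "\<And>i \<eta>. i \<in> I - J1 \<Longrightarrow> \<eta> \<in> (\<lambda>j. X j \<phi>) ` J0 \<Longrightarrow> X i \<eta> = (\<lambda>x. 0)"
  proof (rule common_support[of "(\<lambda>j. X j \<phi>) ` J0"])
    show "(\<lambda>j. X j \<phi>) ` J0 \<subseteq> B" using J0(2) assms by (auto intro: X_B)
  qed (use J0(1) in auto)
  show thesis
  proof (rule that[of "J0 \<union> J1"])
    fix i j assume "i \<in> I - (J0 \<union> J1)" "j \<in> J0 \<union> J1"
    then show "X i (X j \<phi>) = (\<lambda>x. 0)" using J0 J1 X_zero by (cases "j \<in> J0") auto
  qed (use J0 J1 in auto)
qed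

lemma bounded_seqs_grad:
  assumes "h \<in> bounded_seqs N" "\<And>j. j \<in> J \<Longrightarrow> (\<lambda>n. g n j) \<in> bounded_seqs N"
    "\<And>i j. i \<in> J \<Longrightarrow> j \<in> J \<Longrightarrow> (\<lambda>n. k n i j) \<in> bounded_seqs N" "a \<in> bounded_seqs N"
    "\<And>j. j \<in> J \<Longrightarrow> (\<lambda>n. b n j) \<in> bounded_seqs N"
  shows "(\<lambda>n. grad_Q m J (h n) (g n)) \<in> bounded_seqs N"
    and "i \<in> J \<Longrightarrow> (\<lambda>n. grad_QX m J (h n) (g n) (k n) i) \<in> bounded_seqs N"
    and "(\<lambda>n. grad_QA m J (h n) (g n) (k n) (a n) (b n)) \<in> bounded_seqs N"
  unfolding grad_Q_def grad_QX_def grad_QA_def using assms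
  by (auto intro!: bounded_seqs_add bounded_seqs_mult bounded_seqs_cmult bounded_seqs_sum)

lemma bounded_borel_grad:
  assumes "h \<in> bounded_borel M" "\<And>j. j \<in> J \<Longrightarrow> g j \<in> bounded_borel M"
    "\<And>i j. i \<in> J \<Longrightarrow> j \<in> J \<Longrightarrow> k i j \<in> bounded_borel M" "a \<in> bounded_borel M"
    "\<And>j. j \<in> J \<Longrightarrow> b j \<in> bounded_borel M"
  shows "grad_Q m J h g \<in> bounded_borel M"
    and "i \<in> J \<Longrightarrow> grad_QX m J h g k i \<in> bounded_borel M"
    and "grad_QA m J h g k a b \<in> bounded_borel M"
  using bounded_seqs_grad[of "\<lambda>n. h" M J "\<lambda>n. g" "\<lambda>n. k" "\<lambda>n. a" "\<lambda>n. b"] assms unfolding bounded_borel_iff by auto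

lemma tendsto_grad:
  assumes "(\<lambda>n. h n x) \<longlonglongrightarrow> h' x" "\<And>j. j \<in> J \<Longrightarrow> (\<lambda>n. g n j x) \<longlonglongrightarrow> g' j x"
    "\<And>i j. i \<in> J \<Longrightarrow> j \<in> J \<Longrightarrow> (\<lambda>n. k n i j x) \<longlonglongrightarrow> k' i j x" "(\<lambda>n. a n x) \<longlonglongrightarrow> a' x"
    "\<And>j. j \<in> J \<Longrightarrow> (\<lambda>n. b n j x) \<longlonglongrightarrow> b' j x"
  shows "(\<lambda>n. grad_Q m J (h n) (g n) x) \<longlonglongrightarrow> grad_Q m J h' g' x"
    and "i \<in> J \<Longrightarrow> (\<lambda>n. grad_QX m J (h n) (g n) (k n) i x) \<longlonglongrightarrow> grad_QX m J h' g' k' i x"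
    and "(\<lambda>n. grad_QA m J (h n) (g n) (k n) (a n) (b n) x) \<longlonglongrightarrow> grad_QA m J h' g' k' a' b' x"
  unfolding grad_Q_def grad_QX_def grad_QA_def using assms
  by (auto intro!: tendsto_add tendsto_mult tendsto_sum tendsto_const)

lemma real_polynomial_function_continuous:
  fixes P :: "real \<Rightarrow> real"
  assumes "real_polynomial_function P" shows "continuous_on UNIV P"
  using continuous_on_polymonial_function[of P UNIV] assms by (simp add: real_polynomial_function_eq)

text \<open>Two successive limits. For a polynomial in place of \<Psi> the identity is exact for
  mixing operators applied to \<open>\<phi>\<close>, and their limit yields it for
  \<open>H s\<close>; polynomials that converge together with their derivatives on the range of Q
  then yield it for \<Psi>. No field is ever applied to \<open>H s \<phi>\<close>, only
  \<open>H s\<close> to derivatives of \<open>\<phi>\<close>.\<close>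

lemma H_identity:
  fixes m :: real and \<Psi> \<Psi>' :: "real \<Rightarrow> real"
  assumes \<phi>: "\<phi> \<in> B" and J: "finite J" "J \<subseteq> I" "\<And>i. i \<in> I - J \<Longrightarrow> X i \<phi> = (\<lambda>x. 0)"
      "\<And>i j. i \<in> I - J \<Longrightarrow> j \<in> J \<Longrightarrow> X i (X j \<phi>) = (\<lambda>x. 0)"
    and s: "s \<ge> 0" and m: "m \<ge> 0"
    and cont: "\<And>R. continuous_on {0..R} \<Psi>'"
    and der: "\<And>y. y \<ge> 0 \<Longrightarrow> (\<Psi> has_real_derivative \<Psi>' y) (at y)"
  defines "Q \<equiv> grad_Q m J (H s \<phi>) (\<lambda>j. H s (X j \<phi>))"
    and "QX \<equiv> grad_QX m J (H s \<phi>) (\<lambda>j. H s (X j \<phi>)) (\<lambda>i j. H s (X i (X j \<phi>)))"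
    and "QA \<equiv> grad_QA m J (H s \<phi>) (\<lambda>j. H s (X j \<phi>)) (\<lambda>i j. H s (X i (X j \<phi>))) (H s (A \<phi>)) (\<lambda>j. H s (A (X j \<phi>)))"
  shows "(\<integral>x. \<Psi> (Q x) * QA x \<partial>M) = - (\<integral>x. \<Psi>' (Q x) * (\<Sum>i\<in>J. (QX i x)\<^sup>2) \<partial>M)"
proof -
  \<comment> \<open>One sequence of mixing operators has to serve all functions that occur in
    \<open>grad_Q\<close>, \<open>grad_QX\<close> and \<open>grad_QA\<close>.\<close>
  let ?\<Phi> = "{\<phi>, A \<phi>} \<union> (\<lambda>j. X j \<phi>) ` J \<union> (\<lambda>j. A (X j \<phi>)) ` J \<union> (\<lambda>(i, j). X i (X j \<phi>)) ` (J \<times> J)"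
  have \<Phi>: "finite ?\<Phi>" "?\<Phi> \<subseteq> B" using \<phi> J(1,2) by (auto intro!: A_B X_B)
  obtain C where C: "\<And>n. C n \<in> mixing_ops M B I X"
    and lim: "\<And>\<eta> x. \<eta> \<in> ?\<Phi> \<Longrightarrow> x \<in> space M \<Longrightarrow> (\<lambda>n. C n \<eta> x) \<longlonglongrightarrow> H s \<eta> x"
    using H_approxE[OF \<Phi> s] by blast
  have CB: "(\<lambda>n. C n \<eta>) \<in> bounded_seqs M" if "\<eta> \<in> ?\<Phi>" for \<eta>
    by (rule mixing_bounded_seqs[OF C subsetD[OF \<Phi>(2) that]])
  define Qn where "Qn n = grad_Q m J (C n \<phi>) (\<lambda>j. X j (C n \<phi>))" for n
  have XC: "X j (C n \<phi>) = C n (X j \<phi>)" "X i (C n (X j \<phi>)) = C n (X i (X j \<phi>))"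
    "A (C n (X j \<phi>)) = C n (A (X j \<phi>))" if "i \<in> J" "j \<in> J" for i j n
  proof -
    have "i \<in> I" "j \<in> I" using that J(2) by auto
    then show "X j (C n \<phi>) = C n (X j \<phi>)" "X i (C n (X j \<phi>)) = C n (X i (X j \<phi>))"
      "A (C n (X j \<phi>)) = C n (A (X j \<phi>))"
      by (auto intro!: mixing_X[OF C] mixing_A[OF C] X_B \<phi>)
  qed
  have AC: "A (C n \<phi>) = C n (A \<phi>)" for n using mixing_A[OF C \<phi>] .
  have Qn: "Qn n = grad_Q m J (C n \<phi>) (\<lambda>j. C n (X j \<phi>))" for n
    unfolding Qn_def grad_Q_def by (intro ext) (auto simp: XC intro!: sum.cong)
  have QnX: "X i (Qn n) = grad_QX m J (C n \<phi>) (\<lambda>j. C n (X j \<phi>)) (\<lambda>i j. C n (X i (X j \<phi>))) i" if "i \<in> J" for i n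
    unfolding Qn_def using that J(2)
    by (subst X_grad_Q[OF mixing_B[OF C \<phi>]]) (auto simp: grad_QX_def fun_eq_iff XC intro!: sum.cong)
  have zC: "X i (C n \<phi>) = (\<lambda>x. 0)" if "i \<in> I - J" for i n
    using that J(3)[OF that] by (simp add: mixing_X[OF C] \<phi> mixing_zero[OF C])
  have zC2: "X i (X j (C n \<phi>)) = (\<lambda>x. 0)" if "i \<in> I - J" "j \<in> J" for i j n
  proof -
    have "j \<in> I" using that J(2) by auto
    then show ?thesis using that J(4)[OF that] by (simp add: mixing_X[OF C] \<phi> X_B mixing_zero[OF C])
  qed
  have "A (Qn n) = grad_QA m J (C n \<phi>) (\<lambda>j. X j (C n \<phi>)) (\<lambda>i j. X i (X j (C n \<phi>))) (A (C n \<phi>)) (\<lambda>j. A (X j (C n \<phi>)))" for n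
    unfolding Qn_def by (rule A_grad_Q[OF mixing_B[OF C \<phi>] J(1,2) zC zC2])
  then have QnA: "A (Qn n) = grad_QA m J (C n \<phi>) (\<lambda>j. C n (X j \<phi>)) (\<lambda>i j. C n (X i (X j \<phi>))) (C n (A \<phi>)) (\<lambda>j. C n (A (X j \<phi>)))" for n
    by (auto simp: grad_QA_def fun_eq_iff XC AC intro!: sum.cong)
  have poly: "(\<integral>x. P (Q x) * QA x \<partial>M) = - (\<integral>x. P' (Q x) * (\<Sum>i\<in>J. (QX i x)\<^sup>2) \<partial>M)"
    if P: "real_polynomial_function P" and dP: "\<And>y. (P has_real_derivative P' y) (at y)" for P P'
  proof -
    have cP: "continuous_on UNIV P" by (rule real_polynomial_function_continuous[OF P])
    obtain P'' where "real_polynomial_function P''" "\<And>y. (P has_real_derivative P'' y) (at y)"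
      using has_real_derivative_polynomial_function[OF P] by blast
    then have P': "real_polynomial_function P'" using DERIV_unique[OF dP] by (metis ext)
    then have cP': "continuous_on UNIV P'" by (rule real_polynomial_function_continuous)
    have in\<Phi>: "\<phi> \<in> ?\<Phi>" "A \<phi> \<in> ?\<Phi>" "\<And>j. j \<in> J \<Longrightarrow> X j \<phi> \<in> ?\<Phi>" "\<And>j. j \<in> J \<Longrightarrow> A (X j \<phi>) \<in> ?\<Phi>"
      "\<And>i j. i \<in> J \<Longrightarrow> j \<in> J \<Longrightarrow> X i (X j \<phi>) \<in> ?\<Phi>" by auto
    note Cb = CB[OF in\<Phi>(1)] CB[OF in\<Phi>(3)] CB[OF in\<Phi>(5)] CB[OF in\<Phi>(2)] CB[OF in\<Phi>(4)]
    note Cl = lim[OF in\<Phi>(1)] lim[OF in\<Phi>(3)] lim[OF in\<Phi>(5)] lim[OF in\<Phi>(2)] lim[OF in\<Phi>(4)]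
    note tg = tendsto_grad[where h = "\<lambda>n. C n \<phi>" and h' = "H s \<phi>" and g = "\<lambda>n j. C n (X j \<phi>)"
        and g' = "\<lambda>j. H s (X j \<phi>)" and k = "\<lambda>n i j. C n (X i (X j \<phi>))" and k' = "\<lambda>i j. H s (X i (X j \<phi>))"
        and a = "\<lambda>n. C n (A \<phi>)" and a' = "H s (A \<phi>)" and b = "\<lambda>n j. C n (A (X j \<phi>))"
        and b' = "\<lambda>j. H s (A (X j \<phi>))" and J = J]
    have Qb: "Qn \<in> bounded_seqs M"
      unfolding Qn by (rule bounded_seqs_grad(1)[OF Cb])
    have XQb: "(\<lambda>n. X i (Qn n)) \<in> bounded_seqs M" if "i \<in> J" for i
      unfolding QnX[OF that] by (rule bounded_seqs_grad(2)[OF Cb that])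
    have AQb: "(\<lambda>n. A (Qn n)) \<in> bounded_seqs M"
      unfolding QnA by (rule bounded_seqs_grad(3)[OF Cb])
    have Ql: "(\<lambda>n. Qn n x) \<longlonglongrightarrow> Q x" if "x \<in> space M" for x
      unfolding Qn Q_def by (rule tg(1)) (simp_all add: Cl that)
    have XQl: "(\<lambda>n. X i (Qn n) x) \<longlonglongrightarrow> QX i x" if "i \<in> J" "x \<in> space M" for i x
      unfolding QnX[OF that(1)] QX_def by (rule tg(2)) (simp_all add: Cl that)
    have AQl: "(\<lambda>n. A (Qn n) x) \<longlonglongrightarrow> QA x" if "x \<in> space M" for x
      unfolding QnA QA_def by (rule tg(3)) (simp_all add: Cl that)
    have PQl: "(\<lambda>n. p (Qn n x)) \<longlonglongrightarrow> p (Q x)" if "continuous_on UNIV p" "x \<in> space M" for p :: "real \<Rightarrow> real" and x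
      using isCont_tendsto_compose[OF _ Ql[OF that(2)], of p] that(1) by (simp add: continuous_on_eq_continuous_at)
    have "(\<lambda>n. \<integral>x. P (Qn n x) * A (Qn n) x \<partial>M) \<longlonglongrightarrow> (\<integral>x. P (Q x) * QA x \<partial>M)"
      by (intro integral_bounded_seqs_tendsto bounded_seqs_mult bounded_seqs_compose[OF Qb cP] AQb tendsto_mult AQl PQl cP)
    moreover have "(\<lambda>n. - (\<integral>x. P' (Qn n x) * (\<Sum>i\<in>J. (X i (Qn n) x)\<^sup>2) \<partial>M)) \<longlonglongrightarrow> - (\<integral>x. P' (Q x) * (\<Sum>i\<in>J. (QX i x)\<^sup>2) \<partial>M)"
      unfolding power2_eq_square
      by (intro tendsto_minus integral_bounded_seqs_tendsto bounded_seqs_mult bounded_seqs_sum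
          bounded_seqs_compose[OF Qb cP'] XQb tendsto_mult tendsto_sum XQl PQl cP')
    moreover have "(\<integral>x. P (Qn n x) * A (Qn n) x \<partial>M) = - (\<integral>x. P' (Qn n x) * (\<Sum>i\<in>J. (X i (Qn n) x)\<^sup>2) \<partial>M)" for n
      unfolding Qn_def by (rule polynomial_identity_B[OF P dP mixing_B[OF C \<phi>] J(1,2) zC zC2])
    ultimately show ?thesis by (simp add: LIMSEQ_unique)
  qed
  have bb: "H s \<phi> \<in> bounded_borel M" "H s (A \<phi>) \<in> bounded_borel M"
    "\<And>j. j \<in> J \<Longrightarrow> H s (X j \<phi>) \<in> bounded_borel M" "\<And>j. j \<in> J \<Longrightarrow> H s (A (X j \<phi>)) \<in> bounded_borel M"
    "\<And>i j. i \<in> J \<Longrightarrow> j \<in> J \<Longrightarrow> H s (X i (X j \<phi>)) \<in> bounded_borel M"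
    using J(2) by (intro H_bounded[OF B_bounded s] A_B X_B \<phi>; blast)+
  have Q: "Q \<in> bounded_borel M" "QA \<in> bounded_borel M" "\<And>i. i \<in> J \<Longrightarrow> QX i \<in> bounded_borel M"
    unfolding Q_def QA_def QX_def
    by (rule bounded_borel_grad(1)[OF bb(1,3,5,2,4)] bounded_borel_grad(3)[OF bb(1,3,5,2,4)]
        bounded_borel_grad(2)[OF bb(1,3,5,2,4)]; assumption)+
  \<comment> \<open>Q is bounded and nonnegative, so the approximation of \<open>\<Psi>\<close>
    takes place on a compact interval.\<close>
  obtain R where R: "R \<ge> 0" "\<And>x. x \<in> space M \<Longrightarrow> \<bar>Q x\<bar> \<le> R" using bounded_borelE[OF Q(1)] by blast
  have QR: "Q x \<in> {0..R}" if "x \<in> space M" for x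
    using R(2)[OF that] grad_Q_nonneg[OF m] by (auto simp: Q_def abs_le_iff)
  obtain P P' K where P: "\<And>k. real_polynomial_function (P k)" "\<And>k y. (P k has_real_derivative P' k y) (at y)"
    "\<And>y. y \<in> {0..R} \<Longrightarrow> (\<lambda>k. P k y) \<longlonglongrightarrow> \<Psi> y" "\<And>y. y \<in> {0..R} \<Longrightarrow> (\<lambda>k. P' k y) \<longlonglongrightarrow> \<Psi>' y"
    "\<And>k y. y \<in> {0..R} \<Longrightarrow> \<bar>P k y\<bar> \<le> K" "\<And>k y. y \<in> {0..R} \<Longrightarrow> \<bar>P' k y\<bar> \<le> K"
    using C1_polynomial_approx[OF R(1) cont has_field_derivative_at_within[OF der]] by (metis atLeastAtMost_iff)
  have meas: "(\<lambda>x. P k (Q x)) \<in> borel_measurable M" "(\<lambda>x. P' k (Q x)) \<in> borel_measurable M" for k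
  proof -
    obtain P'' where "real_polynomial_function P''" "\<And>y. (P k has_real_derivative P'' y) (at y)"
      using has_real_derivative_polynomial_function[OF P(1)] by blast
    then have P': "real_polynomial_function (P' k)" using DERIV_unique[OF P(2)] by (metis ext)
    have "f \<in> borel_measurable borel" if "real_polynomial_function f" for f :: "real \<Rightarrow> real"
      using that by (intro borel_measurable_continuous_onI)
        (metis DERIV_continuous_on has_field_derivative_at_within has_real_derivative_polynomial_function)
    then show "(\<lambda>x. P k (Q x)) \<in> borel_measurable M" "(\<lambda>x. P' k (Q x)) \<in> borel_measurable M"
      using P(1) P' bounded_borel_measurable[OF Q(1)] by (auto intro: measurable_compose)
  qed
  have b: "(\<lambda>k x. P k (Q x)) \<in> bounded_seqs M" "(\<lambda>k x. P' k (Q x)) \<in> bounded_seqs M"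
    by (rule bounded_seqsI[of _ _ K], use meas P(5,6)[OF QR] in auto)+
  have "(\<lambda>k. \<integral>x. P k (Q x) * QA x \<partial>M) \<longlonglongrightarrow> (\<integral>x. \<Psi> (Q x) * QA x \<partial>M)"
    by (intro integral_bounded_seqs_tendsto bounded_seqs_mult b bounded_seqs_const Q tendsto_intros P(3) QR)
  moreover have "(\<lambda>k. - (\<integral>x. P' k (Q x) * (\<Sum>i\<in>J. (QX i x)\<^sup>2) \<partial>M)) \<longlonglongrightarrow> - (\<integral>x. \<Psi>' (Q x) * (\<Sum>i\<in>J. (QX i x)\<^sup>2) \<partial>M)"
    by (intro tendsto_minus integral_bounded_seqs_tendsto bounded_seqs_mult b bounded_seqs_const
        bounded_borel_sum bounded_borel_power Q tendsto_mult tendsto_const P(4) QR)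
  ultimately show ?thesis using poly[OF P(1,2)] by (simp add: LIMSEQ_unique)
qed

text \<open>The two summands cover increasing and decreasing powers, so that \<open>r\<close> may
  have either sign.\<close>

lemma shift_powr_le:
  fixes y \<epsilon> :: real
  assumes "0 \<le> y" "y \<le> c" "\<epsilon> > 0" shows "\<bar>(y + \<epsilon>) powr r\<bar> \<le> \<epsilon> powr r + (c + \<epsilon>) powr r"
proof (cases "r \<ge> 0")
  case True
  then have "(y + \<epsilon>) powr r \<le> (c + \<epsilon>) powr r" using assms by (intro powr_mono2) auto
  then show ?thesis by (simp add: add_increasing)
next
  case False
  then have "(y + \<epsilon>) powr r \<le> \<epsilon> powr r" using assms by (intro powr_mono2') auto
  then show ?thesis by (simp add: add_increasing2)
qed

lemma bounded_borel_shift_powr: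
  assumes "f \<in> bounded_borel N" "\<And>x. x \<in> space N \<Longrightarrow> 0 \<le> f x" "\<epsilon> > (0::real)"
  shows "(\<lambda>x. (f x + \<epsilon>) powr r) \<in> bounded_borel N"
proof -
  obtain c where c: "c \<ge> 0" "\<And>x. x \<in> space N \<Longrightarrow> \<bar>f x\<bar> \<le> c" using bounded_borelE[OF assms(1)] by blast
  have [measurable]: "f \<in> borel_measurable N" by (rule bounded_borel_measurable[OF assms(1)])
  show ?thesis
  proof (rule bounded_borelI[of _ _ "\<epsilon> powr r + (c + \<epsilon>) powr r"])
    fix x assume x: "x \<in> space N"
    show "\<bar>(f x + \<epsilon>) powr r\<bar> \<le> \<epsilon> powr r + (c + \<epsilon>) powr r"
      using assms(2)[OF x] c(2)[OF x] assms(3) by (intro shift_powr_le) auto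
  qed measurable
qed

text \<open>Compares time 0, where Q is the square of \<open>\<phi>\<close>, with time
  \<open>t\<close>, where Q contains \<open>2 * c * t\<close> times the squared gradient: the
  integral of \<open>(Q s + \<epsilon>) powr q\<close> does not increase in s. The shift
  \<open>\<epsilon>\<close> keeps the powers differentiable where Q vanishes.\<close>

lemma grad_decay:
  assumes \<phi>: "\<phi> \<in> B" and J: "finite J" "J \<subseteq> I" "\<And>i. i \<in> I - J \<Longrightarrow> X i \<phi> = (\<lambda>x. 0)"
      "\<And>i j. i \<in> I - J \<Longrightarrow> j \<in> J \<Longrightarrow> X i (X j \<phi>) = (\<lambda>x. 0)"
    and p: "1 < p" and t: "0 < t" and \<epsilon>: "0 < \<epsilon>"
  defines "c \<equiv> min 1 (p - 1)"
  shows "(\<integral>x. (grad_Q (2 * c * t) J (H t \<phi>) (\<lambda>j. H t (X j \<phi>)) x + \<epsilon>) powr (p / 2) \<partial>M)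
      \<le> (\<integral>x. (\<phi> x * \<phi> x + \<epsilon>) powr (p / 2) \<partial>M)"
proof -
  define q where "q = p / 2"
  have q: "q > 1 / 2" using p by (simp add: q_def)
  have c: "0 < c" "c \<le> 1" using p by (auto simp: c_def)
  define Q where "Q s = grad_Q (2 * c * s) J (H s \<phi>) (\<lambda>j. H s (X j \<phi>))" for s
  define QX where "QX s = grad_QX (2 * c * s) J (H s \<phi>) (\<lambda>j. H s (X j \<phi>)) (\<lambda>i j. H s (X i (X j \<phi>)))" for s
  define QA where "QA s = grad_QA (2 * c * s) J (H s \<phi>) (\<lambda>j. H s (X j \<phi>)) (\<lambda>i j. H s (X i (X j \<phi>)))
      (H s (A \<phi>)) (\<lambda>j. H s (A (X j \<phi>)))" for s
  define \<Gamma> where "\<Gamma> s x = (\<Sum>j\<in>J. H s (X j \<phi>) x * H s (X j \<phi>) x)" for s x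
  define \<Gamma>2 where "\<Gamma>2 s x = (\<Sum>j\<in>J. \<Sum>i\<in>J. H s (X i (X j \<phi>)) x * H s (X i (X j \<phi>)) x)" for s x
  define Qd where "Qd s x = 2 * (H s \<phi> x * H s (A \<phi>) x + c * \<Gamma> s x
      + 2 * c * s * (\<Sum>j\<in>J. H s (X j \<phi>) x * H s (A (X j \<phi>)) x))" for s x
  have Qpos: "0 \<le> Q s x" if "s \<ge> 0" for s x
    unfolding Q_def by (rule grad_Q_nonneg) (use that c in auto)
  have \<Gamma>pos: "0 \<le> \<Gamma> s x" "0 \<le> \<Gamma>2 s x" for s x unfolding \<Gamma>_def \<Gamma>2_def by (auto intro!: sum_nonneg)
  have B: "\<And>j. j \<in> J \<Longrightarrow> X j \<phi> \<in> B" "\<And>i j. i \<in> J \<Longrightarrow> j \<in> J \<Longrightarrow> X i (X j \<phi>) \<in> B"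
    using J(2) \<phi> by (auto intro!: X_B)
  have bb: "H s \<phi> \<in> bounded_borel M" "H s (A \<phi>) \<in> bounded_borel M"
    "\<And>j. j \<in> J \<Longrightarrow> H s (X j \<phi>) \<in> bounded_borel M" "\<And>j. j \<in> J \<Longrightarrow> H s (A (X j \<phi>)) \<in> bounded_borel M"
    "\<And>i j. i \<in> J \<Longrightarrow> j \<in> J \<Longrightarrow> H s (X i (X j \<phi>)) \<in> bounded_borel M" if "s \<ge> 0" for s
    by (rule H_bounded[OF B_bounded that], (intro A_B B \<phi>; assumption))+
  have Qb: "Q s \<in> bounded_borel M" and QAb: "QA s \<in> bounded_borel M" and QXb: "\<And>i. i \<in> J \<Longrightarrow> QX s i \<in> bounded_borel M"
    if "s \<ge> 0" for s
    unfolding Q_def QA_def QX_def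
    by (rule bounded_borel_grad(1)[OF bb(1,3,5,2,4)[OF that]] bounded_borel_grad(3)[OF bb(1,3,5,2,4)[OF that]]
        bounded_borel_grad(2)[OF bb(1,3,5,2,4)[OF that]]; assumption)+
  have \<Gamma>b: "\<Gamma> s \<in> bounded_borel M" "\<Gamma>2 s \<in> bounded_borel M" if "s \<ge> 0" for s
    unfolding \<Gamma>_def \<Gamma>2_def using bb(3,5)[OF that] by (auto intro!: bounded_borel_sum bounded_borel_mult)
  define \<beta> where "\<beta> s = (\<integral>x. (Q s x + \<epsilon>) powr q \<partial>M)" for s
  have powb: "(\<lambda>x. (Q s x + \<epsilon>) powr r) \<in> bounded_borel M" if "s \<ge> 0" for s r
    by (rule bounded_borel_shift_powr[OF Qb[OF that] Qpos[OF that] \<epsilon>])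
  \<comment> \<open>The generator exceeds the time derivative by two terms. The factor
    \<open>1 - c\<close> appears because differentiating the weight \<open>2 * c * s\<close> uses up
    the share \<open>c\<close> of the first of them.\<close>
  have QA_Qd: "QA s x = Qd s x + 2 * (1 - c) * \<Gamma> s x + 2 * (2 * c * s) * \<Gamma>2 s x" for s x
    unfolding QA_def Qd_def grad_QA_def \<Gamma>_def \<Gamma>2_def by (simp add: sum.distrib algebra_simps)
  have nonpos: "(\<integral>x. q * (Q s x + \<epsilon>) powr (q - 1) * Qd s x \<partial>M) \<le> 0" if s: "s > 0" for s
  proof -
    have s0: "s \<ge> 0" using s by simp
    define m where "m = 2 * c * s"
    have m: "m \<ge> 0" using c s by (simp add: m_def)
    define S where "S x = (\<Sum>i\<in>J. (QX s i x)\<^sup>2)" for x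
    define W where "W x = 2 * (1 - c) * \<Gamma> s x + 2 * m * \<Gamma>2 s x" for x
    have Sb: "S \<in> bounded_borel M" unfolding S_def by (intro bounded_borel_sum bounded_borel_power QXb s0)
    have Wb: "W \<in> bounded_borel M" unfolding W_def by (intro bounded_borel_add bounded_borel_cmult \<Gamma>b s0)
    \<comment> \<open>Integration by parts with the multiplier
      \<open>(Q + \<epsilon>) powr (q - 1)\<close>, whose derivative carries the factor
      \<open>q - 1\<close>; it is negative exactly for p < 2.\<close>
    have "(\<integral>x. (Q s x + \<epsilon>) powr (q - 1) * QA s x \<partial>M) = - (\<integral>x. ((q - 1) * (Q s x + \<epsilon>) powr (q - 2)) * S x \<partial>M)"
      unfolding Q_def QA_def S_def QX_def
    proof (rule H_identity[OF \<phi> J s0, where \<Psi> = "\<lambda>y. (y + \<epsilon>) powr (q - 1)" and \<Psi>' = "\<lambda>y. (q - 1) * (y + \<epsilon>) powr (q - 2)"])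
      show "continuous_on {0..R} (\<lambda>y. (q - 1) * (y + \<epsilon>) powr (q - 2))" for R
        using \<epsilon> by (auto intro!: continuous_intros)
      show "((\<lambda>y. (y + \<epsilon>) powr (q - 1)) has_real_derivative (q - 1) * (y + \<epsilon>) powr (q - 2)) (at y)" if "y \<ge> 0" for y
        using that \<epsilon> by (auto intro!: derivative_eq_intros simp: diff_diff_eq)
    qed (use m in \<open>auto simp: m_def\<close>)
    then have id: "(\<integral>x. (Q s x + \<epsilon>) powr (q - 1) * QA s x \<partial>M) = (\<integral>x. (1 - q) * ((Q s x + \<epsilon>) powr (q - 2) * S x) \<partial>M)"
      by (simp flip: Bochner_Integration.integral_minus add: algebra_simps)
    have "(\<integral>x. (Q s x + \<epsilon>) powr (q - 1) * Qd s x \<partial>M)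
        = (\<integral>x. (Q s x + \<epsilon>) powr (q - 1) * QA s x - (Q s x + \<epsilon>) powr (q - 1) * W x \<partial>M)"
      by (simp add: QA_Qd W_def m_def algebra_simps)
    also have "\<dots> = (\<integral>x. (1 - q) * ((Q s x + \<epsilon>) powr (q - 2) * S x) \<partial>M) - (\<integral>x. (Q s x + \<epsilon>) powr (q - 1) * W x \<partial>M)"
      unfolding id[symmetric]
      by (intro Bochner_Integration.integral_diff integrable_bounded_borel bounded_borel_mult powb s0 QAb Wb)
    also have "\<dots> = (\<integral>x. (1 - q) * ((Q s x + \<epsilon>) powr (q - 2) * S x) - (Q s x + \<epsilon>) powr (q - 1) * W x \<partial>M)"
      by (intro Bochner_Integration.integral_diff[symmetric] integrable_bounded_borel bounded_borel_mult bounded_borel_cmult powb s0 Sb Wb)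
    also have "\<dots> \<le> (\<integral>x. 0 \<partial>M)"
    proof (rule integral_mono)
      show "integrable M (\<lambda>x. (1 - q) * ((Q s x + \<epsilon>) powr (q - 2) * S x) - (Q s x + \<epsilon>) powr (q - 1) * W x)"
        by (intro integrable_bounded_borel bounded_borel_diff bounded_borel_mult bounded_borel_cmult powb s0 Sb Wb)
      fix x
      let ?y = "Q s x + \<epsilon>"
      have y: "?y > 0" using Qpos[OF s0, of x] \<epsilon> by linarith
      have Sx: "0 \<le> S x" "S x \<le> 4 * Q s x * (\<Gamma> s x + m * \<Gamma>2 s x)"
        unfolding S_def Q_def QX_def \<Gamma>_def \<Gamma>2_def m_def[symmetric]
        by (auto intro!: sum_nonneg grad_QX_le m J(1))
      have Wx: "0 \<le> W x" using c m \<Gamma>pos by (simp add: W_def)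
      \<comment> \<open>For p at least 2 the integrated term already has the right sign; otherwise
        \<open>W\<close> must absorb it.\<close>
      have "(1 - q) * S x \<le> ?y * W x"
      proof (cases "q \<ge> 1")
        case True
        then have "(1 - q) * S x \<le> 0" using Sx by (simp add: mult_nonpos_nonneg)
        also have "0 \<le> ?y * W x" using y Wx by simp
        finally show ?thesis .
      next
        case False
        \<comment> \<open>Now \<open>4 * (1 - q) = 2 * (1 - c)\<close>, so the first-order terms
          match exactly; this is the origin of the constant \<open>c\<close>.\<close>
        then have cq: "c = 2 * q - 1" using p by (auto simp: c_def q_def)
        have "(1 - q) * S x \<le> (1 - q) * (4 * Q s x * (\<Gamma> s x + m * \<Gamma>2 s x))"
          using False Sx by (intro mult_left_mono) auto
        also have "\<dots> = Q s x * (4 * (1 - q) * \<Gamma> s x + 4 * (1 - q) * (m * \<Gamma>2 s x))" by (simp add: algebra_simps)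
        also have "\<dots> \<le> Q s x * W x"
        proof (rule mult_left_mono[OF _ Qpos[OF s0]])
          \<comment> \<open>Uses \<open>q > 1 / 2\<close>, that is, \<open>1 < p\<close>.\<close>
          have "4 * (1 - q) * (m * \<Gamma>2 s x) \<le> 2 * (m * \<Gamma>2 s x)"
            using q m \<Gamma>pos by (intro mult_right_mono) auto
          then show "4 * (1 - q) * \<Gamma> s x + 4 * (1 - q) * (m * \<Gamma>2 s x) \<le> W x"
            by (simp add: W_def cq algebra_simps)
        qed
        also have "\<dots> \<le> ?y * W x" using \<epsilon> Wx by (intro mult_right_mono) auto
        finally show ?thesis .
      qed
      then have "?y powr (q - 2) * ((1 - q) * S x) \<le> ?y powr (q - 2) * (?y * W x)" by (intro mult_left_mono) auto
      also have "\<dots> = ?y powr (q - 1) * W x"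
        using y powr_add[of ?y "q - 2" 1] by (simp add: mult.assoc)
      finally show "(1 - q) * (?y powr (q - 2) * S x) - ?y powr (q - 1) * W x \<le> 0" by (simp add: algebra_simps)
    qed simp
    finally have "(\<integral>x. (Q s x + \<epsilon>) powr (q - 1) * Qd s x \<partial>M) \<le> 0" by simp
    then show ?thesis using q by (simp add: mult.assoc mult_nonneg_nonpos)
  qed
  \<comment> \<open>A single bound \<open>D\<close>, valid at all times by contractivity, dominates
    \<open>Qd\<close> and the powers of Q between the times 0 and \<open>t + 1\<close>; the extra
    unit leaves room on both sides of \<open>t\<close>.\<close>
  let ?\<Phi> = "{\<phi>, A \<phi>} \<union> (\<lambda>j. X j \<phi>) ` J \<union> (\<lambda>j. A (X j \<phi>)) ` J"
  obtain D where D: "D \<ge> 0" "\<And>\<eta> s x. \<eta> \<in> ?\<Phi> \<Longrightarrow> s \<ge> 0 \<Longrightarrow> x \<in> space M \<Longrightarrow> \<bar>H s \<eta> x\<bar> \<le> D"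
  proof -
    have fin: "finite ?\<Phi>" using J(1) by auto
    have "\<forall>\<eta>\<in>?\<Phi>. \<eta> \<in> B" using B \<phi> by (auto intro: A_B)
    then have "\<forall>\<eta>\<in>?\<Phi>. \<exists>d. \<forall>x\<in>space M. \<bar>\<eta> x\<bar> \<le> d"
      using B_bounded unfolding bounded_borel_def by blast
    then obtain d where d: "\<And>\<eta> x. \<eta> \<in> ?\<Phi> \<Longrightarrow> x \<in> space M \<Longrightarrow> \<bar>\<eta> x\<bar> \<le> d \<eta>" by metis
    show thesis
    proof (rule that[of "\<Sum>\<eta>\<in>?\<Phi>. \<bar>d \<eta>\<bar>"])
      fix \<eta> s x assume *: "\<eta> \<in> ?\<Phi>" "s \<ge> (0::real)" "x \<in> space M"
      have "\<eta> \<in> B" using * B \<phi> by (auto intro: A_B)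
      then have "\<bar>H s \<eta> x\<bar> \<le> d \<eta>" by (intro H_contract B_bounded * d)
      also have "\<dots> \<le> \<bar>d \<eta>\<bar>" by simp
      also have "\<dots> \<le> (\<Sum>\<eta>\<in>?\<Phi>. \<bar>d \<eta>\<bar>)" by (rule member_le_sum[OF *(1) _ fin]) simp
      finally show "\<bar>H s \<eta> x\<bar> \<le> (\<Sum>\<eta>\<in>?\<Phi>. \<bar>d \<eta>\<bar>)" .
    qed (simp add: sum_nonneg)
  qed
  have prodD: "\<bar>H s \<eta> x * H s \<xi> x\<bar> \<le> D * D" if "\<eta> \<in> ?\<Phi>" "\<xi> \<in> ?\<Phi>" "s \<ge> 0" "x \<in> space M" for \<eta> \<xi> s x
    unfolding abs_mult using D that by (intro mult_mono) auto
  have sumD: "\<bar>\<Sum>j\<in>J. H s (f j) x * H s (g j) x\<bar> \<le> card J * (D * D)"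
    if "\<And>j. j \<in> J \<Longrightarrow> f j \<in> ?\<Phi>" "\<And>j. j \<in> J \<Longrightarrow> g j \<in> ?\<Phi>" "s \<ge> 0" "x \<in> space M" for f g s x
  proof -
    have "\<bar>\<Sum>j\<in>J. H s (f j) x * H s (g j) x\<bar> \<le> (\<Sum>j\<in>J. \<bar>H s (f j) x * H s (g j) x\<bar>)" by (rule sum_abs)
    also have "\<dots> \<le> (\<Sum>j\<in>J. D * D)" using that by (intro sum_mono prodD) auto
    finally show ?thesis by simp
  qed
  have cs: "\<bar>2 * c * s\<bar> \<le> 2 * (t + 1)" if "0 \<le> s" "s \<le> t + 1" for s
    using mult_mono[OF c(2) that(2)] that c t by simp
  have Qbd: "\<bar>Q s x\<bar> \<le> D * D + 2 * (t + 1) * (card J * (D * D))" if "0 \<le> s" "s \<le> t + 1" "x \<in> space M" for s x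
  proof -
    have "\<bar>H s \<phi> x * H s \<phi> x\<bar> \<le> D * D" by (rule prodD) (use that in auto)
    moreover have "\<bar>2 * c * s * (\<Sum>j\<in>J. H s (X j \<phi>) x * H s (X j \<phi>) x)\<bar> \<le> 2 * (t + 1) * (card J * (D * D))"
      unfolding abs_mult[of "2 * c * s"] using that t
      by (intro mult_mono sumD cs) auto
    ultimately show ?thesis unfolding Q_def grad_Q_def by linarith
  qed
  define R where "R = D * D + 2 * (t + 1) * (card J * (D * D))"
  have R: "R \<ge> 0" unfolding R_def using t D by simp
  have powbd: "\<bar>(Q s x + \<epsilon>) powr r\<bar> \<le> \<epsilon> powr r + (R + \<epsilon>) powr r" if "0 \<le> s" "s \<le> t + 1" "x \<in> space M" for s x r
    using Qbd[OF that] Qpos[OF that(1), of x] \<epsilon> by (intro shift_powr_le) (auto simp: R_def)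
  define R' where "R' = 2 * (D * D + card J * (D * D) + 2 * (t + 1) * (card J * (D * D)))"
  have Qdbd: "\<bar>Qd s x\<bar> \<le> R'" if "0 \<le> s" "s \<le> t + 1" "x \<in> space M" for s x
  proof -
    have 1: "\<bar>H s \<phi> x * H s (A \<phi>) x\<bar> \<le> D * D" by (rule prodD) (use that in auto)
    have 2: "\<bar>c * \<Gamma> s x\<bar> \<le> 1 * (card J * (D * D))"
      unfolding abs_mult \<Gamma>_def using that c by (intro mult_mono sumD) auto
    have 3: "\<bar>2 * c * s * (\<Sum>j\<in>J. H s (X j \<phi>) x * H s (A (X j \<phi>)) x)\<bar> \<le> 2 * (t + 1) * (card J * (D * D))"
      unfolding abs_mult[of "2 * c * s"] using that t
      by (intro mult_mono sumD cs) auto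
    have tri: "\<bar>2 * (a + b + d)\<bar> \<le> 2 * (a' + b' + d')" if "\<bar>a\<bar> \<le> a'" "\<bar>b\<bar> \<le> 1 * b'" "\<bar>d\<bar> \<le> d'" for a b d a' b' d' :: real
      using that unfolding abs_le_iff by (auto intro: add_mono)
    from tri[OF 1 2 3] show ?thesis unfolding Qd_def R'_def .
  qed
  have deriv: "(\<beta> has_real_derivative (\<integral>x. q * (Q s x + \<epsilon>) powr (q - 1) * Qd s x \<partial>M)) (at s)" if s: "0 < s" "s \<le> t" for s
    unfolding \<beta>_def
  proof (rule DERIV_integral_bounded[where a = 0 and b = "t + 1" and K = "q * (\<epsilon> powr (q - 1) + (R + \<epsilon>) powr (q - 1)) * R'"])
    fix r x assume r: "0 < r" "r < t + 1" and x: "x \<in> space M"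
    have Qder: "((\<lambda>r. Q r x) has_real_derivative Qd r x) (at r)"
    proof -
      have "((\<lambda>r. \<Sum>j\<in>J. H r (X j \<phi>) x * H r (X j \<phi>) x) has_real_derivative
          (\<Sum>j\<in>J. 2 * (H r (X j \<phi>) x * H r (A (X j \<phi>)) x))) (at r)"
        by (rule DERIV_sum) (auto intro!: derivative_eq_intros H_DERIV[OF B(1) r(1) x])
      then show ?thesis
        unfolding Q_def grad_Q_def Qd_def \<Gamma>_def
        by (rule DERIV_cong[OF DERIV_add[OF DERIV_mult[OF H_DERIV[OF \<phi> r(1) x] H_DERIV[OF \<phi> r(1) x]]
              DERIV_mult[OF DERIV_cmult_Id]]])
           (simp add: sum_distrib_left[symmetric] algebra_simps)
    qed
    have "Q r x + \<epsilon> > 0" using Qpos[of r x] r \<epsilon> by linarith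
    then show "((\<lambda>r. (Q r x + \<epsilon>) powr q) has_real_derivative q * (Q r x + \<epsilon>) powr (q - 1) * Qd r x) (at r)"
      by (auto intro!: derivative_eq_intros Qder)
    show "\<bar>q * (Q r x + \<epsilon>) powr (q - 1) * Qd r x\<bar> \<le> q * (\<epsilon> powr (q - 1) + (R + \<epsilon>) powr (q - 1)) * R'"
      unfolding abs_mult using q powbd[of r x "q - 1"] Qdbd[of r x] r x
      by (intro mult_mono) auto
  qed (use s powb in auto)
  have mono: "\<beta> t \<le> \<beta> s" if "0 < s" "s \<le> t" for s
  proof (rule DERIV_nonpos_imp_nonincreasing[OF that(2)])
    fix r assume "s \<le> r" "r \<le> t"
    then show "\<exists>y. (\<beta> has_real_derivative y) (at r) \<and> y \<le> 0"
      using deriv[of r] nonpos[of r] that by (intro exI[of _ "\<integral>x. q * (Q r x + \<epsilon>) powr (q - 1) * Qd r x \<partial>M"]) auto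
  qed
  \<comment> \<open>\<open>\<beta>\<close> is differentiated at positive times only, so time 0 is
    reached as a limit.\<close>
  define r where "r n = t * inverse (real (Suc n))" for n
  have r: "0 < r n" "r n \<le> t" for n using t by (auto simp: r_def field_simps)
  have rlim: "r \<longlonglongrightarrow> 0" unfolding r_def using tendsto_mult_right_zero[OF LIMSEQ_inverse_real_of_nat, of t] by simp
  have Hr: "(\<lambda>n. H (r n) \<eta> x) \<longlonglongrightarrow> \<eta> x" if "\<eta> \<in> B" "x \<in> space M" for \<eta> x
  proof -
    obtain d where d: "d \<ge> 0" "\<And>x. x \<in> space M \<Longrightarrow> \<bar>A \<eta> x\<bar> \<le> d"
      using bounded_borelE[OF B_bounded[OF A_B[OF \<open>\<eta> \<in> B\<close>]]] by blast
    show ?thesis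
      by (rule LIM_zero_cancel, rule Lim_null_comparison[OF _ tendsto_mult_right_zero[OF rlim, of "3 * d"]])
         (use H_lipschitz[OF that(1) less_imp_le[OF r(1)] that(2) d(2)] in auto)
  qed
  have "(\<lambda>n. \<beta> (r n)) \<longlonglongrightarrow> (\<integral>x. (\<phi> x * \<phi> x + \<epsilon>) powr q \<partial>M)"
    unfolding \<beta>_def
  proof (rule bounded_convergence)
    show "(\<lambda>x. (Q (r n) x + \<epsilon>) powr q) \<in> borel_measurable M" for n
      using powb[of "r n" q] r(1)[of n] bounded_borel_measurable by auto
    show "\<bar>(Q (r n) x + \<epsilon>) powr q\<bar> \<le> \<epsilon> powr q + (R + \<epsilon>) powr q" if "x \<in> space M" for n x
      using r[of n] that by (intro powbd) auto
    fix x assume x: "x \<in> space M"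
    have "(\<lambda>n. Q (r n) x) \<longlonglongrightarrow> \<phi> x * \<phi> x + 2 * c * 0 * (\<Sum>j\<in>J. X j \<phi> x * X j \<phi> x)"
      unfolding Q_def grad_Q_def by (intro tendsto_intros Hr \<phi> B x rlim) auto
    then show "(\<lambda>n. (Q (r n) x + \<epsilon>) powr q) \<longlonglongrightarrow> (\<phi> x * \<phi> x + \<epsilon>) powr q"
      using \<epsilon> by (intro tendsto_powr tendsto_intros) (auto simp: add_nonneg_eq_0_iff)
  qed
  then have "\<beta> t \<le> (\<integral>x. (\<phi> x * \<phi> x + \<epsilon>) powr q \<partial>M)"
    by (rule LIMSEQ_le_const) (use mono r in auto)
  then show ?thesis by (simp add: \<beta>_def Q_def q_def)
qed

text \<open>Drop the summand without derivatives from Q in \<open>grad_decay\<close> and let the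
  shift tend to 0. Indices of \<open>J\<close> outside a support of \<open>\<phi>\<close> contribute
  nothing, so the constant is independent of \<open>J\<close>; everything later rests on
  this.\<close>

theorem gradient_estimate:
  assumes \<phi>: "\<phi> \<in> B" and J: "finite J" "J \<subseteq> I" and p: "1 < p" and t: "0 < t"
  shows "pnorm M p (\<lambda>x. sqrt (\<Sum>j\<in>J. (H t (X j \<phi>) x)\<^sup>2)) \<le> (2 * min 1 (p - 1) * t) powr (- (1 / 2)) * pnorm M p \<phi>"
proof -
  define c where "c = min 1 (p - 1)"
  have c: "c > 0" using p by (simp add: c_def)
  obtain J' where J': "finite J'" "J' \<subseteq> I" "\<And>i. i \<in> I - J' \<Longrightarrow> X i \<phi> = (\<lambda>x. 0)"
    "\<And>i j. i \<in> I - J' \<Longrightarrow> j \<in> J' \<Longrightarrow> X i (X j \<phi>) = (\<lambda>x. 0)" using closed_support[OF \<phi>] by blast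
  have XB: "X j \<phi> \<in> B" if "j \<in> J \<union> J'" for j using that J J' \<phi> X_B by auto
  have t0: "t \<ge> 0" using t by simp
  define \<Gamma> where "\<Gamma> x = (\<Sum>j\<in>J. (H t (X j \<phi>) x)\<^sup>2)" for x
  define Q where "Q = grad_Q (2 * c * t) J' (H t \<phi>) (\<lambda>j. H t (X j \<phi>))"
  have \<Gamma>pos: "\<Gamma> x \<ge> 0" for x by (auto simp: \<Gamma>_def intro!: sum_nonneg)
  have \<Gamma>b: "\<Gamma> \<in> bounded_borel M"
    unfolding \<Gamma>_def by (intro bounded_borel_sum bounded_borel_power H_bounded B_bounded XB t0) auto
  have Qb: "Q \<in> bounded_borel M" unfolding Q_def grad_Q_def
    by (intro bounded_borel_sum bounded_borel_add bounded_borel_mult bounded_borel_cmult H_bounded B_bounded XB t0 \<phi>) auto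
  have \<Gamma>Q: "2 * c * t * \<Gamma> x \<le> Q x" if "x \<in> space M" for x
  proof -
    have "\<Gamma> x = (\<Sum>j\<in>J \<inter> J'. (H t (X j \<phi>) x)\<^sup>2)"
      unfolding \<Gamma>_def
    proof (rule sum.mono_neutral_right[OF J(1)])
      show "\<forall>j\<in>J - J \<inter> J'. (H t (X j \<phi>) x)\<^sup>2 = 0"
      proof
        fix j assume "j \<in> J - J \<inter> J'"
        then have "X j \<phi> = (\<lambda>x. 0)" using J(2) J'(3) by auto
        then show "(H t (X j \<phi>) x)\<^sup>2 = 0" using H_zero[OF t0 that] by simp
      qed
    qed auto
    also have "\<dots> \<le> (\<Sum>j\<in>J'. (H t (X j \<phi>) x)\<^sup>2)" by (rule sum_mono2) (use J' in auto)
    finally have "2 * c * t * \<Gamma> x \<le> 2 * c * t * (\<Sum>j\<in>J'. (H t (X j \<phi>) x)\<^sup>2)"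
      using c t by (intro mult_left_mono) auto
    also have "\<dots> \<le> Q x" by (simp add: Q_def grad_Q_def power2_eq_square)
    finally show ?thesis .
  qed
  have le: "(\<integral>x. (2 * c * t * \<Gamma> x) powr (p / 2) \<partial>M) \<le> (\<integral>x. (\<phi> x * \<phi> x + \<epsilon>) powr (p / 2) \<partial>M)" if \<epsilon>: "\<epsilon> > 0" for \<epsilon>
  proof -
    have "(\<integral>x. (2 * c * t * \<Gamma> x) powr (p / 2) \<partial>M) \<le> (\<integral>x. (Q x + \<epsilon>) powr (p / 2) \<partial>M)"
    proof (rule integral_mono)
      obtain d where d: "\<And>x. x \<in> space M \<Longrightarrow> \<bar>2 * c * t * \<Gamma> x\<bar> \<le> d"
        using bounded_borelE[OF bounded_borel_cmult[OF \<Gamma>b, of "2 * c * t"]] by blast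
      show "integrable M (\<lambda>x. (2 * c * t * \<Gamma> x) powr (p / 2))"
      proof (intro integrable_bounded_borel bounded_borelI[of _ _ "d powr (p / 2)"])
        show "(\<lambda>x. (2 * c * t * \<Gamma> x) powr (p / 2)) \<in> borel_measurable M"
          using bounded_borel_measurable[OF \<Gamma>b] by measurable
        show "\<bar>(2 * c * t * \<Gamma> x) powr (p / 2)\<bar> \<le> d powr (p / 2)" if "x \<in> space M" for x
          using d[OF that] c t p \<Gamma>pos[of x] by (auto intro!: powr_mono2)
      qed
      show "integrable M (\<lambda>x. (Q x + \<epsilon>) powr (p / 2))"
        by (intro integrable_bounded_borel bounded_borel_shift_powr Qb \<epsilon>)
           (use c t in \<open>auto simp: Q_def intro!: grad_Q_nonneg\<close>)
      fix x assume "x \<in> space M"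
      then show "(2 * c * t * \<Gamma> x) powr (p / 2) \<le> (Q x + \<epsilon>) powr (p / 2)"
        using \<Gamma>Q[of x] \<epsilon> \<Gamma>pos[of x] c t p by (intro powr_mono2) auto
    qed
    also have "\<dots> \<le> (\<integral>x. (\<phi> x * \<phi> x + \<epsilon>) powr (p / 2) \<partial>M)"
      unfolding Q_def c_def by (rule grad_decay[OF \<phi> J' p t \<epsilon>])
    finally show ?thesis .
  qed
  obtain d where d: "d \<ge> 0" "\<And>x. x \<in> space M \<Longrightarrow> \<bar>\<phi> x\<bar> \<le> d" using bounded_borelE[OF B_bounded[OF \<phi>]] by blast
  have "(\<lambda>n. \<integral>x. (\<phi> x * \<phi> x + inverse (real (Suc n))) powr (p / 2) \<partial>M) \<longlonglongrightarrow> (\<integral>x. \<bar>\<phi> x\<bar> powr p \<partial>M)"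
  proof (rule bounded_convergence)
    show "(\<lambda>x. (\<phi> x * \<phi> x + inverse (real (Suc n))) powr (p / 2)) \<in> borel_measurable M" for n
      using B_measurable[OF \<phi>] by measurable
    fix x assume x: "x \<in> space M"
    have "\<phi> x * \<phi> x \<le> d * d" using d(1) d(2)[OF x] abs_le_square_iff[of "\<phi> x" d] by (simp add: power2_eq_square)
    then have "\<phi> x * \<phi> x + inverse (real (Suc n)) \<le> d * d + 1" for n
      by (intro add_mono) (auto simp: field_simps)
    then show "\<bar>(\<phi> x * \<phi> x + inverse (real (Suc n))) powr (p / 2)\<bar> \<le> (d * d + 1) powr (p / 2)" for n
      using p by (auto intro!: powr_mono2 simp del: of_nat_Suc)
    have "(\<lambda>n. (\<phi> x * \<phi> x + inverse (real (Suc n))) powr (p / 2)) \<longlonglongrightarrow> (\<phi> x * \<phi> x + 0) powr (p / 2)"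
      by (intro tendsto_powr2 tendsto_intros LIMSEQ_inverse_real_of_nat) (use p in auto)
    also have "(\<phi> x * \<phi> x + 0) powr (p / 2) = \<bar>\<phi> x\<bar> powr p"
    proof -
      have "\<phi> x * \<phi> x = \<bar>\<phi> x\<bar> powr 2" by (simp add: power2_eq_square)
      then show ?thesis by (simp only: add_0_right powr_powr) simp
    qed
    finally show "(\<lambda>n. (\<phi> x * \<phi> x + inverse (real (Suc n))) powr (p / 2)) \<longlonglongrightarrow> \<bar>\<phi> x\<bar> powr p" .
  qed
  then have "(\<integral>x. (2 * c * t * \<Gamma> x) powr (p / 2) \<partial>M) \<le> (\<integral>x. \<bar>\<phi> x\<bar> powr p \<partial>M)"
    by (rule LIMSEQ_le_const) (use le in auto)
  then have 1: "(2 * c * t) powr (p / 2) * (\<integral>x. \<Gamma> x powr (p / 2) \<partial>M) \<le> pnorm M p \<phi> powr p"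
    using c t p \<Gamma>pos by (simp add: powr_mult pnorm_powr)
  have "(\<lambda>x. \<bar>sqrt (\<Gamma> x)\<bar> powr p) = (\<lambda>x. \<Gamma> x powr (p / 2))"
    using \<Gamma>pos by (simp add: fun_eq_iff powr_half_sqrt[symmetric] powr_powr)
  then have "pnorm M p (\<lambda>x. sqrt (\<Gamma> x)) = (\<integral>x. \<Gamma> x powr (p / 2) \<partial>M) powr (1 / p)"
    by (simp add: pnorm_def)
  also have "\<dots> \<le> ((2 * c * t) powr (- (p / 2)) * pnorm M p \<phi> powr p) powr (1 / p)"
  proof (rule powr_mono2)
    have pos: "(2 * c * t) powr (p / 2) > 0" using c t by simp
    show "(\<integral>x. \<Gamma> x powr (p / 2) \<partial>M) \<le> (2 * c * t) powr (- (p / 2)) * pnorm M p \<phi> powr p"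
      using 1 pos by (simp add: powr_minus field_simps)
  qed (use p in auto)
  also have "\<dots> = (2 * c * t) powr (- (1 / 2)) * pnorm M p \<phi>"
    using p by (simp add: powr_mult powr_powr)
  finally show ?thesis by (simp add: \<Gamma>_def c_def)
qed

end

section \<open>Smoothing operators\<close>

lemma dual_map_continuous:
  assumes "1 < p" shows "continuous_on UNIV (dual_map p)"
proof -
  have "dual_map p = (\<lambda>x. (max x 0) powr (p - 1) - (max (- x) 0) powr (p - 1))"
    by (auto simp: dual_map_def fun_eq_iff sgn_if max_def)
  moreover have "continuous_on UNIV (\<lambda>x::real. (max x 0) powr (p - 1) - (max (- x) 0) powr (p - 1))"
    using assms by (intro continuous_on_diff continuous_on_powr' continuous_on_max continuous_intros) auto
  ultimately show ?thesis by simp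
qed

context derivation_semigroup
begin

text \<open>The dual image of \<open>w\<close> attains the norm but need not be a test function. It
  is approximated by polynomials in \<open>w\<close>, and these by polynomials in the
  \<open>v n\<close>, which do lie in \<open>B\<close> up to values off the space; bounded
  convergence carries \<open>le\<close> through both limits.\<close>

lemma pnorm_le_by_B_dual:
  assumes p: "1 < p" and q: "q = p / (p - 1)" and K: "K \<ge> 0"
    and v: "\<And>n. v n \<in> B" "v \<in> bounded_seqs M" "\<And>x. x \<in> space M \<Longrightarrow> (\<lambda>n. v n x) \<longlonglongrightarrow> w x"
    and le: "\<And>\<psi>. \<psi> \<in> B \<Longrightarrow> \<bar>\<integral>x. w x * \<psi> x \<partial>M\<bar> \<le> K * pnorm M q \<psi>"
  shows "pnorm M p w \<le> K"
proof -
  note pq = dual_exponent[OF p q]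
  obtain R where R: "R \<ge> 0" "\<And>n x. x \<in> space M \<Longrightarrow> \<bar>v n x\<bar> \<le> R" using bounded_seqsE[OF v(2)] by blast
  have wR: "\<bar>w x\<bar> \<le> R" if "x \<in> space M" for x
    by (rule LIMSEQ_le_const2[OF tendsto_rabs[OF v(3)[OF that]]]) (use R(2)[OF that] in auto)
  have wm: "w \<in> borel_measurable M" by (rule borel_measurable_LIMSEQ_real[OF v(3) bounded_seqs_measurable[OF v(2)]])
  have wb: "w \<in> bounded_borel M" by (rule bounded_borelI[OF wm wR])
  have cont: "continuous_on {-R..R} (dual_map p)" using dual_map_continuous[OF p] continuous_on_subset by blast
  obtain P where P: "\<And>k. real_polynomial_function (P k)"
    "\<And>k y. y \<in> {-R..R} \<Longrightarrow> \<bar>dual_map p y - P k y\<bar> < inverse (real (Suc k))" using polynomial_approx[OF cont] by metis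
  have cP: "continuous_on UNIV (P k)" for k by (rule real_polynomial_function_continuous[OF P(1)])
  have Pm: "P k \<in> borel_measurable borel" for k by (rule borel_measurable_continuous_onI[OF cP])
  have Plim: "(\<lambda>k. P k y) \<longlonglongrightarrow> dual_map p y" if "y \<in> {-R..R}" for y
    by (rule LIM_zero_cancel, rule Lim_null_comparison[OF _ LIMSEQ_inverse_real_of_nat])
       (use less_imp_le[OF P(2)[OF that]] in \<open>auto simp: abs_minus_commute\<close>)
  have lek: "\<bar>\<integral>x. w x * P k (w x) \<partial>M\<bar> \<le> K * pnorm M q (\<lambda>x. P k (w x))" for k
  proof -
    obtain P' where P': "\<And>y. (P k has_real_derivative P' y) (at y)"
      using has_real_derivative_polynomial_function[OF P(1)] by blast
    have "\<exists>\<psi>\<in>B. \<forall>x\<in>space M. \<psi> x = P k (v n x)" for n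
      using B_polynomial[OF P(1) P' v(1)] by metis
    then obtain \<psi> where \<psi>: "\<And>n. \<psi> n \<in> B" "\<And>n x. x \<in> space M \<Longrightarrow> \<psi> n x = P k (v n x)" by metis
    have Pb: "(\<lambda>n x. P k (v n x)) \<in> bounded_seqs M" by (rule bounded_seqs_compose[OF v(2) cP])
    have Pl: "(\<lambda>n. P k (v n x)) \<longlonglongrightarrow> P k (w x)" if "x \<in> space M" for x
      using isCont_tendsto_compose[OF _ v(3)[OF that], of "P k"] cP by (simp add: continuous_on_eq_continuous_at)
    have "(\<lambda>n. \<bar>\<integral>x. w x * P k (v n x) \<partial>M\<bar>) \<longlonglongrightarrow> \<bar>\<integral>x. w x * P k (w x) \<partial>M\<bar>"
      by (intro tendsto_rabs integral_bounded_seqs_tendsto bounded_seqs_mult Pb bounded_seqs_const wb tendsto_intros Pl)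
    moreover have "(\<lambda>n. K * pnorm M q (\<lambda>x. P k (v n x))) \<longlonglongrightarrow> K * pnorm M q (\<lambda>x. P k (w x))"
    proof -
      obtain c where c: "c \<ge> 0" "\<And>n x. x \<in> space M \<Longrightarrow> \<bar>P k (v n x)\<bar> \<le> c" using bounded_seqsE[OF Pb] by blast
      show ?thesis
        by (intro tendsto_mult_left pnorm_bounded_convergence[OF bounded_seqs_measurable[OF Pb] c(2) Pl]) (use pq in auto)
    qed
    moreover have "\<bar>\<integral>x. w x * P k (v n x) \<partial>M\<bar> \<le> K * pnorm M q (\<lambda>x. P k (v n x))" for n
    proof -
      have "pnorm M q (\<psi> n) = pnorm M q (\<lambda>x. P k (v n x))" by (rule pnorm_cong) (simp add: \<psi>)
      moreover have "(\<integral>x. w x * \<psi> n x \<partial>M) = (\<integral>x. w x * P k (v n x) \<partial>M)"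
        by (rule Bochner_Integration.integral_cong) (auto simp: \<psi>)
      ultimately show ?thesis using le[OF \<psi>(1)[of n]] by simp
    qed
    ultimately show ?thesis by (intro LIMSEQ_le) auto
  qed
  have wI: "w x \<in> {-R..R}" if "x \<in> space M" for x using wR[OF that] by (auto simp: abs_le_iff)
  obtain D where D: "\<And>y. y \<in> {-R..R} \<Longrightarrow> \<bar>dual_map p y\<bar> \<le> D"
    using compact_imp_bounded[OF compact_continuous_image[OF cont compact_Icc]]
    unfolding bounded_iff ball_simps real_norm_def by blast
  have PD: "\<bar>P k y\<bar> \<le> D + 1" if "y \<in> {-R..R}" for k y
  proof -
    have "inverse (real (Suc k)) \<le> 1" by (simp add: field_simps)
    then show ?thesis using P(2)[OF that, of k] D[OF that] by linarith
  qed
  have b: "(\<lambda>k x. P k (w x)) \<in> bounded_seqs M"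
    by (rule bounded_seqsI[of _ _ "D + 1"]) (use measurable_compose[OF wm Pm] PD[OF wI] in auto)
  have "(\<lambda>k. \<bar>\<integral>x. w x * P k (w x) \<partial>M\<bar>) \<longlonglongrightarrow> \<bar>\<integral>x. w x * dual_map p (w x) \<partial>M\<bar>"
    by (intro tendsto_rabs integral_bounded_seqs_tendsto bounded_seqs_mult b bounded_seqs_const wb tendsto_intros Plim wI)
  moreover have "(\<lambda>k. K * pnorm M q (\<lambda>x. P k (w x))) \<longlonglongrightarrow> K * pnorm M q (\<lambda>x. dual_map p (w x))"
    by (intro tendsto_mult_left pnorm_bounded_convergence[where K = "D + 1"] bounded_seqs_measurable[OF b] PD wI Plim)
       (use pq in auto)
  ultimately have "\<bar>\<integral>x. w x * dual_map p (w x) \<partial>M\<bar> \<le> K * pnorm M q (\<lambda>x. dual_map p (w x))"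
    using lek by (intro LIMSEQ_le) auto
  then show ?thesis
    using p by (intro pnorm_le_by_dual[OF Lp_bounded_borel[OF wb] p q K]) auto
qed

lemma X_smoothing:
  assumes "i \<in> I" "\<phi> \<in> B" "1 < p" "0 < t"
  shows "pnorm M p (H t (X i \<phi>)) \<le> (2 * min 1 (p - 1)) powr (- (1 / 2)) * t powr (- (1 / 2)) * pnorm M p \<phi>"
proof -
  have "pnorm M p (\<lambda>x. sqrt (\<Sum>j\<in>{i}. (H t (X j \<phi>) x)\<^sup>2)) \<le> (2 * min 1 (p - 1) * t) powr (- (1 / 2)) * pnorm M p \<phi>"
    by (rule gradient_estimate) (use assms in auto)
  then show ?thesis using assms by (simp add: powr_mult pnorm_def)
qed

text \<open>The product of the constants of \<open>gradient_estimate\<close> for p and for the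
  conjugate exponent, each at time t / 2; the factor 2 there cancels the halving.\<close>

definition sos_const :: "real \<Rightarrow> real" where
  "sos_const p = (min 1 (p - 1)) powr (- (1 / 2)) * (min 1 (p / (p - 1) - 1)) powr (- (1 / 2))"

text \<open>In the pairing with a test function \<psi> one \<open>X i\<close> moves across and
  \<open>H t\<close> splits into two copies of \<open>H s\<close> with s = t / 2, which leaves
  products of \<open>H s (X i \<phi>)\<close> and \<open>H s (X i \<psi>)\<close>. Using
  Cauchy-Schwarz in i before Hoelder's inequality in x keeps the bound free of the size of
  \<open>J\<close>.\<close>

lemma sos_smoothing:
  assumes J: "finite J" "J \<subseteq> I" and \<phi>: "\<phi> \<in> B" and p: "1 < p" and t: "0 < t"
  shows "pnorm M p (H t (\<lambda>x. \<Sum>i\<in>J. X i (X i \<phi>) x)) \<le> sos_const p * t powr (-1) * pnorm M p \<phi>"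
proof -
  define q where "q = p / (p - 1)"
  note pq = dual_exponent[OF p q_def]
  define s where "s = t / 2"
  have s: "s > 0" "s \<ge> 0" "s + s = t" "t \<ge> 0" "t = 2 * s" using t by (auto simp: s_def)
  define S where "S = (\<lambda>x. \<Sum>i\<in>J. X i (X i \<phi>) x)"
  have XB: "X i \<psi> \<in> B" if "i \<in> J" "\<psi> \<in> B" for i \<psi> using that J(2) X_B by auto
  have S: "S \<in> B" unfolding S_def by (intro B_sum XB \<phi>)
  define G where "G \<psi> x = sqrt (\<Sum>j\<in>J. (H s (X j \<psi>) x)\<^sup>2)" for \<psi> x
  have Gb: "G \<psi> \<in> bounded_borel M" if "\<psi> \<in> B" for \<psi>
  proof -
    have b: "(\<lambda>x. \<Sum>j\<in>J. (H s (X j \<psi>) x)\<^sup>2) \<in> bounded_borel M"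
      by (intro bounded_borel_sum bounded_borel_power H_bounded B_bounded XB s that)
    obtain c where c: "c \<ge> 0" "\<And>x. x \<in> space M \<Longrightarrow> \<bar>\<Sum>j\<in>J. (H s (X j \<psi>) x)\<^sup>2\<bar> \<le> c"
      using bounded_borelE[OF b] by blast
    show ?thesis unfolding G_def
      by (rule bounded_borelI[of _ _ "sqrt c"])
         (use bounded_borel_measurable[OF b] c(2) in \<open>auto simp: sum_nonneg\<close>)
  qed
  have G: "pnorm M r (G \<psi>) \<le> (2 * min 1 (r - 1) * s) powr (- (1 / 2)) * pnorm M r \<psi>" if "\<psi> \<in> B" "1 < r" for \<psi> r
    unfolding G_def by (rule gradient_estimate[OF that(1) J that(2) s(1)])
  obtain C where C: "\<And>n. C n \<in> mixing_ops M B I X" "\<And>x. x \<in> space M \<Longrightarrow> (\<lambda>n. C n S x) \<longlonglongrightarrow> H t S x"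
    using H_approxE[of "{S}" t] S s(4) by (metis empty_subsetI finite.emptyI finite.insertI insert_subset singletonI)
  have "pnorm M p (H t S) \<le> (2 * min 1 (p - 1) * s) powr (- (1 / 2)) * pnorm M p \<phi> * (2 * min 1 (q - 1) * s) powr (- (1 / 2))"
  proof (rule pnorm_le_by_B_dual[OF p q_def _ mixing_B[OF C(1) S] mixing_bounded_seqs[OF C(1) S] C(2)])
    fix \<psi> assume \<psi>: "\<psi> \<in> B"
    have bb: "H r (X i \<eta>) \<in> bounded_borel M" if "i \<in> J" "\<eta> \<in> B" "r \<ge> 0" for i \<eta> r
      by (intro H_bounded B_bounded XB that)
    have one: "(\<integral>x. X i (X i \<phi>) x * H t \<psi> x \<partial>M) = - (\<integral>x. H s (X i \<phi>) x * H s (X i \<psi>) x \<partial>M)" if "i \<in> J" for i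
    proof -
      have i: "i \<in> I" using that J by auto
      have "(\<integral>x. X i (X i \<phi>) x * H t \<psi> x \<partial>M) = - (\<integral>x. X i \<phi> x * H t (X i \<psi>) x \<partial>M)"
        by (rule H_parts[OF i X_B[OF i \<phi>] \<psi> s(4)])
      also have "(\<integral>x. X i \<phi> x * H t (X i \<psi>) x \<partial>M) = (\<integral>x. X i \<phi> x * H s (H s (X i \<psi>)) x \<partial>M)"
        using H_semigroup[OF B_bounded[OF X_B[OF i \<psi>]] s(2,2)] s(3)
        by (intro Bochner_Integration.integral_cong) auto
      also have "\<dots> = (\<integral>x. H s (X i \<phi>) x * H s (X i \<psi>) x \<partial>M)"
        by (rule H_symmetric[symmetric]) (intro B_bounded bb X_B i \<phi> \<psi> that s(2))+
      finally show ?thesis .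
    qed
    have int: "integrable M (\<lambda>x. H s (X i \<phi>) x * H s (X i \<psi>) x)" if "i \<in> J" for i
      by (intro integrable_bounded_borel bounded_borel_mult bb that \<phi> \<psi> s(2))
    have "(\<integral>x. H t S x * \<psi> x \<partial>M) = (\<integral>x. S x * H t \<psi> x \<partial>M)"
      by (rule H_symmetric[OF B_bounded[OF S] B_bounded[OF \<psi>] s(4)])
    also have "\<dots> = (\<Sum>i\<in>J. \<integral>x. X i (X i \<phi>) x * H t \<psi> x \<partial>M)"
      unfolding S_def sum_distrib_right
      by (intro Bochner_Integration.integral_sum integrable_bounded_borel bounded_borel_mult B_bounded H_bounded XB \<phi> \<psi> s)
    also have "\<dots> = - (\<integral>x. (\<Sum>i\<in>J. H s (X i \<phi>) x * H s (X i \<psi>) x) \<partial>M)"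
      using int by (simp add: one sum_negf)
    finally have "\<bar>\<integral>x. H t S x * \<psi> x \<partial>M\<bar> = \<bar>\<integral>x. (\<Sum>i\<in>J. H s (X i \<phi>) x * H s (X i \<psi>) x) \<partial>M\<bar>" by simp
    also have "\<dots> \<le> (\<integral>x. \<bar>\<Sum>i\<in>J. H s (X i \<phi>) x * H s (X i \<psi>) x\<bar> \<partial>M)" by (rule integral_abs_bound)
    also have "\<dots> \<le> (\<integral>x. \<bar>G \<phi> x * G \<psi> x\<bar> \<partial>M)"
    proof (rule integral_mono)
      show "integrable M (\<lambda>x. \<bar>\<Sum>i\<in>J. H s (X i \<phi>) x * H s (X i \<psi>) x\<bar>)" using int by (intro integrable_abs) simp
      show "integrable M (\<lambda>x. \<bar>G \<phi> x * G \<psi> x\<bar>)"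
        by (intro integrable_abs integrable_bounded_borel bounded_borel_mult Gb \<phi> \<psi>)
      fix x
      have "\<bar>\<Sum>i\<in>J. H s (X i \<phi>) x * H s (X i \<psi>) x\<bar> = sqrt ((\<Sum>i\<in>J. H s (X i \<phi>) x * H s (X i \<psi>) x)\<^sup>2)" by simp
      also have "\<dots> \<le> G \<phi> x * G \<psi> x"
        unfolding G_def real_sqrt_mult[symmetric] by (rule real_sqrt_le_mono[OF Cauchy_Schwarz_ineq_sum])
      finally show "\<bar>\<Sum>i\<in>J. H s (X i \<phi>) x * H s (X i \<psi>) x\<bar> \<le> \<bar>G \<phi> x * G \<psi> x\<bar>" by linarith
    qed
    also have "\<dots> \<le> pnorm M p (G \<phi>) * pnorm M q (G \<psi>)"
      by (rule Lp_holder(2)[OF Lp_bounded_borel[OF Gb[OF \<phi>]] Lp_bounded_borel[OF Gb[OF \<psi>]] p pq(1,2)]) (use p pq in auto)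
    also have "\<dots> \<le> ((2 * min 1 (p - 1) * s) powr (- (1 / 2)) * pnorm M p \<phi>) * ((2 * min 1 (q - 1) * s) powr (- (1 / 2)) * pnorm M q \<psi>)"
      by (intro mult_mono G \<phi> \<psi> p pq(1)) auto
    finally show "\<bar>\<integral>x. H t S x * \<psi> x \<partial>M\<bar>
        \<le> (2 * min 1 (p - 1) * s) powr (- (1 / 2)) * pnorm M p \<phi> * (2 * min 1 (q - 1) * s) powr (- (1 / 2)) * pnorm M q \<psi>"
      by (simp add: mult_ac)
  qed auto
  also have "2 * min 1 (p - 1) * s = min 1 (p - 1) * t" using s by simp
  also have "2 * min 1 (q - 1) * s = min 1 (q - 1) * t" using s by simp
  also have "(min 1 (p - 1) * t) powr (- (1 / 2)) * pnorm M p \<phi> * (min 1 (q - 1) * t) powr (- (1 / 2))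
     = sos_const p * (t powr (- (1 / 2)) * t powr (- (1 / 2))) * pnorm M p \<phi>"
  proof -
    have "(min 1 (p - 1) * t) powr (- (1 / 2)) = (min 1 (p - 1)) powr (- (1 / 2)) * t powr (- (1 / 2))"
      "(min 1 (q - 1) * t) powr (- (1 / 2)) = (min 1 (q - 1)) powr (- (1 / 2)) * t powr (- (1 / 2))"
      using t p pq(1) by (simp_all add: powr_mult)
    then show ?thesis unfolding sos_const_def q_def[symmetric] by simp
  qed
  also have "t powr (- (1 / 2)) * t powr (- (1 / 2)) = t powr (-1)" using powr_add[of t "-(1/2)" "-(1/2)"] by simp
  finally show ?thesis by (simp add: S_def)
qed

text \<open>\<open>\<kappa>\<close> is half the order of \<open>P\<close>: 0 for the identity, 1/2
  for a field, 1 for a sum of squares. Commutation is demanded with the mixing operators because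
  \<open>P\<close> is controlled on \<open>B\<close> only, which \<open>H t\<close> may
  leave.\<close>

definition smoothing :: "real \<Rightarrow> real \<Rightarrow> real \<Rightarrow> 'a operator \<Rightarrow> bool" where
  "smoothing p \<kappa> c P \<longleftrightarrow> 0 \<le> c \<and> (\<forall>\<phi>\<in>B. P \<phi> \<in> B) \<and>
     (\<forall>\<phi>\<in>B. \<forall>\<psi>\<in>B. P (\<lambda>x. \<phi> x - \<psi> x) = (\<lambda>x. P \<phi> x - P \<psi> x)) \<and>
     (\<forall>C\<in>mixing_ops M B I X. \<forall>\<phi>\<in>B. P (C \<phi>) = C (P \<phi>)) \<and>
     (\<forall>\<phi>\<in>B. A (P \<phi>) = P (A \<phi>)) \<and>
     (\<forall>t>0. \<forall>\<phi>\<in>B. pnorm M p (H t (P \<phi>)) \<le> c * t powr (- \<kappa>) * pnorm M p \<phi>)"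

lemma smoothingD:
  assumes "smoothing p \<kappa> c P"
  shows "0 \<le> c" "\<phi> \<in> B \<Longrightarrow> P \<phi> \<in> B"
    "\<phi> \<in> B \<Longrightarrow> \<psi> \<in> B \<Longrightarrow> P (\<lambda>x. \<phi> x - \<psi> x) = (\<lambda>x. P \<phi> x - P \<psi> x)"
    "C \<in> mixing_ops M B I X \<Longrightarrow> \<phi> \<in> B \<Longrightarrow> P (C \<phi>) = C (P \<phi>)"
    "\<phi> \<in> B \<Longrightarrow> A (P \<phi>) = P (A \<phi>)"
    "t > 0 \<Longrightarrow> \<phi> \<in> B \<Longrightarrow> pnorm M p (H t (P \<phi>)) \<le> c * t powr (- \<kappa>) * pnorm M p \<phi>"
  using assms by (auto simp: smoothing_def)

lemma B_Lp: "\<phi> \<in> B \<Longrightarrow> 1 < p \<Longrightarrow> \<phi> \<in> Lp M p"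
  by (auto intro: Lp_bounded_borel B_bounded)

lemma H_B_Lp: "\<phi> \<in> B \<Longrightarrow> t \<ge> 0 \<Longrightarrow> 1 < p \<Longrightarrow> H t \<phi> \<in> Lp M p"
  by (auto intro: H_Lp B_Lp)

lemma smoothing_id: "1 < p \<Longrightarrow> smoothing p 0 1 (\<lambda>\<phi>. \<phi>)"
  by (auto simp: smoothing_def H_Lp_contract B_Lp)

lemma smoothing_X: "1 < p \<Longrightarrow> i \<in> I \<Longrightarrow> smoothing p (1 / 2) ((2 * min 1 (p - 1)) powr (- (1 / 2))) (X i)"
  unfolding smoothing_def using X_smoothing[of i _ p] by (auto simp: X_B X_diff mixing_X A_X_commute)

text \<open>Bounded pointwise convergence gives convergence in \<open>Lp\<close>, and contractivity
  passes it through \<open>H s\<close>.\<close>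

lemma pnorm_H_mixing_tendsto:
  assumes p: "1 < p" and s: "s \<ge> 0" and r: "r \<ge> 0" and \<psi>: "\<psi> \<in> B"
    and C: "\<And>n. C n \<in> mixing_ops M B I X" "\<And>x. x \<in> space M \<Longrightarrow> (\<lambda>n. C n \<psi> x) \<longlonglongrightarrow> H r \<psi> x"
  shows "(\<lambda>n. pnorm M p (\<lambda>x. C n \<psi> x - H r \<psi> x)) \<longlonglongrightarrow> 0"
    and "(\<lambda>n. pnorm M p (H s (C n \<psi>))) \<longlonglongrightarrow> pnorm M p (H (s + r) \<psi>)"
proof -
  have p0: "p > 0" "1 < p" using p by auto
  have d: "(\<lambda>n x. C n \<psi> x - H r \<psi> x) \<in> bounded_seqs M"
    using bounded_seqs_add[OF mixing_bounded_seqs[OF C(1) \<psi>] bounded_seqs_const[OF bounded_borel_minus[OF H_bounded[OF B_bounded[OF \<psi>] r]]]]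
    by simp
  obtain c where c: "c \<ge> 0" "\<And>n x. x \<in> space M \<Longrightarrow> \<bar>C n \<psi> x - H r \<psi> x\<bar> \<le> c" using bounded_seqsE[OF d] by blast
  have "(\<lambda>n. pnorm M p (\<lambda>x. C n \<psi> x - H r \<psi> x)) \<longlonglongrightarrow> pnorm M p (\<lambda>x. 0)"
  proof (rule pnorm_bounded_convergence[OF bounded_seqs_measurable[OF d] c(2) _ p0(1)])
    show "(\<lambda>n. C n \<psi> x - H r \<psi> x) \<longlonglongrightarrow> 0" if "x \<in> space M" for x
      using C(2)[OF that] by (simp add: LIM_zero)
  qed
  then show lim: "(\<lambda>n. pnorm M p (\<lambda>x. C n \<psi> x - H r \<psi> x)) \<longlonglongrightarrow> 0" using p by (simp add: pnorm_def)
  have bb: "C n \<psi> \<in> bounded_borel M" "H r \<psi> \<in> bounded_borel M" for n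
    using mixing_B[OF C(1) \<psi>] r \<psi> by (auto intro: B_bounded H_bounded)
  have "\<bar>pnorm M p (H s (C n \<psi>)) - pnorm M p (H (s + r) \<psi>)\<bar> \<le> pnorm M p (\<lambda>x. C n \<psi> x - H r \<psi> x)" for n
  proof -
    have "pnorm M p (H (s + r) \<psi>) = pnorm M p (H s (H r \<psi>))"
      by (rule pnorm_cong) (use H_semigroup[OF B_bounded[OF \<psi>] s r] in auto)
    moreover have "\<bar>pnorm M p (H s (C n \<psi>)) - pnorm M p (H s (H r \<psi>))\<bar> \<le> pnorm M p (\<lambda>x. H s (C n \<psi>) x - H s (H r \<psi>) x)"
      by (intro abs_pnorm_diff H_Lp Lp_bounded_borel bb p p0 s)
    moreover have "pnorm M p (\<lambda>x. H s (C n \<psi>) x - H s (H r \<psi>) x) = pnorm M p (H s (\<lambda>x. C n \<psi> x - H r \<psi> x))"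
      by (rule pnorm_cong) (use H_diff[OF bb s] in auto)
    moreover have "\<dots> \<le> pnorm M p (\<lambda>x. C n \<psi> x - H r \<psi> x)"
      by (intro H_Lp_contract Lp_bounded_borel bounded_borel_diff bb p p0 s)
    ultimately show ?thesis by linarith
  qed
  then show "(\<lambda>n. pnorm M p (H s (C n \<psi>))) \<longlonglongrightarrow> pnorm M p (H (s + r) \<psi>)"
    by (intro LIM_zero_cancel[OF Lim_null_comparison[OF _ lim]]) auto
qed

text \<open>Formally \<open>P\<close> commutes with \<open>H r\<close>, and the bound is applied to
  \<open>H r \<psi>\<close>; the mixing operators make this legitimate.\<close>

lemma smoothing_shift:
  assumes P: "smoothing p \<kappa> c P" and p: "1 < p" and s: "s > 0" and r: "r \<ge> 0" and \<psi>: "\<psi> \<in> B"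
  shows "pnorm M p (H (s + r) (P \<psi>)) \<le> c * s powr (- \<kappa>) * pnorm M p (H r \<psi>)"
proof -
  have P\<psi>: "P \<psi> \<in> B" using smoothingD(2)[OF P \<psi>] .
  obtain C where C: "\<And>n. C n \<in> mixing_ops M B I X"
    "\<And>\<eta> x. \<eta> \<in> {\<psi>, P \<psi>} \<Longrightarrow> x \<in> space M \<Longrightarrow> (\<lambda>n. C n \<eta> x) \<longlonglongrightarrow> H r \<eta> x"
    using H_approxE[of "{\<psi>, P \<psi>}" r] \<psi> P\<psi> r by auto
  have s0: "s \<ge> 0" using s by simp
  have "(\<lambda>n. pnorm M p (H s (P (C n \<psi>)))) \<longlonglongrightarrow> pnorm M p (H (s + r) (P \<psi>))"
    using pnorm_H_mixing_tendsto(2)[OF p s0 r P\<psi> C(1) C(2)] smoothingD(4)[OF P C(1) \<psi>] by simp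
  moreover have "(\<lambda>n. c * s powr (- \<kappa>) * pnorm M p (C n \<psi>)) \<longlonglongrightarrow> c * s powr (- \<kappa>) * pnorm M p (H r \<psi>)"
  proof (rule tendsto_mult_left)
    have "pnorm M p (H 0 (C n \<psi>)) = pnorm M p (C n \<psi>)" for n
      by (rule pnorm_cong) (use H_0[OF B_bounded[OF mixing_B[OF C(1) \<psi>]]] in auto)
    then show "(\<lambda>n. pnorm M p (C n \<psi>)) \<longlonglongrightarrow> pnorm M p (H r \<psi>)"
      using pnorm_H_mixing_tendsto(2)[OF p order_refl r \<psi> C(1) C(2)] by simp
  qed
  moreover have "pnorm M p (H s (P (C n \<psi>))) \<le> c * s powr (- \<kappa>) * pnorm M p (C n \<psi>)" for n
    by (rule smoothingD(6)[OF P s mixing_B[OF C(1) \<psi>]])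
  ultimately show ?thesis by (intro LIMSEQ_le) auto
qed

text \<open>Half of the time pays for each operator, whence the power of 2.\<close>

lemma smoothing_comp:
  assumes P: "smoothing p \<kappa> c P" and Q: "smoothing p \<rho> d Q" and p: "1 < p"
  shows "smoothing p (\<kappa> + \<rho>) (c * d * 2 powr (\<kappa> + \<rho>)) (\<lambda>\<phi>. P (Q \<phi>))"
  unfolding smoothing_def
proof (intro conjI allI impI ballI)
  fix t :: real and \<phi> assume t: "0 < t" and \<phi>: "\<phi> \<in> B"
  have "pnorm M p (H (t / 2 + t / 2) (P (Q \<phi>))) \<le> c * (t / 2) powr (- \<kappa>) * pnorm M p (H (t / 2) (Q \<phi>))"
    by (rule smoothing_shift[OF P p]) (use t smoothingD(2)[OF Q \<phi>] in auto)
  also have "\<dots> \<le> c * (t / 2) powr (- \<kappa>) * (d * (t / 2) powr (- \<rho>) * pnorm M p \<phi>)"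
    using t \<phi> smoothingD(1)[OF P] by (intro mult_left_mono smoothingD(6)[OF Q]) auto
  also have "\<dots> = c * d * (t / 2) powr (- (\<kappa> + \<rho>)) * pnorm M p \<phi>"
    by (simp add: powr_add[symmetric] add.commute mult_ac)
  also have "(t / 2) powr (- (\<kappa> + \<rho>)) = 2 powr (\<kappa> + \<rho>) * t powr (- (\<kappa> + \<rho>))"
    using t by (simp only: powr_divide powr_minus) (simp add: field_simps)
  finally show "pnorm M p (H t (P (Q \<phi>))) \<le> c * d * 2 powr (\<kappa> + \<rho>) * t powr (- (\<kappa> + \<rho>)) * pnorm M p \<phi>"
    by (simp add: mult.assoc)
qed (use smoothingD(1-5)[OF P] smoothingD(1-5)[OF Q] A_B in auto)

text \<open>The set of contributing indices varies with the function, so the operator is compared,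
  on finitely many functions at a time, with a sum over a common finite set. The estimate holds even
  for infinite \<open>J\<close> because \<open>sos_const\<close> does not depend on the index
  set.\<close>

lemma smoothing_partial_sos:
  assumes p: "1 < p" and J: "J \<subseteq> I"
  shows "smoothing p 1 (sos_const p) (sum_of_squares_op J X)"
proof -
  define S where "S K = (\<lambda>\<phi> x. \<Sum>i\<in>K. X i (X i \<phi>) x)" for K
  define P where "P \<phi> = S {i \<in> J. X i \<phi> \<noteq> (\<lambda>x. 0)} \<phi>" for \<phi>
  have P: "P = sum_of_squares_op J X" by (simp add: fun_eq_iff P_def S_def sum_of_squares_op_def)
  have P_eq: "P \<phi> = S (J \<inter> K) \<phi>" if "finite K" "K \<subseteq> I" "\<phi> \<in> B" "\<And>i. i \<in> I - K \<Longrightarrow> X i \<phi> = (\<lambda>x. 0)" for \<phi> K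
    unfolding P S_def by (rule sum_of_squares_op_eq[OF that(1,2) J that(4) X_zero])
  have XB: "X i \<phi> \<in> B" if "i \<in> J" "\<phi> \<in> B" for i \<phi> using that J X_B by auto
  have SB: "S K \<phi> \<in> B" if "K \<subseteq> J" "\<phi> \<in> B" for K \<phi> unfolding S_def by (intro B_sum XB) (use that in auto)
  have PB: "P \<phi> \<in> B" if "\<phi> \<in> B" for \<phi> unfolding P_def by (rule SB) (use that in auto)
  have "smoothing p 1 (sos_const p) P"
    unfolding smoothing_def
  proof (intro conjI allI impI ballI PB)
    show "0 \<le> sos_const p" by (simp add: sos_const_def)
  next
    fix \<phi> \<psi> assume B: "\<phi> \<in> B" "\<psi> \<in> B"
    obtain K where K: "finite K" "K \<subseteq> I" "\<And>i \<eta>. i \<in> I - K \<Longrightarrow> \<eta> \<in> {\<phi>, \<psi>} \<Longrightarrow> X i \<eta> = (\<lambda>x. 0)"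
      using common_support[of "{\<phi>, \<psi>}"] B by auto
    have "P (\<lambda>x. \<phi> x - \<psi> x) = S (J \<inter> K) (\<lambda>x. \<phi> x - \<psi> x)"
      by (rule P_eq) (use K B in \<open>auto simp: X_diff intro: B_diff\<close>)
    also have "\<dots> = (\<lambda>x. S (J \<inter> K) \<phi> x - S (J \<inter> K) \<psi> x)"
      unfolding S_def using B K(2)
      by (intro ext) (auto simp: sum_subtractf[symmetric] X_diff X_B subset_iff intro!: sum.cong)
    also have "\<dots> = (\<lambda>x. P \<phi> x - P \<psi> x)" using P_eq[OF K(1,2) B(1)] P_eq[OF K(1,2) B(2)] K(3) by simp
    finally show "P (\<lambda>x. \<phi> x - \<psi> x) = (\<lambda>x. P \<phi> x - P \<psi> x)" .
  next
    fix C \<phi> assume C: "C \<in> mixing_ops M B I X" and \<phi>: "\<phi> \<in> B"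
    obtain K where K: "finite K" "K \<subseteq> I" "\<And>i \<eta>. i \<in> I - K \<Longrightarrow> \<eta> \<in> {\<phi>} \<Longrightarrow> X i \<eta> = (\<lambda>x. 0)"
      using common_support[of "{\<phi>}"] \<phi> by auto
    have "P (C \<phi>) = S (J \<inter> K) (C \<phi>)"
      by (rule P_eq) (use K \<phi> in \<open>auto simp: mixing_X[OF C] mixing_zero[OF C] intro: mixing_B[OF C]\<close>)
    also have "\<dots> = (\<lambda>x. \<Sum>i\<in>J \<inter> K. C (X i (X i \<phi>)) x)"
      unfolding S_def using \<phi> K(2) by (intro ext sum.cong) (auto simp: mixing_X[OF C] X_B subset_iff)
    also have "\<dots> = C (S (J \<inter> K) \<phi>)"
      unfolding S_def using \<phi> by (intro mixing_sum[OF C, symmetric] XB) auto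
    also have "\<dots> = C (P \<phi>)" using P_eq[OF K(1,2) \<phi>] K(3) by simp
    finally show "P (C \<phi>) = C (P \<phi>)" .
  next
    fix \<phi> assume \<phi>: "\<phi> \<in> B"
    obtain K where K: "finite K" "K \<subseteq> I" "\<And>i \<eta>. i \<in> I - K \<Longrightarrow> \<eta> \<in> {\<phi>, A \<phi>} \<Longrightarrow> X i \<eta> = (\<lambda>x. 0)"
      using common_support[of "{\<phi>, A \<phi>}"] \<phi> A_B by auto
    have "A (P \<phi>) = A (S (J \<inter> K) \<phi>)" using P_eq[OF K(1,2) \<phi>] K(3) by simp
    also have "\<dots> = (\<lambda>x. \<Sum>i\<in>J \<inter> K. A (X i (X i \<phi>)) x)"
      unfolding S_def using K(1) \<phi> by (intro A_sum XB) auto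
    also have "\<dots> = S (J \<inter> K) (A \<phi>)"
      unfolding S_def using \<phi> K(2) by (intro ext sum.cong) (auto simp: A_X_commute X_B subset_iff)
    also have "\<dots> = P (A \<phi>)" using P_eq[OF K(1,2) A_B[OF \<phi>]] K(3) by simp
    finally show "A (P \<phi>) = P (A \<phi>)" .
  next
    fix t :: real and \<phi> assume "0 < t" "\<phi> \<in> B"
    then show "pnorm M p (H t (P \<phi>)) \<le> sos_const p * t powr (- 1) * pnorm M p \<phi>"
      unfolding P_def S_def
    proof (intro sos_smoothing p)
      show "finite {i \<in> J. X i \<phi> \<noteq> (\<lambda>x. 0)}" using X_finite[OF \<open>\<phi> \<in> B\<close>] by (rule rev_finite_subset) (use J in auto)
    qed (use J in auto)
  qed
  then show ?thesis by (simp only: P)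
qed

lemma smoothing_A: "1 < p \<Longrightarrow> smoothing p 1 (sos_const p) A"
  by (rule smoothing_partial_sos) auto

lemma smoothing_A_power:
  assumes "1 < p" shows "\<exists>c. smoothing p (real n) c (A ^^ n)"
proof (induction n)
  case 0
  then show ?case using smoothing_id[OF assms] by (auto simp: id_def)
next
  case (Suc n)
  then obtain c where "smoothing p (real n) c (A ^^ n)" by blast
  from smoothing_comp[OF smoothing_A[OF assms] this assms] show ?case by (auto simp: comp_def)
qed

end

section \<open>Extension of smoothing operators to \<open>L\<^sup>p\<close>\<close>

context derivation_semigroup
begin

definition B_closure :: "real \<Rightarrow> ('a \<Rightarrow> real) set" where
  "B_closure p = {w \<in> Lp M p. \<forall>\<epsilon>>0. \<exists>\<phi>\<in>B. pnorm M p (\<lambda>x. \<phi> x - w x) < \<epsilon>}"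

text \<open>The value at \<open>w\<close> of the continuous extension of \<open>\<phi> \<mapsto> H t (P \<phi>)\<close> from \<open>B\<close> to its closure in
  \<open>L\<^sup>p\<close>; it is determined up to null sets.\<close>

definition ext_op :: "real \<Rightarrow> 'a operator \<Rightarrow> real \<Rightarrow> 'a operator" where
  "ext_op p P t w = (SOME v. v \<in> Lp M p \<and>
     (\<exists>c. \<forall>\<phi>\<in>B. pnorm M p (\<lambda>x. H t (P \<phi>) x - v x) \<le> c * pnorm M p (\<lambda>x. \<phi> x - w x)))"

lemma B_closure_Lp: "w \<in> B_closure p \<Longrightarrow> w \<in> Lp M p"
  by (simp add: B_closure_def)

lemma B_closure_seq:
  assumes "w \<in> B_closure p"
  obtains \<phi> where "\<And>n. \<phi> n \<in> B" "(\<lambda>n. pnorm M p (\<lambda>x. \<phi> n x - w x)) \<longlonglongrightarrow> 0"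
proof -
  have "\<exists>\<phi>\<in>B. pnorm M p (\<lambda>x. \<phi> x - w x) < inverse (real (Suc n))" for n
    using assms unfolding B_closure_def by (simp del: of_nat_Suc)
  then obtain \<phi> where \<phi>: "\<And>n. \<phi> n \<in> B" "\<And>n. pnorm M p (\<lambda>x. \<phi> n x - w x) < inverse (real (Suc n))" by metis
  show thesis
  proof (rule that[OF \<phi>(1) Lim_null_comparison[OF _ LIMSEQ_inverse_real_of_nat]])
    show "\<forall>\<^sub>F n in sequentially. norm (pnorm M p (\<lambda>x. \<phi> n x - w x)) \<le> inverse (real (Suc n))"
      using less_imp_le[OF \<phi>(2)] by (intro always_eventually allI) simp
  qed
qed

lemma B_closureI:
  assumes "w \<in> Lp M p" "\<And>n. \<phi> n \<in> B" "(\<lambda>n. pnorm M p (\<lambda>x. \<phi> n x - w x)) \<longlonglongrightarrow> 0"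
  shows "w \<in> B_closure p"
  unfolding B_closure_def
proof (intro CollectI conjI allI impI)
  fix \<epsilon> :: real assume "\<epsilon> > 0"
  then obtain n where "pnorm M p (\<lambda>x. \<phi> n x - w x) < \<epsilon>"
    using order_tendstoD(2)[OF assms(3) \<open>\<epsilon> > 0\<close>] unfolding eventually_sequentially by blast
  then show "\<exists>\<phi>\<in>B. pnorm M p (\<lambda>x. \<phi> x - w x) < \<epsilon>" using assms(2) by blast
qed fact

lemma pnorm_H_P_diff:
  assumes P: "smoothing p \<kappa> c P" and p: "1 < p" and t: "t > 0" and B: "\<phi> \<in> B" "\<psi> \<in> B"
  shows "pnorm M p (\<lambda>x. H t (P \<phi>) x - H t (P \<psi>) x) \<le> c * t powr (- \<kappa>) * pnorm M p (\<lambda>x. \<phi> x - \<psi> x)"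
proof -
  have "pnorm M p (\<lambda>x. H t (P \<phi>) x - H t (P \<psi>) x) = pnorm M p (H t (P (\<lambda>x. \<phi> x - \<psi> x)))"
    using t B smoothingD(2)[OF P]
    by (intro pnorm_cong) (auto simp: smoothingD(3)[OF P] H_diff B_bounded)
  also have "\<dots> \<le> c * t powr (- \<kappa>) * pnorm M p (\<lambda>x. \<phi> x - \<psi> x)"
    by (rule smoothingD(6)[OF P t B_diff[OF B]])
  finally show ?thesis .
qed

text \<open>Any two functions of \<open>Lp\<close> that satisfy the defining inequality, with
  whatever constants, have distance 0. So the function picked by the choice operator coincides with
  the limit of approximating images and inherits its explicit constant.\<close>

lemma ext_op:
  assumes P: "smoothing p \<kappa> c P" and p: "1 < p" and t: "t > 0" and w: "w \<in> B_closure p"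
  shows "ext_op p P t w \<in> Lp M p"
    and "\<phi> \<in> B \<Longrightarrow> pnorm M p (\<lambda>x. H t (P \<phi>) x - ext_op p P t w x) \<le> c * t powr (- \<kappa>) * pnorm M p (\<lambda>x. \<phi> x - w x)"
proof -
  note wL = B_closure_Lp[OF w]
  let ?c = "c * t powr (- \<kappa>)"
  have c: "?c \<ge> 0" using smoothingD(1)[OF P] by simp
  obtain \<phi>' where \<phi>': "\<And>n. \<phi>' n \<in> B" "(\<lambda>n. pnorm M p (\<lambda>x. \<phi>' n x - w x)) \<longlonglongrightarrow> 0"
    using B_closure_seq[OF w] by blast
  have HL: "H t (P \<phi>) \<in> Lp M p" if "\<phi> \<in> B" for \<phi>
    by (rule H_B_Lp) (use that t p smoothingD(2)[OF P] in auto)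
  have d: "pnorm M p (\<lambda>x. H t (P \<phi>) x - H t (P \<psi>) x) \<le> ?c * (pnorm M p (\<lambda>x. \<phi> x - w x) + pnorm M p (\<lambda>x. \<psi> x - w x))"
    if "\<phi> \<in> B" "\<psi> \<in> B" for \<phi> \<psi>
  proof -
    have "pnorm M p (\<lambda>x. \<phi> x - \<psi> x) \<le> pnorm M p (\<lambda>x. \<phi> x - w x) + pnorm M p (\<lambda>x. \<psi> x - w x)"
      using pnorm_triangle_diff[OF B_Lp[OF that(1) p] wL B_Lp[OF that(2) p] p]
      by (simp add: pnorm_diff_commute[of M p w])
    then have "?c * pnorm M p (\<lambda>x. \<phi> x - \<psi> x) \<le> ?c * (pnorm M p (\<lambda>x. \<phi> x - w x) + pnorm M p (\<lambda>x. \<psi> x - w x))"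
      using c by (rule mult_left_mono)
    then show ?thesis using pnorm_H_P_diff[OF P p t that] by linarith
  qed
  obtain v where v: "v \<in> Lp M p" "(\<lambda>n. pnorm M p (\<lambda>x. H t (P (\<phi>' n)) x - v x)) \<longlonglongrightarrow> 0"
  proof (rule Lp_complete[OF HL[OF \<phi>'(1)] p])
    fix e :: real assume e: "e > 0"
    \<comment> \<open>The summand 1 covers a vanishing constant.\<close>
    define e' where "e' = e / (2 * ?c + 1)"
    have e': "e' > 0" using e c by (simp add: e'_def)
    obtain N where N: "\<And>n. n \<ge> N \<Longrightarrow> pnorm M p (\<lambda>x. \<phi>' n x - w x) < e'"
      using order_tendstoD(2)[OF \<phi>'(2) e'] by (auto simp: eventually_sequentially)
    show "\<exists>N. \<forall>i\<ge>N. \<forall>j\<ge>N. pnorm M p (\<lambda>x. H t (P (\<phi>' i)) x - H t (P (\<phi>' j)) x) < e"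
    proof (intro exI allI impI)
      fix i j assume ij: "N \<le> i" "N \<le> j"
      have "pnorm M p (\<lambda>x. H t (P (\<phi>' i)) x - H t (P (\<phi>' j)) x) \<le> ?c * (e' + e')"
        by (rule order_trans[OF d[OF \<phi>'(1) \<phi>'(1)]], rule mult_left_mono[OF _ c])
           (use N[OF ij(1)] N[OF ij(2)] in linarith)
      also have "\<dots> < (2 * ?c + 1) * e'" using e' by (simp add: algebra_simps)
      also have "\<dots> = e" using c by (simp add: e'_def)
      finally show "pnorm M p (\<lambda>x. H t (P (\<phi>' i)) x - H t (P (\<phi>' j)) x) < e" .
    qed
  qed
  have vb: "pnorm M p (\<lambda>x. H t (P \<phi>) x - v x) \<le> ?c * pnorm M p (\<lambda>x. \<phi> x - w x)" if \<phi>: "\<phi> \<in> B" for \<phi>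
  proof (rule LIMSEQ_le_const)
    show "(\<lambda>n. ?c * (pnorm M p (\<lambda>x. \<phi> x - w x) + pnorm M p (\<lambda>x. \<phi>' n x - w x)) + pnorm M p (\<lambda>x. H t (P (\<phi>' n)) x - v x))
        \<longlonglongrightarrow> ?c * pnorm M p (\<lambda>x. \<phi> x - w x)"
      by (rule tendsto_eq_intros \<phi>'(2) v(2) refl)+ simp
    show "\<exists>N. \<forall>n\<ge>N. pnorm M p (\<lambda>x. H t (P \<phi>) x - v x)
        \<le> ?c * (pnorm M p (\<lambda>x. \<phi> x - w x) + pnorm M p (\<lambda>x. \<phi>' n x - w x)) + pnorm M p (\<lambda>x. H t (P (\<phi>' n)) x - v x)"
      using pnorm_triangle_diff[OF HL[OF \<phi>] HL[OF \<phi>'(1)] v(1) p] d[OF \<phi> \<phi>'(1)]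
      by (meson add_right_mono order_trans)
  qed
  have "\<exists>v. v \<in> Lp M p \<and> (\<exists>c. \<forall>\<phi>\<in>B. pnorm M p (\<lambda>x. H t (P \<phi>) x - v x) \<le> c * pnorm M p (\<lambda>x. \<phi> x - w x))"
    using v(1) vb by blast
  from someI_ex[OF this] obtain c0 where E: "ext_op p P t w \<in> Lp M p"
    and c0: "\<And>\<phi>. \<phi> \<in> B \<Longrightarrow> pnorm M p (\<lambda>x. H t (P \<phi>) x - ext_op p P t w x) \<le> c0 * pnorm M p (\<lambda>x. \<phi> x - w x)"
    unfolding ext_op_def[symmetric] by blast
  show "ext_op p P t w \<in> Lp M p" by (rule E)
  \<comment> \<open>\<open>c0\<close> is the unknown constant of the chosen function; along
    \<open>\<phi>'\<close> the factor it multiplies tends to 0.\<close>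
  have "pnorm M p (\<lambda>x. v x - ext_op p P t w x) \<le> 0"
  proof (rule LIMSEQ_le_const)
    show "(\<lambda>n. pnorm M p (\<lambda>x. H t (P (\<phi>' n)) x - v x) + c0 * pnorm M p (\<lambda>x. \<phi>' n x - w x)) \<longlonglongrightarrow> 0"
      by (rule tendsto_eq_intros \<phi>'(2) v(2) refl)+ simp
    show "\<exists>N. \<forall>n\<ge>N. pnorm M p (\<lambda>x. v x - ext_op p P t w x)
        \<le> pnorm M p (\<lambda>x. H t (P (\<phi>' n)) x - v x) + c0 * pnorm M p (\<lambda>x. \<phi>' n x - w x)"
    proof (intro exI allI impI)
      fix n
      show "pnorm M p (\<lambda>x. v x - ext_op p P t w x)
          \<le> pnorm M p (\<lambda>x. H t (P (\<phi>' n)) x - v x) + c0 * pnorm M p (\<lambda>x. \<phi>' n x - w x)"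
        using pnorm_triangle_diff[OF v(1) HL[OF \<phi>'(1)[of n]] E p] c0[OF \<phi>'(1)[of n]]
          pnorm_diff_commute[of M p v "H t (P (\<phi>' n))"] by linarith
    qed
  qed
  then show "pnorm M p (\<lambda>x. H t (P \<phi>) x - ext_op p P t w x) \<le> ?c * pnorm M p (\<lambda>x. \<phi> x - w x)" if "\<phi> \<in> B" for \<phi>
    using pnorm_triangle_diff[OF HL[OF that] v(1) E p] vb[OF that] by linarith
qed

lemma ext_op_tendsto:
  assumes P: "smoothing p \<kappa> c P" and p: "1 < p" and t: "t > 0" and w: "w \<in> B_closure p"
    and \<phi>: "\<And>n. \<phi> n \<in> B" "(\<lambda>n. pnorm M p (\<lambda>x. \<phi> n x - w x)) \<longlonglongrightarrow> 0"
  shows "(\<lambda>n. pnorm M p (\<lambda>x. H t (P (\<phi> n)) x - ext_op p P t w x)) \<longlonglongrightarrow> 0"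
    and "(\<lambda>n. pnorm M p (H t (P (\<phi> n)))) \<longlonglongrightarrow> pnorm M p (ext_op p P t w)"
proof -
  have "(\<lambda>n. c * t powr (- \<kappa>) * pnorm M p (\<lambda>x. \<phi> n x - w x)) \<longlonglongrightarrow> 0"
    using tendsto_mult_right_zero[OF \<phi>(2)] .
  then show l: "(\<lambda>n. pnorm M p (\<lambda>x. H t (P (\<phi> n)) x - ext_op p P t w x)) \<longlonglongrightarrow> 0"
    by (rule Lim_null_comparison[rotated]) (use ext_op(2)[OF P p t w \<phi>(1)] in auto)
  have HL: "H t (P (\<phi> n)) \<in> Lp M p" for n
    by (rule H_B_Lp) (use \<phi>(1) t p smoothingD(2)[OF P] in auto)
  show "(\<lambda>n. pnorm M p (H t (P (\<phi> n)))) \<longlonglongrightarrow> pnorm M p (ext_op p P t w)"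
    by (rule LIM_zero_cancel, rule Lim_null_comparison[OF _ l])
       (use abs_pnorm_diff[OF HL ext_op(1)[OF P p t w]] p in auto)
qed

lemma ext_op_bound:
  assumes P: "smoothing p \<kappa> c P" and p: "1 < p" and t: "t > 0" and w: "w \<in> B_closure p"
  shows "pnorm M p (ext_op p P t w) \<le> c * t powr (- \<kappa>) * pnorm M p w"
proof -
  obtain \<phi> where \<phi>: "\<And>n. \<phi> n \<in> B" "(\<lambda>n. pnorm M p (\<lambda>x. \<phi> n x - w x)) \<longlonglongrightarrow> 0"
    using B_closure_seq[OF w] by blast
  have "(\<lambda>n. pnorm M p (\<phi> n)) \<longlonglongrightarrow> pnorm M p w"
    by (rule LIM_zero_cancel, rule Lim_null_comparison[OF _ \<phi>(2)])
       (use abs_pnorm_diff[OF B_Lp[OF \<phi>(1) p] B_closure_Lp[OF w]] p in auto)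
  then have "(\<lambda>n. c * t powr (- \<kappa>) * pnorm M p (\<phi> n)) \<longlonglongrightarrow> c * t powr (- \<kappa>) * pnorm M p w" by (rule tendsto_mult_left)
  then show ?thesis
    by (rule LIMSEQ_le[OF ext_op_tendsto(2)[OF P p t w \<phi>]]) (use smoothingD(6)[OF P t \<phi>(1)] in auto)
qed

text \<open>The inequality of \<open>smoothing_shift\<close>, passed to the closure of
  \<open>B\<close>.\<close>

lemma ext_op_comp_le:
  assumes P: "smoothing p \<kappa> c P" and Q: "smoothing p \<rho> d Q" and p: "1 < p" and s: "s > 0" and r: "r > 0"
    and w: "w \<in> B_closure p"
  shows "pnorm M p (ext_op p (\<lambda>\<phi>. P (Q \<phi>)) (s + r) w) \<le> c * s powr (- \<kappa>) * pnorm M p (ext_op p Q r w)"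
proof -
  obtain \<phi> where \<phi>: "\<And>n. \<phi> n \<in> B" "(\<lambda>n. pnorm M p (\<lambda>x. \<phi> n x - w x)) \<longlonglongrightarrow> 0"
    using B_closure_seq[OF w] by blast
  have sr: "s + r > 0" "r \<ge> 0" using s r by auto
  have "(\<lambda>n. c * s powr (- \<kappa>) * pnorm M p (H r (Q (\<phi> n)))) \<longlonglongrightarrow> c * s powr (- \<kappa>) * pnorm M p (ext_op p Q r w)"
    by (rule tendsto_mult_left[OF ext_op_tendsto(2)[OF Q p r w \<phi>]])
  then show ?thesis
    by (rule LIMSEQ_le[OF ext_op_tendsto(2)[OF smoothing_comp[OF P Q p] p sr(1) w \<phi>]])
       (use smoothing_shift[OF P p s sr(2) smoothingD(2)[OF Q \<phi>(1)]] in auto)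
qed

lemma H_Lp_derivative:
  assumes \<psi>: "\<psi> \<in> B" and t: "t > 0" and p: "1 < p"
  shows "((\<lambda>h. pnorm M p (\<lambda>x. (H (t + h) \<psi> x - H t \<psi> x) / h - H t (A \<psi>) x)) \<longlongrightarrow> 0) (at 0)"
proof -
  obtain K where K: "K \<ge> 0" "\<And>t r x. t \<ge> 0 \<Longrightarrow> t + r \<ge> 0 \<Longrightarrow> x \<in> space M \<Longrightarrow>
    \<bar>H (t + r) \<psi> x - H t \<psi> x - r * H t (A \<psi>) x\<bar> \<le> K * r\<^sup>2" using H_taylor[OF \<psi>] by blast
  show ?thesis
  proof (rule Lim_null_comparison)
    show "\<forall>\<^sub>F h in at 0. norm (pnorm M p (\<lambda>x. (H (t + h) \<psi> x - H t \<psi> x) / h - H t (A \<psi>) x)) \<le> K * \<bar>h\<bar>"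
      unfolding eventually_at
    proof (intro exI[of _ t] conjI ballI impI)
      fix h :: real assume h: "h \<noteq> 0 \<and> dist h 0 < t"
      have "pnorm M p (\<lambda>x. (H (t + h) \<psi> x - H t \<psi> x) / h - H t (A \<psi>) x) \<le> K * \<bar>h\<bar>"
      proof (rule Lp_bounded(2))
        have "H (t + h) \<psi> \<in> borel_measurable M" "H t \<psi> \<in> borel_measurable M" "H t (A \<psi>) \<in> borel_measurable M"
          using h t by (intro bounded_borel_measurable H_bounded[OF B_bounded] A_B \<psi>; simp add: dist_real_def)+
        then show "(\<lambda>x. (H (t + h) \<psi> x - H t \<psi> x) / h - H t (A \<psi>) x) \<in> borel_measurable M" by measurable
        show "\<bar>(H (t + h) \<psi> x - H t \<psi> x) / h - H t (A \<psi>) x\<bar> \<le> K * \<bar>h\<bar>" if "x \<in> space M" for x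
          by (rule abs_quotient_diff_le) (use h K(2)[of t h x] t that in auto)
      qed (use p K in auto)
      then show "norm (pnorm M p (\<lambda>x. (H (t + h) \<psi> x - H t \<psi> x) / h - H t (A \<psi>) x)) \<le> K * \<bar>h\<bar>" by simp
    qed (use t in auto)
    show "((\<lambda>h. K * \<bar>h\<bar>) \<longlongrightarrow> 0) (at 0)" by (auto intro!: tendsto_eq_intros)
  qed
qed

lemma eventually_pos_shift:
  assumes "(s::real) > 0" "\<And>h. s + h > 0 \<Longrightarrow> Q h" shows "\<forall>\<^sub>F h in at 0. Q h"
  unfolding eventually_at by (rule exI[of _ s]) (use assms in \<open>auto simp: dist_real_def abs_if split: if_splits\<close>)

lemma H_decreasing:
  assumes "\<psi> \<in> B" "0 \<le> r" "r \<le> s" "1 < p"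
  shows "pnorm M p (H s \<psi>) \<le> pnorm M p (H r \<psi>)"
proof -
  have "pnorm M p (H s \<psi>) = pnorm M p (H (s - r) (H r \<psi>))"
    using H_semigroup[OF B_bounded[OF assms(1)], of "s - r" r] assms by (intro pnorm_cong) auto
  also have "\<dots> \<le> pnorm M p (H r \<psi>)" using assms by (intro H_Lp_contract H_B_Lp) auto
  finally show ?thesis .
qed

lemma H_increment:
  assumes \<psi>: "\<psi> \<in> B" and ab: "0 < a" "a \<le> b" and p: "1 < p"
  shows "pnorm M p (\<lambda>x. H b \<psi> x - H a \<psi> x) \<le> (b - a) * pnorm M p (H a (A \<psi>))"
proof -
  have "pnorm M p (\<lambda>x. H b \<psi> x - H a \<psi> x) \<le> b * pnorm M p (H a (A \<psi>)) - a * pnorm M p (H a (A \<psi>))"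
  proof (rule Lp_mean_value[OF p ab(2), where c = "\<lambda>s. H s \<psi>" and c' = "\<lambda>s. H s (A \<psi>)"
        and g = "\<lambda>s. s * pnorm M p (H a (A \<psi>))" and g' = "\<lambda>s. pnorm M p (H a (A \<psi>))"])
    fix s assume s: "a \<le> s" "s \<le> b"
    show "\<forall>\<^sub>F h in at 0. H (s + h) \<psi> \<in> Lp M p"
      by (rule eventually_pos_shift[of s]) (use s ab \<psi> p in \<open>auto intro: H_B_Lp\<close>)
    show "pnorm M p (H s (A \<psi>)) \<le> pnorm M p (H a (A \<psi>))" using s ab p by (intro H_decreasing A_B \<psi>) auto
    show "((\<lambda>s. s * pnorm M p (H a (A \<psi>))) has_real_derivative pnorm M p (H a (A \<psi>))) (at s)"
      by (auto intro!: derivative_eq_intros)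
  qed (use ab p \<psi> in \<open>auto intro!: H_B_Lp A_B H_Lp_derivative\<close>)
  then show ?thesis by (simp add: left_diff_distrib)
qed

text \<open>Unlike in \<open>H_taylor\<close> the remainder is measured by an \<open>Lp\<close> norm
  of a smoothed function, which still makes sense when \<open>\<psi>\<close> is replaced by a limit
  of test functions. All times involved are at least \<open>t / 2\<close>, and norms decrease in
  time, so \<open>t / 2\<close> gives the largest one.\<close>

lemma H_taylor_Lp:
  assumes \<psi>: "\<psi> \<in> B" and t: "0 < t" and h: "\<bar>h\<bar> \<le> t / 2" and p: "1 < p"
  shows "pnorm M p (\<lambda>x. H (t + h) \<psi> x - H t \<psi> x - h * H t (A \<psi>) x) \<le> h\<^sup>2 * pnorm M p (H (t / 2) (A (A \<psi>)))"
proof -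
  define K where "K = pnorm M p (H (t / 2) (A (A \<psi>)))"
  have B: "A \<psi> \<in> B" "A (A \<psi>) \<in> B" using \<psi> A_B by auto
  \<comment> \<open>The curve \<open>H s \<psi> - s * H t (A \<psi>)\<close> has a derivative of
    norm at most \<open>\<bar>h\<bar> * K\<close> as long as s is within
    \<open>\<bar>h\<bar>\<close> of t; this is used for steps in both directions.\<close>
  have main: "pnorm M p (\<lambda>x. (H b \<psi> x - b * H t (A \<psi>) x) - (H a \<psi> x - a * H t (A \<psi>) x)) \<le> b * (\<bar>h\<bar> * K) - a * (\<bar>h\<bar> * K)"
    if ab: "t / 2 \<le> a" "a \<le> b" and d: "\<And>s. a \<le> s \<Longrightarrow> s \<le> b \<Longrightarrow> \<bar>s - t\<bar> \<le> \<bar>h\<bar>" for a b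
  proof (rule Lp_mean_value[OF p ab(2), where c = "\<lambda>s x. H s \<psi> x - s * H t (A \<psi>) x" and c' = "\<lambda>s x. H s (A \<psi>) x - H t (A \<psi>) x"
        and g = "\<lambda>s. s * (\<bar>h\<bar> * K)" and g' = "\<lambda>s. \<bar>h\<bar> * K"])
    fix s assume s: "a \<le> s" "s \<le> b"
    have s0: "s > 0" using s ab t by linarith
    show "(\<lambda>x. H s \<psi> x - s * H t (A \<psi>) x) \<in> Lp M p" "(\<lambda>x. H s (A \<psi>) x - H t (A \<psi>) x) \<in> Lp M p"
      using s0 t p by (auto intro!: Lp_diff Lp_cmult H_B_Lp B \<psi>)
    show "\<forall>\<^sub>F h in at 0. (\<lambda>x. H (s + h) \<psi> x - (s + h) * H t (A \<psi>) x) \<in> Lp M p"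
      by (rule eventually_pos_shift[OF s0]) (use t p in \<open>auto intro!: Lp_diff Lp_cmult H_B_Lp B \<psi>\<close>)
    have "((\<lambda>h. pnorm M p (\<lambda>x. (H (s + h) \<psi> x - H s \<psi> x) / h - H s (A \<psi>) x)) \<longlongrightarrow> 0) (at 0)"
      by (rule H_Lp_derivative[OF \<psi> s0 p])
    moreover have "\<forall>\<^sub>F h in at 0. pnorm M p (\<lambda>x. (H (s + h) \<psi> x - H s \<psi> x) / h - H s (A \<psi>) x)
       = pnorm M p (\<lambda>x. ((H (s + h) \<psi> x - (s + h) * H t (A \<psi>) x) - (H s \<psi> x - s * H t (A \<psi>) x)) / h - (H s (A \<psi>) x - H t (A \<psi>) x))"
      unfolding eventually_at
      by (rule exI[of _ 1]) (auto simp: field_simps intro!: arg_cong[where f = "pnorm M p"])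
    ultimately show "((\<lambda>h. pnorm M p (\<lambda>x. ((H (s + h) \<psi> x - (s + h) * H t (A \<psi>) x) - (H s \<psi> x - s * H t (A \<psi>) x)) / h
        - (H s (A \<psi>) x - H t (A \<psi>) x))) \<longlongrightarrow> 0) (at 0)"
      by (rule Lim_transform_eventually)
    show "pnorm M p (\<lambda>x. H s (A \<psi>) x - H t (A \<psi>) x) \<le> \<bar>h\<bar> * K"
    proof (cases "s \<le> t")
      case True
      have "pnorm M p (\<lambda>x. H s (A \<psi>) x - H t (A \<psi>) x) \<le> (t - s) * pnorm M p (H s (A (A \<psi>)))"
        using H_increment[OF B(1) s0 True p] by (subst pnorm_diff_commute)
      also have "\<dots> \<le> \<bar>h\<bar> * K"
        using True d[OF s] s ab t p unfolding K_def by (intro mult_mono H_decreasing B) auto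
      finally show ?thesis .
    next
      case False
      have "pnorm M p (\<lambda>x. H s (A \<psi>) x - H t (A \<psi>) x) \<le> (s - t) * pnorm M p (H t (A (A \<psi>)))"
        using H_increment[OF B(1) t _ p, of s] False by simp
      also have "\<dots> \<le> \<bar>h\<bar> * K"
        using False d[OF s] s ab t p unfolding K_def by (intro mult_mono H_decreasing B) auto
      finally show ?thesis .
    qed
    show "((\<lambda>s. s * (\<bar>h\<bar> * K)) has_real_derivative \<bar>h\<bar> * K) (at s)" by (auto intro!: derivative_eq_intros)
  qed
  show ?thesis
  proof (cases "h \<ge> 0")
    case True
    have "pnorm M p (\<lambda>x. (H (t + h) \<psi> x - (t + h) * H t (A \<psi>) x) - (H t \<psi> x - t * H t (A \<psi>) x)) \<le> (t + h) * (\<bar>h\<bar> * K) - t * (\<bar>h\<bar> * K)"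
      by (rule main) (use True t in auto)
    then show ?thesis using True by (simp add: K_def power2_eq_square algebra_simps)
  next
    case False
    have "pnorm M p (\<lambda>x. (H t \<psi> x - t * H t (A \<psi>) x) - (H (t + h) \<psi> x - (t + h) * H t (A \<psi>) x)) \<le> t * (\<bar>h\<bar> * K) - (t + h) * (\<bar>h\<bar> * K)"
      by (rule main) (use False h t in auto)
    then have "pnorm M p (\<lambda>x. (H (t + h) \<psi> x - (t + h) * H t (A \<psi>) x) - (H t \<psi> x - t * H t (A \<psi>) x)) \<le> h\<^sup>2 * K"
      using False by (subst pnorm_diff_commute) (simp add: power2_eq_square algebra_simps)
    then show ?thesis by (simp add: K_def algebra_simps)
  qed
qed

text \<open>The remainder in \<open>H_taylor_Lp\<close>, applied to the images of test functions
  under \<open>P\<close>, is controlled by \<open>A\<close> applied twice more at time t / 2. These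
  norms converge along an approximating sequence, so the quadratic bound passes to the
  limit.\<close>

lemma ext_op_derivative:
  assumes P: "smoothing p \<kappa> c P" and p: "1 < p" and t: "t > 0" and w: "w \<in> B_closure p"
  shows "((\<lambda>h. pnorm M p (\<lambda>x. (ext_op p P (t + h) w x - ext_op p P t w x) / h - ext_op p (\<lambda>\<phi>. A (P \<phi>)) t w x)) \<longlongrightarrow> 0) (at 0)"
proof -
  have p1: "1 < p" "p > 0" using p by auto
  note AP = smoothing_comp[OF smoothing_A[OF p] P p]
  note AAP = smoothing_comp[OF smoothing_A[OF p] AP p]
  obtain \<phi> where \<phi>: "\<And>n. \<phi> n \<in> B" "(\<lambda>n. pnorm M p (\<lambda>x. \<phi> n x - w x)) \<longlonglongrightarrow> 0"
    using B_closure_seq[OF w] by blast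
  have PB: "P (\<phi> n) \<in> B" "A (P (\<phi> n)) \<in> B" for n using smoothingD(2)[OF P \<phi>(1)] A_B by auto
  define K where "K = pnorm M p (ext_op p (\<lambda>\<phi>. A (A (P \<phi>))) (t / 2) w)"
  have Klim: "(\<lambda>n. pnorm M p (H (t / 2) (A (A (P (\<phi> n)))))) \<longlonglongrightarrow> K"
    unfolding K_def by (rule ext_op_tendsto(2)[OF AAP p _ w \<phi>]) (use t in simp)
  have main: "pnorm M p (\<lambda>x. (ext_op p P (t + h) w x - ext_op p P t w x) / h - ext_op p (\<lambda>\<phi>. A (P \<phi>)) t w x) \<le> K * \<bar>h\<bar>"
    if h: "h \<noteq> 0" "\<bar>h\<bar> \<le> t / 2" for h
  proof -
    have th: "t + h > 0" using h t by linarith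
    let ?E1 = "ext_op p P (t + h) w" and ?E0 = "ext_op p P t w" and ?E' = "ext_op p (\<lambda>\<phi>. A (P \<phi>)) t w"
    note E = ext_op(1)[OF P p th w] ext_op(1)[OF P p t w] ext_op(1)[OF AP p t w]
    have HL: "H (t + h) (P (\<phi> n)) \<in> Lp M p" "H t (P (\<phi> n)) \<in> Lp M p" "H t (A (P (\<phi> n))) \<in> Lp M p" for n
      using th t p by (auto intro!: H_B_Lp PB)
    have tri: "pnorm M p (\<lambda>x. ?E1 x - ?E0 x - h * ?E' x)
        \<le> pnorm M p (\<lambda>x. H (t + h) (P (\<phi> n)) x - H t (P (\<phi> n)) x - h * H t (A (P (\<phi> n))) x)
          + (pnorm M p (\<lambda>x. H (t + h) (P (\<phi> n)) x - ?E1 x) + pnorm M p (\<lambda>x. H t (P (\<phi> n)) x - ?E0 x)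
             + \<bar>h\<bar> * pnorm M p (\<lambda>x. H t (A (P (\<phi> n))) x - ?E' x))" for n
    proof -
      let ?a = "\<lambda>x. H (t + h) (P (\<phi> n)) x - ?E1 x" and ?b = "\<lambda>x. H t (P (\<phi> n)) x - ?E0 x"
        and ?c = "\<lambda>x. H t (A (P (\<phi> n))) x - ?E' x"
        and ?d = "\<lambda>x. H (t + h) (P (\<phi> n)) x - H t (P (\<phi> n)) x - h * H t (A (P (\<phi> n))) x"
      have L: "?a \<in> Lp M p" "?b \<in> Lp M p" "?c \<in> Lp M p" "?d \<in> Lp M p"
        by (intro Lp_diff Lp_cmult HL E p1)+
      have Lc: "(\<lambda>x. h * ?c x) \<in> Lp M p" by (rule Lp_cmult(1)[OF L(3)])
      have "(\<lambda>x. ?E1 x - ?E0 x - h * ?E' x) = (\<lambda>x. ?d x - ((?a x - ?b x) - h * ?c x))"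
        by (simp add: fun_eq_iff algebra_simps)
      then have "pnorm M p (\<lambda>x. ?E1 x - ?E0 x - h * ?E' x) \<le> pnorm M p ?d + pnorm M p (\<lambda>x. (?a x - ?b x) - h * ?c x)"
        using Lp_diff(2)[OF L(4) Lp_diff(1)[OF Lp_diff(1)[OF L(1,2) p1(1)] Lc p1(1)] p1(1)] by simp
      also have "pnorm M p (\<lambda>x. (?a x - ?b x) - h * ?c x) \<le> pnorm M p (\<lambda>x. ?a x - ?b x) + pnorm M p (\<lambda>x. h * ?c x)"
        by (rule Lp_diff(2)[OF Lp_diff(1)[OF L(1,2) p1(1)] Lc p1(1)])
      also have "pnorm M p (\<lambda>x. ?a x - ?b x) \<le> pnorm M p ?a + pnorm M p ?b" by (rule Lp_diff(2)[OF L(1,2) p1(1)])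
      also have "pnorm M p (\<lambda>x. h * ?c x) = \<bar>h\<bar> * pnorm M p ?c" by (rule Lp_cmult(2)[OF L(3) p1(2)])
      finally show ?thesis by simp
    qed
    have "pnorm M p (\<lambda>x. ?E1 x - ?E0 x - h * ?E' x) \<le> h\<^sup>2 * K"
    proof (rule LIMSEQ_le_const)
      show "(\<lambda>n. h\<^sup>2 * pnorm M p (H (t / 2) (A (A (P (\<phi> n))))) + (pnorm M p (\<lambda>x. H (t + h) (P (\<phi> n)) x - ?E1 x)
          + pnorm M p (\<lambda>x. H t (P (\<phi> n)) x - ?E0 x) + \<bar>h\<bar> * pnorm M p (\<lambda>x. H t (A (P (\<phi> n))) x - ?E' x))) \<longlonglongrightarrow> h\<^sup>2 * K"
        by (rule tendsto_eq_intros refl Klim ext_op_tendsto(1)[OF P p th w \<phi>] ext_op_tendsto(1)[OF P p t w \<phi>]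
              ext_op_tendsto(1)[OF AP p t w \<phi>])+ simp
      show "\<exists>N. \<forall>n\<ge>N. pnorm M p (\<lambda>x. ?E1 x - ?E0 x - h * ?E' x) \<le> h\<^sup>2 * pnorm M p (H (t / 2) (A (A (P (\<phi> n)))))
          + (pnorm M p (\<lambda>x. H (t + h) (P (\<phi> n)) x - ?E1 x) + pnorm M p (\<lambda>x. H t (P (\<phi> n)) x - ?E0 x)
             + \<bar>h\<bar> * pnorm M p (\<lambda>x. H t (A (P (\<phi> n))) x - ?E' x))"
        using tri H_taylor_Lp[OF PB(1) t h(2) p] by (meson add_right_mono order_trans)
    qed
    moreover have "(\<lambda>x. (?E1 x - ?E0 x) / h - ?E' x) = (\<lambda>x. (1 / h) * (?E1 x - ?E0 x - h * ?E' x))"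
      using h by (simp add: fun_eq_iff field_simps)
    then have "pnorm M p (\<lambda>x. (?E1 x - ?E0 x) / h - ?E' x) = \<bar>1 / h\<bar> * pnorm M p (\<lambda>x. ?E1 x - ?E0 x - h * ?E' x)"
      using Lp_cmult(2)[OF Lp_diff(1)[OF Lp_diff(1)[OF E(1,2) p1(1)] Lp_cmult(1)[OF E(3), of h] p1(1)] p1(2), of "1 / h"] by simp
    ultimately have "pnorm M p (\<lambda>x. (?E1 x - ?E0 x) / h - ?E' x) \<le> \<bar>1 / h\<bar> * (h\<^sup>2 * K)"
      by (simp only: mult_left_mono abs_ge_zero)
    also have "\<dots> = K * \<bar>h\<bar>" using h by (simp add: power2_eq_square abs_if)
    finally show ?thesis .
  qed
  show ?thesis
  proof (rule Lim_null_comparison)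
    show "\<forall>\<^sub>F h in at 0. norm (pnorm M p (\<lambda>x. (ext_op p P (t + h) w x - ext_op p P t w x) / h - ext_op p (\<lambda>\<phi>. A (P \<phi>)) t w x)) \<le> K * \<bar>h\<bar>"
      unfolding eventually_at using main t by (intro exI[of _ "t / 2"]) auto
    show "((\<lambda>h. K * \<bar>h\<bar>) \<longlongrightarrow> 0) (at 0)" by (auto intro!: tendsto_eq_intros)
  qed
qed

text \<open>Trades one power of \<open>A\<close> for one integration in time.\<close>

lemma ext_op_increment:
  assumes P: "smoothing p \<kappa> c P" and p: "1 < p" and w: "w \<in> B_closure p" and ab: "0 < a" "a \<le> b"
    and g: "\<And>s. a \<le> s \<Longrightarrow> s \<le> b \<Longrightarrow> (g has_real_derivative g' s) (at s)"
    and le: "\<And>s. a \<le> s \<Longrightarrow> s \<le> b \<Longrightarrow> pnorm M p (ext_op p (\<lambda>\<phi>. A (P \<phi>)) s w) \<le> g' s"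
  shows "pnorm M p (\<lambda>x. ext_op p P b w x - ext_op p P a w x) \<le> g b - g a"
proof (rule Lp_mean_value[OF p ab(2), where c' = "\<lambda>s. ext_op p (\<lambda>\<phi>. A (P \<phi>)) s w"])
  fix s assume s: "a \<le> s" "s \<le> b"
  then have s0: "s > 0" using ab by simp
  show "ext_op p P s w \<in> Lp M p" by (rule ext_op(1)[OF P p s0 w])
  show "ext_op p (\<lambda>\<phi>. A (P \<phi>)) s w \<in> Lp M p"
    by (rule ext_op(1)[OF smoothing_comp[OF smoothing_A[OF p] P p] p s0 w])
  show "\<forall>\<^sub>F h in at 0. ext_op p P (s + h) w \<in> Lp M p"
    by (rule eventually_pos_shift[OF s0]) (rule ext_op(1)[OF P p _ w])
  show "((\<lambda>h. pnorm M p (\<lambda>x. (ext_op p P (s + h) w x - ext_op p P s w x) / h - ext_op p (\<lambda>\<phi>. A (P \<phi>)) s w x)) \<longlongrightarrow> 0) (at 0)"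
    by (rule ext_op_derivative[OF P p s0 w])
qed (use g le in auto)

text \<open>The graph of the closure in \<open>Lp\<close> of the operator \<open>P\<close> on
  \<open>B\<close>, as a relation between representatives.\<close>

definition graph_closure :: "real \<Rightarrow> 'a operator \<Rightarrow> ('a \<Rightarrow> real) \<Rightarrow> ('a \<Rightarrow> real) \<Rightarrow> bool" where
  "graph_closure p P u v \<longleftrightarrow> u \<in> Lp M p \<and> v \<in> Lp M p \<and>
     (\<exists>\<phi>. (\<forall>n::nat. \<phi> n \<in> B) \<and> (\<lambda>n. pnorm M p (\<lambda>x. \<phi> n x - u x)) \<longlonglongrightarrow> 0 \<and>
        (\<lambda>n. pnorm M p (\<lambda>x. P (\<phi> n) x - v x)) \<longlonglongrightarrow> 0)"

lemma graph_closureE: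
  assumes "graph_closure p P u v"
  obtains \<phi> where "\<And>n. \<phi> n \<in> B" "(\<lambda>n. pnorm M p (\<lambda>x. \<phi> n x - u x)) \<longlonglongrightarrow> 0"
    "(\<lambda>n. pnorm M p (\<lambda>x. P (\<phi> n) x - v x)) \<longlonglongrightarrow> 0"
  using assms by (auto simp: graph_closure_def)

lemma graph_closure_closure:
  assumes "graph_closure p P u v"
  shows "u \<in> B_closure p" "(\<And>\<phi>. \<phi> \<in> B \<Longrightarrow> P \<phi> \<in> B) \<Longrightarrow> v \<in> B_closure p"
proof -
  obtain \<phi> where \<phi>: "\<And>n. \<phi> n \<in> B" "(\<lambda>n. pnorm M p (\<lambda>x. \<phi> n x - u x)) \<longlonglongrightarrow> 0"
    "(\<lambda>n. pnorm M p (\<lambda>x. P (\<phi> n) x - v x)) \<longlonglongrightarrow> 0" using graph_closureE[OF assms] by blast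
  show "u \<in> B_closure p" using assms \<phi> by (auto simp: graph_closure_def intro: B_closureI)
  show "v \<in> B_closure p" if "\<And>\<phi>. \<phi> \<in> B \<Longrightarrow> P \<phi> \<in> B"
    by (rule B_closureI[OF _ that[OF \<phi>(1)] \<phi>(3)]) (use assms in \<open>simp add: graph_closure_def\<close>)
qed

lemma graph_closureI:
  assumes "u \<in> Lp M p" "v \<in> Lp M p"
    and ex: "\<And>\<epsilon>. \<epsilon> > 0 \<Longrightarrow> \<exists>\<phi>\<in>B. pnorm M p (\<lambda>x. \<phi> x - u x) < \<epsilon> \<and> pnorm M p (\<lambda>x. P \<phi> x - v x) < \<epsilon>"
  shows "graph_closure p P u v"
proof -
  have "\<exists>\<phi>\<in>B. pnorm M p (\<lambda>x. \<phi> x - u x) < inverse (real (Suc n)) \<and> pnorm M p (\<lambda>x. P \<phi> x - v x) < inverse (real (Suc n))" for n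
    by (rule ex) simp
  then obtain \<phi> where \<phi>: "\<And>n. \<phi> n \<in> B" "\<And>n. pnorm M p (\<lambda>x. \<phi> n x - u x) < inverse (real (Suc n))"
    "\<And>n. pnorm M p (\<lambda>x. P (\<phi> n) x - v x) < inverse (real (Suc n))" by metis
  have "(\<lambda>n. pnorm M p (\<lambda>x. \<phi> n x - u x)) \<longlonglongrightarrow> 0" "(\<lambda>n. pnorm M p (\<lambda>x. P (\<phi> n) x - v x)) \<longlonglongrightarrow> 0"
    by (rule Lim_null_comparison[OF always_eventually LIMSEQ_inverse_real_of_nat];
        use less_imp_le[OF \<phi>(2)] less_imp_le[OF \<phi>(3)] in \<open>simp del: of_nat_Suc\<close>)+
  then show ?thesis using \<phi>(1) assms(1,2) unfolding graph_closure_def by blast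
qed

text \<open>Both sides are limits of \<open>H t (Q (P (\<phi> n)))\<close> along one and the same
  sequence from the graph.\<close>

lemma graph_closure_ext_op:
  assumes uv: "graph_closure p P u v" and P: "smoothing p \<kappa> c P" and Q: "smoothing p \<rho> d Q" and p: "1 < p" and t: "t > 0"
  shows "pnorm M p (ext_op p Q t v) = pnorm M p (ext_op p (\<lambda>\<phi>. Q (P \<phi>)) t u)"
    and "pnorm M p (\<lambda>x. ext_op p Q t v x - ext_op p (\<lambda>\<phi>. Q (P \<phi>)) t u x) = 0"
proof -
  obtain \<phi> where \<phi>: "\<And>n. \<phi> n \<in> B" "(\<lambda>n. pnorm M p (\<lambda>x. \<phi> n x - u x)) \<longlonglongrightarrow> 0"
    "(\<lambda>n. pnorm M p (\<lambda>x. P (\<phi> n) x - v x)) \<longlonglongrightarrow> 0" using graph_closureE[OF uv] by blast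
  note u = graph_closure_closure(1)[OF uv]
  have v: "v \<in> B_closure p" by (rule graph_closure_closure(2)[OF uv]) (rule smoothingD(2)[OF P])
  have PB: "P (\<phi> n) \<in> B" for n by (rule smoothingD(2)[OF P \<phi>(1)])
  note QP = smoothing_comp[OF Q P p]
  note E = ext_op(1)[OF Q p t v] ext_op(1)[OF QP p t u]
  have HL: "H t (Q (P (\<phi> n))) \<in> Lp M p" for n
    by (rule H_B_Lp) (use t p smoothingD(2)[OF Q PB] in auto)
  have "pnorm M p (\<lambda>x. ext_op p Q t v x - ext_op p (\<lambda>\<phi>. Q (P \<phi>)) t u x) \<le> 0"
  proof (rule LIMSEQ_le_const)
    show "(\<lambda>n. pnorm M p (\<lambda>x. H t (Q (P (\<phi> n))) x - ext_op p Q t v x)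
        + pnorm M p (\<lambda>x. H t (Q (P (\<phi> n))) x - ext_op p (\<lambda>\<phi>. Q (P \<phi>)) t u x)) \<longlonglongrightarrow> 0"
      by (rule tendsto_eq_intros refl ext_op_tendsto(1)[OF Q p t v PB \<phi>(3)] ext_op_tendsto(1)[OF QP p t u \<phi>(1,2)])+ simp
    show "\<exists>N. \<forall>n\<ge>N. pnorm M p (\<lambda>x. ext_op p Q t v x - ext_op p (\<lambda>\<phi>. Q (P \<phi>)) t u x)
        \<le> pnorm M p (\<lambda>x. H t (Q (P (\<phi> n))) x - ext_op p Q t v x)
        + pnorm M p (\<lambda>x. H t (Q (P (\<phi> n))) x - ext_op p (\<lambda>\<phi>. Q (P \<phi>)) t u x)"
    proof (intro exI allI impI)
      fix n
      show "pnorm M p (\<lambda>x. ext_op p Q t v x - ext_op p (\<lambda>\<phi>. Q (P \<phi>)) t u x)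
        \<le> pnorm M p (\<lambda>x. H t (Q (P (\<phi> n))) x - ext_op p Q t v x)
        + pnorm M p (\<lambda>x. H t (Q (P (\<phi> n))) x - ext_op p (\<lambda>\<phi>. Q (P \<phi>)) t u x)"
        using pnorm_triangle_diff[OF E(1) HL[of n] E(2)] p pnorm_diff_commute[of M p "ext_op p Q t v" "H t (Q (P (\<phi> n)))"]
        by linarith
    qed
  qed
  then show z: "pnorm M p (\<lambda>x. ext_op p Q t v x - ext_op p (\<lambda>\<phi>. Q (P \<phi>)) t u x) = 0"
    using pnorm_nonneg order.antisym by blast
  show "pnorm M p (ext_op p Q t v) = pnorm M p (ext_op p (\<lambda>\<phi>. Q (P \<phi>)) t u)"
    using abs_pnorm_diff[OF E] p z by simp
qed

lemma integral_tendsto_Lp: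
  assumes "\<And>n. w n \<in> Lp M p" "v \<in> Lp M p" "(\<lambda>n. pnorm M p (\<lambda>x. w n x - v x)) \<longlonglongrightarrow> 0" "\<psi> \<in> B" "1 < p"
  shows "(\<lambda>n. \<integral>x. w n x * \<psi> x \<partial>M) \<longlonglongrightarrow> (\<integral>x. v x * \<psi> x \<partial>M)"
proof (rule LIM_zero_cancel, rule Lim_null_comparison)
  define q where "q = p / (p - 1)"
  note pq = dual_exponent[OF assms(5) q_def]
  note \<psi> = B_Lp[OF assms(4) pq(1)]
  note hol = Lp_holder[OF _ \<psi> assms(5) pq(1,2)]
  show "\<forall>\<^sub>F n in sequentially. norm ((\<integral>x. w n x * \<psi> x \<partial>M) - (\<integral>x. v x * \<psi> x \<partial>M))
      \<le> pnorm M p (\<lambda>x. w n x - v x) * pnorm M q \<psi>"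
  proof (intro always_eventually allI)
    fix n
    have "(\<integral>x. w n x * \<psi> x \<partial>M) - (\<integral>x. v x * \<psi> x \<partial>M) = (\<integral>x. (w n x - v x) * \<psi> x \<partial>M)"
      using hol(1)[OF assms(1)[of n]] hol(1)[OF assms(2)] by (simp add: left_diff_distrib)
    then show "norm ((\<integral>x. w n x * \<psi> x \<partial>M) - (\<integral>x. v x * \<psi> x \<partial>M)) \<le> pnorm M p (\<lambda>x. w n x - v x) * pnorm M q \<psi>"
      using hol(3)[OF Lp_diff(1)[OF assms(1)[of n] assms(2,5)]] by simp
  qed
  show "(\<lambda>n. pnorm M p (\<lambda>x. w n x - v x) * pnorm M q \<psi>) \<longlonglongrightarrow> 0"
    using tendsto_mult_left_zero[OF assms(3)] .
qed

text \<open>Identifies \<open>v\<close> as a distribution: \<open>\<eta>\<close> is the image of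
  \<open>\<psi>\<close> under the formal adjoint of \<open>P\<close>.\<close>

lemma graph_closure_integral:
  assumes uv: "graph_closure p P u v" and PB: "\<And>\<phi>. \<phi> \<in> B \<Longrightarrow> P \<phi> \<in> B" and p: "1 < p" and "\<psi> \<in> B" "\<eta> \<in> B"
    and adj: "\<And>\<phi>. \<phi> \<in> B \<Longrightarrow> (\<integral>x. P \<phi> x * \<psi> x \<partial>M) = (\<integral>x. \<phi> x * \<eta> x \<partial>M)"
  shows "(\<integral>x. v x * \<psi> x \<partial>M) = (\<integral>x. u x * \<eta> x \<partial>M)"
proof -
  obtain \<phi> where \<phi>: "\<And>n. \<phi> n \<in> B" "(\<lambda>n. pnorm M p (\<lambda>x. \<phi> n x - u x)) \<longlonglongrightarrow> 0"
    "(\<lambda>n. pnorm M p (\<lambda>x. P (\<phi> n) x - v x)) \<longlonglongrightarrow> 0" using graph_closureE[OF uv] by blast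
  have uvL: "u \<in> Lp M p" "v \<in> Lp M p" using uv by (auto simp: graph_closure_def)
  have "(\<lambda>n. \<integral>x. P (\<phi> n) x * \<psi> x \<partial>M) \<longlonglongrightarrow> (\<integral>x. v x * \<psi> x \<partial>M)"
    by (rule integral_tendsto_Lp[OF _ uvL(2) \<phi>(3) assms(4) p]) (intro B_Lp PB \<phi>(1) p)
  moreover have "(\<lambda>n. \<integral>x. \<phi> n x * \<eta> x \<partial>M) \<longlonglongrightarrow> (\<integral>x. u x * \<eta> x \<partial>M)"
    by (rule integral_tendsto_Lp[OF _ uvL(1) \<phi>(2) assms(5) p]) (intro B_Lp \<phi>(1) p)
  ultimately show ?thesis using adj[OF \<phi>(1)] by (simp add: LIMSEQ_unique)
qed

lemma H_Lp_diff_le: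
  assumes "1 < p" "f \<in> Lp M p" "g \<in> Lp M p" "t \<ge> 0"
  shows "pnorm M p (\<lambda>x. H t f x - H t g x) \<le> pnorm M p (\<lambda>x. f x - g x)"
proof -
  have "pnorm M p (\<lambda>x. H t f x - H t g x) = pnorm M p (H t (\<lambda>x. f x - g x))"
  proof (rule Lp_cong_AE(2)[OF H_Lp[OF assms(1) Lp_diff(1)[OF assms(2,3) assms(1)] assms(4)]])
    show "(\<lambda>x. H t f x - H t g x) \<in> borel_measurable M"
      using Lp_measurable[OF Lp_diff(1)[OF H_Lp[OF assms(1,2,4)] H_Lp[OF assms(1,3,4)] assms(1)]] .
    show "AE x in M. H t (\<lambda>x. f x - g x) x = H t f x - H t g x" by (rule H_Lp_diff[OF assms])
  qed
  also have "\<dots> \<le> pnorm M p (\<lambda>x. f x - g x)"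
    by (rule H_Lp_contract[OF assms(1) Lp_diff(1)[OF assms(2,3) assms(1)] assms(4)])
  finally show ?thesis .
qed

text \<open>Ties the abstract extension back to the operator defined by integrals, in terms of which
  the seminorms are formulated.\<close>

lemma ext_op_id:
  assumes p: "1 < p" and t: "t > 0" and w: "w \<in> B_closure p"
  shows "pnorm M p (\<lambda>x. ext_op p (\<lambda>\<phi>. \<phi>) t w x - H t w x) = 0"
proof -
  have p1: "1 < p" "t \<ge> 0" using p t by auto
  obtain \<phi> where \<phi>: "\<And>n. \<phi> n \<in> B" "(\<lambda>n. pnorm M p (\<lambda>x. \<phi> n x - w x)) \<longlonglongrightarrow> 0"
    using B_closure_seq[OF w] by blast
  note wL = B_closure_Lp[OF w]
  have "pnorm M p (\<lambda>x. ext_op p (\<lambda>\<phi>. \<phi>) t w x - H t w x) \<le> 0"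
  proof (rule LIMSEQ_le_const)
    show "(\<lambda>n. pnorm M p (\<lambda>x. H t (\<phi> n) x - ext_op p (\<lambda>\<phi>. \<phi>) t w x) + pnorm M p (\<lambda>x. \<phi> n x - w x)) \<longlonglongrightarrow> 0"
      by (rule tendsto_eq_intros refl ext_op_tendsto(1)[OF smoothing_id[OF p] p t w \<phi>] \<phi>(2))+ simp
    show "\<exists>N. \<forall>n\<ge>N. pnorm M p (\<lambda>x. ext_op p (\<lambda>\<phi>. \<phi>) t w x - H t w x)
      \<le> pnorm M p (\<lambda>x. H t (\<phi> n) x - ext_op p (\<lambda>\<phi>. \<phi>) t w x) + pnorm M p (\<lambda>x. \<phi> n x - w x)"
    proof (intro exI allI impI)
      fix n
      show "pnorm M p (\<lambda>x. ext_op p (\<lambda>\<phi>. \<phi>) t w x - H t w x)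
        \<le> pnorm M p (\<lambda>x. H t (\<phi> n) x - ext_op p (\<lambda>\<phi>. \<phi>) t w x) + pnorm M p (\<lambda>x. \<phi> n x - w x)"
        using pnorm_triangle_diff[OF ext_op(1)[OF smoothing_id[OF p] p t w] H_B_Lp[OF \<phi>(1)[of n] p1(2) p] H_Lp[OF p wL p1(2)] p1(1)]
          pnorm_diff_commute[of M p "ext_op p (\<lambda>\<phi>. \<phi>) t w" "H t (\<phi> n)"]
          H_Lp_diff_le[OF p B_Lp[OF \<phi>(1)[of n] p] wL p1(2)] by linarith
    qed
  qed
  then show ?thesis using pnorm_nonneg order.antisym by blast
qed

text \<open>The extension of \<open>H a (P u)\<close> converges to some \<open>v\<close> as a tends
  to 0. Since \<open>P\<close> commutes with the regularisation, it maps regularised approximants of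
  \<open>u\<close> to functions near \<open>H a (P u)\<close>, hence near \<open>v\<close>; mixing
  operators take the place of \<open>H a\<close> so that the approximants stay in
  \<open>B\<close>.\<close>

lemma graph_closure_exists:
  assumes P: "smoothing p \<kappa> c P" and p: "1 < p" and u: "u \<in> B_closure p"
    and cauchy: "\<And>\<epsilon>. \<epsilon> > 0 \<Longrightarrow> \<exists>\<delta>>0. \<forall>a b. 0 < a \<longrightarrow> a \<le> b \<longrightarrow> b < \<delta> \<longrightarrow>
          pnorm M p (\<lambda>x. ext_op p P b u x - ext_op p P a u x) < \<epsilon>"
  obtains v where "graph_closure p P u v"
proof -
  note uL = B_closure_Lp[OF u]
  define r where "r n = inverse (real (Suc n))" for n
  have r: "r n > 0" for n by (simp add: r_def)
  have rlim: "r \<longlonglongrightarrow> 0" unfolding r_def by (rule LIMSEQ_inverse_real_of_nat)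
  have WL: "ext_op p P (r n) u \<in> Lp M p" for n by (rule ext_op(1)[OF P p r u])
  obtain v where v: "v \<in> Lp M p" "(\<lambda>n. pnorm M p (\<lambda>x. ext_op p P (r n) u x - v x)) \<longlonglongrightarrow> 0"
  proof (rule Lp_complete[OF WL p])
    fix e :: real assume "e > 0"
    then obtain \<delta> where \<delta>: "\<delta> > 0" "\<And>a b. 0 < a \<Longrightarrow> a \<le> b \<Longrightarrow> b < \<delta> \<Longrightarrow>
        pnorm M p (\<lambda>x. ext_op p P b u x - ext_op p P a u x) < e" using cauchy by blast
    obtain N where N: "\<And>n. n \<ge> N \<Longrightarrow> r n < \<delta>"
      using order_tendstoD(2)[OF rlim \<delta>(1)] by (auto simp: eventually_sequentially)
    show "\<exists>N. \<forall>i\<ge>N. \<forall>j\<ge>N. pnorm M p (\<lambda>x. ext_op p P (r i) u x - ext_op p P (r j) u x) < e"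
    proof (intro exI allI impI)
      fix i j assume ij: "N \<le> i" "N \<le> j"
      show "pnorm M p (\<lambda>x. ext_op p P (r i) u x - ext_op p P (r j) u x) < e"
      proof (cases "r j \<le> r i")
        case True
        then show ?thesis using \<delta>(2)[OF r True N[OF ij(1)]] by simp
      next
        case False
        then have "pnorm M p (\<lambda>x. ext_op p P (r j) u x - ext_op p P (r i) u x) < e"
          using \<delta>(2)[OF r _ N[OF ij(2)]] by simp
        then show ?thesis by (subst pnorm_diff_commute)
      qed
    qed
  qed
  show thesis
  proof (rule that[of v], rule graph_closureI[OF uL v(1)])
    fix \<epsilon> :: real assume \<epsilon>: "\<epsilon> > 0"
    define e where "e = \<epsilon> / 5"
    have e: "e > 0" using \<epsilon> by (simp add: e_def)
    \<comment> \<open>\<open>\<phi>0\<close> is fixed before the time a: continuity at time 0 is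
      quantitative on test functions, and a is chosen small for this one.\<close>
    obtain \<phi>0 where \<phi>0: "\<phi>0 \<in> B" "pnorm M p (\<lambda>x. \<phi>0 x - u x) < e"
      using u e unfolding B_closure_def by blast
    obtain K where K: "K \<ge> 0" "\<And>x. x \<in> space M \<Longrightarrow> \<bar>A \<phi>0 x\<bar> \<le> K" using bounded_borelE[OF B_bounded[OF A_B[OF \<phi>0(1)]]] by blast
    have "\<forall>\<^sub>F n in sequentially. pnorm M p (\<lambda>x. ext_op p P (r n) u x - v x) < e"
      by (rule order_tendstoD(2)[OF v(2) e])
    moreover have "(\<lambda>n. 3 * K * r n) \<longlonglongrightarrow> 0" using tendsto_mult_right_zero[OF rlim] .
    then have "\<forall>\<^sub>F n in sequentially. 3 * K * r n < e" by (rule order_tendstoD(2)[OF _ e])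
    ultimately have "\<forall>\<^sub>F n in sequentially. pnorm M p (\<lambda>x. ext_op p P (r n) u x - v x) < e \<and> 3 * K * r n < e"
      by eventually_elim simp
    then obtain n where n: "pnorm M p (\<lambda>x. ext_op p P (r n) u x - v x) < e" "3 * K * r n < e"
      unfolding eventually_sequentially by blast
    define a where "a = r n"
    have a: "a > 0" "a \<ge> 0" using r[of n] by (auto simp: a_def)
    have Ha: "pnorm M p (\<lambda>x. H a \<phi>0 x - \<phi>0 x) \<le> 3 * K * a"
    proof (rule Lp_bounded(2))
      show "(\<lambda>x. H a \<phi>0 x - \<phi>0 x) \<in> borel_measurable M"
        by (intro borel_measurable_diff bounded_borel_measurable H_bounded B_bounded \<phi>0 a)
      show "\<bar>H a \<phi>0 x - \<phi>0 x\<bar> \<le> 3 * K * a" if "x \<in> space M" for x by (rule H_lipschitz[OF \<phi>0(1) a(2) that K(2)])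
    qed (use p K a in auto)
    \<comment> \<open>The accuracy of the next approximant depends on \<open>a\<close>, because the
      constant of \<open>P\<close> may blow up as \<open>a\<close> tends to 0.\<close>
    define e' where "e' = min e (e / (c * a powr (- \<kappa>) + 1))"
    have ca: "c * a powr (- \<kappa>) \<ge> 0" using smoothingD(1)[OF P] by simp
    have e': "e' > 0" using e ca by (auto simp: e'_def add_nonneg_pos)
    obtain \<phi> where \<phi>: "\<phi> \<in> B" "pnorm M p (\<lambda>x. \<phi> x - u x) < e'"
      using u e' unfolding B_closure_def by blast
    have "pnorm M p (\<lambda>x. H a (P \<phi>) x - ext_op p P a u x) \<le> c * a powr (- \<kappa>) * pnorm M p (\<lambda>x. \<phi> x - u x)"
      by (rule ext_op(2)[OF P p a(1) u \<phi>(1)])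
    also have "\<dots> \<le> c * a powr (- \<kappa>) * (e / (c * a powr (- \<kappa>) + 1))"
      using \<phi>(2) ca by (intro mult_left_mono) (auto simp: e'_def)
    also have "\<dots> < e"
      using e ca by (simp add: divide_simps add_nonneg_pos mult.commute)
    finally have 1: "pnorm M p (\<lambda>x. H a (P \<phi>) x - ext_op p P a u x) < e" .
    have PB: "P \<phi> \<in> B" by (rule smoothingD(2)[OF P \<phi>(1)])
    obtain C where C: "\<And>n. C n \<in> mixing_ops M B I X"
      "\<And>\<eta> x. \<eta> \<in> {\<phi>, P \<phi>} \<Longrightarrow> x \<in> space M \<Longrightarrow> (\<lambda>n. C n \<eta> x) \<longlonglongrightarrow> H a \<eta> x"
      using H_approxE[of "{\<phi>, P \<phi>}" a] \<phi>(1) PB a by auto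
    have "\<forall>\<^sub>F n in sequentially. pnorm M p (\<lambda>x. C n \<phi> x - H a \<phi> x) < e"
      by (rule order_tendstoD(2)[OF pnorm_H_mixing_tendsto(1)[OF p order_refl a(2) \<phi>(1) C(1)] e]) (simp add: C(2))
    moreover have "\<forall>\<^sub>F n in sequentially. pnorm M p (\<lambda>x. C n (P \<phi>) x - H a (P \<phi>) x) < e"
      by (rule order_tendstoD(2)[OF pnorm_H_mixing_tendsto(1)[OF p order_refl a(2) PB C(1)] e]) (simp add: C(2))
    ultimately have "\<forall>\<^sub>F n in sequentially. pnorm M p (\<lambda>x. C n \<phi> x - H a \<phi> x) < e \<and> pnorm M p (\<lambda>x. C n (P \<phi>) x - H a (P \<phi>) x) < e"
      by eventually_elim simp
    then obtain m where m: "pnorm M p (\<lambda>x. C m \<phi> x - H a \<phi> x) < e" "pnorm M p (\<lambda>x. C m (P \<phi>) x - H a (P \<phi>) x) < e"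
      unfolding eventually_sequentially by blast
    have CB: "C m \<phi> \<in> B" "C m (P \<phi>) \<in> B" using mixing_B[OF C(1)] \<phi>(1) PB by auto
    note L = B_Lp[OF CB(1) p] B_Lp[OF CB(2) p] B_Lp[OF \<phi>0(1) p] H_B_Lp[OF \<phi>(1) a(2) p] H_B_Lp[OF PB a(2) p]
      H_B_Lp[OF \<phi>0(1) a(2) p] ext_op(1)[OF P p a(1) u]
    show "\<exists>\<phi>\<in>B. pnorm M p (\<lambda>x. \<phi> x - u x) < \<epsilon> \<and> pnorm M p (\<lambda>x. P \<phi> x - v x) < \<epsilon>"
    proof (intro bexI[of _ "C m \<phi>"] conjI CB)
      have "pnorm M p (\<lambda>x. P (C m \<phi>) x - v x) \<le> pnorm M p (\<lambda>x. C m (P \<phi>) x - H a (P \<phi>) x)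
          + (pnorm M p (\<lambda>x. H a (P \<phi>) x - ext_op p P a u x) + pnorm M p (\<lambda>x. ext_op p P a u x - v x))"
        unfolding smoothingD(4)[OF P C(1) \<phi>(1)]
        using pnorm_triangle_diff[OF L(2) L(5) v(1) p] pnorm_triangle_diff[OF L(5) L(7) v(1) p] by linarith
      then show "pnorm M p (\<lambda>x. P (C m \<phi>) x - v x) < \<epsilon>" using m(2) 1 n(1) e unfolding a_def[symmetric] e_def by linarith
      have "pnorm M p (\<lambda>x. H a \<phi> x - H a \<phi>0 x) \<le> pnorm M p (\<lambda>x. \<phi> x - \<phi>0 x)"
        by (rule H_Lp_diff_le[OF p B_Lp[OF \<phi>(1) p] L(3) a(2)])
      also have "\<dots> \<le> pnorm M p (\<lambda>x. \<phi> x - u x) + pnorm M p (\<lambda>x. \<phi>0 x - u x)"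
        using pnorm_triangle_diff[OF B_Lp[OF \<phi>(1) p] uL L(3) p] pnorm_diff_commute[of M p u \<phi>0] by linarith
      finally have 2: "pnorm M p (\<lambda>x. H a \<phi> x - H a \<phi>0 x) < 2 * e" using \<phi>(2) \<phi>0(2) by (simp add: e'_def)
      have "pnorm M p (\<lambda>x. C m \<phi> x - u x) \<le> pnorm M p (\<lambda>x. C m \<phi> x - H a \<phi> x) + (pnorm M p (\<lambda>x. H a \<phi> x - H a \<phi>0 x)
          + (pnorm M p (\<lambda>x. H a \<phi>0 x - \<phi>0 x) + pnorm M p (\<lambda>x. \<phi>0 x - u x)))"
        using pnorm_triangle_diff[OF L(1) L(4) uL p] pnorm_triangle_diff[OF L(4) L(6) uL p]
          pnorm_triangle_diff[OF L(6) L(3) uL p] by linarith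
      also have "\<dots> < e + (2 * e + (e + e))" using m(1) 2 Ha n(2) \<phi>0(2) unfolding a_def by linarith
      finally show "pnorm M p (\<lambda>x. C m \<phi> x - u x) < \<epsilon>" by (simp add: e_def)
    qed
  qed
qed

lemma ext_op_cong: "(\<And>\<phi>. \<phi> \<in> B \<Longrightarrow> P \<phi> = Q \<phi>) \<Longrightarrow> ext_op p P t w = ext_op p Q t w"
  unfolding ext_op_def by (simp cong: ball_cong)

lemma smoothing_power_comp:
  assumes "smoothing p \<kappa> c P" "1 < p"
  obtains d where "smoothing p (real k + \<kappa>) d (\<lambda>\<phi>. (A ^^ k) (P \<phi>))"
  using smoothing_A_power[OF assms(2), of k] smoothing_comp[OF _ assms(1,2)] by blast

lemma A_power_commute:
  assumes P: "smoothing p \<kappa> c P" and "\<phi> \<in> B"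
  shows "(A ^^ k) \<phi> \<in> B" "P ((A ^^ k) \<phi>) = (A ^^ k) (P \<phi>)"
proof -
  show B: "(A ^^ k) \<phi> \<in> B" for k by (induction k) (auto simp: assms A_B)
  show "P ((A ^^ k) \<phi>) = (A ^^ k) (P \<phi>)"
    by (induction k) (auto simp: smoothingD(5)[OF P B, symmetric])
qed

lemma power_deriv:
  assumes "(s::real) > 0" "a \<noteq> 0"
  shows "((\<lambda>r. D * r powr a / a) has_real_derivative D * s powr (a - 1)) (at s)"
  using assms by (auto intro!: derivative_eq_intros)

text \<open>Write W(k, s) for H s applied to the k-th power of \<open>A\<close> on P u. Order n + 1
  is controlled by \<open>bd\<close>, because \<open>A\<close> maps \<open>u\<close> to
  \<open>f\<close>. Integrating in time passes from order k + 1 to order k and improves the exponent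
  by 1; at order 1 it exceeds -1, so H s (P u) is Cauchy as s tends to 0, which yields
  \<open>v\<close>.\<close>

lemma graph_closure_estimate:
  assumes p: "1 < p" and n: "real n > \<theta> / 2" "real n \<le> \<theta> / 2 + 1"
    and P: "smoothing p \<kappa> c P" and \<kappa>: "0 < \<kappa>" "\<kappa> \<le> 1" and \<theta>: "\<theta> > 0"
    and uf: "graph_closure p A u f" and D: "D \<ge> 0"
    and bd: "\<And>s. s > 0 \<Longrightarrow> pnorm M p (ext_op p (\<lambda>\<phi>. P ((A ^^ n) \<phi>)) s f) \<le> D * s powr (\<theta> / 2 - n - \<kappa>)"
    and \<sigma>: "\<sigma> = \<theta> / 2 + 1 - \<kappa>" and m: "real m > \<sigma>" "real m \<le> \<sigma> + 1"
  obtains v where "graph_closure p P u v"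
    "\<And>t. t > 0 \<Longrightarrow> pnorm M p (ext_op p (A ^^ m) t v) \<le> (1 + 1 / (real m - \<sigma>)) * D * t powr (\<sigma> - m)"
proof -
  note u = graph_closure_closure(1)[OF uf]
  define W where "W k s = ext_op p (\<lambda>\<phi>. (A ^^ k) (P \<phi>)) s u" for k s
  have WL: "W k s \<in> Lp M p" if "s > 0" for k s
    unfolding W_def using smoothing_power_comp[OF P p, of k] ext_op(1)[OF _ p that u] by metis
  have inc: "pnorm M p (\<lambda>x. W k b x - W k a x) \<le> g b - g a"
    if "0 < a" "a \<le> b" "\<And>s. a \<le> s \<Longrightarrow> s \<le> b \<Longrightarrow> (g has_real_derivative g' s) (at s)"
      "\<And>s. a \<le> s \<Longrightarrow> s \<le> b \<Longrightarrow> pnorm M p (W (Suc k) s) \<le> g' s" for k a b g g'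
  proof -
    obtain d where d: "smoothing p (real k + \<kappa>) d (\<lambda>\<phi>. (A ^^ k) (P \<phi>))" using smoothing_power_comp[OF P p] by blast
    show ?thesis unfolding W_def
      by (rule ext_op_increment[OF d p u that(1-3)]) (use that(4) in \<open>auto simp: W_def\<close>)
  qed
  \<comment> \<open>\<open>P\<close> commutes with \<open>A\<close>, so one factor \<open>A\<close>
    can be moved next to \<open>u\<close>, where it produces \<open>f\<close>.\<close>
  have top: "pnorm M p (W (Suc n) s) \<le> D * s powr (\<sigma> - Suc n)" if s: "s > 0" for s
  proof -
    obtain d where d: "smoothing p (real n) d (A ^^ n)" using smoothing_A_power[OF p] by blast
    note PA = smoothing_comp[OF P d p]
    have "pnorm M p (W (Suc n) s) = pnorm M p (ext_op p (\<lambda>\<phi>. P ((A ^^ n) (A \<phi>))) s u)"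
      unfolding W_def
    proof (rule arg_cong[where f = "pnorm M p"], rule ext_op_cong)
      fix \<phi> assume \<phi>: "\<phi> \<in> B"
      have "P ((A ^^ n) (A \<phi>)) = P ((A ^^ Suc n) \<phi>)" by (simp only: funpow_Suc_right comp_def)
      then show "(A ^^ Suc n) (P \<phi>) = P ((A ^^ n) (A \<phi>))" using A_power_commute(2)[OF P \<phi>, of "Suc n"] by simp
    qed
    also have "\<dots> = pnorm M p (ext_op p (\<lambda>\<phi>. P ((A ^^ n) \<phi>)) s f)"
      by (rule graph_closure_ext_op(1)[OF uf smoothing_A[OF p] PA p s, symmetric])
    also have "\<dots> \<le> D * s powr (\<theta> / 2 - n - \<kappa>)" by (rule bd[OF s])
    also have "\<theta> / 2 - n - \<kappa> = \<sigma> - Suc n" by (simp add: \<sigma>)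
    finally show ?thesis .
  qed
  \<comment> \<open>Lowering the exponent to at most 1/2 is harmless for times up to 1 and keeps
    \<open>\<sigma>' - k\<close> negative for all k from 1 on; with \<open>\<sigma>\<close> itself
    an intermediate exponent could be 0, where integration produces a logarithm.\<close>
  define \<sigma>' where "\<sigma>' = min \<sigma> (1 / 2)"
  have \<sigma>': "0 < \<sigma>'" "\<sigma>' \<le> 1 / 2" "\<sigma>' \<le> \<sigma>" using \<theta> \<kappa> unfolding \<sigma>'_def \<sigma> by linarith+
  have "\<exists>D1\<ge>0. \<forall>s. 0 < s \<longrightarrow> s \<le> 1 \<longrightarrow> pnorm M p (W (Suc 0) s) \<le> D1 * s powr (\<sigma>' - real (Suc 0))"
  \<comment> \<open>Downward induction on the order, from n + 1 to 1.\<close>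
  proof (rule inc_induct[where i = "Suc 0" and j = "Suc n"
        and P = "\<lambda>k. \<exists>D1\<ge>0. \<forall>s. 0 < s \<longrightarrow> s \<le> 1 \<longrightarrow> pnorm M p (W k s) \<le> D1 * s powr (\<sigma>' - real k)"])
    show "\<exists>D1\<ge>0. \<forall>s. 0 < s \<longrightarrow> s \<le> 1 \<longrightarrow> pnorm M p (W (Suc n) s) \<le> D1 * s powr (\<sigma>' - real (Suc n))"
    proof (intro exI[of _ D] conjI allI impI D)
      fix s :: real assume s: "0 < s" "s \<le> 1"
      have "D * s powr (\<sigma> - Suc n) \<le> D * s powr (\<sigma>' - Suc n)"
        using s \<sigma>' D by (intro mult_left_mono powr_mono') auto
      then show "pnorm M p (W (Suc n) s) \<le> D * s powr (\<sigma>' - Suc n)" using top[OF s(1)] by linarith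
    qed
  next
    fix k assume k: "Suc 0 \<le> k" "k < Suc n"
      and IH: "\<exists>D1\<ge>0. \<forall>s. 0 < s \<longrightarrow> s \<le> 1 \<longrightarrow> pnorm M p (W (Suc k) s) \<le> D1 * s powr (\<sigma>' - real (Suc k))"
    then obtain D1 where D1: "D1 \<ge> 0" "\<And>s. 0 < s \<Longrightarrow> s \<le> 1 \<Longrightarrow> pnorm M p (W (Suc k) s) \<le> D1 * s powr (\<sigma>' - real (Suc k))" by blast
    define a where "a = \<sigma>' - real k"
    have a: "a < 0" using k \<sigma>' by (simp add: a_def)
    show "\<exists>D1\<ge>0. \<forall>s. 0 < s \<longrightarrow> s \<le> 1 \<longrightarrow> pnorm M p (W k s) \<le> D1 * s powr (\<sigma>' - real k)"
    proof (intro exI[of _ "pnorm M p (W k 1) + D1 / (- a)"] conjI allI impI)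
      show "0 \<le> pnorm M p (W k 1) + D1 / - a" using D1(1) a by (intro add_nonneg_nonneg divide_nonneg_pos) auto
      fix s :: real assume s: "0 < s" "s \<le> 1"
      have "pnorm M p (\<lambda>x. W k 1 x - W k s x) \<le> D1 * 1 powr a / a - D1 * s powr a / a"
      proof (rule inc[OF s])
        show "((\<lambda>r. D1 * r powr a / a) has_real_derivative D1 * r powr (a - 1)) (at r)" if "s \<le> r" for r
          using s that a by (intro power_deriv) auto
        show "pnorm M p (W (Suc k) r) \<le> D1 * r powr (a - 1)" if "s \<le> r" "r \<le> 1" for r
          using D1(2)[of r] that s by (simp add: a_def diff_diff_eq add.commute)
      qed
      also have "\<dots> \<le> D1 / (- a) * s powr a"
        using a D1(1) by (simp add: divide_nonneg_neg divide_nonpos_neg divide_simps mult_nonneg_nonneg)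
      finally have 1: "pnorm M p (\<lambda>x. W k 1 x - W k s x) \<le> D1 / (- a) * s powr a" .
      \<comment> \<open>For negative \<open>a\<close> and times up to 1 the power is at least 1, so
        the value at time 1 can be absorbed into the constant.\<close>
      have "1 \<le> s powr a" using powr_mono2'[of a s 1] s a by simp
      then have 2: "pnorm M p (W k 1) \<le> pnorm M p (W k 1) * s powr a"
        using mult_left_mono[OF _ pnorm_nonneg, of 1 "s powr a" M p "W k 1"] by simp
      have "pnorm M p (W k s) \<le> pnorm M p (W k 1) + pnorm M p (\<lambda>x. W k 1 x - W k s x)"
        using pnorm_le_diff[OF WL[OF s(1), of k] WL[of 1 k] p] by (simp add: pnorm_diff_commute[of M p "W k 1"])
      then show "pnorm M p (W k s) \<le> (pnorm M p (W k 1) + D1 / - a) * s powr (\<sigma>' - real k)"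
        using 1 2 unfolding a_def[symmetric] distrib_right by linarith
    qed
  qed simp
  then obtain D1 where D1: "D1 \<ge> 0" "\<And>s. 0 < s \<Longrightarrow> s \<le> 1 \<Longrightarrow> pnorm M p (W (Suc 0) s) \<le> D1 * s powr (\<sigma>' - 1)" by auto
  obtain v where v: "graph_closure p P u v"
  proof (rule graph_closure_exists[OF P p u])
    fix \<epsilon> :: real assume \<epsilon>: "\<epsilon> > 0"
    \<comment> \<open>Makes \<open>D1 * b powr \<sigma>' / \<sigma>'\<close> at most
      \<open>\<epsilon> * D1 / (D1 + 1)\<close>; the 1 in the denominator gives strict
      inequality.\<close>
    define \<delta> where "\<delta> = min 1 ((\<epsilon> * \<sigma>' / (D1 + 1)) powr (1 / \<sigma>'))"
    show "\<exists>\<delta>>0. \<forall>a b. 0 < a \<longrightarrow> a \<le> b \<longrightarrow> b < \<delta> \<longrightarrow> pnorm M p (\<lambda>x. ext_op p P b u x - ext_op p P a u x) < \<epsilon>"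
    proof (intro exI[of _ \<delta>] conjI allI impI)
      show "\<delta> > 0" using \<epsilon> \<sigma>' D1 by (simp add: \<delta>_def)
      fix a b :: real assume ab: "0 < a" "a \<le> b" "b < \<delta>"
      have "pnorm M p (\<lambda>x. W 0 b x - W 0 a x) \<le> D1 * b powr \<sigma>' / \<sigma>' - D1 * a powr \<sigma>' / \<sigma>'"
      proof (rule inc[OF ab(1,2)])
        show "((\<lambda>r. D1 * r powr \<sigma>' / \<sigma>') has_real_derivative D1 * r powr (\<sigma>' - 1)) (at r)" if "a \<le> r" for r
          using ab that \<sigma>' by (intro power_deriv) auto
        show "pnorm M p (W (Suc 0) r) \<le> D1 * r powr (\<sigma>' - 1)" if "a \<le> r" "r \<le> b" for r
          using that ab by (intro D1(2)) (auto simp: \<delta>_def)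
      qed
      also have "\<dots> \<le> D1 * b powr \<sigma>' / \<sigma>'" using D1(1) \<sigma>' by simp
      also have "\<dots> \<le> D1 * (((\<epsilon> * \<sigma>' / (D1 + 1)) powr (1 / \<sigma>')) powr \<sigma>') / \<sigma>'"
        using D1(1) \<sigma>' ab by (intro divide_right_mono mult_left_mono powr_mono2) (auto simp: \<delta>_def)
      also have "\<dots> = \<epsilon> * (D1 / (D1 + 1))" using \<epsilon> \<sigma>' D1(1) by (simp add: powr_powr)
      also have "\<dots> < \<epsilon>" using \<epsilon> D1(1) by (simp add: divide_simps)
      finally show "pnorm M p (\<lambda>x. ext_op p P b u x - ext_op p P a u x) < \<epsilon>" by (simp add: W_def)
    qed
  qed
  show thesis
  proof (rule that[OF v])
    fix t :: real assume t: "t > 0"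
    obtain d where d: "smoothing p (real m) d (A ^^ m)" using smoothing_A_power[OF p] by blast
    have "pnorm M p (ext_op p (A ^^ m) t v) = pnorm M p (W m t)"
      unfolding W_def by (rule graph_closure_ext_op(1)[OF v P d p t])
    also have "\<dots> \<le> (1 + 1 / (real m - \<sigma>)) * D * t powr (\<sigma> - m)"
    proof -
      \<comment> \<open>\<open>\<sigma>\<close> exceeds \<open>\<theta> / 2\<close> by less than 1,
        so the order of the seminorm of v is n + 1 or n.\<close>
      have "n \<le> m" "m \<le> Suc n" using n m \<kappa> by (auto simp: \<sigma>)
      then consider "m = Suc n" | "m = n" by linarith
      then show ?thesis
      proof cases
        case 1
        have "1 * (D * t powr (\<sigma> - m)) \<le> (1 + 1 / (real m - \<sigma>)) * (D * t powr (\<sigma> - m))"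
          using m D by (intro mult_right_mono) auto
        then show ?thesis using top[OF t] 1 by (simp add: mult.assoc)
      next
        case 2
        \<comment> \<open>One integration remains. It runs to infinity, where the decay of
          \<open>W n\<close> in terms of the norm of \<open>u\<close> kills the boundary term; this
          produces the factor \<open>1 / (m - \<sigma>)\<close> and a bound free of
          \<open>u\<close>.\<close>
        define a where "a = \<sigma> - real n"
        have a: "a < 0" using m 2 by (simp add: a_def)
        obtain d' where d': "smoothing p (real n + \<kappa>) d' (\<lambda>\<phi>. (A ^^ n) (P \<phi>))" using smoothing_power_comp[OF P p] by blast
        have le: "pnorm M p (W n t) \<le> d' * R powr (- (real n + \<kappa>)) * pnorm M p u + D / (- a) * t powr a" if R: "t \<le> R" for R
        proof -
          have "pnorm M p (\<lambda>x. W n R x - W n t x) \<le> D * R powr a / a - D * t powr a / a"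
          proof (rule inc[OF t R])
            show "((\<lambda>r. D * r powr a / a) has_real_derivative D * r powr (a - 1)) (at r)" if "t \<le> r" for r
              using t that a by (intro power_deriv) auto
            show "pnorm M p (W (Suc n) r) \<le> D * r powr (a - 1)" if "t \<le> r" for r
              using top[of r] that t by (simp add: a_def diff_diff_eq add.commute)
          qed
          also have "\<dots> \<le> D / (- a) * t powr a"
            using a D by (simp add: divide_nonneg_neg divide_nonpos_neg divide_simps mult_nonneg_nonneg)
          finally have 1: "pnorm M p (\<lambda>x. W n R x - W n t x) \<le> D / (- a) * t powr a" .
          have R0: "R > 0" using t R by simp
          have "pnorm M p (W n R) \<le> d' * R powr (- (real n + \<kappa>)) * pnorm M p u"
            unfolding W_def by (rule ext_op_bound[OF d' p R0 u])
          moreover have "pnorm M p (W n t) \<le> pnorm M p (W n R) + pnorm M p (\<lambda>x. W n R x - W n t x)"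
            using pnorm_le_diff[OF WL[OF t, of n] WL[OF R0, of n] p] by (simp add: pnorm_diff_commute[of M p "W n R"])
          ultimately show ?thesis using 1 by linarith
        qed
        have "pnorm M p (W n t) \<le> d' * 0 * pnorm M p u + D / (- a) * t powr a"
        proof (rule tendsto_lowerbound)
          show "((\<lambda>R. d' * R powr (- (real n + \<kappa>)) * pnorm M p u + D / (- a) * t powr a)
              \<longlongrightarrow> d' * 0 * pnorm M p u + D / (- a) * t powr a) at_top"
            by (intro tendsto_intros tendsto_neg_powr filterlim_ident) (use \<kappa> in auto)
          show "\<forall>\<^sub>F R in at_top. pnorm M p (W n t) \<le> d' * R powr (- (real n + \<kappa>)) * pnorm M p u + D / (- a) * t powr a"
            using eventually_ge_at_top[of t] by eventually_elim (rule le)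
        qed simp
        also have "\<dots> \<le> (1 + 1 / (real m - \<sigma>)) * D * t powr (\<sigma> - m)"
        proof -
          have "D / (- a) * t powr a = (1 / (real m - \<sigma>)) * (D * t powr (\<sigma> - m))" by (simp add: a_def 2)
          moreover have "(1 / (real m - \<sigma>)) * (D * t powr (\<sigma> - m)) \<le> (1 + 1 / (real m - \<sigma>)) * (D * t powr (\<sigma> - m))"
            using D by (intro mult_right_mono) auto
          ultimately show ?thesis by (simp add: mult.assoc)
        qed
        finally show ?thesis using 2 by simp
      qed
    qed
    finally show "pnorm M p (ext_op p (A ^^ m) t v) \<le> (1 + 1 / (real m - \<sigma>)) * D * t powr (\<sigma> - m)" .
  qed
qed

text \<open>Splits off a test function, whose contribution is accessible directly, from a remainder
  that can be made small.\<close>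

lemma ext_op_diff_le:
  assumes Q: "smoothing p \<kappa> c Q" and p: "1 < p" and s: "s > 0" and w: "w \<in> B_closure p" and \<psi>: "\<psi> \<in> B"
  shows "(\<lambda>x. w x - \<psi> x) \<in> B_closure p"
    and "pnorm M p (ext_op p Q s w) \<le> pnorm M p (ext_op p Q s (\<lambda>x. w x - \<psi> x)) + pnorm M p (H s (Q \<psi>))"
proof -
  obtain \<phi> where \<phi>: "\<And>n. \<phi> n \<in> B" "(\<lambda>n. pnorm M p (\<lambda>x. \<phi> n x - w x)) \<longlonglongrightarrow> 0"
    using B_closure_seq[OF w] by blast
  have d: "\<And>n. (\<lambda>x. \<phi> n x - \<psi> x) \<in> B" "(\<lambda>n. pnorm M p (\<lambda>x. (\<phi> n x - \<psi> x) - (w x - \<psi> x))) \<longlonglongrightarrow> 0"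
    using \<phi> \<psi> by (auto intro: B_diff)
  show cl: "(\<lambda>x. w x - \<psi> x) \<in> B_closure p"
    by (rule B_closureI[OF Lp_diff(1)[OF B_closure_Lp[OF w] B_Lp[OF \<psi> p] p] d])
  show "pnorm M p (ext_op p Q s w) \<le> pnorm M p (ext_op p Q s (\<lambda>x. w x - \<psi> x)) + pnorm M p (H s (Q \<psi>))"
  proof (rule LIMSEQ_le)
    show "(\<lambda>n. pnorm M p (H s (Q (\<phi> n)))) \<longlonglongrightarrow> pnorm M p (ext_op p Q s w)"
      by (rule ext_op_tendsto(2)[OF Q p s w \<phi>])
    show "(\<lambda>n. pnorm M p (H s (Q (\<lambda>x. \<phi> n x - \<psi> x))) + pnorm M p (H s (Q \<psi>)))
      \<longlonglongrightarrow> pnorm M p (ext_op p Q s (\<lambda>x. w x - \<psi> x)) + pnorm M p (H s (Q \<psi>))"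
      by (intro tendsto_add tendsto_const ext_op_tendsto(2)[OF Q p s cl d])
    show "\<exists>N. \<forall>n\<ge>N. pnorm M p (H s (Q (\<phi> n))) \<le> pnorm M p (H s (Q (\<lambda>x. \<phi> n x - \<psi> x))) + pnorm M p (H s (Q \<psi>))"
    proof (intro exI allI impI)
      fix n
      have QB: "Q (\<phi> n) \<in> B" "Q \<psi> \<in> B" using smoothingD(2)[OF Q] \<phi>(1) \<psi> by auto
      have s0: "s \<ge> 0" using s by simp
      have "pnorm M p (H s (Q (\<lambda>x. \<phi> n x - \<psi> x))) = pnorm M p (\<lambda>x. H s (Q (\<phi> n)) x - H s (Q \<psi>) x)"
        using smoothingD(3)[OF Q \<phi>(1)[of n] \<psi>] H_diff[OF B_bounded[OF QB(1)] B_bounded[OF QB(2)] s0]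
        by (intro pnorm_cong) simp
      then show "pnorm M p (H s (Q (\<phi> n))) \<le> pnorm M p (H s (Q (\<lambda>x. \<phi> n x - \<psi> x))) + pnorm M p (H s (Q \<psi>))"
        using pnorm_le_diff[OF H_B_Lp[OF QB(1) s0 p] H_B_Lp[OF QB(2) s0 p] p] by simp
    qed
  qed
qed

lemma smoothing_minus:
  assumes "smoothing p \<kappa> c P" "\<phi> \<in> B" shows "P (\<lambda>x. - \<phi> x) = (\<lambda>x. - P \<phi> x)"
proof -
  have "P (\<lambda>x. 0) = (\<lambda>x. 0)" using smoothingD(3)[OF assms(1) assms(2) assms(2)] by simp
  then show ?thesis using smoothingD(3)[OF assms(1) B_nonempty assms(2)] by simp
qed

lemma pnorm_minus_diff: "pnorm M p (\<lambda>x. - f x - - g x) = pnorm M p (\<lambda>x. f x - g x)"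
  by (simp add: pnorm_def abs_minus_commute)

lemma graph_closure_minus:
  assumes "graph_closure p P u v" "smoothing p \<kappa> c P"
  shows "graph_closure p P (\<lambda>x. - u x) (\<lambda>x. - v x)"
proof -
  obtain \<phi> where \<phi>: "\<And>n. \<phi> n \<in> B" "(\<lambda>n. pnorm M p (\<lambda>x. \<phi> n x - u x)) \<longlonglongrightarrow> 0"
    "(\<lambda>n. pnorm M p (\<lambda>x. P (\<phi> n) x - v x)) \<longlonglongrightarrow> 0" using graph_closureE[OF assms(1)] by blast
  show ?thesis unfolding graph_closure_def
  proof (intro conjI exI[of _ "\<lambda>n x. - \<phi> n x"] allI)
    show "(\<lambda>x. - u x) \<in> Lp M p" "(\<lambda>x. - v x) \<in> Lp M p" using assms(1) by (auto simp: graph_closure_def Lp_minus)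
    show "(\<lambda>x. - \<phi> n x) \<in> B" for n by (rule B_minus[OF \<phi>(1)])
    show "(\<lambda>n. pnorm M p (\<lambda>x. - \<phi> n x - - u x)) \<longlonglongrightarrow> 0" using \<phi>(2) unfolding pnorm_minus_diff .
    show "(\<lambda>n. pnorm M p (\<lambda>x. P (\<lambda>x. - \<phi> n x) x - - v x)) \<longlonglongrightarrow> 0"
      using \<phi>(3) unfolding smoothing_minus[OF assms(2) \<phi>(1)] pnorm_minus_diff .
  qed
qed

lemma ext_op_minus:
  assumes Q: "smoothing p \<kappa> c Q" and p: "1 < p" and s: "s > 0" and w: "w \<in> B_closure p"
  shows "(\<lambda>x. - w x) \<in> B_closure p" "pnorm M p (ext_op p Q s (\<lambda>x. - w x)) = pnorm M p (ext_op p Q s w)"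
proof -
  obtain \<phi> where \<phi>: "\<And>n. \<phi> n \<in> B" "(\<lambda>n. pnorm M p (\<lambda>x. \<phi> n x - w x)) \<longlonglongrightarrow> 0"
    using B_closure_seq[OF w] by blast
  have d: "\<And>n. (\<lambda>x. - \<phi> n x) \<in> B" "(\<lambda>n. pnorm M p (\<lambda>x. - \<phi> n x - - w x)) \<longlonglongrightarrow> 0"
    using \<phi> B_minus unfolding pnorm_minus_diff by auto
  show cl: "(\<lambda>x. - w x) \<in> B_closure p" by (rule B_closureI[OF Lp_minus(1)[OF B_closure_Lp[OF w]] d])
  have "pnorm M p (H s (Q (\<lambda>x. - \<phi> n x))) = pnorm M p (H s (Q (\<phi> n)))" for n
  proof -
    have QB: "Q (\<phi> n) \<in> B" using smoothingD(2)[OF Q \<phi>(1)] .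
    have "pnorm M p (H s (Q (\<lambda>x. - \<phi> n x))) = pnorm M p (\<lambda>x. - H s (Q (\<phi> n)) x)"
      using H_cmult[OF B_bounded[OF QB], of s _ "-1"] s by (intro pnorm_cong) (simp add: smoothing_minus[OF Q \<phi>(1)])
    then show ?thesis by (simp add: pnorm_def)
  qed
  then show "pnorm M p (ext_op p Q s (\<lambda>x. - w x)) = pnorm M p (ext_op p Q s w)"
    using LIMSEQ_unique[OF ext_op_tendsto(2)[OF Q p s cl d]] ext_op_tendsto(2)[OF Q p s w \<phi>] by simp
qed

end

section \<open>Lipschitz seminorms\<close>

lemma Lp_norm_triangle:
  assumes "1 < p" shows "Lp_norm N p (\<lambda>x. f x + g x) \<le> Lp_norm N p f + Lp_norm N p g"
proof (cases "f \<in> Lp N p \<and> g \<in> Lp N p")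
  case True
  then have f: "f \<in> Lp N p" and g: "g \<in> Lp N p" by auto
  show ?thesis
    using Lp_add[OF f g assms] by (simp add: Lp_norm_eq f g ennreal_plus[symmetric] del: ennreal_plus)
qed (auto simp: Lp_norm_not_Lp)

lemma Lp_norm_0_cmult:
  assumes "Lp_norm N p f = 0" "p > 0" shows "Lp_norm N p (\<lambda>x. c * f x) = 0"
proof -
  have f: "f \<in> Lp N p" using assms(1) by (simp add: Lp_def)
  then have "pnorm N p f = 0" using assms by (simp add: Lp_norm_eq)
  then show ?thesis using Lp_cmult[OF f] assms(2) by (simp add: Lp_norm_eq)
qed

lemma Lp_norm_minus: "Lp_norm N p (\<lambda>x. - f x) = Lp_norm N p f"
  by (auto simp: Lp_norm_def)

lemma tendsto_Lp_norm:
  assumes "\<forall>\<^sub>F h in F. f h \<in> Lp N p" "((\<lambda>h. pnorm N p (f h)) \<longlongrightarrow> 0) F"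
  shows "((\<lambda>h. Lp_norm N p (f h)) \<longlongrightarrow> 0) F"
proof -
  have "((\<lambda>h. ennreal (pnorm N p (f h))) \<longlongrightarrow> ennreal 0) F" by (rule tendsto_ennrealI[OF assms(2)])
  then have "((\<lambda>h. ennreal (pnorm N p (f h))) \<longlongrightarrow> 0) F" by simp
  then show ?thesis
    by (rule Lim_transform_eventually) (use assms(1) in eventually_elim, simp add: Lp_norm_eq)
qed

lemma tendsto_pnorm:
  assumes "\<forall>\<^sub>F h in F. f h \<in> Lp N p" "((\<lambda>h. Lp_norm N p (f h)) \<longlongrightarrow> 0) F"
  shows "((\<lambda>h. pnorm N p (f h)) \<longlongrightarrow> 0) F"
proof -
  have "\<forall>\<^sub>F h in F. Lp_norm N p (f h) = ennreal (pnorm N p (f h))"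
    using assms(1) by eventually_elim (rule Lp_norm_eq)
  then have "((\<lambda>h. ennreal (pnorm N p (f h))) \<longlongrightarrow> ennreal 0) F" using assms(2) by (simp add: tendsto_cong)
  then show ?thesis by (subst (asm) tendsto_ennreal_iff) auto
qed

definition lip_order :: "real \<Rightarrow> nat" where
  "lip_order \<theta> = (LEAST n::nat. real n > \<theta> / 2)"

lemma lip_order:
  shows "real (lip_order \<theta>) > \<theta> / 2" and "0 \<le> \<theta> \<Longrightarrow> real (lip_order \<theta>) \<le> \<theta> / 2 + 1"
proof -
  have "\<exists>n::nat. real n > \<theta> / 2" by (rule reals_Archimedean2)
  then show "real (lip_order \<theta>) > \<theta> / 2" unfolding lip_order_def by (rule LeastI_ex)
  assume \<theta>: "0 \<le> \<theta>"
  show "real (lip_order \<theta>) \<le> \<theta> / 2 + 1"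
  proof (rule ccontr)
    assume "\<not> ?thesis"
    then have less: "real (lip_order \<theta> - 1) > \<theta> / 2" "lip_order \<theta> > 0" using \<theta> by linarith+
    from less(1) have "lip_order \<theta> \<le> lip_order \<theta> - 1" unfolding lip_order_def by (rule Least_le)
    then show False using less(2) by simp
  qed
qed

lemma lip_order_add_2: "0 < \<theta> \<Longrightarrow> lip_order (\<theta> + 2) = Suc (lip_order \<theta>)"
proof -
  assume \<theta>: "0 < \<theta>"
  have "real (lip_order (\<theta> + 2)) > real (lip_order \<theta>)" "real (Suc (lip_order \<theta>)) > real (lip_order (\<theta> + 2)) - 1"
    using lip_order[of \<theta>] lip_order[of "\<theta> + 2"] \<theta> unfolding add_divide_distrib of_nat_Suc by linarith+
  then show ?thesis by linarith
qed

context derivation_semigroup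
begin

lemma B_power_in: "\<phi> \<in> B \<Longrightarrow> (A ^^ k) \<phi> \<in> B"
  by (induction k) (auto simp: A_B)

text \<open>\<open>heat_time_deriv\<close> starts the chain of derivatives at \<open>heat\<close>
  itself, whereas \<open>ext_op\<close> is an arbitrary representative. So the member of order 0 is
  exchanged, and the difference quotients agree almost everywhere.\<close>

lemma lipschitz_seminorm_le:
  fixes G :: "('a, 'm) monoid_scheme"
  assumes heat: "\<And>t f. t > 0 \<Longrightarrow> H t f = heat G \<mu> t f"
    and p: "1 < p" and \<theta>: "\<theta> > 0" and v: "v \<in> B_closure p"
    and bd: "\<And>t. t > 0 \<Longrightarrow> pnorm M p (ext_op p (A ^^ lip_order \<theta>) t v) \<le> c * t powr (\<theta> / 2 - lip_order \<theta>)"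
  shows "lipschitz_seminorm G M \<mu> p \<theta> v \<le> ennreal c"
proof -
  have p1: "1 < p" "p > 0" using p by auto
  define n where "n = lip_order \<theta>"
  have n: "n > 0" using lip_order(1)[of \<theta>] \<theta> by (cases n) (auto simp: n_def)
  have sm: "\<exists>d. smoothing p (real k) d (A ^^ k)" for k by (rule smoothing_A_power[OF p])
  define E where "E k t = ext_op p (A ^^ k) t v" for k t
  have EL: "E k t \<in> Lp M p" if "t > 0" for k t
    using sm[of k] ext_op(1)[OF _ p that v] unfolding E_def by blast
  define F where "F k = (if k = 0 then (\<lambda>t. heat G \<mu> t v) else E k)" for k
  have FE: "AE x in M. E k t x = F k t x" and FL: "F k t \<in> Lp M p" if t: "t > 0" for k t
  proof -
    show "F k t \<in> Lp M p"
      using EL[OF t, of k] H_Lp[OF p B_closure_Lp[OF v], of t] t heat[OF t, of v] by (auto simp: F_def)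
    show "AE x in M. E k t x = F k t x"
    proof (cases "k = 0")
      case True
      have HL: "H t v \<in> Lp M p" using t by (intro H_Lp[OF p B_closure_Lp[OF v]]) simp
      have "pnorm M p (\<lambda>x. E 0 t x - H t v x) = 0"
        unfolding E_def using ext_op_id[OF p t v] by (simp add: id_def)
      then have "AE x in M. E 0 t x - H t v x = 0"
        by (rule pnorm_eq_0_AE[OF Lp_diff(1)[OF EL[OF t] HL p1(1)] _ p1(2)])
      then show ?thesis by eventually_elim (simp add: F_def True heat[OF t])
    qed (simp add: F_def)
  qed
  have der: "Lp_time_deriv M p (F k) (F (Suc k))" for k
    unfolding Lp_time_deriv_def
  proof (intro allI impI)
    fix t :: real assume t: "t > 0"
    obtain d where d: "smoothing p (real k) d (A ^^ k)" using sm by blast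
    have FSuc: "F (Suc k) t = ext_op p (\<lambda>\<phi>. A ((A ^^ k) \<phi>)) t v"
      by (simp add: F_def E_def comp_def)
    show "((\<lambda>h. Lp_norm M p (\<lambda>x. (F k (t + h) x - F k t x) / h - F (Suc k) t x)) \<longlongrightarrow> 0) (at 0)"
    proof (rule tendsto_Lp_norm)
      have L: "(\<lambda>x. (F k (t + h) x - F k t x) / h - F (Suc k) t x) \<in> Lp M p" if "t + h > 0" for h
        by (intro Lp_diff_quotient FL that t p)
      then show "\<forall>\<^sub>F h in at 0. (\<lambda>x. (F k (t + h) x - F k t x) / h - F (Suc k) t x) \<in> Lp M p"
        by (rule eventually_pos_shift[OF t])
      have "\<forall>\<^sub>F h in at 0. pnorm M p (\<lambda>x. (E k (t + h) x - E k t x) / h - F (Suc k) t x)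
          = pnorm M p (\<lambda>x. (F k (t + h) x - F k t x) / h - F (Suc k) t x)"
      proof (rule eventually_pos_shift[OF t])
        fix h assume th: "t + h > 0"
        have m: "(\<lambda>x. (E k (t + h) x - E k t x) / h - F (Suc k) t x) \<in> borel_measurable M"
          using Lp_measurable[OF EL[OF th]] Lp_measurable[OF EL[OF t]] Lp_measurable[OF FL[OF t]] by measurable
        show "pnorm M p (\<lambda>x. (E k (t + h) x - E k t x) / h - F (Suc k) t x)
          = pnorm M p (\<lambda>x. (F k (t + h) x - F k t x) / h - F (Suc k) t x)"
          by (rule Lp_cong_AE(2)[OF L[OF th] m], use FE[OF th, of k] FE[OF t, of k] in eventually_elim) simp
      qed
      moreover have "((\<lambda>h. pnorm M p (\<lambda>x. (E k (t + h) x - E k t x) / h - F (Suc k) t x)) \<longlongrightarrow> 0) (at 0)"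
        unfolding FSuc E_def by (rule ext_op_derivative[OF d p t v])
      ultimately show "((\<lambda>h. pnorm M p (\<lambda>x. (F k (t + h) x - F k t x) / h - F (Suc k) t x)) \<longlongrightarrow> 0) (at 0)"
        by (rule Lim_transform_eventually[rotated])
    qed
  qed
  have "heat_time_deriv G M \<mu> p n v (F n)"
    unfolding heat_time_deriv_def by (rule exI[of _ F]) (use der in \<open>auto simp: F_def\<close>)
  then have "lipschitz_seminorm G M \<mu> p \<theta> v \<le> (SUP t\<in>{0<..}. ennreal (t powr (real n - \<theta> / 2)) * Lp_norm M p (F n t))"
    unfolding lipschitz_seminorm_def lip_order_def[symmetric] n_def[symmetric] Let_def by (intro INF_lower) simp
  also have "\<dots> \<le> ennreal c"
  proof (rule SUP_least)
    fix t :: real assume "t \<in> {0<..}"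
    then have t: "t > 0" by simp
    have "Lp_norm M p (F n t) = ennreal (pnorm M p (E n t))" using n EL[OF t, of n] by (simp add: F_def Lp_norm_eq)
    then have "ennreal (t powr (real n - \<theta> / 2)) * Lp_norm M p (F n t) = ennreal (t powr (real n - \<theta> / 2) * pnorm M p (E n t))"
      by (simp add: ennreal_mult)
    also have "\<dots> \<le> ennreal (t powr (real n - \<theta> / 2) * (c * t powr (\<theta> / 2 - n)))"
      using bd[OF t] unfolding E_def n_def by (intro ennreal_leI mult_left_mono) auto
    also have "t powr (real n - \<theta> / 2) * (c * t powr (\<theta> / 2 - n)) = c * (t powr (real n - \<theta> / 2) * t powr (\<theta> / 2 - n))"
      by simp
    also have "t powr (real n - \<theta> / 2) * t powr (\<theta> / 2 - n) = 1" using t by (simp add: powr_add[symmetric])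
    finally show "ennreal (t powr (real n - \<theta> / 2)) * Lp_norm M p (F n t) \<le> ennreal c" by simp
  qed
  finally show ?thesis .
qed

text \<open>The infimum ranges over all chains of time derivatives; each of them is forced, order by
  order, to agree almost everywhere with \<open>H t\<close> applied to the powers of
  \<open>A\<close>.\<close>

lemma lipschitz_seminorm_ge:
  fixes G :: "('a, 'm) monoid_scheme"
  assumes heat: "\<And>t f. t > 0 \<Longrightarrow> H t f = heat G \<mu> t f"
    and p: "1 < p" and \<phi>: "\<phi> \<in> B" and t: "t > 0"
  shows "ennreal (t powr (real (lip_order \<theta>) - \<theta> / 2) * pnorm M p (H t ((A ^^ lip_order \<theta>) \<phi>))) \<le> lipschitz_seminorm G M \<mu> p \<theta> \<phi>"
proof -
  have p1: "1 < p" "p > 0" using p by auto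
  define n where "n = lip_order \<theta>"
  show ?thesis
    unfolding lipschitz_seminorm_def lip_order_def[symmetric] n_def[symmetric] Let_def
  proof (rule INF_greatest)
    fix D assume "D \<in> {D. heat_time_deriv G M \<mu> p n \<phi> D}"
    then obtain F where F: "F 0 = (\<lambda>t. heat G \<mu> t \<phi>)" "\<And>k. k < n \<Longrightarrow> Lp_time_deriv M p (F k) (F (Suc k))" "F n = D"
      by (auto simp: heat_time_deriv_def)
    have eq: "Lp_norm M p (\<lambda>x. F k t x - H t ((A ^^ k) \<phi>) x) = 0" if "k \<le> n" "t > 0" for k t
      using that
    proof (induction k arbitrary: t)
      case 0
      then show ?case using heat[OF 0(2)] p1 by (simp add: F(1) Lp_norm_def)
    next
      case (Suc k)
      let ?\<psi> = "(A ^^ k) \<phi>"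
      have \<psi>: "?\<psi> \<in> B" by (rule B_power_in[OF \<phi>])
      have IH: "Lp_norm M p (\<lambda>x. F k s x - H s ?\<psi> x) = 0" if "s > 0" for s using Suc that by simp
      have IH': "Lp_norm M p (\<lambda>x. - (F k s x - H s ?\<psi> x)) = 0" if "s > 0" for s
        using IH[OF that] by (simp only: Lp_norm_minus)
      let ?d = "\<lambda>x. F (Suc k) t x - H t (A ?\<psi>) x"
      have "Lp_norm M p ?d \<le> 0"
      proof (rule tendsto_lowerbound)
        show "((\<lambda>h. Lp_norm M p (\<lambda>x. (F k (t + h) x - F k t x) / h - F (Suc k) t x)
            + Lp_norm M p (\<lambda>x. (H (t + h) ?\<psi> x - H t ?\<psi> x) / h - H t (A ?\<psi>) x)) \<longlongrightarrow> 0) (at 0)"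
        proof (rule tendsto_eq_intros)
          show "((\<lambda>h. Lp_norm M p (\<lambda>x. (F k (t + h) x - F k t x) / h - F (Suc k) t x)) \<longlongrightarrow> 0) (at 0)"
            using F(2)[of k] Suc by (auto simp: Lp_time_deriv_def)
          show "((\<lambda>h. Lp_norm M p (\<lambda>x. (H (t + h) ?\<psi> x - H t ?\<psi> x) / h - H t (A ?\<psi>) x)) \<longlongrightarrow> 0) (at 0)"
          proof (rule tendsto_Lp_norm[OF _ H_Lp_derivative[OF \<psi> Suc(3) p]])
            show "\<forall>\<^sub>F h in at 0. (\<lambda>x. (H (t + h) ?\<psi> x - H t ?\<psi> x) / h - H t (A ?\<psi>) x) \<in> Lp M p"
            proof (rule eventually_pos_shift[OF Suc(3)])
              fix h assume h: "t + h > 0"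
              show "(\<lambda>x. (H (t + h) ?\<psi> x - H t ?\<psi> x) / h - H t (A ?\<psi>) x) \<in> Lp M p"
                using h Suc(3) by (intro Lp_diff_quotient H_B_Lp \<psi> A_B p) auto
            qed
          qed
        qed simp
        show "\<forall>\<^sub>F h in at 0. Lp_norm M p ?d \<le> Lp_norm M p (\<lambda>x. (F k (t + h) x - F k t x) / h - F (Suc k) t x)
            + Lp_norm M p (\<lambda>x. (H (t + h) ?\<psi> x - H t ?\<psi> x) / h - H t (A ?\<psi>) x)"
        proof (rule eventually_pos_shift[OF Suc(3)])
          fix h assume h: "t + h > 0"
          \<comment> \<open>The members of a chain are not assumed to lie in \<open>Lp\<close>, so
            everything is estimated by \<open>Lp_norm\<close>, whose triangle inequality includes
            the value infinity; \<open>?a\<close> and \<open>?b\<close> have norm 0 by the previous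
            order.\<close>
          let ?a = "\<lambda>x. (1 / h) * (F k (t + h) x - H (t + h) ?\<psi> x)" and ?b = "\<lambda>x. (1 / h) * - (F k t x - H t ?\<psi> x)"
            and ?e = "\<lambda>x. - ((F k (t + h) x - F k t x) / h - F (Suc k) t x)"
            and ?f = "\<lambda>x. (H (t + h) ?\<psi> x - H t ?\<psi> x) / h - H t (A ?\<psi>) x"
          have z: "Lp_norm M p ?a = 0" "Lp_norm M p ?b = 0"
            by (rule Lp_norm_0_cmult[OF IH[OF h] p1(2)] Lp_norm_0_cmult[OF IH'[OF Suc(3)] p1(2)])+
          have "?d = (\<lambda>x. (?a x + ?b x) + (?e x + ?f x))"
            by (simp add: fun_eq_iff algebra_simps diff_divide_distrib add_divide_distrib)
          then have "Lp_norm M p ?d = Lp_norm M p (\<lambda>x. (?a x + ?b x) + (?e x + ?f x))" by simp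
          also have "\<dots> \<le> Lp_norm M p (\<lambda>x. ?a x + ?b x) + Lp_norm M p (\<lambda>x. ?e x + ?f x)"
            by (rule Lp_norm_triangle[OF p1(1)])
          also have "\<dots> \<le> (Lp_norm M p ?a + Lp_norm M p ?b) + (Lp_norm M p ?e + Lp_norm M p ?f)"
            by (intro add_mono Lp_norm_triangle[OF p1(1)])
          also have "\<dots> = Lp_norm M p ?e + Lp_norm M p ?f" using z by simp
          also have "Lp_norm M p ?e = Lp_norm M p (\<lambda>x. (F k (t + h) x - F k t x) / h - F (Suc k) t x)"
            by (rule Lp_norm_minus)
          finally show "Lp_norm M p ?d \<le> Lp_norm M p (\<lambda>x. (F k (t + h) x - F k t x) / h - F (Suc k) t x) + Lp_norm M p ?f" .
        qed
      qed simp
      then show ?case by simp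
    qed
    have HL: "H t ((A ^^ n) \<phi>) \<in> Lp M p" by (rule H_B_Lp[OF B_power_in[OF \<phi>] less_imp_le[OF t] p])
    have "ennreal (t powr (real n - \<theta> / 2) * pnorm M p (H t ((A ^^ n) \<phi>)))
        = ennreal (t powr (real n - \<theta> / 2)) * Lp_norm M p (H t ((A ^^ n) \<phi>))"
      by (simp add: Lp_norm_eq[OF HL] ennreal_mult)
    also have "Lp_norm M p (H t ((A ^^ n) \<phi>)) \<le> Lp_norm M p (D t)"
    proof -
      have "Lp_norm M p (\<lambda>x. D t x + - (D t x - H t ((A ^^ n) \<phi>) x)) \<le> Lp_norm M p (D t) + Lp_norm M p (\<lambda>x. - (D t x - H t ((A ^^ n) \<phi>) x))"
        by (rule Lp_norm_triangle[OF p1(1)])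
      also have "Lp_norm M p (\<lambda>x. - (D t x - H t ((A ^^ n) \<phi>) x)) = 0"
        using eq[OF order_refl t] by (simp only: Lp_norm_minus F(3))
      finally show ?thesis by simp
    qed
    also have "ennreal (t powr (real n - \<theta> / 2)) * Lp_norm M p (D t)
        \<le> (SUP t\<in>{0<..}. ennreal (t powr (real n - \<theta> / 2)) * Lp_norm M p (D t))"
      using t by (intro SUP_upper) simp
    finally show "ennreal (t powr (real n - \<theta> / 2) * pnorm M p (H t ((A ^^ n) \<phi>)))
        \<le> (SUP t\<in>{0<..}. ennreal (t powr (real n - \<theta> / 2)) * Lp_norm M p (D t))"
      by (simp add: mult_left_mono)
  qed
qed

end

lemma tendsto_0_ennrealI:
  fixes f :: "nat \<Rightarrow> ennreal"
  assumes "\<And>e. e > 0 \<Longrightarrow> \<forall>\<^sub>F n in sequentially. f n \<le> ennreal e"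
  shows "f \<longlonglongrightarrow> 0"
proof (rule order_tendstoI)
  fix a :: ennreal assume "0 < a"
  then obtain y where y: "0 < y" "y < a" using dense by blast
  then have "y < \<top>" using less_top_ennreal by (metis order_less_trans top.not_eq_extremum)
  then obtain e where e: "y = ennreal e" "e \<ge> 0" by (cases y) auto
  then have "e > 0" using y(1) by auto
  from assms[OF this] show "\<forall>\<^sub>F n in sequentially. f n < a"
    by eventually_elim (use y(2) e(1) in auto)
qed simp

lemma powr_cancel_le:
  fixes t :: real
  assumes "t powr a * y \<le> c" "t > 0" shows "y \<le> c * t powr (- a)"
proof -
  have "t powr (- a) * (t powr a * y) \<le> t powr (- a) * c" using assms(1) by (rule mult_left_mono) simp
  also have "t powr (- a) * (t powr a * y) = y" using assms(2) by (simp add: powr_minus)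
  finally show ?thesis by (simp only: mult.commute)
qed

section \<open>The regularity statement for the abstract semigroup\<close>

context derivation_semigroup
begin

text \<open>Each square is symmetric, since two integrations by parts cancel their signs.\<close>

lemma partial_sos_symmetric:
  assumes J: "J \<subseteq> I" and "\<phi> \<in> B" "\<eta> \<in> B"
  shows "(\<integral>x. sum_of_squares_op J X \<phi> x * \<eta> x \<partial>M) = (\<integral>x. \<phi> x * sum_of_squares_op J X \<eta> x \<partial>M)"
proof -
  obtain K where K: "finite K" "K \<subseteq> I" "\<And>i \<xi>. i \<in> I - K \<Longrightarrow> \<xi> \<in> {\<phi>, \<eta>} \<Longrightarrow> X i \<xi> = (\<lambda>x. 0)"
    using common_support[of "{\<phi>, \<eta>}"] assms by auto
  have e: "sum_of_squares_op J X \<phi> = (\<lambda>x. \<Sum>i\<in>J \<inter> K. X i (X i \<phi>) x)" "sum_of_squares_op J X \<eta> = (\<lambda>x. \<Sum>i\<in>J \<inter> K. X i (X i \<eta>) x)"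
    using K(3) X_zero by (auto intro!: sum_of_squares_op_eq[OF K(1,2) J])
  have XB: "X i \<xi> \<in> B" if "i \<in> J \<inter> K" "\<xi> \<in> B" for i \<xi> using that J X_B by auto
  have int: "integrable M (\<lambda>x. \<xi> x * \<zeta> x)" if "\<xi> \<in> B" "\<zeta> \<in> B" for \<xi> \<zeta>
    using that by (intro integrable_bounded_borel bounded_borel_mult B_bounded)
  have "(\<integral>x. sum_of_squares_op J X \<phi> x * \<eta> x \<partial>M) = (\<Sum>i\<in>J \<inter> K. \<integral>x. X i (X i \<phi>) x * \<eta> x \<partial>M)"
    unfolding e sum_distrib_right by (intro Bochner_Integration.integral_sum int XB assms)
  also have "\<dots> = (\<Sum>i\<in>J \<inter> K. \<integral>x. \<phi> x * X i (X i \<eta>) x \<partial>M)"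
  proof (rule sum.cong[OF refl])
    fix i assume i: "i \<in> J \<inter> K"
    then have iI: "i \<in> I" using J by auto
    show "(\<integral>x. X i (X i \<phi>) x * \<eta> x \<partial>M) = (\<integral>x. \<phi> x * X i (X i \<eta>) x \<partial>M)"
      using integration_by_parts[OF iI XB[OF i assms(2)] assms(3)] integration_by_parts[OF iI assms(2) XB[OF i assms(3)]] by simp
  qed
  also have "\<dots> = (\<integral>x. \<phi> x * sum_of_squares_op J X \<eta> x \<partial>M)"
    unfolding e sum_distrib_left by (intro Bochner_Integration.integral_sum[symmetric] int XB assms)
  finally show ?thesis .
qed

text \<open>Half of the time is spent on \<open>P\<close> and half on the given decay; the power of
  2 is the price.\<close>

lemma ext_op_comp_power_le:
  assumes P: "smoothing p \<kappa> c P" and p: "1 < p" and w: "w \<in> B_closure p"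
    and C: "\<And>t. t > 0 \<Longrightarrow> pnorm M p (ext_op p (A ^^ n) t w) \<le> C * t powr (\<theta> / 2 - n)" and s: "s > 0"
  shows "pnorm M p (ext_op p (\<lambda>\<phi>. P ((A ^^ n) \<phi>)) s w) \<le> (c * 2 powr (\<kappa> + n - \<theta> / 2) * C) * s powr (\<theta> / 2 - n - \<kappa>)"
proof -
  obtain d where d: "smoothing p (real n) d (A ^^ n)" using smoothing_A_power[OF p] by blast
  have "pnorm M p (ext_op p (\<lambda>\<phi>. P ((A ^^ n) \<phi>)) (s / 2 + s / 2) w) \<le> c * (s / 2) powr (- \<kappa>) * pnorm M p (ext_op p (A ^^ n) (s / 2) w)"
    by (rule ext_op_comp_le[OF P d p _ _ w]) (use s in auto)
  also have "\<dots> \<le> c * (s / 2) powr (- \<kappa>) * (C * (s / 2) powr (\<theta> / 2 - n))"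
    using s smoothingD(1)[OF P] by (intro mult_left_mono C) auto
  also have "\<dots> = c * C * ((s / 2) powr (- \<kappa>) * (s / 2) powr (\<theta> / 2 - n))" by simp
  also have "(s / 2) powr (- \<kappa>) * (s / 2) powr (\<theta> / 2 - n) = (s / 2) powr (\<theta> / 2 - n - \<kappa>)"
    by (simp add: powr_add[symmetric] algebra_simps)
  also have "\<dots> = s powr (\<theta> / 2 - n - \<kappa>) * 2 powr (\<kappa> + n - \<theta> / 2)"
  proof -
    have "\<kappa> + n - \<theta> / 2 = - (\<theta> / 2 - n - \<kappa>)" by simp
    then show ?thesis using s by (simp only: powr_minus) (simp add: powr_divide field_simps)
  qed
  finally show ?thesis by (simp add: mult_ac)
qed

theorem regularity:
  fixes G :: "('a, 'm) monoid_scheme"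
  assumes heat: "\<And>t f. t > 0 \<Longrightarrow> H t f = heat G \<mu> t f"
    and p: "1 < p" and \<theta>: "\<theta> > 0"
    and uf: "graph_closure p A u (\<lambda>x. - f x)"
    and f: "f \<in> lipschitz_space G M \<mu> B p \<theta>"
  shows "lipschitz_seminorm G M \<mu> p (\<theta> + 2) u < \<infinity>"
    and "i \<in> I \<Longrightarrow> lipschitz_seminorm_distr G M \<mu> B p (\<theta> + 1) (distr_deriv (X i) (regular_distr M u)) < \<infinity>"
    and "i \<in> I \<Longrightarrow> j \<in> I \<Longrightarrow>
      lipschitz_seminorm_distr G M \<mu> B p \<theta> (distr_deriv (X i) (distr_deriv (X j) (regular_distr M u))) < \<infinity>"
    and "(\<lambda>m. lipschitz_seminorm_distr G M \<mu> B p \<theta>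
            (\<lambda>\<phi>. regular_distr M f \<phi> +
               (\<Sum>i\<in>{i\<in>I. i \<le> m}. distr_deriv (X i) (distr_deriv (X i) (regular_distr M u)) \<phi>))) \<longlonglongrightarrow> 0"
proof -
  define n where "n = lip_order \<theta>"
  have n: "real n > \<theta> / 2" "real n \<le> \<theta> / 2 + 1" using lip_order[of \<theta>] \<theta> by (auto simp: n_def)
  obtain dA where dA: "smoothing p (real n) dA (A ^^ n)" using smoothing_A_power[OF p] by blast
  note u = graph_closure_closure(1)[OF uf]
  have nf: "(\<lambda>x. - f x) \<in> B_closure p" by (rule graph_closure_closure(2)[OF uf A_B])
  \<comment> \<open>\<open>A\<close> is minus the Laplacian, so it maps u to -f and -u to f. The
    first form serves the derivatives, the second the tails of the series.\<close>
  have uf': "graph_closure p A (\<lambda>x. - u x) f" using graph_closure_minus[OF uf smoothing_A[OF p]] by simp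
  have fcl: "f \<in> B_closure p" by (rule graph_closure_closure(2)[OF uf' A_B])
  obtain \<psi> where \<psi>: "\<And>k. \<psi> k \<in> B" "\<And>k. lipschitz_seminorm G M \<mu> p \<theta> (\<psi> k) < \<infinity>"
    "(\<lambda>k. Lp_norm M p (\<lambda>x. \<psi> k x - f x)) \<longlonglongrightarrow> 0"
    "\<And>\<epsilon>. \<epsilon> > 0 \<Longrightarrow> \<exists>N. \<forall>k\<ge>N. \<forall>l\<ge>N. lipschitz_seminorm G M \<mu> p \<theta> (\<lambda>x. \<psi> k x - \<psi> l x) < \<epsilon>"
    using f unfolding lipschitz_space_def by blast
  have \<psi>f: "(\<lambda>k. pnorm M p (\<lambda>x. \<psi> k x - f x)) \<longlonglongrightarrow> 0"
    by (intro tendsto_pnorm[OF always_eventually \<psi>(3)] allI Lp_diff B_Lp \<psi>(1) p B_closure_Lp[OF fcl])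
  \<comment> \<open>Membership in the completion enters in this form: after subtraction of a test
    function the decay constant is \<open>\<epsilon>\<close>, because the differences
    \<open>\<psi> k - \<psi> N\<close> have seminorm below \<open>\<epsilon>\<close> and
    \<open>\<psi> k\<close> tends to \<open>f\<close> in \<open>Lp\<close>.\<close>
  have small: "\<exists>\<psi>\<in>B. lipschitz_seminorm G M \<mu> p \<theta> \<psi> < \<infinity> \<and>
      (\<forall>t>0. pnorm M p (ext_op p (A ^^ n) t (\<lambda>x. f x - \<psi> x)) \<le> \<epsilon> * t powr (\<theta> / 2 - n))" if \<epsilon>: "\<epsilon> > 0" for \<epsilon>
  proof -
    obtain N where N: "\<And>k l. k \<ge> N \<Longrightarrow> l \<ge> N \<Longrightarrow> lipschitz_seminorm G M \<mu> p \<theta> (\<lambda>x. \<psi> k x - \<psi> l x) < ennreal \<epsilon>"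
      using \<psi>(4)[of "ennreal \<epsilon>"] \<epsilon> by auto
    have "pnorm M p (ext_op p (A ^^ n) t (\<lambda>x. f x - \<psi> N x)) \<le> \<epsilon> * t powr (\<theta> / 2 - n)" if t: "t > 0" for t
    proof (rule LIMSEQ_le_const2)
      have d: "\<And>k. (\<lambda>x. \<psi> k x - \<psi> N x) \<in> B" "(\<lambda>k. pnorm M p (\<lambda>x. (\<psi> k x - \<psi> N x) - (f x - \<psi> N x))) \<longlonglongrightarrow> 0"
        using \<psi>f \<psi>(1) by (auto intro: B_diff)
      show "(\<lambda>k. pnorm M p (H t ((A ^^ n) (\<lambda>x. \<psi> k x - \<psi> N x)))) \<longlonglongrightarrow> pnorm M p (ext_op p (A ^^ n) t (\<lambda>x. f x - \<psi> N x))"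
        by (rule ext_op_tendsto(2)[OF dA p t ext_op_diff_le(1)[OF dA p t fcl \<psi>(1)] d])
      have "pnorm M p (H t ((A ^^ n) (\<lambda>x. \<psi> k x - \<psi> N x))) \<le> \<epsilon> * t powr (\<theta> / 2 - n)" if k: "k \<ge> N" for k
      proof -
        have "ennreal (t powr (real n - \<theta> / 2) * pnorm M p (H t ((A ^^ n) (\<lambda>x. \<psi> k x - \<psi> N x)))) \<le> ennreal \<epsilon>"
          using lipschitz_seminorm_ge[OF heat p d(1)[of k] t, where \<theta> = \<theta>] N[OF k order_refl] unfolding n_def by (meson order_trans less_imp_le)
        then have "t powr (real n - \<theta> / 2) * pnorm M p (H t ((A ^^ n) (\<lambda>x. \<psi> k x - \<psi> N x))) \<le> \<epsilon>"
          using \<epsilon> by (simp add: ennreal_le_iff)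
        from powr_cancel_le[OF this t] show ?thesis by simp
      qed
      then show "\<exists>N'. \<forall>k\<ge>N'. pnorm M p (H t ((A ^^ n) (\<lambda>x. \<psi> k x - \<psi> N x))) \<le> \<epsilon> * t powr (\<theta> / 2 - n)" by blast
    qed
    then show ?thesis using \<psi>(1,2) by blast
  qed
  have "\<exists>C\<ge>0. \<forall>t>0. pnorm M p (ext_op p (A ^^ n) t f) \<le> C * t powr (\<theta> / 2 - n)"
  proof -
    obtain \<psi> where \<psi>: "\<psi> \<in> B" "lipschitz_seminorm G M \<mu> p \<theta> \<psi> < \<infinity>"
      "\<And>t. t > 0 \<Longrightarrow> pnorm M p (ext_op p (A ^^ n) t (\<lambda>x. f x - \<psi> x)) \<le> 1 * t powr (\<theta> / 2 - n)"
      using small[of 1] by auto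
    obtain c where c: "c \<ge> 0" "lipschitz_seminorm G M \<mu> p \<theta> \<psi> = ennreal c" using \<psi>(2) by (cases "lipschitz_seminorm G M \<mu> p \<theta> \<psi>") auto
    show ?thesis
    proof (intro exI[of _ "1 + c"] conjI allI impI)
      fix t :: real assume t: "t > 0"
      have "t powr (real n - \<theta> / 2) * pnorm M p (H t ((A ^^ n) \<psi>)) \<le> c"
        using lipschitz_seminorm_ge[OF heat p \<psi>(1) t, where \<theta> = \<theta>] c unfolding n_def by (simp add: ennreal_le_iff)
      from powr_cancel_le[OF this t] have "pnorm M p (H t ((A ^^ n) \<psi>)) \<le> c * t powr (\<theta> / 2 - n)" by simp
      then show "pnorm M p (ext_op p (A ^^ n) t f) \<le> (1 + c) * t powr (\<theta> / 2 - n)"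
        using ext_op_diff_le(2)[OF dA p t fcl \<psi>(1)] \<psi>(3)[OF t] unfolding distrib_right by linarith
    qed (use c in simp)
  qed
  then obtain C where C: "C \<ge> 0" "\<And>t. t > 0 \<Longrightarrow> pnorm M p (ext_op p (A ^^ n) t f) \<le> C * t powr (\<theta> / 2 - n)" by blast
  have C': "pnorm M p (ext_op p (A ^^ n) t (\<lambda>x. - f x)) \<le> C * t powr (\<theta> / 2 - n)" if "t > 0" for t
    using C(2)[OF that] ext_op_minus(2)[OF dA p that fcl] by simp

  show "lipschitz_seminorm G M \<mu> p (\<theta> + 2) u < \<infinity>"
  proof -
    have "lipschitz_seminorm G M \<mu> p (\<theta> + 2) u \<le> ennreal C"
    proof (rule lipschitz_seminorm_le[OF heat p _ u])
      fix t :: real assume t: "t > 0"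
      \<comment> \<open>One power of \<open>A\<close> is spent on replacing \<open>u\<close> by
        \<open>-f\<close>, which accounts for the gain of 2 in the order.\<close>
      have "pnorm M p (ext_op p (A ^^ lip_order (\<theta> + 2)) t u) = pnorm M p (ext_op p (\<lambda>\<phi>. (A ^^ n) (A \<phi>)) t u)"
        using lip_order_add_2[OF \<theta>] by (simp add: n_def funpow_Suc_right comp_def del: funpow.simps)
      also have "\<dots> = pnorm M p (ext_op p (A ^^ n) t (\<lambda>x. - f x))"
        by (rule graph_closure_ext_op(1)[OF uf smoothing_A[OF p] dA p t, symmetric])
      also have "\<dots> \<le> C * t powr (\<theta> / 2 - n)" by (rule C'[OF t])
      also have "\<theta> / 2 - n = (\<theta> + 2) / 2 - lip_order (\<theta> + 2)" by (simp add: lip_order_add_2[OF \<theta>] n_def add_divide_distrib)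
      finally show "pnorm M p (ext_op p (A ^^ lip_order (\<theta> + 2)) t u) \<le> C * t powr ((\<theta> + 2) / 2 - lip_order (\<theta> + 2))" .
    qed (use \<theta> in auto)
    then show ?thesis by (simp add: le_less_trans)
  qed

  \<comment> \<open>The common scheme for fields, products of fields and tails: construct the
    \<open>Lp\<close> value \<open>v\<close> of \<open>P\<close> at \<open>w\<close>, bound its
    seminorm, and recognise \<open>U\<close> as the distribution of \<open>v\<close> by moving
    \<open>P\<close> to the test function as \<open>P'\<close>.\<close>
  have distr: "lipschitz_seminorm_distr G M \<mu> B p \<theta>' U \<le> ennreal ((1 + 1 / (real (lip_order \<theta>') - \<theta>' / 2)) * D)"
    if P: "smoothing p \<kappa> c P" and \<kappa>: "0 < \<kappa>" "\<kappa> \<le> 1" and \<theta>': "\<theta>' = \<theta> + 2 - 2 * \<kappa>" and w: "graph_closure p A w g" and D: "D \<ge> 0"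
      and bd: "\<And>s. s > 0 \<Longrightarrow> pnorm M p (ext_op p (\<lambda>\<phi>. P ((A ^^ n) \<phi>)) s g) \<le> D * s powr (\<theta> / 2 - n - \<kappa>)"
      and adj: "\<And>\<eta>. \<eta> \<in> B \<Longrightarrow> P' \<eta> \<in> B" "\<And>\<phi> \<eta>. \<phi> \<in> B \<Longrightarrow> \<eta> \<in> B \<Longrightarrow> (\<integral>x. P \<phi> x * \<eta> x \<partial>M) = (\<integral>x. \<phi> x * P' \<eta> x \<partial>M)"
      and U: "\<And>\<eta>. \<eta> \<in> B \<Longrightarrow> U \<eta> = (\<integral>x. w x * P' \<eta> x \<partial>M)"
    for \<kappa> c P \<theta>' w g D P' U
  proof -
    have \<theta>'0: "\<theta>' > 0" using \<theta> \<kappa> \<theta>' by simp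
    obtain v where v: "graph_closure p P w v"
      "\<And>t. t > 0 \<Longrightarrow> pnorm M p (ext_op p (A ^^ lip_order \<theta>') t v) \<le> (1 + 1 / (real (lip_order \<theta>') - \<theta>' / 2)) * D * t powr (\<theta>' / 2 - lip_order \<theta>')"
    proof (rule graph_closure_estimate[OF p n P \<kappa> \<theta> w D bd, where \<sigma> = "\<theta>' / 2" and m = "lip_order \<theta>'"])
      show "\<theta>' / 2 = \<theta> / 2 + 1 - \<kappa>" using \<theta>' by simp
      show "real (lip_order \<theta>') > \<theta>' / 2" "real (lip_order \<theta>') \<le> \<theta>' / 2 + 1" using lip_order[of \<theta>'] \<theta>'0 by auto
    qed auto
    have vcl: "v \<in> B_closure p" by (rule graph_closure_closure(2)[OF v(1) smoothingD(2)[OF P]])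
    have rep: "U \<eta> = regular_distr M v \<eta>" if "\<eta> \<in> B" for \<eta>
      unfolding regular_distr_def U[OF that]
      by (rule graph_closure_integral[OF v(1) smoothingD(2)[OF P] p that adj(1)[OF that] adj(2)[OF _ that], symmetric])
    have "lipschitz_seminorm_distr G M \<mu> B p \<theta>' U \<le> lipschitz_seminorm G M \<mu> p \<theta>' v"
      unfolding lipschitz_seminorm_distr_def using rep B_closure_Lp[OF vcl] by (intro INF_lower) auto
    also have "\<dots> \<le> ennreal ((1 + 1 / (real (lip_order \<theta>') - \<theta>' / 2)) * D)"
      by (rule lipschitz_seminorm_le[OF heat p \<theta>'0 vcl v(2)])
    finally show ?thesis .
  qed

  show "lipschitz_seminorm_distr G M \<mu> B p (\<theta> + 1) (distr_deriv (X i) (regular_distr M u)) < \<infinity>" if i: "i \<in> I" for i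
  proof -
    note P = smoothing_X[OF p i]
    let ?D = "(2 * min 1 (p - 1)) powr (- (1 / 2)) * 2 powr (1 / 2 + n - \<theta> / 2) * C"
    \<comment> \<open>The formal adjoint of a field is its negative, which is the sign built into
      \<open>distr_deriv\<close>.\<close>
    have adj1: "(\<lambda>x. - X i \<eta> x) \<in> B" if "\<eta> \<in> B" for \<eta> by (rule B_minus[OF X_B[OF i that]])
    have adj2: "(\<integral>x. X i \<phi> x * \<eta> x \<partial>M) = (\<integral>x. \<phi> x * - X i \<eta> x \<partial>M)" if "\<phi> \<in> B" "\<eta> \<in> B" for \<phi> \<eta>
      using integration_by_parts[OF i that] by simp
    have "lipschitz_seminorm_distr G M \<mu> B p (\<theta> + 1) (distr_deriv (X i) (regular_distr M u))
      \<le> ennreal ((1 + 1 / (real (lip_order (\<theta> + 1)) - (\<theta> + 1) / 2)) * ?D)"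
    proof (rule distr[OF P _ _ _ uf _ ext_op_comp_power_le[OF P p nf C'] adj1 adj2])
    qed (use C(1) in \<open>auto simp: distr_deriv_def regular_distr_def\<close>)
    then show ?thesis by (simp add: le_less_trans)
  qed

  show "lipschitz_seminorm_distr G M \<mu> B p \<theta> (distr_deriv (X i) (distr_deriv (X j) (regular_distr M u))) < \<infinity>"
    if ij: "i \<in> I" "j \<in> I" for i j
  proof -
    obtain d where "smoothing p (1 / 2 + 1 / 2) d (\<lambda>\<phi>. X i (X j \<phi>))"
      using smoothing_comp[OF smoothing_X[OF p ij(1)] smoothing_X[OF p ij(2)] p] by blast
    then have P: "smoothing p 1 d (\<lambda>\<phi>. X i (X j \<phi>))" by simp
    let ?D = "d * 2 powr ((1::real) + real n - \<theta> / 2) * C"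
    \<comment> \<open>Taking adjoints reverses the order of the two fields, and their signs
      cancel.\<close>
    have adj1: "X j (X i \<eta>) \<in> B" if "\<eta> \<in> B" for \<eta> by (intro X_B ij that)
    have adj2: "(\<integral>x. X i (X j \<phi>) x * \<eta> x \<partial>M) = (\<integral>x. \<phi> x * X j (X i \<eta>) x \<partial>M)" if "\<phi> \<in> B" "\<eta> \<in> B" for \<phi> \<eta>
      using integration_by_parts[OF ij(1) X_B[OF ij(2) that(1)] that(2)] integration_by_parts[OF ij(2) that(1) X_B[OF ij(1) that(2)]] by simp
    have "lipschitz_seminorm_distr G M \<mu> B p \<theta> (distr_deriv (X i) (distr_deriv (X j) (regular_distr M u)))
      \<le> ennreal ((1 + 1 / (real (lip_order \<theta>) - \<theta> / 2)) * ?D)"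
    proof (rule distr[OF P _ _ _ uf _ ext_op_comp_power_le[OF P p nf C'] adj1 adj2])
    qed (use C(1) smoothingD(1)[OF P] in \<open>auto simp: distr_deriv_def regular_distr_def\<close>)
    then show ?thesis by (simp add: le_less_trans)
  qed

  let ?N = "\<lambda>m. lipschitz_seminorm_distr G M \<mu> B p \<theta>
            (\<lambda>\<phi>. regular_distr M f \<phi> +
               (\<Sum>i\<in>{i\<in>I. i \<le> m}. distr_deriv (X i) (distr_deriv (X i) (regular_distr M u)) \<phi>))"
  show "?N \<longlonglongrightarrow> 0"
  proof (rule tendsto_0_ennrealI)
    fix e :: real assume e: "e > 0"
    \<comment> \<open>\<open>k1\<close> comes from \<open>graph_closure_estimate\<close>,
      \<open>k2\<close> from sharing the time between a tail and the decay of order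
      \<open>n\<close>; neither depends on the length of the partial sum.\<close>
    define k1 where "k1 = 1 + 1 / (real (lip_order \<theta>) - \<theta> / 2)"
    define k2 where "k2 = sos_const p * 2 powr (1 + n - \<theta> / 2)"
    have k: "k1 \<ge> 0" "k2 \<ge> 0" using n unfolding k1_def k2_def n_def sos_const_def by auto
    define \<epsilon> where "\<epsilon> = e / (k1 * k2 + 1)"
    have \<epsilon>: "\<epsilon> > 0" using e k unfolding \<epsilon>_def by (intro divide_pos_pos add_nonneg_pos mult_nonneg_nonneg) auto
    obtain \<psi> where \<psi>: "\<psi> \<in> B"
      "\<And>t. t > 0 \<Longrightarrow> pnorm M p (ext_op p (A ^^ n) t (\<lambda>x. f x - \<psi> x)) \<le> \<epsilon> * t powr (\<theta> / 2 - n)"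
      using small[OF \<epsilon>] by blast
    have A\<psi>: "(A ^^ n) \<psi> \<in> B" by (rule B_power_in[OF \<psi>(1)])
    \<comment> \<open>The tail acts on \<open>(A ^^ n) \<psi>\<close>, so the finite support of this
      function, not that of \<open>\<psi>\<close>, decides from where on the tail vanishes.\<close>
    obtain m0 where m0: "\<And>i. i \<in> I \<Longrightarrow> X i ((A ^^ n) \<psi>) \<noteq> (\<lambda>x. 0) \<Longrightarrow> i \<le> m0"
      using X_finite[OF A\<psi>] unfolding finite_nat_set_iff_bounded_le by blast
    show "\<forall>\<^sub>F m in sequentially. ?N m \<le> ennreal e"
      unfolding eventually_sequentially
    proof (intro exI[of _ m0] allI impI)
      fix m assume m: "m \<ge> m0"
      define J where "J = {i \<in> I. \<not> i \<le> m}"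
      have J: "J \<subseteq> I" by (auto simp: J_def)
      define P where "P = sum_of_squares_op J X"
      have P: "smoothing p 1 (sos_const p) P" unfolding P_def by (rule smoothing_partial_sos[OF p J])
      note PA = smoothing_comp[OF P dA p]
      have P0: "P ((A ^^ n) \<psi>) = (\<lambda>x. 0)"
      proof -
        have "{i \<in> J. X i ((A ^^ n) \<psi>) \<noteq> (\<lambda>x. 0)} = {}" using m0 m by (force simp: J_def)
        then show ?thesis unfolding P_def by (subst sum_of_squares_op_def) (simp only: sum.empty)
      qed
      have bd: "pnorm M p (ext_op p (\<lambda>\<phi>. P ((A ^^ n) \<phi>)) s f) \<le> k2 * \<epsilon> * s powr (\<theta> / 2 - n - 1)" if s: "s > 0" for s
      proof -
        have "pnorm M p (H s (P ((A ^^ n) \<psi>))) = pnorm M p (\<lambda>x. 0)"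
          unfolding P0 using s by (intro pnorm_cong H_zero) auto
        also have "\<dots> = 0" using p by (simp add: pnorm_def)
        finally show ?thesis
          using ext_op_diff_le(2)[OF PA p s fcl \<psi>(1)]
            ext_op_comp_power_le[OF P p ext_op_diff_le(1)[OF dA p s fcl \<psi>(1)] \<psi>(2) s]
          unfolding k2_def by simp
      qed
      have split: "A \<eta> x = (\<Sum>i\<in>{i\<in>I. i \<le> m}. X i (X i \<eta>) x) + P \<eta> x" if \<eta>: "\<eta> \<in> B" for \<eta> x
      proof -
        have fin: "finite {i \<in> I. i \<le> m}" by (rule finite_subset[of _ "{..m}"]) auto
        have "A \<eta> x = (\<Sum>i\<in>{i \<in> I. i \<le> m \<and> X i \<eta> \<noteq> (\<lambda>x. 0)} \<union> {i \<in> J. X i \<eta> \<noteq> (\<lambda>x. 0)}. X i (X i \<eta>) x)"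
          unfolding sum_of_squares_op_def by (rule sum.cong) (auto simp: J_def)
        also have "\<dots> = (\<Sum>i\<in>{i \<in> I. i \<le> m \<and> X i \<eta> \<noteq> (\<lambda>x. 0)}. X i (X i \<eta>) x) + P \<eta> x"
          unfolding P_def sum_of_squares_op_def
          by (rule sum.union_disjoint)
             (use X_finite[OF \<eta>] J in \<open>auto simp: J_def intro: finite_subset[OF _ X_finite[OF \<eta>]] finite_subset[OF _ fin]\<close>)
        also have "(\<Sum>i\<in>{i \<in> I. i \<le> m \<and> X i \<eta> \<noteq> (\<lambda>x. 0)}. X i (X i \<eta>) x) = (\<Sum>i\<in>{i\<in>I. i \<le> m}. X i (X i \<eta>) x)"
          by (rule sum.mono_neutral_left[OF fin]) (auto simp: X_zero)
        finally show ?thesis .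
      qed
      have adj2: "(\<integral>x. P \<phi> x * \<eta> x \<partial>M) = (\<integral>x. \<phi> x * P \<eta> x \<partial>M)" if "\<phi> \<in> B" "\<eta> \<in> B" for \<phi> \<eta>
        unfolding P_def by (rule partial_sos_symmetric[OF J that])
      \<comment> \<open>What remains of the series after \<open>m\<close> is the tail operator
        applied to \<open>-u\<close>, so the scheme is used with \<open>uf'\<close>.\<close>
      have "?N m \<le> ennreal (k1 * (k2 * \<epsilon>))"
        unfolding k1_def
      proof (rule distr[OF P _ _ _ uf' _ bd smoothingD(2)[OF P] adj2])
        fix \<eta> assume \<eta>: "\<eta> \<in> B"
        define q where "q = p / (p - 1)"
        note pq = dual_exponent[OF p q_def]
        have int: "integrable M (\<lambda>x. u x * \<zeta> x)" if "\<zeta> \<in> B" for \<zeta>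
          by (rule Lp_holder(1)[OF B_closure_Lp[OF u] B_Lp[OF that pq(1)] p pq(1,2)])
        have XXB: "X i (X i \<eta>) \<in> B" if "i \<in> {i\<in>I. i \<le> m}" for i using that X_B \<eta> by auto
        have "regular_distr M f \<eta> = (\<integral>x. - u x * A \<eta> x \<partial>M)"
          unfolding regular_distr_def
          by (rule graph_closure_integral[OF uf' A_B p \<eta> A_B[OF \<eta>] partial_sos_symmetric[OF order_refl _ \<eta>]])
        also have "\<dots> = - ((\<Sum>i\<in>{i\<in>I. i \<le> m}. \<integral>x. u x * X i (X i \<eta>) x \<partial>M) + (\<integral>x. u x * P \<eta> x \<partial>M))"
        proof -
          have "(\<integral>x. - u x * A \<eta> x \<partial>M) = - (\<integral>x. (\<Sum>i\<in>{i\<in>I. i \<le> m}. u x * X i (X i \<eta>) x) + u x * P \<eta> x \<partial>M)"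
            unfolding Bochner_Integration.integral_minus[symmetric]
            by (rule Bochner_Integration.integral_cong) (simp_all add: split[OF \<eta>] distrib_left sum_distrib_left sum_negf)
          also have "(\<integral>x. (\<Sum>i\<in>{i\<in>I. i \<le> m}. u x * X i (X i \<eta>) x) + u x * P \<eta> x \<partial>M)
              = (\<integral>x. (\<Sum>i\<in>{i\<in>I. i \<le> m}. u x * X i (X i \<eta>) x) \<partial>M) + (\<integral>x. u x * P \<eta> x \<partial>M)"
            by (intro Bochner_Integration.integral_add Bochner_Integration.integrable_sum int XXB smoothingD(2)[OF P \<eta>])
          also have "(\<integral>x. (\<Sum>i\<in>{i\<in>I. i \<le> m}. u x * X i (X i \<eta>) x) \<partial>M) = (\<Sum>i\<in>{i\<in>I. i \<le> m}. \<integral>x. u x * X i (X i \<eta>) x \<partial>M)"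
            by (intro Bochner_Integration.integral_sum int XXB)
          finally show ?thesis .
        qed
        finally show "regular_distr M f \<eta> + (\<Sum>i\<in>{i\<in>I. i \<le> m}. distr_deriv (X i) (distr_deriv (X i) (regular_distr M u)) \<eta>)
            = (\<integral>x. - u x * P \<eta> x \<partial>M)"
          by (simp add: distr_deriv_def regular_distr_def)
      qed (use k \<epsilon> in auto)
      also have "ennreal (k1 * (k2 * \<epsilon>)) \<le> ennreal e"
      proof (rule ennreal_leI)
        have "k1 * (k2 * \<epsilon>) \<le> (k1 * k2 + 1) * \<epsilon>" using \<epsilon> by (simp add: algebra_simps)
        also have "\<dots> = e" using k by (simp add: \<epsilon>_def add_nonneg_eq_0_iff)
        finally show "k1 * (k2 * \<epsilon>) \<le> e" .
      qed
      finally show "?N m \<le> ennreal e" .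
    qed
  qed
qed

end

section \<open>Smooth functions\<close>

lemma smooth_fun_on_const: "smooth_fun_on d U (\<lambda>x. c)"
  unfolding smooth_fun_on_def
  by (rule exI[of _ "\<lambda>w x. if w = [] then c else 0"]) auto

definition iterated_partials :: "nat \<Rightarrow> (nat \<Rightarrow> real) set \<Rightarrow> (nat list \<Rightarrow> (nat \<Rightarrow> real) \<Rightarrow> real) \<Rightarrow> bool" where
  "iterated_partials d U F \<longleftrightarrow> (\<forall>w. set w \<subseteq> {..<d} \<longrightarrow>
     continuous_map (subtopology (Euclidean_space d) U) euclideanreal (F w) \<and>
     (\<forall>i<d. \<forall>x\<in>U. ((\<lambda>s. F w (x(i := s))) has_real_derivative F (i # w) x) (at (x i))))"

lemma smooth_fun_on_iff:
  "smooth_fun_on d U f \<longleftrightarrow> (\<exists>F. (\<forall>x\<in>U. F [] x = f x) \<and> iterated_partials d U F)"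
  by (simp add: smooth_fun_on_def iterated_partials_def)

lemma smooth_fun_on_add:
  assumes "smooth_fun_on d U f" "smooth_fun_on d U g"
  shows "smooth_fun_on d U (\<lambda>x. f x + g x)"
proof -
  obtain F G where FG: "\<forall>x\<in>U. F [] x = f x" "iterated_partials d U F"
    "\<forall>x\<in>U. G [] x = g x" "iterated_partials d U G"
    using assms unfolding smooth_fun_on_iff by blast
  note F = FG(1) FG(2)[unfolded iterated_partials_def, rule_format]
  note G = FG(3) FG(4)[unfolded iterated_partials_def, rule_format]
  show ?thesis unfolding smooth_fun_on_def
    by (rule exI[of _ "\<lambda>w x. F w x + G w x"])
       (use F G in \<open>auto intro!: continuous_map_add DERIV_add\<close>)
qed

text \<open>Leibniz rule: the iterated derivative of a product along the word \<open>w\<close> is the sum over all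
  ways of distributing the letters of \<open>w\<close> to the two factors.\<close>

fun shuffles_of :: "nat list \<Rightarrow> (nat list \<times> nat list) list" where
  "shuffles_of [] = [([], [])]"
| "shuffles_of (i # w) = map (\<lambda>(a, b). (i # a, b)) (shuffles_of w) @ map (\<lambda>(a, b). (a, i # b)) (shuffles_of w)"

lemma shuffles_of_set: "(a, b) \<in> set (shuffles_of w) \<Longrightarrow> set a \<subseteq> set w \<and> set b \<subseteq> set w"
  by (induction w arbitrary: a b) fastforce+

lemma smooth_fun_on_mult:
  assumes "smooth_fun_on d U f" "smooth_fun_on d U g"
  shows "smooth_fun_on d U (\<lambda>x. f x * g x)"
proof -
  obtain F G where FG: "\<forall>x\<in>U. F [] x = f x" "iterated_partials d U F"
    "\<forall>x\<in>U. G [] x = g x" "iterated_partials d U G"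
    using assms unfolding smooth_fun_on_iff by blast
  note F = FG(1) FG(2)[unfolded iterated_partials_def, rule_format]
  note G = FG(3) FG(4)[unfolded iterated_partials_def, rule_format]
  \<comment> \<open>The sum runs over a list, not a set, because a word with repeated letters yields
    the same pair of words several times.\<close>
  define P where "P l x = (\<Sum>(a, b)\<leftarrow>l. F a x * G b x)" for l x
  have P_simps: "P [] x = 0" "P ((a, b) # l) x = F a x * G b x + P l x" "P (l @ l') x = P l x + P l' x" for l l' a b x
    by (simp_all add: P_def)
  have cont: "continuous_map (subtopology (Euclidean_space d) U) euclideanreal (P l)"
    if "\<And>a b. (a, b) \<in> set l \<Longrightarrow> set a \<subseteq> {..<d} \<and> set b \<subseteq> {..<d}" for l
    using that
  proof (induction l)
    case (Cons ab l)
    obtain a b where ab: "ab = (a, b)" by fastforce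
    have sub: "set a \<subseteq> {..<d}" "set b \<subseteq> {..<d}" using Cons.prems[of a b] ab by auto
    have "P (ab # l) = (\<lambda>x. F a x * G b x + P l x)" by (simp add: fun_eq_iff ab P_simps)
    then show ?case
      by (auto intro!: continuous_map_add continuous_map_real_mult Cons.IH F(2)[THEN conjunct1, OF sub(1)]
          G(2)[THEN conjunct1, OF sub(2)] dest: Cons.prems[OF list.set_intros(2)])
  next
    case Nil
    have "P [] = (\<lambda>x. 0)" by (simp add: fun_eq_iff P_simps)
    then show ?case by simp
  qed
  have der: "((\<lambda>s. P l (x(i := s))) has_real_derivative
      P (map (\<lambda>(a, b). (i # a, b)) l @ map (\<lambda>(a, b). (a, i # b)) l) x) (at (x i))"
    if "\<And>a b. (a, b) \<in> set l \<Longrightarrow> set a \<subseteq> {..<d} \<and> set b \<subseteq> {..<d}" "i < d" "x \<in> U" for l i x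
    using that(1)
  proof (induction l)
    case (Cons ab l)
    obtain a b where ab: "ab = (a, b)" by fastforce
    have "((\<lambda>s. F a (x(i := s))) has_real_derivative F (i # a) x) (at (x i))"
      "((\<lambda>s. G b (x(i := s))) has_real_derivative G (i # b) x) (at (x i))"
      using Cons.prems[of a b] F(2)[of a] G(2)[of b] that(2,3) ab by auto
    moreover have "((\<lambda>s. P l (x(i := s))) has_real_derivative
      P (map (\<lambda>(a, b). (i # a, b)) l @ map (\<lambda>(a, b). (a, i # b)) l) x) (at (x i))"
      by (rule Cons.IH) (use Cons.prems in auto)
    ultimately show ?case unfolding ab P_simps
      by (auto intro!: derivative_eq_intros simp: P_simps algebra_simps)
  qed (simp add: P_def)
  show ?thesis unfolding smooth_fun_on_def
  proof (intro exI[of _ "\<lambda>w. P (shuffles_of w)"] conjI allI impI ballI)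
    show "P (shuffles_of []) x = f x * g x" if "x \<in> U" for x using that F(1) G(1) by (simp add: P_def)
    fix w assume w: "set w \<subseteq> {..<d}"
    have sub: "(a, b) \<in> set (shuffles_of w) \<Longrightarrow> set a \<subseteq> {..<d} \<and> set b \<subseteq> {..<d}" for a b
      using shuffles_of_set[of a b w] w by blast
    show "continuous_map (subtopology (Euclidean_space d) U) euclideanreal (P (shuffles_of w))" by (rule cont[OF sub])
    fix i x assume "i < d" "x \<in> U"
    show "((\<lambda>s. P (shuffles_of w) (x(i := s))) has_real_derivative P (shuffles_of (i # w)) x) (at (x i))"
      using der[OF sub \<open>i < d\<close> \<open>x \<in> U\<close>] by simp
  qed
qed

lemma smooth_functions_add:
  "f \<in> smooth_functions S N \<Longrightarrow> g \<in> smooth_functions S N \<Longrightarrow> (\<lambda>x. f x + g x) \<in> smooth_functions S N"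
  unfolding smooth_functions_def by (auto intro!: smooth_fun_on_add)

lemma smooth_functions_mult:
  "f \<in> smooth_functions S N \<Longrightarrow> g \<in> smooth_functions S N \<Longrightarrow> (\<lambda>x. f x * g x) \<in> smooth_functions S N"
  unfolding smooth_functions_def by (auto intro!: smooth_fun_on_mult)

lemma smooth_functions_cmult:
  "f \<in> smooth_functions S N \<Longrightarrow> (\<lambda>x. c * f x) \<in> smooth_functions S N"
  unfolding smooth_functions_def by (auto intro!: smooth_fun_on_mult smooth_fun_on_const)

lemma smooth_fun_on_cong:
  assumes "smooth_fun_on d U f" "\<And>x. x \<in> U \<Longrightarrow> f x = g x" shows "smooth_fun_on d U g"
  using assms unfolding smooth_fun_on_def by (elim exE) (rule exI, auto)

lemma chart_inv:
  assumes "smooth_mfd T N" "(U, \<phi>) \<in> snd N" "x \<in> U"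
  shows "the_inv_into U \<phi> (\<phi> x) = x" "U \<subseteq> topspace T"
proof -
  have *: "openin T U" "homeomorphic_map (subtopology T U) (subtopology (Euclidean_space (fst N)) (\<phi> ` U)) \<phi>"
    using assms(1,2) unfolding smooth_mfd_def by auto
  show "U \<subseteq> topspace T" using openin_subset[OF *(1)] .
  then have "inj_on \<phi> U" using homeomorphic_imp_injective_map[OF *(2)] by (simp add: inf_absorb2)
  then show "the_inv_into U \<phi> (\<phi> x) = x" using assms(3) by (rule the_inv_into_f_f)
qed

lemma smooth_functions_const:
  assumes "smooth_mfd T N" "S = topspace T"
  shows "(\<lambda>x. if x \<in> S then c else 0) \<in> smooth_functions S N"
proof -
  have "smooth_fun_on (fst N) (\<phi> ` U) (\<lambda>z. if the_inv_into U \<phi> z \<in> S then c else 0)"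
    if "(U, \<phi>) \<in> snd N" for U \<phi>
    by (rule smooth_fun_on_cong[OF smooth_fun_on_const[of _ _ c]])
       (use chart_inv(2)[OF assms(1) that, THEN subsetD] chart_inv(1)[OF assms(1) that] assms(2) in auto)
  then show ?thesis by (auto simp: smooth_functions_def)
qed

text \<open>The empty word in \<open>smooth_fun_on\<close> gives continuity in coordinates; charts
  are homeomorphisms onto their images, and the pieces are glued over the open chart
  domains.\<close>

lemma smooth_functions_continuous:
  assumes "smooth_mfd T N" "S = topspace T" "f \<in> smooth_functions S N"
  shows "continuous_map T euclideanreal f"
proof (rule pasting_lemma[where I = "snd N" and T = fst and f = "\<lambda>_. f"])
  fix c assume c: "c \<in> snd N"
  obtain U \<phi> where U: "c = (U, \<phi>)" by fastforce
  have *: "openin T U" "homeomorphic_map (subtopology T U) (subtopology (Euclidean_space (fst N)) (\<phi> ` U)) \<phi>"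
    "smooth_fun_on (fst N) (\<phi> ` U) (\<lambda>z. f (the_inv_into U \<phi> z))"
    using assms c unfolding smooth_mfd_def smooth_functions_def U by auto
  show "openin T (fst c)" using * U by simp
  obtain F where F: "\<And>z. z \<in> \<phi> ` U \<Longrightarrow> F z = f (the_inv_into U \<phi> z)"
    "continuous_map (subtopology (Euclidean_space (fst N)) (\<phi> ` U)) euclideanreal F"
    using *(3) unfolding smooth_fun_on_def by (metis empty_set empty_subsetI)
  have "continuous_map (subtopology T U) euclideanreal (F \<circ> \<phi>)"
    by (rule continuous_map_compose[OF homeomorphic_imp_continuous_map[OF *(2)] F(2)])
  then show "continuous_map (subtopology T (fst c)) euclideanreal f"
    unfolding U fst_conv
    by (rule continuous_map_eq) (use F(1) chart_inv(1)[OF assms(1) c[unfolded U]] in auto)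
next
  fix x assume "x \<in> topspace T"
  then have "x \<in> (\<Union>(U, \<phi>) \<in> snd N. U)" using assms(1) unfolding smooth_mfd_def by blast
  then show "\<exists>j. j \<in> snd N \<and> x \<in> fst j \<and> f x = f x" by fastforce
qed auto

lemma quotient_map_coset_topology:
  "continuous_map T (quotient_topology T q) q"
  "topspace (quotient_topology T q) = q ` topspace T"
proof -
  have "openin (quotient_topology T q) (q ` topspace T)"
  proof -
    have "{x \<in> topspace T. q x \<in> q ` topspace T} = topspace T" by auto
    then show ?thesis unfolding openin_quotient_topology by simp
  qed
  moreover have "topspace (quotient_topology T q) \<subseteq> q ` topspace T"
    using openin_topspace[of "quotient_topology T q"] unfolding openin_quotient_topology by blast
  ultimately show "topspace (quotient_topology T q) = q ` topspace T" using openin_subset by blast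
  then show "continuous_map T (quotient_topology T q) q"
    by (auto simp: continuous_map_def openin_quotient_topology)
qed

section \<open>Compact groups and Haar measure\<close>

text \<open>The balls of radius 1 / (n + 1) about the points of finite nets form a countable
  base.\<close>

lemma compact_metrizable_second_countable:
  assumes "compact_space T" "metrizable_space T" shows "second_countable T"
proof -
  obtain M d where "Metric_space M d" and T: "T = Metric_space.mtopology M d"
    using assms(2) by (auto simp: metrizable_space_def)
  interpret Metric_space M d by fact
  have top: "topspace T = M" by (simp add: T)
  have "\<exists>F. finite F \<and> F \<subseteq> M \<and> M \<subseteq> (\<Union>x\<in>F. mball x (inverse (real (Suc n))))" for n
  proof -
    have "\<exists>\<F>. finite \<F> \<and> \<F> \<subseteq> (\<lambda>x. mball x (inverse (real (Suc n)))) ` M \<and> topspace T \<subseteq> \<Union>\<F>"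
      using assms(1) unfolding compact_space_alt
      by (elim allE[of _ "(\<lambda>x. mball x (inverse (real (Suc n)))) ` M"] impE)
         (auto simp: T intro!: bexI)
    then show ?thesis unfolding top by (metis (no_types, lifting) finite_subset_image)
  qed
  then obtain F where F: "\<And>n. finite (F n)" "\<And>n. F n \<subseteq> M" "\<And>n. M \<subseteq> (\<Union>x\<in>F n. mball x (inverse (real (Suc n))))" by metis
  define \<B> where "\<B> = (\<Union>n. (\<lambda>x. mball x (inverse (real (Suc n)))) ` F n)"
  have "countable \<B>" unfolding \<B>_def by (intro countable_UN countable_finite finite_imageI F(1) countableI_type)
  moreover have "\<forall>V\<in>\<B>. openin T V" unfolding \<B>_def T using openin_mball by blast
  moreover have "\<exists>V\<in>\<B>. x \<in> V \<and> V \<subseteq> U" if U: "openin T U" "x \<in> U" for U x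
  proof -
    obtain r where r: "r > 0" "mball x r \<subseteq> U" and xM: "x \<in> M" using U unfolding T openin_mtopology by blast
    obtain n where n: "inverse (real (Suc n)) < r / 2" using reals_Archimedean[of "r / 2"] r(1) by auto
    obtain y where y: "y \<in> F n" "x \<in> mball y (inverse (real (Suc n)))" using F(3)[of n] xM by auto
    have "mball y (inverse (real (Suc n))) \<subseteq> mball x r"
    proof
      fix z assume z: "z \<in> mball y (inverse (real (Suc n)))"
      have "d x z \<le> d x y + d y z" using z y xM by (intro triangle) auto
      also have "\<dots> < r / 2 + r / 2" using z y n by (intro add_strict_mono) (auto simp: commute intro: less_trans)
      finally show "z \<in> mball x r" using z xM by auto
    qed
    then show ?thesis using y r by (intro bexI[of _ "mball y (inverse (real (Suc n)))"]) (auto simp: \<B>_def)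
  qed
  ultimately show ?thesis unfolding second_countable_def by (intro exI[of _ \<B>]) simp
qed

lemma borel_sigma_simps:
  shows "space (borel_sigma T) = topspace T" "openin T U \<Longrightarrow> U \<in> sets (borel_sigma T)"
    "sets (borel_sigma T) = sigma_sets (topspace T) {U. openin T U}"
proof -
  have "{U. openin T U} \<subseteq> Pow (topspace T)" using openin_subset by auto
  then show "space (borel_sigma T) = topspace T" "openin T U \<Longrightarrow> U \<in> sets (borel_sigma T)"
    "sets (borel_sigma T) = sigma_sets (topspace T) {U. openin T U}"
    by (simp_all add: borel_sigma_def sets_measure_of space_measure_of)
qed

lemma continuous_map_measurable:
  assumes "continuous_map T S f" shows "f \<in> borel_sigma T \<rightarrow>\<^sub>M borel_sigma S"
proof (rule measurable_sigma_sets[OF borel_sigma_simps(3)])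
    fix A assume "A \<in> {U. openin S U}"
    then have "openin T {x \<in> topspace T. f x \<in> A}" using assms by (simp add: continuous_map_def)
    moreover have "f -` A \<inter> space (borel_sigma T) = {x \<in> topspace T. f x \<in> A}" by (auto simp: borel_sigma_simps)
    ultimately show "f -` A \<inter> space (borel_sigma T) \<in> sets (borel_sigma T)" by (simp add: borel_sigma_simps)
next
  show "{U. openin S U} \<subseteq> Pow (topspace S)" using openin_subset by auto
  show "f \<in> space (borel_sigma T) \<rightarrow> topspace S" using assms by (auto simp: borel_sigma_simps continuous_map_def)
qed

lemma borel_sigma_euclidean: "borel_sigma euclidean = borel"
  by (simp add: borel_sigma_def borel_def)

lemma continuous_map_borel_measurable:
  "continuous_map T euclideanreal f \<Longrightarrow> f \<in> borel_measurable (borel_sigma T)"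
  using continuous_map_measurable[of T euclideanreal f] by (simp add: borel_sigma_euclidean)

text \<open>Countable bases write an open set of the product as a countable union of open
  rectangles, so it lies in the product of the Borel sigma-algebras. This makes the group
  multiplication measurable in the sense required by Fubini's theorem.\<close>

lemma continuous_map_prod_measurable:
  assumes "second_countable T" "second_countable S" "continuous_map (prod_topology T S) R f"
  shows "f \<in> borel_sigma T \<Otimes>\<^sub>M borel_sigma S \<rightarrow>\<^sub>M borel_sigma R"
proof -
  obtain \<B> where \<B>: "countable \<B>" "\<And>V. V \<in> \<B> \<Longrightarrow> openin T V"
    "\<And>U x. openin T U \<Longrightarrow> x \<in> U \<Longrightarrow> \<exists>V\<in>\<B>. x \<in> V \<and> V \<subseteq> U" using assms(1) unfolding second_countable_def by metis
  obtain \<C> where \<C>: "countable \<C>" "\<And>V. V \<in> \<C> \<Longrightarrow> openin S V"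
    "\<And>U x. openin S U \<Longrightarrow> x \<in> U \<Longrightarrow> \<exists>V\<in>\<C>. x \<in> V \<and> V \<subseteq> U" using assms(2) unfolding second_countable_def by metis
  show ?thesis
  proof (rule measurable_sigma_sets[OF borel_sigma_simps(3)])
    fix A assume "A \<in> {U. openin R U}"
    then have o: "openin (prod_topology T S) {z \<in> topspace (prod_topology T S). f z \<in> A}"
      using assms(3) by (simp add: continuous_map_def)
    let ?W = "{z \<in> topspace (prod_topology T S). f z \<in> A}"
    let ?D = "{(U, V). U \<in> \<B> \<and> V \<in> \<C> \<and> U \<times> V \<subseteq> ?W}"
    have "f -` A \<inter> space (borel_sigma T \<Otimes>\<^sub>M borel_sigma S) = ?W"
      by (auto simp: borel_sigma_simps space_pair_measure)
    also have "\<dots> = (\<Union>(U, V)\<in>?D. U \<times> V)"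
    proof
      show "?W \<subseteq> (\<Union>(U, V)\<in>?D. U \<times> V)"
      proof
        fix z assume z: "z \<in> ?W"
        obtain x y where xy: "z = (x, y)" by fastforce
        have "\<exists>U V. openin T U \<and> openin S V \<and> x \<in> U \<and> y \<in> V \<and> U \<times> V \<subseteq> ?W"
          using o z unfolding xy openin_prod_topology_alt by blast
        then obtain U V where UV: "openin T U" "openin S V" "x \<in> U" "y \<in> V" "U \<times> V \<subseteq> ?W" by blast
        obtain U' V' where "U' \<in> \<B>" "x \<in> U'" "U' \<subseteq> U" "V' \<in> \<C>" "y \<in> V'" "V' \<subseteq> V"
          using \<B>(3)[OF UV(1,3)] \<C>(3)[OF UV(2,4)] by blast
        then have "(U', V') \<in> ?D \<and> z \<in> U' \<times> V'" using UV(5) xy by blast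
        then show "z \<in> (\<Union>(U, V)\<in>?D. U \<times> V)" by blast
      qed
    qed auto
    also have "\<dots> \<in> sets (borel_sigma T \<Otimes>\<^sub>M borel_sigma S)"
    proof (rule sets.countable_UN'')
      show "countable ?D" by (rule countable_subset[OF _ countable_SIGMA[OF \<B>(1), of "\<lambda>_. \<C>"]]) (use \<C>(1) in auto)
      show "(case c of (U, V) \<Rightarrow> U \<times> V) \<in> sets (borel_sigma T \<Otimes>\<^sub>M borel_sigma S)" if "c \<in> ?D" for c
        using that \<B>(2) \<C>(2) by (auto simp: borel_sigma_simps intro!: pair_measureI)
    qed
    finally show "f -` A \<inter> space (borel_sigma T \<Otimes>\<^sub>M borel_sigma S) \<in> sets (borel_sigma T \<Otimes>\<^sub>M borel_sigma S)" .
  next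
    show "f \<in> space (borel_sigma T \<Otimes>\<^sub>M borel_sigma S) \<rightarrow> topspace R"
      using assms(3) by (auto simp: borel_sigma_simps space_pair_measure continuous_map_def)
  qed (use openin_subset in auto)
qed

section \<open>Haar measure on a compact metrizable group\<close>

locale compact_group = topological_group G T
  for G :: "('g, 'm) monoid_scheme" (structure) and T +
  fixes \<nu> :: "'g measure"
  assumes compact: "compact_space T" and metrizable: "metrizable_space T"
    and haar: "normalized_haar_measure G T \<nu>"
begin

lemma sets_haar: "sets \<nu> = sets (borel_sigma T)" and prob_haar: "prob_space \<nu>"
  using haar by (auto simp: normalized_haar_measure_def)

lemma space_borel: "space (borel_sigma T) = carrier G"
  by (simp add: borel_sigma_simps topspace_eq)

lemma space_haar: "space \<nu> = carrier G"
  using sets_eq_imp_space_eq[OF sets_haar] by (simp add: space_borel)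

lemma measurable_mult: "(\<lambda>(x, y). x \<otimes> y) \<in> borel_sigma T \<Otimes>\<^sub>M borel_sigma T \<rightarrow>\<^sub>M borel_sigma T"
  using compact_metrizable_second_countable[OF compact metrizable] continuous_mult
  by (intro continuous_map_prod_measurable)

lemma measurable_inv [measurable]: "(\<lambda>x. inv x) \<in> borel_sigma T \<rightarrow>\<^sub>M borel_sigma T"
  by (rule continuous_map_measurable[OF continuous_inv])

lemma measurable_mult2 [measurable (raw)]:
  "f \<in> N \<rightarrow>\<^sub>M borel_sigma T \<Longrightarrow> g \<in> N \<rightarrow>\<^sub>M borel_sigma T \<Longrightarrow> (\<lambda>x. f x \<otimes> g x) \<in> N \<rightarrow>\<^sub>M borel_sigma T"
  using measurable_compose[OF measurable_Pair measurable_mult, of f N g] by simp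

lemma measurable_haar: "measurable \<nu> N = measurable (borel_sigma T) N"
  by (rule measurable_cong_sets[OF sets_haar refl])

lemma measurable_const_group [measurable (raw)]: "a \<in> carrier G \<Longrightarrow> (\<lambda>x. a) \<in> N \<rightarrow>\<^sub>M borel_sigma T"
  by (simp add: space_borel)

lemma continuous_measurable: "continuous_map T euclideanreal f \<Longrightarrow> f \<in> borel_measurable (borel_sigma T)"
  by (rule continuous_map_borel_measurable)

lemma continuous_mult2:
  "continuous_map S T f \<Longrightarrow> continuous_map S T g \<Longrightarrow> continuous_map S T (\<lambda>x. f x \<otimes> g x)"
  using continuous_map_compose[OF continuous_map_pairedI continuous_mult, of S f g] by (simp add: o_def)

lemma distr_left_translation:
  assumes a: "a \<in> carrier G" shows "distr \<nu> (borel_sigma T) (\<lambda>x. a \<otimes> x) = \<nu>"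
proof (rule measure_eqI)
  fix A assume "A \<in> sets (distr \<nu> (borel_sigma T) (\<lambda>x. a \<otimes> x))"
  then have A: "A \<in> sets (borel_sigma T)" by simp
  have AG: "A \<subseteq> carrier G" using sets.sets_into_space[OF A] by (simp add: space_borel)
  have "(\<lambda>x. a \<otimes> x) -` A \<inter> space \<nu> = inv a <# A"
  proof (intro subset_antisym subsetI)
    fix x assume x: "x \<in> (\<lambda>x. a \<otimes> x) -` A \<inter> space \<nu>"
    then have "x = inv a \<otimes> (a \<otimes> x)" using a by (simp add: space_haar m_assoc[symmetric])
    then show "x \<in> inv a <# A" using x unfolding l_coset_def by blast
  next
    fix x assume "x \<in> inv a <# A"
    then obtain h where h: "h \<in> A" "x = inv a \<otimes> h" unfolding l_coset_def by blast
    then show "x \<in> (\<lambda>x. a \<otimes> x) -` A \<inter> space \<nu>" using a AG by (auto simp: space_haar m_assoc[symmetric] subset_iff)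
  qed
  then have "emeasure (distr \<nu> (borel_sigma T) (\<lambda>x. a \<otimes> x)) A = emeasure \<nu> (inv a <# A)"
    using A a by (subst emeasure_distr) (auto simp: measurable_haar)
  then show "emeasure (distr \<nu> (borel_sigma T) (\<lambda>x. a \<otimes> x)) A = emeasure \<nu> A"
    using haar a A by (simp add: normalized_haar_measure_def)
qed (simp add: sets_haar)

lemma nn_integral_left_translation:
  assumes a: "a \<in> carrier G" and f: "f \<in> borel_measurable (borel_sigma T)"
  shows "(\<integral>\<^sup>+x. f (a \<otimes> x) \<partial>\<nu>) = (\<integral>\<^sup>+x. f x \<partial>\<nu>)"
proof -
  have "(\<integral>\<^sup>+x. f x \<partial>distr \<nu> (borel_sigma T) (\<lambda>x. a \<otimes> x)) = (\<integral>\<^sup>+x. f (a \<otimes> x) \<partial>\<nu>)"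
    using a f by (intro nn_integral_distr) (auto simp: measurable_haar)
  then show ?thesis by (simp add: distr_left_translation[OF a])
qed

text \<open>Integrate \<open>f (inv x \<otimes> y)\<close> in the two orders.\<close>

lemma nn_integral_inv:
  assumes f: "f \<in> borel_measurable (borel_sigma T)"
  shows "(\<integral>\<^sup>+x. f (inv x) \<partial>\<nu>) = (\<integral>\<^sup>+x. f x \<partial>\<nu>)"
proof -
  interpret prob_space \<nu> by (rule prob_haar)
  interpret P: pair_sigma_finite \<nu> \<nu> by standard
  have one: "(\<integral>\<^sup>+x. c \<partial>\<nu>) = c" for c using emeasure_space_1 by (simp only: nn_integral_const mult_1_right)
  have m: "(\<lambda>(x, y). f (inv x \<otimes> y)) \<in> borel_measurable (\<nu> \<Otimes>\<^sub>M \<nu>)"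
    unfolding measurable_cong_sets[OF sets_pair_measure_cong[OF sets_haar sets_haar] refl]
    using f by measurable
  have "(\<integral>\<^sup>+x. f x \<partial>\<nu>) = (\<integral>\<^sup>+x. \<integral>\<^sup>+y. f (inv x \<otimes> y) \<partial>\<nu> \<partial>\<nu>)"
  proof -
    have "(\<integral>\<^sup>+x. \<integral>\<^sup>+y. f (inv x \<otimes> y) \<partial>\<nu> \<partial>\<nu>) = (\<integral>\<^sup>+x. (\<integral>\<^sup>+y. f y \<partial>\<nu>) \<partial>\<nu>)"
      by (intro nn_integral_cong nn_integral_left_translation f) (simp add: space_haar)
    then show ?thesis by (simp only: one)
  qed
  also have "\<dots> = (\<integral>\<^sup>+y. \<integral>\<^sup>+x. f (inv x \<otimes> y) \<partial>\<nu> \<partial>\<nu>)"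
    using P.Fubini[OF m] by simp
  also have "\<dots> = (\<integral>\<^sup>+y. \<integral>\<^sup>+x. f (inv x) \<partial>\<nu> \<partial>\<nu>)"
  proof (rule nn_integral_cong)
    fix y assume y: "y \<in> space \<nu>"
    then have "(\<integral>\<^sup>+x. f (inv x \<otimes> y) \<partial>\<nu>) = (\<integral>\<^sup>+x. f (inv (inv y \<otimes> x)) \<partial>\<nu>)"
      by (intro nn_integral_cong) (simp add: space_haar inv_mult_group)
    also have "\<dots> = (\<integral>\<^sup>+x. f (inv x) \<partial>\<nu>)"
      using y f by (intro nn_integral_left_translation) (auto simp: space_haar)
    finally show "(\<integral>\<^sup>+x. f (inv x \<otimes> y) \<partial>\<nu>) = (\<integral>\<^sup>+x. f (inv x) \<partial>\<nu>)" .
  qed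
  finally show ?thesis by (simp only: one)
qed

text \<open>Unimodularity: inversion preserves the measure and exchanges right with left
  translations.\<close>

lemma nn_integral_right_translation:
  assumes a: "a \<in> carrier G" and f: "f \<in> borel_measurable (borel_sigma T)"
  shows "(\<integral>\<^sup>+x. f (x \<otimes> a) \<partial>\<nu>) = (\<integral>\<^sup>+x. f x \<partial>\<nu>)"
proof -
  have "(\<integral>\<^sup>+x. f (x \<otimes> a) \<partial>\<nu>) = (\<integral>\<^sup>+x. f (inv (inv a \<otimes> inv x)) \<partial>\<nu>)"
    using a by (intro nn_integral_cong) (simp add: space_haar inv_mult_group)
  also have "\<dots> = (\<integral>\<^sup>+x. f (inv (inv a \<otimes> x)) \<partial>\<nu>)"
    using a f by (intro nn_integral_inv[of "\<lambda>z. f (inv (inv a \<otimes> z))"]) auto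
  also have "\<dots> = (\<integral>\<^sup>+x. f (inv x) \<partial>\<nu>)"
    using a f by (intro nn_integral_left_translation[of _ "\<lambda>z. f (inv z)"]) auto
  finally show ?thesis by (simp add: nn_integral_inv f)
qed

lemma distr_right_translation:
  assumes a: "a \<in> carrier G" shows "distr \<nu> (borel_sigma T) (\<lambda>x. x \<otimes> a) = \<nu>"
proof (rule measure_eqI)
  fix A assume "A \<in> sets (distr \<nu> (borel_sigma T) (\<lambda>x. x \<otimes> a))"
  then have A: "A \<in> sets (borel_sigma T)" by simp
  then have "emeasure (distr \<nu> (borel_sigma T) (\<lambda>x. x \<otimes> a)) A
      = (\<integral>\<^sup>+x. indicator A x \<partial>distr \<nu> (borel_sigma T) (\<lambda>x. x \<otimes> a))" by simp
  also have "\<dots> = (\<integral>\<^sup>+x. indicator A (x \<otimes> a) \<partial>\<nu>)"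
    using A a by (intro nn_integral_distr) (auto simp: measurable_haar)
  also have "\<dots> = (\<integral>\<^sup>+x. indicator A x \<partial>\<nu>)" using A a by (intro nn_integral_right_translation) auto
  finally show "emeasure (distr \<nu> (borel_sigma T) (\<lambda>x. x \<otimes> a)) A = emeasure \<nu> A"
    using A by (simp add: sets_haar)
qed (simp add: sets_haar)

lemma integral_right_translation:
  fixes f :: "'g \<Rightarrow> real"
  assumes "a \<in> carrier G" "f \<in> borel_measurable (borel_sigma T)"
  shows "(\<integral>x. f (x \<otimes> a) \<partial>\<nu>) = (\<integral>x. f x \<partial>\<nu>)"
  using integral_distr[of "\<lambda>x. x \<otimes> a" \<nu> "borel_sigma T" f] assms
  by (simp add: distr_right_translation measurable_haar)

text \<open>Translates of \<open>U\<close> cover the group, finitely many suffice by compactness,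
  and they would all be null sets together with \<open>U\<close>.\<close>

lemma haar_open_pos:
  assumes U: "openin T U" and x: "x \<in> U" shows "emeasure \<nu> U > 0"
proof (rule ccontr)
  assume "\<not> emeasure \<nu> U > 0"
  then have z: "emeasure \<nu> U = 0" by simp
  have xG: "x \<in> carrier G" using openin_subset[OF U] x topspace_eq by auto
  define W where "W a = {y \<in> topspace T. a \<otimes> y \<in> U}" for a
  have W: "openin T (W a)" if "a \<in> carrier G" for a
    unfolding W_def using continuous_map_openin_preimage_eq[THEN iffD1, OF continuous_mult2[of T "\<lambda>_. a" "\<lambda>y. y"]] that U
    by (simp add: topspace_eq vimage_def Int_def conj_commute)
  have Wz: "W a \<in> null_sets \<nu>" if "a \<in> carrier G" for a
  proof -
    have "emeasure \<nu> (W a) = emeasure (distr \<nu> (borel_sigma T) (\<lambda>y. a \<otimes> y)) U"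
      using U that by (subst emeasure_distr)
        (auto simp: measurable_haar borel_sigma_simps W_def space_haar topspace_eq intro!: arg_cong[where f = "emeasure \<nu>"])
    then show ?thesis using z W[OF that] that
      by (auto simp: distr_left_translation null_sets_def sets_haar borel_sigma_simps)
  qed
  have "topspace T \<subseteq> \<Union>(W ` carrier G)"
  proof
    fix y assume y: "y \<in> topspace T"
    then have "y \<in> W (x \<otimes> inv y)" using xG x by (auto simp: W_def topspace_eq m_assoc)
    then show "y \<in> \<Union>(W ` carrier G)" using xG y by (auto simp: topspace_eq)
  qed
  then have "\<exists>\<F>. finite \<F> \<and> \<F> \<subseteq> W ` carrier G \<and> topspace T \<subseteq> \<Union>\<F>"
    using compact unfolding compact_space_alt
    by (elim allE[of _ "W ` carrier G"] impE) (use W in auto)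
  then obtain F where F: "finite F" "F \<subseteq> W ` carrier G" "topspace T \<subseteq> \<Union>F" by blast
  have "\<Union>F \<in> null_sets \<nu>" using F Wz by (intro null_sets.finite_Union) auto
  then have "emeasure \<nu> (space \<nu>) = 0"
    using F(3) by (metis null_setsD1 null_sets_subset sets.top space_haar topspace_eq)
  then show False using prob_space.emeasure_space_1[OF prob_haar] by simp
qed

text \<open>A violation at one point persists on an open set, which has positive measure.\<close>

lemma continuous_AE_le:
  assumes "continuous_map T euclideanreal f" "AE x in \<nu>. f x \<le> c" "x \<in> carrier G"
  shows "f x \<le> c"
proof (rule ccontr)
  assume "\<not> f x \<le> c"
  let ?U = "{x \<in> topspace T. f x \<in> {c<..}}"
  have "openin euclideanreal {c<..}" by simp
  then have U: "openin T ?U" using assms(1) unfolding continuous_map_def by blast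
  have "emeasure \<nu> ?U > 0"
    by (rule haar_open_pos[OF U, of x]) (use assms(3) \<open>\<not> f x \<le> c\<close> in \<open>auto simp: topspace_eq\<close>)
  moreover have "emeasure \<nu> ?U = 0"
  proof -
    have "{x \<in> space \<nu>. \<not> f x \<le> c} \<in> null_sets \<nu>"
    proof (rule AE_iff_null[THEN iffD1, OF _ assms(2)])
      have "{x \<in> space \<nu>. \<not> f x \<le> c} = ?U" by (auto simp: space_haar topspace_eq)
      then show "{x \<in> space \<nu>. \<not> f x \<le> c} \<in> sets \<nu>" using U by (simp add: sets_haar borel_sigma_simps)
    qed
    also have "{x \<in> space \<nu>. \<not> f x \<le> c} = ?U" by (auto simp: space_haar topspace_eq)
    finally show ?thesis by auto
  qed
  ultimately show False by simp
qed

lemma continuous_bounded: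
  assumes "continuous_map T euclideanreal f"
  shows "\<exists>c. \<forall>x\<in>carrier G. \<bar>f x\<bar> \<le> c"
proof -
  have "compactin euclideanreal (f ` topspace T)"
    using image_compactin[OF _ assms] compact by (simp add: compact_space_def)
  then have "bounded (f ` carrier G)" by (simp add: compact_imp_bounded topspace_eq)
  then show ?thesis by (auto simp: bounded_real)
qed

text \<open>Projections along a compact factor are closed maps.\<close>

lemma uniform_continuity:
  assumes k: "continuous_map (prod_topology T T) euclideanreal (\<lambda>(x, y). k x y)"
    and y0: "y0 \<in> carrier G" and e: "e > 0"
  shows "\<exists>V. openin T V \<and> y0 \<in> V \<and> (\<forall>y\<in>V. \<forall>x\<in>carrier G. \<bar>k x y - k x y0\<bar> < e)"
proof -
  let ?C = "{z \<in> topspace (prod_topology T T). (\<lambda>(x, y). \<bar>k x y - k x y0\<bar>) z \<in> {e..}}"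
  have k0: "continuous_map (prod_topology T T) euclideanreal (\<lambda>(x, y). k x y0)"
  proof -
    have "continuous_map (prod_topology T T) (prod_topology T T) (\<lambda>z. (fst z, y0))"
      using y0 by (intro continuous_map_pairedI continuous_map_fst) (simp add: topspace_eq)
    from continuous_map_compose[OF this k] show ?thesis by (simp add: o_def case_prod_unfold)
  qed
  have "continuous_map (prod_topology T T) euclideanreal (\<lambda>z. \<bar>(\<lambda>(x, y). k x y) z - (\<lambda>(x, y). k x y0) z\<bar>)"
    by (intro continuous_map_real_abs continuous_map_diff k k0)
  then have "continuous_map (prod_topology T T) euclideanreal (\<lambda>(x, y). \<bar>k x y - k x y0\<bar>)"
    by (simp add: case_prod_unfold)
  then have "closedin (prod_topology T T) ?C"
    by (rule closedin_continuous_map_preimage) simp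
  then have cl: "closedin T (snd ` ?C)"
    using closed_map_snd[OF compact, of T] unfolding closed_map_def by blast
  show ?thesis
  proof (intro exI[of _ "topspace T - snd ` ?C"] conjI ballI)
    show "openin T (topspace T - snd ` ?C)" using cl by (rule openin_diff[OF openin_topspace])
    show "y0 \<in> topspace T - snd ` ?C" using y0 e by (auto simp: topspace_eq)
    fix y x assume y: "y \<in> topspace T - snd ` ?C" and x: "x \<in> carrier G"
    show "\<bar>k x y - k x y0\<bar> < e"
    proof (rule ccontr)
      assume "\<not> \<bar>k x y - k x y0\<bar> < e"
      then have "(x, y) \<in> ?C" using x y by (auto simp: topspace_eq)
      then show False using y by (auto intro: rev_image_eqI)
    qed
  qed
qed

lemma continuous_mult_arg:
  assumes "continuous_map T euclideanreal f"
  shows "continuous_map (prod_topology T T) euclideanreal (\<lambda>(x, y). f (x \<otimes> y))"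
    and "continuous_map (prod_topology T T) euclideanreal (\<lambda>(x, y). f (y \<otimes> x))"
proof -
  show "continuous_map (prod_topology T T) euclideanreal (\<lambda>(x, y). f (x \<otimes> y))"
    using continuous_map_compose[OF continuous_mult assms] by (simp add: o_def case_prod_unfold)
  have "continuous_map (prod_topology T T) T (\<lambda>z. snd z \<otimes> fst z)"
    by (intro continuous_mult2 continuous_map_fst continuous_map_snd)
  from continuous_map_compose[OF this assms]
  show "continuous_map (prod_topology T T) euclideanreal (\<lambda>(x, y). f (y \<otimes> x))"
    by (simp add: o_def case_prod_unfold)
qed

lemma continuous_translate:
  assumes "continuous_map T euclideanreal f" "a \<in> carrier G"
  shows "continuous_map T euclideanreal (\<lambda>x. f (a \<otimes> x))" "continuous_map T euclideanreal (\<lambda>x. f (x \<otimes> a))"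
proof -
  have "continuous_map T T (\<lambda>x. a \<otimes> x)" "continuous_map T T (\<lambda>x. x \<otimes> a)"
    using assms(2) by (auto intro!: continuous_mult2 simp: topspace_eq)
  from this[THEN continuous_map_compose, OF assms(1)]
  show "continuous_map T euclideanreal (\<lambda>x. f (a \<otimes> x))" "continuous_map T euclideanreal (\<lambda>x. f (x \<otimes> a))"
    by (simp_all add: o_def)
qed

lemma integrable_continuous:
  assumes "sets N = sets (borel_sigma T)" "prob_space N" "continuous_map T euclideanreal f"
  shows "integrable N f"
proof -
  interpret N: prob_space N by fact
  obtain c where c: "\<And>x. x \<in> carrier G \<Longrightarrow> \<bar>f x\<bar> \<le> c" using continuous_bounded[OF assms(3)] by blast
  have "space N = carrier G" using sets_eq_imp_space_eq[OF assms(1)] by (simp add: space_borel)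
  then show ?thesis using c continuous_measurable[OF assms(3)]
    by (intro N.integrable_const_bound[of _ c]) (auto simp: measurable_cong_sets[OF assms(1) refl])
qed

lemma continuous_convolution:
  assumes N: "sets N = sets (borel_sigma T)" "prob_space N" and f: "continuous_map T euclideanreal f"
  shows "continuous_map T euclideanreal (\<lambda>x. \<integral>y. f (y \<otimes> x) \<partial>N)"
  unfolding mtopology_is_euclidean[symmetric] Met_TC.continuous_map_to_metric
proof (intro ballI allI impI)
  fix x0 e assume x0: "x0 \<in> topspace T" and e: "(0::real) < e"
  interpret N: prob_space N by fact
  have sp: "space N = carrier G" using sets_eq_imp_space_eq[OF N(1)] by (simp add: space_borel)
  have x0G: "x0 \<in> carrier G" using x0 by (simp add: topspace_eq)
  have "e / 2 > 0" using e by simp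
  then obtain V where V: "openin T V" "x0 \<in> V" "\<And>x y. x \<in> V \<Longrightarrow> y \<in> carrier G \<Longrightarrow> \<bar>f (y \<otimes> x) - f (y \<otimes> x0)\<bar> < e / 2"
    using uniform_continuity[OF continuous_mult_arg(1)[OF f] x0G] by metis
  show "\<exists>U. openin T U \<and> x0 \<in> U \<and> (\<forall>x\<in>U. (\<integral>y. f (y \<otimes> x) \<partial>N) \<in> Met_TC.mball (\<integral>y. f (y \<otimes> x0) \<partial>N) e)"
  proof (intro exI[of _ V] conjI ballI V)
    fix x assume x: "x \<in> V"
    then have xG: "x \<in> carrier G" using openin_subset[OF V(1)] by (auto simp: topspace_eq)
    have i: "integrable N (\<lambda>y. f (y \<otimes> x))" "integrable N (\<lambda>y. f (y \<otimes> x0))"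
      using continuous_translate(2)[OF f] x0G xG by (auto intro!: integrable_continuous N)
    have "\<bar>(\<integral>y. f (y \<otimes> x) \<partial>N) - (\<integral>y. f (y \<otimes> x0) \<partial>N)\<bar> = \<bar>\<integral>y. f (y \<otimes> x) - f (y \<otimes> x0) \<partial>N\<bar>" using i by simp
    also have "\<dots> \<le> (\<integral>y. \<bar>f (y \<otimes> x) - f (y \<otimes> x0)\<bar> \<partial>N)" by (rule integral_abs_bound)
    also have "\<dots> \<le> (\<integral>y. e / 2 \<partial>N)"
      using i V(3)[OF x] by (intro integral_mono) (auto simp: sp intro: less_imp_le)
    also have "\<dots> < e" using e by (simp add: N.prob_space)
    finally show "(\<integral>y. f (y \<otimes> x) \<partial>N) \<in> Met_TC.mball (\<integral>y. f (y \<otimes> x0) \<partial>N) e"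
      by (simp add: dist_real_def abs_minus_commute)
  qed
qed

text \<open>By compactness the group splits into finitely many measurable pieces, each contained in
  a neighbourhood of some \<open>y k\<close> on which \<phi>(y x) varies by less than
  \<open>e\<close> in y, uniformly in x and in the finitely many functions. Sampling at
  \<open>y k\<close> with the mass of the piece as weight gives the convex combination.\<close>

lemma finite_convex_approx:
  assumes N: "sets N = sets (borel_sigma T)" "prob_space N"
    and \<Phi>: "finite \<Phi>" "\<And>\<phi>. \<phi> \<in> \<Phi> \<Longrightarrow> continuous_map T euclideanreal \<phi>" and e: "e > 0"
  shows "\<exists>n c y. (\<forall>k<n. c k \<ge> 0 \<and> y k \<in> carrier G) \<and> (\<Sum>k<n. c k) = (1::real) \<and>
    (\<forall>\<phi>\<in>\<Phi>. \<forall>x\<in>carrier G. \<bar>(\<Sum>k<n::nat. c k * \<phi> (y k \<otimes> x)) - (\<integral>z. \<phi> (z \<otimes> x) \<partial>N)\<bar> \<le> e)"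
proof -
  interpret N: prob_space N by fact
  have sp: "space N = carrier G" using sets_eq_imp_space_eq[OF N(1)] by (simp add: space_borel)
  have "\<exists>V. openin T V \<and> z \<in> V \<and> (\<forall>y\<in>V. \<forall>\<phi>\<in>\<Phi>. \<forall>x\<in>carrier G. \<bar>\<phi> (y \<otimes> x) - \<phi> (z \<otimes> x)\<bar> < e)"
    if z: "z \<in> carrier G" for z
  proof -
    have "\<exists>V. openin T V \<and> z \<in> V \<and> (\<forall>y\<in>V. \<forall>x\<in>carrier G. \<bar>\<phi> (y \<otimes> x) - \<phi> (z \<otimes> x)\<bar> < e)" if "\<phi> \<in> \<Phi>" for \<phi>
      by (rule uniform_continuity[OF continuous_mult_arg(2)[OF \<Phi>(2)[OF that]] z e])
    then obtain V where V: "\<And>\<phi>. \<phi> \<in> \<Phi> \<Longrightarrow> openin T (V \<phi>) \<and> z \<in> V \<phi> \<and>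
        (\<forall>y\<in>V \<phi>. \<forall>x\<in>carrier G. \<bar>\<phi> (y \<otimes> x) - \<phi> (z \<otimes> x)\<bar> < e)" by metis
    have "openin T (topspace T \<inter> \<Inter>(V ` \<Phi>))" using V \<Phi>(1) by (intro openin_Int_Inter) auto
    moreover have "z \<in> topspace T \<inter> \<Inter>(V ` \<Phi>)" using z V by (auto simp: topspace_eq)
    ultimately show ?thesis using V by (intro exI[of _ "topspace T \<inter> \<Inter>(V ` \<Phi>)"]) auto
  qed
  then obtain V where V: "\<And>z. z \<in> carrier G \<Longrightarrow> openin T (V z) \<and> z \<in> V z \<and>
      (\<forall>y\<in>V z. \<forall>\<phi>\<in>\<Phi>. \<forall>x\<in>carrier G. \<bar>\<phi> (y \<otimes> x) - \<phi> (z \<otimes> x)\<bar> < e)" by metis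
  have "\<exists>\<F>. finite \<F> \<and> \<F> \<subseteq> V ` carrier G \<and> topspace T \<subseteq> \<Union>\<F>"
    using compact unfolding compact_space_alt
    by (elim allE[of _ "V ` carrier G"] impE) (use V in \<open>auto simp: topspace_eq\<close>)
  then obtain F where F: "finite F" "F \<subseteq> carrier G" "topspace T \<subseteq> \<Union>(V ` F)"
    by (metis finite_subset_image)
  obtain ys where ys: "set ys = F" using finite_list[OF F(1)] by blast
  define n where "n = length ys"
  define y where "y k = ys ! k" for k
  \<comment> \<open>Empty from \<open>n\<close> on, so that disjointing an infinite sequence of sets
    leaves only \<open>n\<close> pieces.\<close>
  define W where "W k = (if k < n then V (y k) else {})" for k
  have yG: "y k \<in> carrier G" if "k < n" for k using that F(2) ys by (auto simp: y_def n_def)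
  have Wm: "range W \<subseteq> sets N" using V yG by (auto simp: W_def N(1) borel_sigma_simps)
  have D: "disjointed W k \<in> sets N" for k using sets.range_disjointed_sets[OF Wm] by auto
  have D0: "disjointed W k = {}" if "k \<ge> n" for k using that disjointed_subset[of W k] by (simp add: W_def)
  have "(\<Union>k. disjointed W k) = carrier G"
  proof -
    have "(\<Union>k. W k) = carrier G"
    proof
      have "W k \<subseteq> carrier G" for k
        using V[OF yG, of k, THEN conjunct1, THEN openin_subset] by (auto simp: W_def topspace_eq)
      then show "(\<Union>k. W k) \<subseteq> carrier G" by blast
      show "carrier G \<subseteq> (\<Union>k. W k)"
      proof
        fix x assume "x \<in> carrier G"
        then obtain z where "z \<in> set ys" "x \<in> V z" using F(3) ys by (auto simp: topspace_eq)
        then obtain k where "k < n" "y k = z" by (auto simp: in_set_conv_nth n_def y_def)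
        then have "x \<in> W k" using \<open>x \<in> V z\<close> by (simp add: W_def)
        then show "x \<in> (\<Union>k. W k)" by blast
      qed
    qed
    then show ?thesis by (simp add: UN_disjointed_eq)
  qed
  have one: "(\<Sum>k<n. indicator (disjointed W k) z) = (1::real)" if "z \<in> carrier G" for z
  proof -
    have "z \<in> (\<Union>k. disjointed W k)" using that \<open>(\<Union>k. disjointed W k) = carrier G\<close> by simp
    then obtain k where k: "z \<in> disjointed W k" by (rule UN_E)
    then have "k < n" using D0 by (metis empty_iff not_less)
    have "(\<Sum>j<n. indicator (disjointed W j) z) = (\<Sum>j<n. if j = k then 1 else (0::real))"
      using k disjoint_family_disjointed[of W] by (intro sum.cong) (auto simp: disjoint_family_on_def indicator_def)
    then show ?thesis using \<open>k < n\<close> by simp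
  qed
  define c where "c k = measure N (disjointed W k)" for k
  have ci: "(\<integral>z. indicator (disjointed W k) z * r \<partial>N) = c k * r" for k and r :: real
    using D[of k] by (simp add: c_def)
  have ii: "integrable N (\<lambda>z. indicator (disjointed W k) z * r)" for k and r :: real
    using D[of k] N.emeasure_finite by (simp add: integrable_indicator_iff less_top[symmetric])
  have sum1: "(\<Sum>k<n. c k) = 1"
  proof -
    have "(\<Sum>k<n. c k) = (\<integral>z. (\<Sum>k<n. indicator (disjointed W k) z * 1) \<partial>N)"
      using ci[of _ 1] ii[of _ 1] by (subst Bochner_Integration.integral_sum) auto
    also have "\<dots> = (\<integral>z. 1 \<partial>N)" by (rule Bochner_Integration.integral_cong) (auto simp: one sp)
    finally show ?thesis by (simp add: N.prob_space)
  qed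
  have main: "\<bar>(\<Sum>k<n. c k * \<phi> (y k \<otimes> x)) - (\<integral>z. \<phi> (z \<otimes> x) \<partial>N)\<bar> \<le> e"
    if \<phi>: "\<phi> \<in> \<Phi>" and x: "x \<in> carrier G" for \<phi> x
  proof -
    have i: "integrable N (\<lambda>z. \<phi> (z \<otimes> x))"
      by (intro integrable_continuous N continuous_translate \<Phi>(2) \<phi> x)
    have i2: "integrable N (\<lambda>z. \<Sum>k<n. indicator (disjointed W k) z * \<phi> (y k \<otimes> x))"
      by (intro Bochner_Integration.integrable_sum ii)
    have "(\<Sum>k<n. c k * \<phi> (y k \<otimes> x)) = (\<integral>z. (\<Sum>k<n. indicator (disjointed W k) z * \<phi> (y k \<otimes> x)) \<partial>N)"
      by (simp only: Bochner_Integration.integral_sum[OF ii] ci)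
    then have "\<bar>(\<Sum>k<n. c k * \<phi> (y k \<otimes> x)) - (\<integral>z. \<phi> (z \<otimes> x) \<partial>N)\<bar>
        = \<bar>\<integral>z. (\<Sum>k<n. indicator (disjointed W k) z * \<phi> (y k \<otimes> x)) - \<phi> (z \<otimes> x) \<partial>N\<bar>"
      using i i2 by simp
    also have "\<dots> \<le> (\<integral>z. \<bar>(\<Sum>k<n. indicator (disjointed W k) z * \<phi> (y k \<otimes> x)) - \<phi> (z \<otimes> x)\<bar> \<partial>N)"
      by (rule integral_abs_bound)
    also have "\<dots> \<le> (\<integral>z. e \<partial>N)"
    proof (rule integral_mono)
      fix z assume "z \<in> space N"
      then have z: "z \<in> carrier G" by (simp add: sp)
      have "(\<Sum>k<n. indicator (disjointed W k) z * \<phi> (y k \<otimes> x)) - \<phi> (z \<otimes> x)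
          = (\<Sum>k<n. indicator (disjointed W k) z * \<phi> (y k \<otimes> x)) - (\<Sum>k<n. indicator (disjointed W k) z) * \<phi> (z \<otimes> x)"
        by (simp add: one z)
      also have "\<dots> = (\<Sum>k<n. indicator (disjointed W k) z * (\<phi> (y k \<otimes> x) - \<phi> (z \<otimes> x)))"
        by (simp add: sum_distrib_right sum_subtractf right_diff_distrib)
      also have "\<bar>\<dots>\<bar> \<le> (\<Sum>k<n. \<bar>indicator (disjointed W k) z * (\<phi> (y k \<otimes> x) - \<phi> (z \<otimes> x))\<bar>)" by (rule sum_abs)
      also have "\<dots> \<le> (\<Sum>k<n. indicator (disjointed W k) z * e)"
      proof (rule sum_mono)
        fix k assume "k \<in> {..<n}"
        show "\<bar>indicator (disjointed W k) z * (\<phi> (y k \<otimes> x) - \<phi> (z \<otimes> x))\<bar> \<le> indicator (disjointed W k) z * e"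
        proof (cases "z \<in> disjointed W k")
          case True
          then have "z \<in> V (y k)" using disjointed_subset[of W k] \<open>k \<in> {..<n}\<close> by (auto simp: W_def)
          then have "\<bar>\<phi> (z \<otimes> x) - \<phi> (y k \<otimes> x)\<bar> < e" using V[OF yG] \<phi> x \<open>k \<in> {..<n}\<close> by auto
          then show ?thesis using True by (simp add: abs_minus_commute)
        qed simp
      qed
      also have "\<dots> = e" by (simp add: sum_distrib_right[symmetric] one z)
      finally show "\<bar>(\<Sum>k<n. indicator (disjointed W k) z * \<phi> (y k \<otimes> x)) - \<phi> (z \<otimes> x)\<bar> \<le> e" .
    qed (use i i2 in auto)
    finally show ?thesis by (simp add: N.prob_space)
  qed
  show ?thesis
    by (intro exI[of _ n] exI[of _ c] exI[of _ y] conjI allI impI ballI main sum1 yG) (simp_all add: c_def)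
qed

end

section \<open>The convolution semigroup as a semigroup of operators\<close>

locale compact_gaussian = compact_group G T \<nu> + symmetric_central_gaussian_semigroup G T \<mu>
  for G :: "('g, 'm) monoid_scheme" (structure) and T \<nu> \<mu>
begin

text \<open>The measures are constrained at positive times only, so at time 0 the identity is put in
  by hand.\<close>

definition heat_op :: "real \<Rightarrow> 'g operator" where
  "heat_op t f = (if t > 0 then heat G \<mu> t f else f)"

lemma heat_op_pos: "t > 0 \<Longrightarrow> heat_op t f = heat G \<mu> t f"
  and heat_op_0: "heat_op 0 f = f"
  by (simp_all add: heat_op_def)

lemma measurable_mu: "t > 0 \<Longrightarrow> measurable (\<mu> t) N = measurable (borel_sigma T) N"
  by (rule measurable_cong_sets[OF sets_eq refl])

lemma space_mu: "t > 0 \<Longrightarrow> space (\<mu> t) = carrier G"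
  using sets_eq_imp_space_eq[OF sets_eq] by (simp add: space_borel)

lemma heat_measurable:
  assumes t: "t > 0" and f: "f \<in> borel_measurable (borel_sigma T)"
  shows "heat G \<mu> t f \<in> borel_measurable (borel_sigma T)"
proof -
  interpret N: prob_space "\<mu> t" by (rule prob[OF t])
  have "(\<lambda>(x, y). f (x \<otimes> y)) \<in> borel_measurable (borel_sigma T \<Otimes>\<^sub>M \<mu> t)"
    unfolding measurable_cong_sets[OF sets_pair_measure_cong[OF refl sets_eq[OF t]] refl]
    using f by measurable
  from N.borel_measurable_lebesgue_integral[OF this]
  show ?thesis unfolding heat_def by simp
qed

lemma measurable_translate:
  assumes "f \<in> borel_measurable (borel_sigma T)" "x \<in> carrier G"
  shows "(\<lambda>y. f (x \<otimes> y)) \<in> borel_measurable (borel_sigma T)" "(\<lambda>y. f (y \<otimes> x)) \<in> borel_measurable (borel_sigma T)"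
  using assms by measurable

lemma heat_integrable:
  assumes t: "t > 0" and f: "f \<in> bounded_borel \<nu>" and x: "x \<in> carrier G"
  shows "integrable (\<mu> t) (\<lambda>y. f (x \<otimes> y))"
proof -
  interpret N: prob_space "\<mu> t" by (rule prob[OF t])
  obtain c where "\<And>x. x \<in> space \<nu> \<Longrightarrow> \<bar>f x\<bar> \<le> c" using bounded_borelE[OF f] by blast
  then show ?thesis using measurable_translate(1)[of f x] bounded_borel_measurable[OF f] x
    by (intro N.integrable_const_bound[of _ c]) (auto simp: measurable_mu t space_mu measurable_haar space_haar)
qed

lemma heat_abs_le:
  assumes t: "t > 0" and f: "f \<in> bounded_borel \<nu>" and c: "\<And>x. x \<in> space \<nu> \<Longrightarrow> \<bar>f x\<bar> \<le> c" and x: "x \<in> space \<nu>"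
  shows "\<bar>heat G \<mu> t f x\<bar> \<le> c"
proof -
  interpret N: prob_space "\<mu> t" by (rule prob[OF t])
  have xG: "x \<in> carrier G" using x by (simp add: space_haar)
  have "\<bar>heat G \<mu> t f x\<bar> \<le> (\<integral>y. \<bar>f (x \<otimes> y)\<bar> \<partial>\<mu> t)" unfolding heat_def by (rule integral_abs_bound)
  also have "\<dots> \<le> (\<integral>y. c \<partial>\<mu> t)"
    using heat_integrable[OF t f xG] c xG by (intro integral_mono) (auto simp: space_mu t space_haar)
  finally show ?thesis by (simp add: N.prob_space)
qed

lemma heat_bounded: "t > 0 \<Longrightarrow> f \<in> bounded_borel \<nu> \<Longrightarrow> heat G \<mu> t f \<in> bounded_borel \<nu>"
  using heat_measurable[of t f] heat_abs_le[of t f] by (auto simp: measurable_haar bounded_borel_def)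

lemma heat_add:
  assumes "t > 0" "f \<in> bounded_borel \<nu>" "g \<in> bounded_borel \<nu>" "x \<in> space \<nu>"
  shows "heat G \<mu> t (\<lambda>x. a * f x + b * g x) x = a * heat G \<mu> t f x + b * heat G \<mu> t g x"
  using heat_integrable[OF assms(1) assms(2)] heat_integrable[OF assms(1) assms(3)] assms(4)
  by (simp add: heat_def space_haar)

lemma heat_heat:
  assumes s: "s > 0" and t: "t > 0" and f: "f \<in> bounded_borel \<nu>" and x: "x \<in> space \<nu>"
  shows "heat G \<mu> s (heat G \<mu> t f) x = heat G \<mu> (s + t) f x"
proof -
  interpret S: prob_space "\<mu> s" by (rule prob[OF s])
  interpret U: prob_space "\<mu> t" by (rule prob[OF t])
  interpret P: pair_prob_space "\<mu> s" "\<mu> t" ..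
  have xG: "x \<in> carrier G" using x by (simp add: space_haar)
  have fm: "f \<in> borel_measurable (borel_sigma T)" using bounded_borel_measurable[OF f] by (simp add: measurable_haar)
  obtain c where c: "\<And>x. x \<in> carrier G \<Longrightarrow> \<bar>f x\<bar> \<le> c" using bounded_borelE[OF f] by (metis space_haar)
  have mm: "measurable (\<mu> s \<Otimes>\<^sub>M \<mu> t) N = measurable (borel_sigma T \<Otimes>\<^sub>M borel_sigma T) N" for N
    by (rule measurable_cong_sets[OF sets_pair_measure_cong[OF sets_eq[OF s] sets_eq[OF t]] refl])
  have m: "(\<lambda>(y, z). f (x \<otimes> (y \<otimes> z))) \<in> borel_measurable (\<mu> s \<Otimes>\<^sub>M \<mu> t)"
    unfolding mm using fm xG by measurable
  have i: "integrable (\<mu> s \<Otimes>\<^sub>M \<mu> t) (\<lambda>(y, z). f (x \<otimes> (y \<otimes> z)))"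
    using m c xG by (intro P.integrable_const_bound[of _ c] AE_I2) (auto simp: space_pair_measure space_mu s t)
  have "heat G \<mu> s (heat G \<mu> t f) x = (\<integral>y. \<integral>z. f (x \<otimes> (y \<otimes> z)) \<partial>\<mu> t \<partial>\<mu> s)"
    unfolding heat_def using xG by (intro Bochner_Integration.integral_cong refl) (auto simp: space_mu s t m_assoc)
  also have "\<dots> = (\<integral>yz. (\<lambda>(y, z). f (x \<otimes> (y \<otimes> z))) yz \<partial>(\<mu> s \<Otimes>\<^sub>M \<mu> t))"
    using P.integral_fst'[OF i] by simp
  also have "\<dots> = (\<integral>w. f (x \<otimes> w) \<partial>distr (\<mu> s \<Otimes>\<^sub>M \<mu> t) (borel_sigma T) (\<lambda>(x, y). x \<otimes> y))"
    using measurable_mult measurable_translate(1)[OF fm xG]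
    by (subst integral_distr) (auto simp: mm case_prod_unfold)
  finally show ?thesis by (simp add: convolution[OF s t] heat_def)
qed

lemma integral_mu_inv:
  fixes f :: "'g \<Rightarrow> real"
  assumes t: "t > 0" and f: "f \<in> borel_measurable (borel_sigma T)"
  shows "(\<integral>y. f (inv y) \<partial>\<mu> t) = (\<integral>y. f y \<partial>\<mu> t)"
proof -
  have "distr (\<mu> t) (borel_sigma T) (\<lambda>y. inv y) = \<mu> t"
  proof (rule measure_eqI)
    fix A assume "A \<in> sets (distr (\<mu> t) (borel_sigma T) (\<lambda>y. inv y))"
    then have A: "A \<in> sets (borel_sigma T)" by simp
    have AG: "A \<subseteq> carrier G" using sets.sets_into_space[OF A] by (simp add: space_borel)
    have "(\<lambda>y. inv y) -` A \<inter> space (\<mu> t) = (\<lambda>y. inv y) ` A"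
    proof (intro subset_antisym subsetI)
      fix y assume "y \<in> (\<lambda>y. inv y) -` A \<inter> space (\<mu> t)"
      then show "y \<in> (\<lambda>y. inv y) ` A" by (intro image_eqI[of _ _ "inv y"]) (auto simp: space_mu t)
    qed (use AG in \<open>auto simp: space_mu t\<close>)
    then show "emeasure (distr (\<mu> t) (borel_sigma T) (\<lambda>y. inv y)) A = emeasure (\<mu> t) A"
      using A symmetric[OF t A] by (subst emeasure_distr) (auto simp: measurable_mu t)
  qed (simp add: sets_eq t)
  then show ?thesis using integral_distr[of "\<lambda>y. inv y" "\<mu> t" "borel_sigma T" f] f
    by (simp add: measurable_mu t)
qed

text \<open>Conjugation by \<open>a\<close> preserves the measure and turns multiplication on the
  right into multiplication on the left. The convolution thus becomes an average of left
  translations, which \<open>finite_convex_approx\<close> can discretise.\<close>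

lemma heat_central:
  assumes t: "t > 0" and f: "f \<in> borel_measurable (borel_sigma T)" and a: "a \<in> carrier G"
  shows "heat G \<mu> t f a = (\<integral>y. f (y \<otimes> a) \<partial>\<mu> t)"
proof -
  have m: "(\<lambda>y. a \<otimes> y \<otimes> inv a) \<in> borel_sigma T \<rightarrow>\<^sub>M borel_sigma T" using a by measurable
  have d: "distr (\<mu> t) (borel_sigma T) (\<lambda>y. a \<otimes> y \<otimes> inv a) = \<mu> t"
  proof (rule measure_eqI)
    fix A assume "A \<in> sets (distr (\<mu> t) (borel_sigma T) (\<lambda>y. a \<otimes> y \<otimes> inv a))"
    then have A: "A \<in> sets (borel_sigma T)" by simp
    have AG: "A \<subseteq> carrier G" using sets.sets_into_space[OF A] by (simp add: space_borel)
    have "(\<lambda>y. a \<otimes> y \<otimes> inv a) -` A \<inter> space (\<mu> t) = (inv a <# A) #> a"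
    proof (intro subset_antisym subsetI)
      fix y assume y: "y \<in> (\<lambda>y. a \<otimes> y \<otimes> inv a) -` A \<inter> space (\<mu> t)"
      then have yG: "y \<in> carrier G" by (simp add: space_mu t)
      then have "y = inv a \<otimes> (a \<otimes> y \<otimes> inv a) \<otimes> a" using a by (simp add: m_assoc) (simp add: m_assoc[symmetric])
      then show "y \<in> (inv a <# A) #> a" using y unfolding l_coset_def r_coset_def by blast
    next
      fix y assume "y \<in> (inv a <# A) #> a"
      then obtain h where h: "h \<in> A" "y = inv a \<otimes> h \<otimes> a" unfolding l_coset_def r_coset_def by blast
      then have "h \<in> carrier G" using AG by blast
      then have "a \<otimes> y \<otimes> inv a = h" using h a by (simp add: m_assoc) (simp add: m_assoc[symmetric])
      then show "y \<in> (\<lambda>y. a \<otimes> y \<otimes> inv a) -` A \<inter> space (\<mu> t)" using h a \<open>h \<in> carrier G\<close> by (simp add: space_mu t)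
    qed
    then show "emeasure (distr (\<mu> t) (borel_sigma T) (\<lambda>y. a \<otimes> y \<otimes> inv a)) A = emeasure (\<mu> t) A"
      using A m central[OF t A a] by (subst emeasure_distr) (auto simp: measurable_mu t)
  qed (simp add: sets_eq t)
  have "(\<integral>y. f (y \<otimes> a) \<partial>\<mu> t) = (\<integral>y. f (y \<otimes> a) \<partial>distr (\<mu> t) (borel_sigma T) (\<lambda>y. a \<otimes> y \<otimes> inv a))" by (simp add: d)
  also have "\<dots> = (\<integral>y. f (a \<otimes> y \<otimes> inv a \<otimes> a) \<partial>\<mu> t)"
    using m measurable_translate(2)[OF f a] by (intro integral_distr) (auto simp: measurable_mu t)
  also have "\<dots> = heat G \<mu> t f a"
    unfolding heat_def using a by (intro Bochner_Integration.integral_cong refl) (auto simp: space_mu t m_assoc)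
  finally show ?thesis ..
qed

text \<open>Right invariance of Haar measure moves the translation to the other factor, with the
  inverse element; symmetry of the measure removes the inverse.\<close>

lemma heat_symmetric:
  assumes t: "t > 0" and f: "f \<in> bounded_borel \<nu>" and g: "g \<in> bounded_borel \<nu>"
  shows "(\<integral>x. heat G \<mu> t f x * g x \<partial>\<nu>) = (\<integral>x. f x * heat G \<mu> t g x \<partial>\<nu>)"
proof -
  interpret S: prob_space \<nu> by (rule prob_haar)
  interpret U: prob_space "\<mu> t" by (rule prob[OF t])
  interpret P: pair_prob_space \<nu> "\<mu> t" ..
  have fm: "f \<in> borel_measurable (borel_sigma T)" "g \<in> borel_measurable (borel_sigma T)"
    using bounded_borel_measurable[OF f] bounded_borel_measurable[OF g] by (simp_all add: measurable_haar)
  obtain c where c: "c \<ge> 0" "\<And>x. x \<in> carrier G \<Longrightarrow> \<bar>f x\<bar> \<le> c" using bounded_borelE[OF f] by (metis space_haar)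
  obtain d where d: "\<And>x. x \<in> carrier G \<Longrightarrow> \<bar>g x\<bar> \<le> d" using bounded_borelE[OF g] by (metis space_haar)
  have mm: "measurable (\<nu> \<Otimes>\<^sub>M \<mu> t) N = measurable (borel_sigma T \<Otimes>\<^sub>M borel_sigma T) N" for N
    by (rule measurable_cong_sets[OF sets_pair_measure_cong[OF sets_haar sets_eq[OF t]] refl])
  have i: "integrable (\<nu> \<Otimes>\<^sub>M \<mu> t) (\<lambda>(x, y). f (x \<otimes> y) * g x)"
  proof (intro P.integrable_const_bound[of _ "c * d"] AE_I2)
    show "(\<lambda>(x, y). f (x \<otimes> y) * g x) \<in> borel_measurable (\<nu> \<Otimes>\<^sub>M \<mu> t)" unfolding mm using fm by measurable
  qed (use c d in \<open>auto simp: space_pair_measure space_mu space_haar t abs_mult intro!: mult_mono\<close>)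
  have i2: "integrable (\<nu> \<Otimes>\<^sub>M \<mu> t) (\<lambda>(x, y). f x * g (x \<otimes> inv y))"
  proof (intro P.integrable_const_bound[of _ "c * d"] AE_I2)
    show "(\<lambda>(x, y). f x * g (x \<otimes> inv y)) \<in> borel_measurable (\<nu> \<Otimes>\<^sub>M \<mu> t)" unfolding mm using fm by measurable
  qed (use c d in \<open>auto simp: space_pair_measure space_mu space_haar t abs_mult intro!: mult_mono\<close>)
  have "(\<integral>x. heat G \<mu> t f x * g x \<partial>\<nu>) = (\<integral>x. \<integral>y. f (x \<otimes> y) * g x \<partial>\<mu> t \<partial>\<nu>)" by (simp add: heat_def)
  also have "\<dots> = (\<integral>y. \<integral>x. f (x \<otimes> y) * g x \<partial>\<nu> \<partial>\<mu> t)" by (rule P.Fubini_integral[OF i, symmetric])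
  also have "\<dots> = (\<integral>y. \<integral>x. f x * g (x \<otimes> inv y) \<partial>\<nu> \<partial>\<mu> t)"
  proof (rule Bochner_Integration.integral_cong[OF refl])
    fix y assume "y \<in> space (\<mu> t)"
    then have y: "y \<in> carrier G" by (simp add: space_mu t)
    have "(\<integral>x. f x * g (x \<otimes> inv y) \<partial>\<nu>) = (\<integral>x. f (x \<otimes> y) * g (x \<otimes> y \<otimes> inv y) \<partial>\<nu>)"
      using y fm(1) measurable_translate(2)[OF fm(2), of "inv y"]
      by (intro integral_right_translation[symmetric, of y "\<lambda>x. f x * g (x \<otimes> inv y)"]) auto
    also have "\<dots> = (\<integral>x. f (x \<otimes> y) * g x \<partial>\<nu>)"
      using y by (intro Bochner_Integration.integral_cong refl) (simp add: space_haar m_assoc)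
    finally show "(\<integral>x. f (x \<otimes> y) * g x \<partial>\<nu>) = (\<integral>x. f x * g (x \<otimes> inv y) \<partial>\<nu>)" by (rule sym)
  qed
  also have "\<dots> = (\<integral>x. \<integral>y. f x * g (x \<otimes> inv y) \<partial>\<mu> t \<partial>\<nu>)" by (rule P.Fubini_integral[OF i2])
  also have "\<dots> = (\<integral>x. f x * heat G \<mu> t g x \<partial>\<nu>)"
  proof (rule Bochner_Integration.integral_cong[OF refl])
    fix x assume "x \<in> space \<nu>"
    then have x: "x \<in> carrier G" by (simp add: space_haar)
    show "(\<integral>y. f x * g (x \<otimes> inv y) \<partial>\<mu> t) = f x * heat G \<mu> t g x"
      using integral_mu_inv[OF t measurable_translate(1)[OF fm(2) x]] by (simp add: heat_def)
  qed
  finally show ?thesis .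
qed

text \<open>Right invariance makes Haar measure invariant under the convolution; nonnegative
  integrals avoid all questions of integrability.\<close>

lemma nn_integral_heat:
  assumes t: "t > 0" and f: "f \<in> borel_measurable (borel_sigma T)"
  shows "(\<integral>\<^sup>+x. \<integral>\<^sup>+y. f (x \<otimes> y) \<partial>\<mu> t \<partial>\<nu>) = (\<integral>\<^sup>+x. f x \<partial>\<nu>)"
    and "(\<lambda>x. \<integral>\<^sup>+y. f (x \<otimes> y) \<partial>\<mu> t) \<in> borel_measurable \<nu>"
proof -
  interpret S: prob_space \<nu> by (rule prob_haar)
  interpret U: prob_space "\<mu> t" by (rule prob[OF t])
  interpret P: pair_prob_space \<nu> "\<mu> t" ..
  have mm: "measurable (\<nu> \<Otimes>\<^sub>M \<mu> t) N = measurable (borel_sigma T \<Otimes>\<^sub>M borel_sigma T) N" for N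
    by (rule measurable_cong_sets[OF sets_pair_measure_cong[OF sets_haar sets_eq[OF t]] refl])
  have m: "(\<lambda>(x, y). f (x \<otimes> y)) \<in> borel_measurable (\<nu> \<Otimes>\<^sub>M \<mu> t)" unfolding mm using f by measurable
  have "(\<integral>\<^sup>+x. \<integral>\<^sup>+y. f (x \<otimes> y) \<partial>\<mu> t \<partial>\<nu>) = (\<integral>\<^sup>+y. \<integral>\<^sup>+x. f (x \<otimes> y) \<partial>\<nu> \<partial>\<mu> t)"
    using P.Fubini[OF m] by simp
  also have "\<dots> = (\<integral>\<^sup>+y. \<integral>\<^sup>+x. f x \<partial>\<nu> \<partial>\<mu> t)"
    using f by (intro nn_integral_cong nn_integral_right_translation) (auto simp: space_mu t)
  also have "\<dots> = (\<integral>\<^sup>+x. f x \<partial>\<nu>)" using U.emeasure_space_1 by (simp only: nn_integral_const mult_1_right)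
  finally show "(\<integral>\<^sup>+x. \<integral>\<^sup>+y. f (x \<otimes> y) \<partial>\<mu> t \<partial>\<nu>) = (\<integral>\<^sup>+x. f x \<partial>\<nu>)" .
  show "(\<lambda>x. \<integral>\<^sup>+y. f (x \<otimes> y) \<partial>\<mu> t) \<in> borel_measurable \<nu>"
    using U.borel_measurable_nn_integral_fst[OF m] by simp
qed

text \<open>Jensen's inequality. It is trivial when the right side is infinite, which covers the
  points where the integral in \<open>heat\<close> does not converge.\<close>

lemma heat_powr_le:
  assumes t: "t > 0" and p: "1 < p" and f: "f \<in> borel_measurable (borel_sigma T)" and x: "x \<in> carrier G"
  shows "ennreal (\<bar>heat G \<mu> t f x\<bar> powr p) \<le> (\<integral>\<^sup>+y. ennreal (\<bar>f (x \<otimes> y)\<bar> powr p) \<partial>\<mu> t)"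
proof (cases "(\<integral>\<^sup>+y. ennreal (\<bar>f (x \<otimes> y)\<bar> powr p) \<partial>\<mu> t) < \<infinity>")
  case True
  interpret U: prob_space "\<mu> t" by (rule prob[OF t])
  have m: "(\<lambda>y. f (x \<otimes> y)) \<in> borel_measurable (\<mu> t)" using measurable_translate(1)[OF f x] by (simp add: measurable_mu t)
  then have i: "integrable (\<mu> t) (\<lambda>y. \<bar>f (x \<otimes> y)\<bar> powr p)" using True by (intro integrableI_nonneg) auto
  then have L: "(\<lambda>y. f (x \<otimes> y)) \<in> Lp (\<mu> t) p" using m by (simp add: Lp_iff)
  have "\<bar>heat G \<mu> t f x\<bar> \<le> (\<integral>y. \<bar>f (x \<otimes> y)\<bar> \<partial>\<mu> t)" unfolding heat_def by (rule integral_abs_bound)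
  also have "\<dots> \<le> pnorm (\<mu> t) p (\<lambda>y. f (x \<otimes> y))" by (rule U.Lp_imp_integrable(2)[OF L p])
  finally have "\<bar>heat G \<mu> t f x\<bar> powr p \<le> pnorm (\<mu> t) p (\<lambda>y. f (x \<otimes> y)) powr p" using p by (intro powr_mono2) auto
  also have "\<dots> = (\<integral>y. \<bar>f (x \<otimes> y)\<bar> powr p \<partial>\<mu> t)" using p by (simp add: pnorm_powr)
  finally show ?thesis using nn_integral_eq_integral[OF i] by (simp add: ennreal_leI)
qed (simp add: not_less top_unique)

lemma heat_Lp:
  assumes t: "t > 0" and p: "1 < p" and f: "f \<in> Lp \<nu> p"
  shows "heat G \<mu> t f \<in> Lp \<nu> p" "pnorm \<nu> p (heat G \<mu> t f) \<le> pnorm \<nu> p f"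
    and "AE x in \<nu>. integrable (\<mu> t) (\<lambda>y. f (x \<otimes> y))"
proof -
  have fm: "f \<in> borel_measurable (borel_sigma T)" using Lp_measurable[OF f] by (simp add: measurable_haar)
  have fi: "integrable \<nu> (\<lambda>x. \<bar>f x\<bar> powr p)" using f by (simp add: Lp_iff)
  have pm: "(\<lambda>y. ennreal (\<bar>f y\<bar> powr p)) \<in> borel_measurable (borel_sigma T)" using fm by measurable
  note nn = nn_integral_heat[OF t pm]
  have fin: "(\<integral>\<^sup>+x. \<integral>\<^sup>+y. ennreal (\<bar>f (x \<otimes> y)\<bar> powr p) \<partial>\<mu> t \<partial>\<nu>) = ennreal (\<integral>x. \<bar>f x\<bar> powr p \<partial>\<nu>)"
    using nn_integral_eq_integral[OF fi] nn(1) by simp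
  have le: "(\<integral>\<^sup>+x. ennreal (\<bar>heat G \<mu> t f x\<bar> powr p) \<partial>\<nu>) \<le> ennreal (\<integral>x. \<bar>f x\<bar> powr p \<partial>\<nu>)"
    unfolding fin[symmetric] by (intro nn_integral_mono heat_powr_le t p fm) (simp add: space_haar)
  have hm: "heat G \<mu> t f \<in> borel_measurable \<nu>" using heat_measurable[OF t fm] by (simp add: measurable_haar)
  have hi: "integrable \<nu> (\<lambda>x. \<bar>heat G \<mu> t f x\<bar> powr p)"
    using hm le by (intro integrableI_nonneg) (auto simp: ennreal_less_top intro: le_less_trans)
  show "heat G \<mu> t f \<in> Lp \<nu> p" using hm hi by (simp add: Lp_iff)
  have "(\<integral>x. \<bar>heat G \<mu> t f x\<bar> powr p \<partial>\<nu>) \<le> (\<integral>x. \<bar>f x\<bar> powr p \<partial>\<nu>)"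
    using le unfolding nn_integral_eq_integral[OF hi AE_I2[OF powr_ge_zero]] by (subst (asm) ennreal_le_iff) auto
  then show "pnorm \<nu> p (heat G \<mu> t f) \<le> pnorm \<nu> p f"
    unfolding pnorm_def using p by (intro powr_mono2) auto
  have "AE x in \<nu>. (\<integral>\<^sup>+y. ennreal (\<bar>f (x \<otimes> y)\<bar> powr p) \<partial>\<mu> t) \<noteq> \<infinity>"
    by (rule nn_integral_PInf_AE[OF nn(2)]) (simp add: fin)
  then show "AE x in \<nu>. integrable (\<mu> t) (\<lambda>y. f (x \<otimes> y))"
  proof (rule AE_mp, intro AE_I2 impI)
    fix x assume x: "x \<in> space \<nu>" "(\<integral>\<^sup>+y. ennreal (\<bar>f (x \<otimes> y)\<bar> powr p) \<partial>\<mu> t) \<noteq> \<infinity>"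
    interpret U: prob_space "\<mu> t" by (rule prob[OF t])
    have m: "(\<lambda>y. f (x \<otimes> y)) \<in> borel_measurable (\<mu> t)"
      using measurable_translate(1)[OF fm, of x] x(1) by (simp add: measurable_mu t space_haar)
    then have "integrable (\<mu> t) (\<lambda>y. \<bar>f (x \<otimes> y)\<bar> powr p)"
      using x(2) by (intro integrableI_nonneg) (auto simp: less_top)
    then show "integrable (\<mu> t) (\<lambda>y. f (x \<otimes> y))" using m p by (intro U.Lp_imp_integrable(1)[of _ p]) (auto simp: Lp_iff)
  qed
qed

lemma heat_Lp_diff:
  assumes t: "t > 0" and p: "1 < p" and "f \<in> Lp \<nu> p" "g \<in> Lp \<nu> p"
  shows "AE x in \<nu>. heat G \<mu> t (\<lambda>x. f x - g x) x = heat G \<mu> t f x - heat G \<mu> t g x"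
  using heat_Lp(3)[OF t p assms(3)] heat_Lp(3)[OF t p assms(4)]
  by eventually_elim (simp add: heat_def)

lemma heat_continuous:
  assumes t: "t > 0" and f: "continuous_map T euclideanreal f"
  shows "continuous_map T euclideanreal (heat G \<mu> t f)"
  using continuous_convolution[OF sets_eq[OF t] prob[OF t] f]
  by (rule continuous_map_eq) (simp add: heat_central[OF t continuous_measurable[OF f]] topspace_eq)

text \<open>The mass outside a neighbourhood of the neutral element tends to 0, and by compactness
  continuity is uniform over the group.\<close>

lemma heat_small_time:
  assumes f: "continuous_map T euclideanreal f" and e: "e > 0"
  shows "\<exists>d>0. \<forall>t. 0 < t \<and> t < d \<longrightarrow> (\<forall>x\<in>carrier G. \<bar>heat G \<mu> t f x - f x\<bar> \<le> e)"
proof -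
  obtain c where c: "\<And>x. x \<in> carrier G \<Longrightarrow> \<bar>f x\<bar> \<le> c" using continuous_bounded[OF f] by blast
  have c0: "c \<ge> 0" using c[OF one_closed] by linarith
  have "e / 2 > 0" using e by simp
  then obtain V where V: "openin T V" "\<one> \<in> V" "\<And>x y. y \<in> V \<Longrightarrow> x \<in> carrier G \<Longrightarrow> \<bar>f (x \<otimes> y) - f (x \<otimes> \<one>)\<bar> < e / 2"
    using uniform_continuity[OF continuous_mult_arg(1)[OF f] one_closed] by metis
  \<comment> \<open>The summand 1 allows for \<open>c = 0\<close>; the part of the integral outside
    \<open>V\<close> then contributes at most half of \<open>e\<close>.\<close>
  have "e / (4 * (c + 1)) > 0" using e c0 by simp
  from order_tendstoD(2)[OF gaussian[OF V(1,2)] this]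
  obtain d0 where d0: "d0 > 0" "\<And>t. 0 < t \<Longrightarrow> t < d0 \<Longrightarrow> measure (\<mu> t) (carrier G - V) / t < e / (4 * (c + 1))"
    by (auto simp: eventually_at_right_field)
  have "\<bar>heat G \<mu> t f x - f x\<bar> \<le> e" if t: "0 < t" "t < min d0 1" and x: "x \<in> carrier G" for t x
  proof -
    interpret U: prob_space "\<mu> t" by (rule prob[OF t(1)])
    have W: "carrier G - V \<in> sets (\<mu> t)"
      using sets.compl_sets[of V "\<mu> t"] V(1) by (simp add: sets_eq[OF t(1)] borel_sigma_simps space_mu t(1))
    have "measure (\<mu> t) (carrier G - V) < e / (4 * (c + 1)) * t" using d0(2)[of t] t by (simp add: pos_divide_less_eq)
    also have "\<dots> \<le> e / (4 * (c + 1))" using t e c0 by (intro mult_right_le_one_le) auto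
    finally have mW: "measure (\<mu> t) (carrier G - V) \<le> e / (4 * (c + 1))" by simp
    have i: "integrable (\<mu> t) (\<lambda>y. f (x \<otimes> y))"
      by (intro integrable_continuous sets_eq prob t(1) continuous_translate f x)
    have iW: "integrable (\<mu> t) (\<lambda>y. e / 2 + 2 * c * indicator (carrier G - V) y)"
      using W U.emeasure_finite by (simp add: integrable_indicator_iff less_top[symmetric])
    have "heat G \<mu> t f x - f x = (\<integral>y. f (x \<otimes> y) - f x \<partial>\<mu> t)" using i by (simp add: heat_def U.prob_space)
    also have "\<bar>\<dots>\<bar> \<le> (\<integral>y. \<bar>f (x \<otimes> y) - f x\<bar> \<partial>\<mu> t)" by (rule integral_abs_bound)
    also have "\<dots> \<le> (\<integral>y. e / 2 + 2 * c * indicator (carrier G - V) y \<partial>\<mu> t)"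
    proof (rule integral_mono[OF _ iW])
      fix y assume "y \<in> space (\<mu> t)"
      then have y: "y \<in> carrier G" by (simp add: space_mu t(1))
      show "\<bar>f (x \<otimes> y) - f x\<bar> \<le> e / 2 + 2 * c * indicator (carrier G - V) y"
        using V(3)[of y x] x y c[of "x \<otimes> y"] c[of x] e by (cases "y \<in> V") (auto simp: abs_le_iff)
    qed (use i in simp)
    also have "\<dots> = e / 2 + 2 * c * measure (\<mu> t) (carrier G - V)"
      using W U.emeasure_finite by (simp add: integrable_indicator_iff less_top[symmetric] U.prob_space)
    also have "\<dots> \<le> e / 2 + 2 * (c + 1) * (e / (4 * (c + 1)))"
      using mW c0 e by (intro add_left_mono mult_mono) auto
    also have "\<dots> = e"
    proof -
      have "2 * (c + 1) * (e / (4 * (c + 1))) = e * (2 * (c + 1)) / (2 * (2 * (c + 1)))" by simp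
      also have "\<dots> = e / 2" using c0 by (subst mult_divide_mult_cancel_right) auto
      finally show ?thesis by simp
    qed
    finally show ?thesis .
  qed
  then show ?thesis using d0(1) by (intro exI[of _ "min d0 1"]) auto
qed

lemma bounded_borel_continuous: "continuous_map T euclideanreal f \<Longrightarrow> f \<in> bounded_borel \<nu>"
  using continuous_bounded[of f] continuous_measurable[of f]
  by (auto simp: bounded_borel_def measurable_haar space_haar)

lemma heat_op_continuous: "continuous_map T euclideanreal f \<Longrightarrow> continuous_map T euclideanreal (heat_op t f)"
  by (simp add: heat_op_def heat_continuous)

lemma heat_op_bounded: "f \<in> bounded_borel \<nu> \<Longrightarrow> heat_op t f \<in> bounded_borel \<nu>"
  by (simp add: heat_op_def heat_bounded)

lemma heat_op_linear:
  "f \<in> bounded_borel \<nu> \<Longrightarrow> g \<in> bounded_borel \<nu> \<Longrightarrow> x \<in> space \<nu> \<Longrightarrow>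
     heat_op t (\<lambda>x. a * f x + b * g x) x = a * heat_op t f x + b * heat_op t g x"
  by (simp add: heat_op_def heat_add)

lemma heat_op_semigroup:
  "f \<in> bounded_borel \<nu> \<Longrightarrow> s \<ge> 0 \<Longrightarrow> t \<ge> 0 \<Longrightarrow> x \<in> space \<nu> \<Longrightarrow> heat_op s (heat_op t f) x = heat_op (s + t) f x"
  by (auto simp: heat_op_def heat_heat add_pos_pos not_less)

lemma heat_op_Lp:
  assumes "1 < p" "f \<in> Lp \<nu> p"
  shows "heat_op t f \<in> Lp \<nu> p" "pnorm \<nu> p (heat_op t f) \<le> pnorm \<nu> p f"
  using assms heat_Lp[of t p f] by (auto simp: heat_op_def)

text \<open>Summing the increments of the semigroup over \<open>n\<close> steps of length \<open>r / n\<close> bounds the difference in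
  \<open>L\<^sup>2\<close>, up to an error tending to \<open>0\<close>.\<close>

lemma heat_op_generator:
  assumes \<phi>: "continuous_map T euclideanreal \<phi>" and \<psi>: "continuous_map T euclideanreal \<psi>"
    and L: "L2_laplacian G \<nu> \<mu> \<phi> (\<lambda>x. - \<psi> x)" and r: "r \<ge> 0"
    and e: "\<And>s x. 0 \<le> s \<Longrightarrow> s \<le> r \<Longrightarrow> x \<in> space \<nu> \<Longrightarrow> \<bar>heat_op s \<psi> x - \<psi> x\<bar> \<le> e"
    and x: "x \<in> space \<nu>"
  shows "\<bar>heat_op r \<phi> x - \<phi> x - r * \<psi> x\<bar> \<le> r * e"
proof (cases "r = 0")
  case False
  then have r0: "r > 0" using r by simp
  interpret prob_space \<nu> by (rule prob_haar)
  have bb: "\<phi> \<in> bounded_borel \<nu>" "\<psi> \<in> bounded_borel \<nu>" by (intro bounded_borel_continuous \<phi> \<psi>)+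
  \<comment> \<open>The defect of a step of length \<open>h\<close> against its linear prediction;
    the hypothesis on the generator says that it is o(h) in L^2.\<close>
  define R where "R h x = heat_op h \<phi> x - \<phi> x - h * \<psi> x" for h x
  have Rc: "continuous_map T euclideanreal (R h)" for h
    unfolding R_def[abs_def] by (intro continuous_map_diff continuous_map_real_mult heat_op_continuous \<phi> \<psi>) simp
  have cL: "g \<in> Lp \<nu> 2" if g: "continuous_map T euclideanreal g" for g
  proof -
    obtain c where "\<And>x. x \<in> space \<nu> \<Longrightarrow> \<bar>g x\<bar> \<le> c" using continuous_bounded[OF g] by (auto simp: space_haar)
    then show ?thesis using continuous_measurable[OF g] by (intro Lp_bounded(1)) (auto simp: measurable_haar)
  qed
  define k where "k = R r"
  have step: "heat_op (real m * h) \<phi> x - \<phi> x = (\<Sum>j<m. heat_op (real j * h) (R h) x + h * heat_op (real j * h) \<psi> x)"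
    if "h > 0" "x \<in> space \<nu>" for m h x
  proof (induction m)
    case (Suc m)
    have "heat_op (real (Suc m) * h) \<phi> x = heat_op (real m * h) (heat_op h \<phi>) x"
      using that by (subst heat_op_semigroup[OF bb(1)]) (auto simp: algebra_simps)
    also have "heat_op h \<phi> = (\<lambda>x. 1 * (\<lambda>x. 1 * R h x + h * \<psi> x) x + 1 * \<phi> x)" by (simp add: R_def fun_eq_iff)
    also have "heat_op (real m * h) \<dots> x = heat_op (real m * h) (R h) x + h * heat_op (real m * h) \<psi> x + heat_op (real m * h) \<phi> x"
      using that bounded_borel_continuous[OF Rc] bb
      by (subst heat_op_linear, (auto intro!: bounded_borel_add bounded_borel_cmult)[3], subst heat_op_linear) auto
    finally show ?case using Suc by simp
  qed (simp add: heat_op_0)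
  define S where "S n x = (\<Sum>j<Suc n. heat_op (real j * (r / real (Suc n))) (R (r / real (Suc n))) x)" for n x
  have Sc: "continuous_map T euclideanreal (S n)" for n
    unfolding S_def[abs_def] by (intro continuous_map_sum heat_op_continuous Rc) simp
  have close: "\<bar>k x - S n x\<bar> \<le> r * e" if x: "x \<in> space \<nu>" for n x
  proof -
    define h where "h = r / real (Suc n)"
    have h: "h > 0" "real (Suc n) * h = r" using r0 by (simp_all add: h_def)
    have "k x = (\<Sum>j<Suc n. heat_op (real j * h) (R h) x + h * heat_op (real j * h) \<psi> x) - r * \<psi> x"
      using step[OF h(1) x, of "Suc n"] unfolding h(2) by (simp add: k_def R_def)
    also have "r * \<psi> x = (\<Sum>j<Suc n. h * \<psi> x)" using h(2) by simp
    finally have "k x - S n x = h * (\<Sum>j<Suc n. heat_op (real j * h) \<psi> x - \<psi> x)"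
      unfolding S_def h_def[symmetric] by (simp only: sum.distrib sum_subtractf sum_distrib_left right_diff_distrib)
    then have "\<bar>k x - S n x\<bar> = h * \<bar>\<Sum>j<Suc n. heat_op (real j * h) \<psi> x - \<psi> x\<bar>" using h by (simp only: abs_mult abs_of_pos)
    also have "\<dots> \<le> h * (\<Sum>j<Suc n. e)"
    proof (intro mult_left_mono order_trans[OF sum_abs] sum_mono e x)
      fix j assume "j \<in> {..<Suc n}"
      then have "real j * h \<le> real (Suc n) * h" using h by (intro mult_right_mono) auto
      then show "real j * h \<le> r" unfolding h(2) .
    qed (use h in auto)
    also have "\<dots> = r * e" using h(2)[symmetric] by simp
    finally show ?thesis .
  qed
  have Sn: "pnorm \<nu> 2 (S n) \<le> real m * pnorm \<nu> 2 (R h)"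
    if "S n = (\<lambda>x. \<Sum>j<m. heat_op (real j * h) (R h) x)" for n m h
    unfolding that
  proof (induction m)
    case 0 then show ?case by (simp add: pnorm_def)
  next
    case (Suc m)
    have "pnorm \<nu> 2 (\<lambda>x. (\<Sum>j<m. heat_op (real j * h) (R h) x) + heat_op (real m * h) (R h) x)
        \<le> pnorm \<nu> 2 (\<lambda>x. \<Sum>j<m. heat_op (real j * h) (R h) x) + pnorm \<nu> 2 (heat_op (real m * h) (R h))"
      by (intro Lp_add(2) cL continuous_map_sum heat_op_continuous Rc) auto
    also have "\<dots> \<le> real m * pnorm \<nu> 2 (R h) + pnorm \<nu> 2 (R h)"
      using Suc heat_op_Lp(2)[OF _ cL[OF Rc]] by (intro add_mono) auto
    finally show ?case by (simp add: algebra_simps)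
  qed
  have lim: "((\<lambda>h. pnorm \<nu> 2 (\<lambda>x. R h x / h)) \<longlongrightarrow> 0) (at_right 0)"
  proof (rule tendsto_pnorm)
    have "(\<lambda>x. 1 / t * R t x) \<in> Lp \<nu> 2" for t by (intro Lp_cmult cL Rc)
    then show "\<forall>\<^sub>F t in at_right 0. (\<lambda>x. R t x / t) \<in> Lp \<nu> 2" by simp
    have "\<forall>\<^sub>F t in at_right 0. Lp_norm \<nu> 2 (\<lambda>x. (heat G \<mu> t \<phi> x - \<phi> x) / t - (- (- \<psi> x))) = Lp_norm \<nu> 2 (\<lambda>x. R t x / t)"
      using eventually_at_right_less by eventually_elim (simp add: R_def heat_op_pos diff_divide_distrib)
    then show "((\<lambda>t. Lp_norm \<nu> 2 (\<lambda>x. R t x / t)) \<longlongrightarrow> 0) (at_right 0)"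
      using L by (simp add: L2_laplacian_def tendsto_cong)
  qed
  have "filterlim (\<lambda>n. r / real (Suc n)) (at_right 0) sequentially"
    unfolding filterlim_at using LIMSEQ_Suc[OF lim_const_over_n[of r]] r0 by auto
  from filterlim_compose[OF lim this]
  have "(\<lambda>n. r * pnorm \<nu> 2 (\<lambda>x. R (r / real (Suc n)) x / (r / real (Suc n)))) \<longlonglongrightarrow> r * 0" by (rule tendsto_mult_left)
  moreover have "pnorm \<nu> 2 (S n) \<le> r * pnorm \<nu> 2 (\<lambda>x. R (r / real (Suc n)) x / (r / real (Suc n)))" for n
  proof -
    define h where "h = r / real (Suc n)"
    have h: "h > 0" "real (Suc n) * h = r" using r0 by (simp_all add: h_def)
    have "pnorm \<nu> 2 (S n) \<le> real (Suc n) * pnorm \<nu> 2 (R h)" by (rule Sn) (simp add: S_def fun_eq_iff h_def)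
    also have "pnorm \<nu> 2 (R h) = h * pnorm \<nu> 2 (\<lambda>x. 1 / h * R h x)"
      using h(1) by (subst Lp_cmult(2)[OF cL[OF Rc]]) auto
    finally show ?thesis using h unfolding h_def[symmetric] by (simp flip: mult.assoc)
  qed
  ultimately have S0: "(\<lambda>n. pnorm \<nu> 2 (S n)) \<longlonglongrightarrow> 0"
    by (intro tendsto_sandwich[of "\<lambda>_. 0" "\<lambda>n. pnorm \<nu> 2 (S n)" sequentially]) auto
  \<comment> \<open>The excess over the claimed bound. Its L^2 norm is at most that of every
    \<open>S n\<close>, hence 0, and a continuous function that vanishes almost everywhere vanishes
    everywhere; this upgrades L^2 information to a pointwise bound.\<close>
  define m where "m x = max 0 (\<bar>k x\<bar> - r * e)" for x
  have mc: "continuous_map T euclideanreal m"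
    unfolding m_def[abs_def] k_def by (intro continuous_map_real_max continuous_map_diff continuous_map_real_abs Rc) auto
  have "pnorm \<nu> 2 m \<le> pnorm \<nu> 2 (S n)" for n
  proof -
    have "(\<integral>x. \<bar>m x\<bar> powr 2 \<partial>\<nu>) \<le> (\<integral>x. \<bar>S n x\<bar> powr 2 \<partial>\<nu>)"
    proof (rule integral_mono)
      fix x assume x: "x \<in> space \<nu>"
      have "m x \<le> \<bar>S n x\<bar>" using close[OF x, of n] by (auto simp: m_def)
      then show "\<bar>m x\<bar> powr 2 \<le> \<bar>S n x\<bar> powr 2" by (intro powr_mono2) (auto simp: m_def)
    qed (use cL[OF mc] cL[OF Sc] in \<open>simp_all add: Lp_iff\<close>)
    then show ?thesis unfolding pnorm_def by (intro powr_mono2) simp_all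
  qed
  then have "pnorm \<nu> 2 m \<le> 0" using S0 by (intro LIMSEQ_le_const[OF S0]) auto
  then have "AE x in \<nu>. m x = 0" using pnorm_nonneg[of \<nu> 2 m] by (intro pnorm_eq_0_AE[OF cL[OF mc]]) auto
  then have "AE x in \<nu>. m x \<le> 0" by eventually_elim simp
  from continuous_AE_le[OF mc this] x have "m x \<le> 0" by (simp add: space_haar)
  then show ?thesis by (simp add: m_def k_def R_def)
qed (simp add: heat_op_0)

text \<open>Strong maximum principle: such a function is invariant under \<open>heat\<close>, so at
  a maximum its average for a measure of full support equals the maximal value.\<close>

lemma L2_laplacian_0_imp_const:
  assumes \<phi>: "continuous_map T euclideanreal \<phi>" and L: "L2_laplacian G \<nu> \<mu> \<phi> (\<lambda>x. 0)"
    and y: "y \<in> carrier G" and z: "z \<in> carrier G"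
  shows "\<phi> y = \<phi> z"
proof -
  interpret U: prob_space "\<mu> 1" by (rule prob) simp
  have inv: "heat G \<mu> 1 \<phi> x = \<phi> x" if "x \<in> carrier G" for x
  proof -
    have "\<bar>heat_op 1 \<phi> x - \<phi> x - 1 * 0\<bar> \<le> 1 * 0"
      by (rule heat_op_generator[where \<psi> = "\<lambda>x. 0"]) (use \<phi> L that in \<open>auto simp: space_haar heat_op_def heat_def\<close>)
    then show ?thesis by (simp add: heat_op_def)
  qed
  have "compactin euclideanreal (\<phi> ` topspace T)"
    using image_compactin[OF _ \<phi>] compact by (simp add: compact_space_def)
  then have "compact (\<phi> ` carrier G)" by (simp add: topspace_eq)
  then obtain x0 where x0: "x0 \<in> carrier G" "\<And>x. x \<in> carrier G \<Longrightarrow> \<phi> x \<le> \<phi> x0"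
    using compact_attains_sup[of "\<phi> ` carrier G"] one_closed by auto
  define g where "g x = \<phi> x0 - \<phi> (x0 \<otimes> x)" for x
  have gc: "continuous_map T euclideanreal g"
    unfolding g_def[abs_def] by (rule continuous_map_diff[OF _ continuous_translate(1)[OF \<phi> x0(1)]]) simp
  have gi: "integrable (\<mu> 1) g" by (intro integrable_continuous gc prob sets_eq) auto
  have i: "integrable (\<mu> 1) (\<lambda>y. \<phi> (x0 \<otimes> y))"
    by (intro integrable_continuous continuous_translate \<phi> x0 prob sets_eq) auto
  have "(\<integral>x. g x \<partial>\<mu> 1) = \<phi> x0 - heat G \<mu> 1 \<phi> x0" using i by (simp add: g_def heat_def U.prob_space)
  then have "(\<integral>x. g x \<partial>\<mu> 1) = 0" using inv[OF x0(1)] by simp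
  then have ae: "AE x in \<mu> 1. g x = 0"
    using gi x0 by (subst (asm) integral_nonneg_eq_0_iff_AE) (auto simp: g_def space_mu)
  have g0: "g x = 0" if x: "x \<in> carrier G" for x
  proof (rule ccontr)
    assume "g x \<noteq> 0"
    let ?U = "{x \<in> topspace T. g x \<in> - {0}}"
    have U: "openin T ?U" by (rule openin_continuous_map_preimage[OF gc]) auto
    have "x \<in> measure_support T (\<mu> 1)" using nondegenerate[of 1] x by simp
    then have "emeasure (\<mu> 1) ?U > 0"
      using U x \<open>g x \<noteq> 0\<close> by (auto simp: measure_support_def topspace_eq)
    moreover have "emeasure (\<mu> 1) ?U = 0"
    proof -
      have eq: "{x \<in> space (\<mu> 1). \<not> g x = 0} = ?U" by (auto simp: space_mu topspace_eq)
      have "?U \<in> sets (\<mu> 1)" using U by (simp add: sets_eq borel_sigma_simps)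
      then have "?U \<in> null_sets (\<mu> 1)" using AE_iff_null[of "\<mu> 1" "\<lambda>x. g x = 0"] ae unfolding eq by simp
      then show ?thesis by auto
    qed
    ultimately show False by simp
  qed
  have "\<phi> x = \<phi> x0" if "x \<in> carrier G" for x
    using g0[of "inv x0 \<otimes> x"] that x0(1) by (simp add: g_def m_assoc[symmetric])
  then show ?thesis using y z by simp
qed

end

section \<open>Test functions and invariant vector fields\<close>

lemma infsum_finite_support:
  fixes f :: "'b \<Rightarrow> real"
  assumes "finite S" "S \<subseteq> A" "\<And>i. i \<in> A - S \<Longrightarrow> f i = 0"
  shows "(\<Sum>\<^sub>\<infinity>i\<in>A. f i) = (\<Sum>i\<in>S. f i)"
proof -
  have "(\<Sum>\<^sub>\<infinity>i\<in>A. f i) = (\<Sum>\<^sub>\<infinity>i\<in>S. f i)" using assms by (intro infsum_cong_neutral) auto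
  then show ?thesis using assms(1) by simp
qed

locale lie_gaussian = lie_projective_system G T \<A> K M + compact_gaussian G T \<nu> \<mu>
  for G :: "('g, 'm) monoid_scheme" (structure) and T
    and \<A> :: "'i set" and K :: "'i \<Rightarrow> 'g set" and M :: "'i \<Rightarrow> 'g set mfd" and \<nu> \<mu> +
  fixes I :: "nat set" and X :: "nat \<Rightarrow> 'i \<Rightarrow> 'g set operator"
  assumes basis: "projective_basis G \<A> K M I X"
    and sum_of_squares: "\<And>\<phi>. \<phi> \<in> test_functions G \<A> K M \<Longrightarrow>
          L2_laplacian G \<nu> \<mu> \<phi>
            (\<lambda>x. - (\<Sum>\<^sub>\<infinity>i\<in>I. lie_action G \<A> K M (X i) (lie_action G \<A> K M (X i) \<phi>) x))"
begin

abbreviation C where "C \<equiv> quotient_smooth G K M"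
abbreviation B where "B \<equiv> test_functions G \<A> K M"
abbreviation XB where "XB i \<equiv> lie_action G \<A> K M (X i)"
abbreviation A where "A \<equiv> sum_of_squares_op I XB"
abbreviation translate where "translate a \<equiv> pull (carrier G) (\<lambda>x. a \<otimes> x)"

lemma carrier_Mod: "carrier (G Mod N) = (\<lambda>x. N #> x) ` carrier G"
  by (auto simp: FactGroup_def RCOSETS_def)

lemma lift_eq: "x \<in> carrier G \<Longrightarrow> lift G N \<phi> x = \<phi> (N #> x)" "x \<notin> carrier G \<Longrightarrow> lift G N \<phi> x = 0"
  by (simp_all add: pull_def)

lemma C_vanish: "\<phi> \<in> C \<alpha> \<Longrightarrow> c \<notin> carrier (G Mod K \<alpha>) \<Longrightarrow> \<phi> c = 0"
  by (simp add: smooth_functions_def)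

lemma lift_inj:
  assumes "\<And>c. c \<notin> carrier (G Mod N) \<Longrightarrow> \<phi> c = 0" "\<And>c. c \<notin> carrier (G Mod N) \<Longrightarrow> \<psi> c = 0"
    and eq: "lift G N \<phi> = lift G N \<psi>"
  shows "\<phi> = \<psi>"
proof
  fix c show "\<phi> c = \<psi> c"
  proof (cases "c \<in> carrier (G Mod N)")
    case True
    then obtain x where "x \<in> carrier G" "c = N #> x" by (auto simp: carrier_Mod)
    then show ?thesis using fun_cong[OF eq, of x] by (simp add: lift_eq)
  qed (simp add: assms)
qed

lemma const_eq:
  assumes "\<And>c. c \<notin> carrier (G Mod N) \<Longrightarrow> \<phi> c = 0" "\<And>x. x \<in> carrier G \<Longrightarrow> \<phi> (N #> x) = r"
  shows "\<phi> = (\<lambda>c. if c \<in> carrier (G Mod N) then r else 0)"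
proof
  fix c show "\<phi> c = (if c \<in> carrier (G Mod N) then r else 0)"
  proof (cases "c \<in> carrier (G Mod N)")
    case True
    then obtain x where "x \<in> carrier G" "c = N #> x" by (auto simp: carrier_Mod)
    then show ?thesis using True assms(2) by simp
  qed (simp add: assms)
qed

lemma mfd: "\<alpha> \<in> \<A> \<Longrightarrow> smooth_mfd (coset_topology G T (K \<alpha>)) (M \<alpha>)"
  and topspace_coset: "topspace (coset_topology G T (K \<alpha>)) = carrier (G Mod K \<alpha>)"
  using quotient_lie[of \<alpha>] by (auto simp: lie_group_def quotient_map_coset_topology(2) carrier_Mod topspace_eq)

lemma C_add: "\<phi> \<in> C \<alpha> \<Longrightarrow> \<psi> \<in> C \<alpha> \<Longrightarrow> (\<lambda>x. \<phi> x + \<psi> x) \<in> C \<alpha>"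
  and C_mult: "\<phi> \<in> C \<alpha> \<Longrightarrow> \<psi> \<in> C \<alpha> \<Longrightarrow> (\<lambda>x. \<phi> x * \<psi> x) \<in> C \<alpha>"
  and C_cmult: "\<phi> \<in> C \<alpha> \<Longrightarrow> (\<lambda>x. r * \<phi> x) \<in> C \<alpha>"
  by (rule smooth_functions_add smooth_functions_mult smooth_functions_cmult; assumption)+

lemma C_const: "\<alpha> \<in> \<A> \<Longrightarrow> (\<lambda>x. if x \<in> carrier (G Mod K \<alpha>) then r else 0) \<in> C \<alpha>"
  by (rule smooth_functions_const[OF mfd topspace_coset[symmetric]])

lemma lift_continuous:
  assumes "\<alpha> \<in> \<A>" "\<phi> \<in> C \<alpha>" shows "continuous_map T euclideanreal (lift G (K \<alpha>) \<phi>)"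
proof -
  have "continuous_map T euclideanreal (\<phi> \<circ> (\<lambda>x. K \<alpha> #> x))"
    by (rule continuous_map_compose[OF quotient_map_coset_topology(1)
          smooth_functions_continuous[OF mfd topspace_coset[symmetric]]]) (use assms in auto)
  then show ?thesis by (rule continuous_map_eq) (simp add: topspace_eq lift_eq)
qed

lemma X_mem: "i \<in> I \<Longrightarrow> X i \<in> projective_lie_algebra G \<A> K M"
  using basis by (simp add: projective_basis_def)

lemma X_lie: "i \<in> I \<Longrightarrow> \<alpha> \<in> \<A> \<Longrightarrow> X i \<alpha> \<in> lie_algebra (G Mod K \<alpha>) (M \<alpha>)"
  using X_mem[of i] by (simp add: projective_lie_algebra_def)

lemma X_simps:
  assumes i: "i \<in> I" and \<alpha>: "\<alpha> \<in> \<A>"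
  shows "\<phi> \<in> C \<alpha> \<Longrightarrow> X i \<alpha> \<phi> \<in> C \<alpha>" and "\<phi> \<notin> C \<alpha> \<Longrightarrow> X i \<alpha> \<phi> = (\<lambda>x. 0)"
    and "\<phi> \<in> C \<alpha> \<Longrightarrow> \<psi> \<in> C \<alpha> \<Longrightarrow> X i \<alpha> (\<lambda>x. \<phi> x + \<psi> x) = (\<lambda>x. X i \<alpha> \<phi> x + X i \<alpha> \<psi> x)"
    and "\<phi> \<in> C \<alpha> \<Longrightarrow> X i \<alpha> (\<lambda>x. r * \<phi> x) = (\<lambda>x. r * X i \<alpha> \<phi> x)"
    and "\<phi> \<in> C \<alpha> \<Longrightarrow> \<psi> \<in> C \<alpha> \<Longrightarrow> X i \<alpha> (\<lambda>x. \<phi> x * \<psi> x) = (\<lambda>x. X i \<alpha> \<phi> x * \<psi> x + \<phi> x * X i \<alpha> \<psi> x)"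
    and "a \<in> carrier (G Mod K \<alpha>) \<Longrightarrow> \<phi> \<in> C \<alpha> \<Longrightarrow>
      X i \<alpha> (pull (carrier (G Mod K \<alpha>)) (\<lambda>x. a \<otimes>\<^bsub>G Mod K \<alpha>\<^esub> x) \<phi>) =
      pull (carrier (G Mod K \<alpha>)) (\<lambda>x. a \<otimes>\<^bsub>G Mod K \<alpha>\<^esub> x) (X i \<alpha> \<phi>)"
  using X_lie[OF i \<alpha>] unfolding lie_algebra_def Let_def by blast+

abbreviation up where "up \<alpha> \<gamma> \<equiv> pull (carrier (G Mod K \<gamma>)) (\<lambda>c. K \<alpha> <#> c)"

lemma X_up:
  "i \<in> I \<Longrightarrow> \<alpha> \<in> \<A> \<Longrightarrow> \<gamma> \<in> \<A> \<Longrightarrow> K \<gamma> \<subseteq> K \<alpha> \<Longrightarrow> \<phi> \<in> C \<alpha> \<Longrightarrow> X i \<gamma> (up \<alpha> \<gamma> \<phi>) = up \<alpha> \<gamma> (X i \<alpha> \<phi>)"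
  using X_mem[of i] by (simp add: projective_lie_algebra_def)

lemma kernel_subgroup: "\<alpha> \<in> \<A> \<Longrightarrow> subgroup (K \<alpha>) G"
  using kernel_normal by (simp add: normal_imp_subgroup)

lemma lift_up:
  assumes "\<alpha> \<in> \<A>" "\<gamma> \<in> \<A>" "K \<gamma> \<subseteq> K \<alpha>"
  shows "lift G (K \<gamma>) (up \<alpha> \<gamma> \<phi>) = lift G (K \<alpha>) \<phi>"
proof
  fix x show "lift G (K \<gamma>) (up \<alpha> \<gamma> \<phi>) x = lift G (K \<alpha>) \<phi> x"
  proof (cases "x \<in> carrier G")
    case True
    interpret Ka: subgroup "K \<alpha>" G by (rule kernel_subgroup[OF assms(1)])
    interpret Kg: subgroup "K \<gamma>" G by (rule kernel_subgroup[OF assms(2)])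
    have "K \<alpha> <#> K \<gamma> = K \<alpha>"
    proof
      show "K \<alpha> <#> K \<gamma> \<subseteq> K \<alpha>" using assms(3) by (auto simp: set_mult_def)
      show "K \<alpha> \<subseteq> K \<alpha> <#> K \<gamma>"
      proof
        fix k assume k: "k \<in> K \<alpha>"
        then have "k = k \<otimes> \<one>" using Ka.subset by auto
        then show "k \<in> K \<alpha> <#> K \<gamma>" using k Kg.one_closed unfolding set_mult_def by blast
      qed
    qed
    then have "K \<alpha> <#> (K \<gamma> #> x) = K \<alpha> #> x"
      using setmult_rcos_assoc[OF Ka.subset Kg.subset True] by simp
    then show ?thesis using True by (simp add: pull_def carrier_Mod)
  qed (simp add: pull_def)
qed

lemma up_vanish: "c \<notin> carrier (G Mod K \<gamma>) \<Longrightarrow> up \<alpha> \<gamma> \<phi> c = 0"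
  by (simp add: pull_def)

text \<open>Independence of the representation: two lifts of the same function are pulled back to a
  common smaller kernel, where injectivity of \<open>lift\<close> makes them equal, and
  compatibility of the field does the rest.\<close>

lemma XB_lift:
  assumes i: "i \<in> I" and \<alpha>: "\<alpha> \<in> \<A>" and \<phi>: "\<phi> \<in> C \<alpha>"
  shows "XB i (lift G (K \<alpha>) \<phi>) = lift G (K \<alpha>) (X i \<alpha> \<phi>)"
  unfolding lie_action_def
proof (rule the_equality)
  show "\<exists>\<beta>\<in>\<A>. \<exists>\<psi>\<in>C \<beta>. lift G (K \<alpha>) \<phi> = lift G (K \<beta>) \<psi> \<and> lift G (K \<alpha>) (X i \<alpha> \<phi>) = lift G (K \<beta>) (X i \<beta> \<psi>)"
    using \<alpha> \<phi> by blast
next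
  fix g assume "\<exists>\<beta>\<in>\<A>. \<exists>\<psi>\<in>C \<beta>. lift G (K \<alpha>) \<phi> = lift G (K \<beta>) \<psi> \<and> g = lift G (K \<beta>) (X i \<beta> \<psi>)"
  then obtain \<beta> \<psi> where \<beta>: "\<beta> \<in> \<A>" "\<psi> \<in> C \<beta>" "lift G (K \<alpha>) \<phi> = lift G (K \<beta>) \<psi>" "g = lift G (K \<beta>) (X i \<beta> \<psi>)" by blast
  obtain \<gamma> where \<gamma>: "\<gamma> \<in> \<A>" "K \<gamma> \<subseteq> K \<alpha>" "K \<gamma> \<subseteq> K \<beta>" using descending[OF \<alpha> \<beta>(1)] by blast
  have "up \<alpha> \<gamma> \<phi> = up \<beta> \<gamma> \<psi>"
    by (rule lift_inj[of "K \<gamma>"])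
       (use \<beta>(3) in \<open>simp_all add: up_vanish lift_up[OF \<alpha> \<gamma>(1,2)] lift_up[OF \<beta>(1) \<gamma>(1,3)]\<close>)
  then have "up \<alpha> \<gamma> (X i \<alpha> \<phi>) = up \<beta> \<gamma> (X i \<beta> \<psi>)"
    using X_up[OF i \<alpha> \<gamma>(1,2) \<phi>] X_up[OF i \<beta>(1) \<gamma>(1,3) \<beta>(2)] by simp
  then show "g = lift G (K \<alpha>) (X i \<alpha> \<phi>)"
    unfolding \<beta>(4) lift_up[OF \<alpha> \<gamma>(1,2), symmetric] lift_up[OF \<beta>(1) \<gamma>(1,3), symmetric] by simp
qed

lemma test_lift: "\<alpha> \<in> \<A> \<Longrightarrow> \<phi> \<in> C \<alpha> \<Longrightarrow> lift G (K \<alpha>) \<phi> \<in> B"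
  by (auto simp: test_functions_def)

lemma B_E:
  assumes "f \<in> B" obtains \<alpha> \<phi> where "\<alpha> \<in> \<A>" "\<phi> \<in> C \<alpha>" "f = lift G (K \<alpha>) \<phi>"
  using assms by (auto simp: test_functions_def)

lemma lift_0: "lift G N (\<lambda>x. 0) = (\<lambda>x. 0)"
  by (simp add: pull_def fun_eq_iff)

lemma zero_C: "\<alpha> \<in> \<A> \<Longrightarrow> (\<lambda>x. 0) \<in> C \<alpha>"
  using C_const[of \<alpha> 0] by simp

lemma X_0: "i \<in> I \<Longrightarrow> \<alpha> \<in> \<A> \<Longrightarrow> X i \<alpha> (\<lambda>x. 0) = (\<lambda>x. 0)"
  using X_simps(4)[of i \<alpha> "\<lambda>x. 0" 0] zero_C[of \<alpha>] by simp

lemma XB_0: "i \<in> I \<Longrightarrow> XB i (\<lambda>x. 0) = (\<lambda>x. 0)"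
proof -
  assume i: "i \<in> I"
  obtain \<alpha> where \<alpha>: "\<alpha> \<in> \<A>" using nonempty_index by blast
  show ?thesis using XB_lift[OF i \<alpha> zero_C[OF \<alpha>]] X_0[OF i \<alpha>] by (simp add: lift_0)
qed

lemma XB_finite:
  assumes "f \<in> B" shows "finite {i \<in> I. XB i f \<noteq> (\<lambda>x. 0)}"
proof -
  obtain \<alpha> \<phi> where f: "\<alpha> \<in> \<A>" "\<phi> \<in> C \<alpha>" "f = lift G (K \<alpha>) \<phi>" using B_E[OF assms] .
  obtain J where J: "J \<subseteq> I" "is_basis_of J (\<lambda>i. X i \<alpha>) (lie_algebra (G Mod K \<alpha>) (M \<alpha>))"
    "\<And>i. i \<in> I - J \<Longrightarrow> X i \<alpha> = (\<lambda>f x. 0)"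
    using basis f(1) unfolding projective_basis_def by blast
  have "{i \<in> I. XB i f \<noteq> (\<lambda>x. 0)} \<subseteq> J"
    using J(3) by (auto simp: f(3) XB_lift[OF _ f(1,2)] lift_0)
  then show ?thesis using J(2) finite_subset by (auto simp: is_basis_of_def)
qed

lemma A_eq:
  assumes "finite S" "S \<subseteq> I" "\<And>i. i \<in> I - S \<Longrightarrow> XB i f = (\<lambda>x. 0)"
  shows "A f x = (\<Sum>i\<in>S. XB i (XB i f) x)"
  using sum_of_squares_op_eq[OF assms(1,2) order_refl, of XB] assms XB_0 by (simp add: Int_absorb1)

lemma L2_laplacian_A:
  assumes "f \<in> B" shows "L2_laplacian G \<nu> \<mu> f (\<lambda>x. - A f x)"
proof -
  have "(\<Sum>\<^sub>\<infinity>i\<in>I. XB i (XB i f) x) = A f x" for x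
    unfolding sum_of_squares_op_def using XB_finite[OF assms] XB_0
    by (intro infsum_finite_support) auto
  then show ?thesis using sum_of_squares[OF assms] by simp
qed

text \<open>A function killed by all fields is killed by the generator, so the maximum principle
  applies to its lift.\<close>

lemma X_zero_imp_const:
  assumes \<alpha>: "\<alpha> \<in> \<A>" and \<phi>: "\<phi> \<in> C \<alpha>" and X0: "\<And>i. i \<in> I \<Longrightarrow> X i \<alpha> \<phi> = (\<lambda>x. 0)"
    and xy: "x \<in> carrier G" "y \<in> carrier G"
  shows "\<phi> (K \<alpha> #> x) = \<phi> (K \<alpha> #> y)"
proof -
  let ?f = "lift G (K \<alpha>) \<phi>"
  have "A ?f = (\<lambda>x. 0)"
    by (rule ext, subst A_eq[of "{}"]) (simp_all add: XB_lift[OF _ \<alpha> \<phi>] X0 lift_0)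
  then have "?f x = ?f y"
    using L2_laplacian_A[OF test_lift[OF \<alpha> \<phi>]] xy
    by (intro L2_laplacian_0_imp_const[OF lift_continuous[OF \<alpha> \<phi>]]) auto
  then show ?thesis using xy by (simp add: lift_eq)
qed

text \<open>A vector field kills functions that are not smooth by convention.  If the pullback of \<open>\<phi>\<close> along
  a projection were not smooth, compatibility would give \<open>X i \<phi> = 0\<close> for all \<open>i\<close>, so \<open>\<phi>\<close> would be constant.
  This replaces the chain rule, and likewise for translations.\<close>

lemma up_C:
  assumes \<alpha>: "\<alpha> \<in> \<A>" and \<gamma>: "\<gamma> \<in> \<A>" "K \<gamma> \<subseteq> K \<alpha>" and \<phi>: "\<phi> \<in> C \<alpha>"
  shows "up \<alpha> \<gamma> \<phi> \<in> C \<gamma>"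
proof (rule ccontr)
  assume not: "up \<alpha> \<gamma> \<phi> \<notin> C \<gamma>"
  have "X i \<alpha> \<phi> = (\<lambda>x. 0)" if i: "i \<in> I" for i
  proof (rule lift_inj[of "K \<alpha>"])
    have "up \<alpha> \<gamma> (X i \<alpha> \<phi>) = (\<lambda>x. 0)" using X_up[OF i \<alpha> \<gamma> \<phi>] X_simps(2)[OF i \<gamma>(1) not] by simp
    then show "lift G (K \<alpha>) (X i \<alpha> \<phi>) = lift G (K \<alpha>) (\<lambda>x. 0)"
      using lift_up[OF \<alpha> \<gamma>, of "X i \<alpha> \<phi>"] by (simp add: lift_0)
  qed (use C_vanish[OF X_simps(1)[OF i \<alpha> \<phi>]] in auto)
  then have const: "\<phi> (K \<alpha> #> x) = \<phi> (K \<alpha> #> \<one>)" if "x \<in> carrier G" for x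
    using X_zero_imp_const[OF \<alpha> \<phi> _ that one_closed] by blast
  have "up \<alpha> \<gamma> \<phi> = (\<lambda>x. if x \<in> carrier (G Mod K \<gamma>) then \<phi> (K \<alpha> #> \<one>) else 0)"
  proof (rule const_eq[OF up_vanish])
    fix x assume x: "x \<in> carrier G"
    then show "up \<alpha> \<gamma> \<phi> (K \<gamma> #> x) = \<phi> (K \<alpha> #> \<one>)"
      using fun_cong[OF lift_up[OF \<alpha> \<gamma>, of \<phi>], of x] const[OF x] by (simp only: lift_eq)
  qed
  then show False using not C_const[OF \<gamma>(1)] by simp
qed

lemma B_common:
  assumes "f \<in> B" "g \<in> B"
  obtains \<gamma> \<phi> \<psi> where "\<gamma> \<in> \<A>" "\<phi> \<in> C \<gamma>" "\<psi> \<in> C \<gamma>" "f = lift G (K \<gamma>) \<phi>" "g = lift G (K \<gamma>) \<psi>"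
proof -
  obtain \<alpha> \<phi> where f: "\<alpha> \<in> \<A>" "\<phi> \<in> C \<alpha>" "f = lift G (K \<alpha>) \<phi>" using B_E[OF assms(1)] .
  obtain \<beta> \<psi> where g: "\<beta> \<in> \<A>" "\<psi> \<in> C \<beta>" "g = lift G (K \<beta>) \<psi>" using B_E[OF assms(2)] .
  obtain \<gamma> where \<gamma>: "\<gamma> \<in> \<A>" "K \<gamma> \<subseteq> K \<alpha>" "K \<gamma> \<subseteq> K \<beta>" using descending[OF f(1) g(1)] by blast
  show thesis
    by (rule that[OF \<gamma>(1) up_C[OF f(1) \<gamma>(1,2) f(2)] up_C[OF g(1) \<gamma>(1,3) g(2)]])
       (simp_all add: f(3) g(3) lift_up[OF f(1) \<gamma>(1,2)] lift_up[OF g(1) \<gamma>(1,3)])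
qed

lemma lift_ops:
  "lift G N (\<lambda>x. \<phi> x + \<psi> x) = (\<lambda>x. lift G N \<phi> x + lift G N \<psi> x)"
  "lift G N (\<lambda>x. \<phi> x * \<psi> x) = (\<lambda>x. lift G N \<phi> x * lift G N \<psi> x)"
  by (auto simp: pull_def)

lemma B_add: "f \<in> B \<Longrightarrow> g \<in> B \<Longrightarrow> (\<lambda>x. f x + g x) \<in> B"
  and B_mult: "f \<in> B \<Longrightarrow> g \<in> B \<Longrightarrow> (\<lambda>x. f x * g x) \<in> B"
  and XB_add: "i \<in> I \<Longrightarrow> f \<in> B \<Longrightarrow> g \<in> B \<Longrightarrow> XB i (\<lambda>x. f x + g x) = (\<lambda>x. XB i f x + XB i g x)"
  and XB_mult: "i \<in> I \<Longrightarrow> f \<in> B \<Longrightarrow> g \<in> B \<Longrightarrow> XB i (\<lambda>x. f x * g x) = (\<lambda>x. XB i f x * g x + f x * XB i g x)"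
proof -
  assume "f \<in> B" "g \<in> B"
  then obtain \<gamma> \<phi> \<psi> where *: "\<gamma> \<in> \<A>" "\<phi> \<in> C \<gamma>" "\<psi> \<in> C \<gamma>" "f = lift G (K \<gamma>) \<phi>" "g = lift G (K \<gamma>) \<psi>"
    by (rule B_common)
  have eq: "(\<lambda>x. f x + g x) = lift G (K \<gamma>) (\<lambda>x. \<phi> x + \<psi> x)" "(\<lambda>x. f x * g x) = lift G (K \<gamma>) (\<lambda>x. \<phi> x * \<psi> x)"
    by (simp_all only: lift_ops *(4,5))
  show "(\<lambda>x. f x + g x) \<in> B" "(\<lambda>x. f x * g x) \<in> B" unfolding eq by (intro test_lift C_add C_mult *)+
  assume i: "i \<in> I"
  show "XB i (\<lambda>x. f x + g x) = (\<lambda>x. XB i f x + XB i g x)"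
    unfolding eq XB_lift[OF i *(1) C_add[OF *(2,3)]] X_simps(3)[OF i *(1,2,3)]
    by (simp only: *(4,5) XB_lift[OF i *(1)] *(2,3) lift_ops)
  show "XB i (\<lambda>x. f x * g x) = (\<lambda>x. XB i f x * g x + f x * XB i g x)"
    unfolding eq XB_lift[OF i *(1) C_mult[OF *(2,3)]] X_simps(5)[OF i *(1,2,3)]
    by (simp only: *(4,5) XB_lift[OF i *(1)] *(2,3) lift_ops)
qed

lemma B_cmult: "f \<in> B \<Longrightarrow> (\<lambda>x. r * f x) \<in> B"
  and XB_B: "i \<in> I \<Longrightarrow> f \<in> B \<Longrightarrow> XB i f \<in> B"
  and XB_cmult: "i \<in> I \<Longrightarrow> f \<in> B \<Longrightarrow> XB i (\<lambda>x. r * f x) = (\<lambda>x. r * XB i f x)"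
  and B_continuous: "f \<in> B \<Longrightarrow> continuous_map T euclideanreal f"
  and B_vanish: "f \<in> B \<Longrightarrow> x \<notin> carrier G \<Longrightarrow> f x = 0"
proof -
  assume "f \<in> B"
  then obtain \<alpha> \<phi> where *: "\<alpha> \<in> \<A>" "\<phi> \<in> C \<alpha>" "f = lift G (K \<alpha>) \<phi>" by (rule B_E)
  have eq: "(\<lambda>x. r * f x) = lift G (K \<alpha>) (\<lambda>x. r * \<phi> x)" by (auto simp: pull_def *(3))
  show "(\<lambda>x. r * f x) \<in> B" unfolding eq by (intro test_lift C_cmult *)
  show "continuous_map T euclideanreal f" unfolding *(3) by (rule lift_continuous[OF *(1,2)])
  show "x \<notin> carrier G \<Longrightarrow> f x = 0" by (simp add: *(3) lift_eq)
  assume i: "i \<in> I"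
  show "XB i f \<in> B" unfolding *(3) XB_lift[OF i *(1,2)] by (intro test_lift X_simps i *)
  show "XB i (\<lambda>x. r * f x) = (\<lambda>x. r * XB i f x)"
    unfolding eq XB_lift[OF i *(1) C_cmult[OF *(2)]] X_simps(4)[OF i *(1,2)]
    unfolding *(3) XB_lift[OF i *(1,2)] by (auto simp: pull_def)
qed

lemma B_one: "\<exists>e\<in>B. \<forall>x\<in>carrier G. e x = 1"
proof -
  obtain \<alpha> where \<alpha>: "\<alpha> \<in> \<A>" using nonempty_index by blast
  show ?thesis
    by (rule bexI[OF _ test_lift[OF \<alpha> C_const[OF \<alpha>, of 1]]]) (simp add: pull_def carrier_Mod)
qed

lemma translate_lift:
  assumes \<alpha>: "\<alpha> \<in> \<A>" and a: "a \<in> carrier G"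
  shows "translate a (lift G (K \<alpha>) \<phi>) =
    lift G (K \<alpha>) (pull (carrier (G Mod K \<alpha>)) (\<lambda>x. (K \<alpha> #> a) \<otimes>\<^bsub>G Mod K \<alpha>\<^esub> x) \<phi>)"
proof -
  interpret normal "K \<alpha>" G by (rule kernel_normal[OF \<alpha>])
  show ?thesis using a by (auto simp: pull_def fun_eq_iff carrier_Mod rcos_sum)
qed

lemma translate_B:
  assumes f: "f \<in> B" and a: "a \<in> carrier G"
  shows "translate a f \<in> B" and "i \<in> I \<Longrightarrow> XB i (translate a f) = translate a (XB i f)"
proof -
  obtain \<alpha> \<phi> where *: "\<alpha> \<in> \<A>" "\<phi> \<in> C \<alpha>" "f = lift G (K \<alpha>) \<phi>" using B_E[OF f] .
  define H where "H = G Mod K \<alpha>"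
  let ?P = "pull (carrier H) (\<lambda>x. (K \<alpha> #> a) \<otimes>\<^bsub>H\<^esub> x)"
  have aH: "K \<alpha> #> a \<in> carrier H" using a by (auto simp: H_def carrier_Mod)
  note comm = X_simps(6)[OF _ *(1) aH[unfolded H_def] *(2), folded H_def]
  note tl = translate_lift[OF *(1) a, folded H_def]
  have PC: "?P \<phi> \<in> C \<alpha>"
  proof (rule ccontr)
    assume not: "?P \<phi> \<notin> C \<alpha>"
    have "X i \<alpha> \<phi> = (\<lambda>x. 0)" if i: "i \<in> I" for i
    proof (rule lift_inj[of "K \<alpha>"])
      have "?P (X i \<alpha> \<phi>) = (\<lambda>x. 0)" using comm[OF i] X_simps(2)[OF i *(1) not] by simp
      then have "translate a (lift G (K \<alpha>) (X i \<alpha> \<phi>)) = (\<lambda>x. 0)" by (simp add: tl lift_0)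
      then have "lift G (K \<alpha>) (X i \<alpha> \<phi>) (a \<otimes> x) = 0" if "x \<in> carrier G" for x
        using that by (auto simp: pull_def fun_eq_iff split: if_splits)
      then have "lift G (K \<alpha>) (X i \<alpha> \<phi>) (a \<otimes> (inv a \<otimes> x)) = 0" if "x \<in> carrier G" for x using that a by simp
      then show "lift G (K \<alpha>) (X i \<alpha> \<phi>) = lift G (K \<alpha>) (\<lambda>x. 0)"
        using a by (auto simp: fun_eq_iff pull_def m_assoc[symmetric])
    qed (use C_vanish[OF X_simps(1)[OF i *(1,2)]] in auto)
    then have const: "\<phi> (K \<alpha> #> x) = \<phi> (K \<alpha> #> \<one>)" if "x \<in> carrier G" for x
      using X_zero_imp_const[OF *(1,2) _ that one_closed] by blast
    have "?P \<phi> = (\<lambda>x. if x \<in> carrier H then \<phi> (K \<alpha> #> \<one>) else 0)"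
      unfolding H_def
    proof (rule const_eq)
      fix x assume x: "x \<in> carrier G"
      then show "pull (carrier (G Mod K \<alpha>)) (\<lambda>x. (K \<alpha> #> a) \<otimes>\<^bsub>G Mod K \<alpha>\<^esub> x) \<phi> (K \<alpha> #> x) = \<phi> (K \<alpha> #> \<one>)"
        using fun_cong[OF tl[of \<phi>], of x] const[of "a \<otimes> x"] a by (simp add: H_def pull_def)
    qed (simp add: pull_def)
    then show False using not C_const[OF *(1)] by (simp add: H_def)
  qed
  show "translate a f \<in> B" unfolding *(3) tl by (rule test_lift[OF *(1) PC])
  show "XB i (translate a f) = translate a (XB i f)" if i: "i \<in> I"
    unfolding *(3) tl XB_lift[OF i *(1,2)] XB_lift[OF i *(1) PC] comm[OF i] ..
qed

section \<open>Averages of left translates and invariance of the integral under the fields\<close>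

definition convex_translate :: "nat \<Rightarrow> (nat \<Rightarrow> real) \<Rightarrow> (nat \<Rightarrow> 'g) \<Rightarrow> 'g operator" where
  "convex_translate n c y f = (\<lambda>x. \<Sum>k<n. c k * translate (y k) f x)"

lemma zero_B: "(\<lambda>x. 0) \<in> B"
  using B_one B_cmult[of _ 0] by fastforce

lemma XB_sum:
  assumes "finite S" "\<And>k. k \<in> S \<Longrightarrow> f k \<in> B"
  shows "(\<lambda>x. \<Sum>k\<in>S. f k x) \<in> B" and "i \<in> I \<Longrightarrow> XB i (\<lambda>x. \<Sum>k\<in>S. f k x) = (\<lambda>x. \<Sum>k\<in>S. XB i (f k) x)"
proof -
  have "(\<lambda>x. \<Sum>k\<in>S. f k x) \<in> B \<and> (i \<in> I \<longrightarrow> XB i (\<lambda>x. \<Sum>k\<in>S. f k x) = (\<lambda>x. \<Sum>k\<in>S. XB i (f k) x))"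
    using assms by (induction S rule: finite_induct) (auto simp: zero_B XB_0 B_add XB_add)
  then show "(\<lambda>x. \<Sum>k\<in>S. f k x) \<in> B" "i \<in> I \<Longrightarrow> XB i (\<lambda>x. \<Sum>k\<in>S. f k x) = (\<lambda>x. \<Sum>k\<in>S. XB i (f k) x)"
    by simp_all
qed

lemma convex_translate_mixing:
  assumes cy: "\<And>k. k < n \<Longrightarrow> c k \<ge> 0 \<and> y k \<in> carrier G" and c1: "(\<Sum>k<n. c k) = 1"
  shows "convex_translate n c y \<in> mixing_ops \<nu> B I XB"
  unfolding mixing_ops_def mem_Collect_eq
proof (intro conjI ballI allI impI)
  fix f assume f: "f \<in> B"
  have tB: "(\<lambda>x. c k * translate (y k) f x) \<in> B" if "k \<in> {..<n}" for k
    using that cy f by (intro B_cmult translate_B) auto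
  show "convex_translate n c y f \<in> B" unfolding convex_translate_def by (rule XB_sum(1)[OF finite_lessThan tB])
  show "XB i (convex_translate n c y f) = convex_translate n c y (XB i f)" if i: "i \<in> I" for i
  proof -
    have "XB i (convex_translate n c y f) = (\<lambda>x. \<Sum>k<n. XB i (\<lambda>x. c k * translate (y k) f x) x)"
      unfolding convex_translate_def by (rule XB_sum(2)[OF finite_lessThan tB i])
    also have "\<dots> = convex_translate n c y (XB i f)"
      unfolding convex_translate_def
      by (intro ext sum.cong refl) (simp add: XB_cmult[OF i translate_B(1)[OF f]] translate_B(2)[OF f _ i] cy)
    finally show ?thesis .
  qed
  show "convex_translate n c y (\<lambda>x. f x + g x) = (\<lambda>x. convex_translate n c y f x + convex_translate n c y g x)" for g
    unfolding convex_translate_def sum.distrib[symmetric]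
    by (intro ext sum.cong refl) (simp add: pull_def distrib_left)
  fix r x assume r: "\<forall>x\<in>space \<nu>. \<bar>f x\<bar> \<le> r" and x: "x \<in> space \<nu>"
  have "\<bar>convex_translate n c y f x\<bar> \<le> (\<Sum>k<n. c k * r)"
    unfolding convex_translate_def using cy r x
    by (intro order_trans[OF sum_abs] sum_mono) (auto simp: abs_mult pull_def space_haar intro!: mult_left_mono)
  then show "\<bar>convex_translate n c y f x\<bar> \<le> r" by (simp add: sum_distrib_right[symmetric] c1)
qed

lemma convex_translate_eq:
  "x \<in> carrier G \<Longrightarrow> convex_translate n c y f x = (\<Sum>k<n. c k * f (y k \<otimes> x))"
  by (simp add: convex_translate_def pull_def)

lemma B_mixing_approx:
  assumes N: "sets N = sets (borel_sigma T)" "prob_space N" and \<Phi>: "finite \<Phi>" "\<Phi> \<subseteq> B" and e: "e > 0"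
  shows "\<exists>n c y. convex_translate n c y \<in> mixing_ops \<nu> B I XB \<and>
    (\<forall>\<phi>\<in>\<Phi>. \<forall>x\<in>space \<nu>. \<bar>convex_translate n c y \<phi> x - (\<integral>z. \<phi> (z \<otimes> x) \<partial>N)\<bar> \<le> e)"
proof -
  obtain n c y where ncy: "\<forall>k<n. c k \<ge> 0 \<and> y k \<in> carrier G" "(\<Sum>k<n. c k) = (1::real)"
    "\<forall>\<phi>\<in>\<Phi>. \<forall>x\<in>carrier G. \<bar>(\<Sum>k<n::nat. c k * \<phi> (y k \<otimes> x)) - (\<integral>z. \<phi> (z \<otimes> x) \<partial>N)\<bar> \<le> e"
    using finite_convex_approx[OF N \<Phi>(1) _ e] \<Phi>(2) B_continuous by blast
  show ?thesis
    by (intro exI[of _ n] exI[of _ c] exI[of _ y] conjI convex_translate_mixing ncy(2))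
       (use ncy in \<open>auto simp: space_haar convex_translate_eq\<close>)
qed

lemma B_bounded: "f \<in> B \<Longrightarrow> f \<in> bounded_borel \<nu>"
  by (rule bounded_borel_continuous[OF B_continuous])

lemma A_B: "f \<in> B \<Longrightarrow> A f \<in> B"
  unfolding sum_of_squares_op_def by (intro XB_sum XB_finite XB_B) auto

text \<open>The semigroup preserves integrals, being symmetric and fixing constants, so the integral
  of its generator vanishes.\<close>

lemma integral_A:
  assumes f: "f \<in> B" shows "(\<integral>x. A f x \<partial>\<nu>) = 0"
proof -
  interpret prob_space \<nu> by (rule prob_haar)
  note int = integrable_bounded_borel[OF B_bounded[OF f]] integrable_bounded_borel[OF B_bounded[OF A_B[OF f]]]
  have "\<bar>\<integral>x. A f x \<partial>\<nu>\<bar> \<le> e" if e: "e > 0" for e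
  proof -
    obtain d where d: "d > 0" "\<And>t x. 0 < t \<Longrightarrow> t < d \<Longrightarrow> x \<in> carrier G \<Longrightarrow> \<bar>heat G \<mu> t (A f) x - A f x\<bar> \<le> e"
      using heat_small_time[OF B_continuous[OF A_B[OF f]] e] by blast
    define r where "r = d / 2"
    have r: "r > 0" "r < d" using d(1) by (simp_all add: r_def)
    have le: "\<bar>heat G \<mu> r f x - f x - r * A f x\<bar> \<le> r * e" if x: "x \<in> space \<nu>" for x
    proof -
      have "\<bar>heat_op r f x - f x - r * A f x\<bar> \<le> r * e"
        by (rule heat_op_generator[OF B_continuous[OF f] B_continuous[OF A_B[OF f]] L2_laplacian_A[OF f] _ _ x])
           (use r d e in \<open>auto simp: heat_op_def space_haar\<close>)
      then show ?thesis using r by (simp add: heat_op_def)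
    qed
    interpret U: prob_space "\<mu> r" by (rule prob[OF r(1)])
    have hint: "integrable \<nu> (heat G \<mu> r f)" by (rule integrable_bounded_borel[OF heat_bounded[OF r(1) B_bounded[OF f]]])
    have "(\<integral>x. heat G \<mu> r f x \<partial>\<nu>) = (\<integral>x. f x \<partial>\<nu>)"
      using heat_symmetric[OF r(1) B_bounded[OF f] bounded_borel_const[of 1]] by (simp add: heat_def U.prob_space)
    then have "r * \<bar>\<integral>x. A f x \<partial>\<nu>\<bar> = \<bar>\<integral>x. heat G \<mu> r f x - f x - r * A f x \<partial>\<nu>\<bar>"
      using hint int r by (simp add: abs_mult)
    also have "\<dots> \<le> (\<integral>x. \<bar>heat G \<mu> r f x - f x - r * A f x\<bar> \<partial>\<nu>)" by (rule integral_abs_bound)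
    also have "\<dots> \<le> (\<integral>x. r * e \<partial>\<nu>)" using hint int le by (intro integral_mono) auto
    finally show ?thesis using r by (simp add: prob_space)
  qed
  then have "\<bar>\<integral>x. A f x \<partial>\<nu>\<bar> \<le> 0" by (rule field_le_epsilon) simp
  then show ?thesis by simp
qed

lemma XB_square:
  assumes i: "i \<in> I" and f: "f \<in> B"
  shows "XB i (\<lambda>x. f x * f x) = (\<lambda>x. 2 * (XB i f x * f x))"
    and "XB i (XB i (\<lambda>x. f x * f x)) x = 2 * (f x * XB i (XB i f) x) + 2 * (XB i f x)\<^sup>2"
proof -
  show eq: "XB i (\<lambda>x. f x * f x) = (\<lambda>x. 2 * (XB i f x * f x))" by (simp add: XB_mult[OF i f f] mult.commute)
  show "XB i (XB i (\<lambda>x. f x * f x)) x = 2 * (f x * XB i (XB i f) x) + 2 * (XB i f x)\<^sup>2"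
    unfolding eq XB_cmult[OF i B_mult[OF XB_B[OF i f] f]] XB_mult[OF i XB_B[OF i f] f]
    by (simp add: power2_eq_square)
qed

lemma energy_identity:
  assumes f: "f \<in> B" and S: "finite S" "S \<subseteq> I" "\<And>i. i \<in> I - S \<Longrightarrow> XB i f = (\<lambda>x. 0)"
  shows "(\<Sum>i\<in>S. \<integral>x. (XB i f x)\<^sup>2 \<partial>\<nu>) = - (\<integral>x. f x * A f x \<partial>\<nu>)"
proof -
  interpret prob_space \<nu> by (rule prob_haar)
  have int: "integrable \<nu> g" if "g \<in> B" for g by (rule integrable_bounded_borel[OF B_bounded[OF that]])
  have i2: "integrable \<nu> (\<lambda>x. (XB i f x)\<^sup>2)" if "i \<in> S" for i
    using that S(2) f unfolding power2_eq_square by (intro int B_mult XB_B) auto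
  have "A (\<lambda>x. f x * f x) = (\<lambda>x. 2 * (f x * A f x) + 2 * (\<Sum>i\<in>S. (XB i f x)\<^sup>2))"
  proof
    fix x
    have "A (\<lambda>x. f x * f x) x = (\<Sum>i\<in>S. XB i (XB i (\<lambda>x. f x * f x)) x)"
      using S f by (intro A_eq) (auto simp: XB_square(1))
    also have "\<dots> = (\<Sum>i\<in>S. 2 * (f x * XB i (XB i f) x) + 2 * (XB i f x)\<^sup>2)"
      using S(2) f by (intro sum.cong refl XB_square(2)) auto
    also have "\<dots> = 2 * (f x * A f x) + 2 * (\<Sum>i\<in>S. (XB i f x)\<^sup>2)"
      using A_eq[OF S, of x] by (simp add: sum.distrib sum_distrib_left)
    finally show "A (\<lambda>x. f x * f x) x = 2 * (f x * A f x) + 2 * (\<Sum>i\<in>S. (XB i f x)\<^sup>2)" .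
  qed
  then have "0 = (\<integral>x. 2 * (f x * A f x) + 2 * (\<Sum>i\<in>S. (XB i f x)\<^sup>2) \<partial>\<nu>)"
    using integral_A[OF B_mult[OF f f]] by simp
  also have "\<dots> = 2 * (\<integral>x. f x * A f x \<partial>\<nu>) + 2 * (\<Sum>i\<in>S. \<integral>x. (XB i f x)\<^sup>2 \<partial>\<nu>)"
    using int[OF B_mult[OF f A_B[OF f]]] i2 by simp
  finally show ?thesis by simp
qed

lemma convex_translate_A:
  assumes m: "convex_translate n c y \<in> mixing_ops \<nu> B I XB" and f: "f \<in> B" and x: "x \<in> carrier G"
  shows "A (convex_translate n c y f) x = convex_translate n c y (A f) x"
proof -
  define S where "S = {i \<in> I. XB i f \<noteq> (\<lambda>x. 0)}"
  have S: "finite S" "S \<subseteq> I" "\<And>i. i \<in> I - S \<Longrightarrow> XB i f = (\<lambda>x. 0)" using XB_finite[OF f] by (auto simp: S_def)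
  have comm: "XB i (convex_translate n c y g) = convex_translate n c y (XB i g)" if "i \<in> I" "g \<in> B" for i g
    using m that by (simp add: mixing_ops_def)
  have "A (convex_translate n c y f) x = (\<Sum>i\<in>S. XB i (XB i (convex_translate n c y f)) x)"
  proof (rule A_eq[OF S(1,2)])
    fix i assume i: "i \<in> I - S"
    then have "XB i (convex_translate n c y f) = convex_translate n c y (\<lambda>x. 0)" using comm[OF _ f] S(3) by simp
    also have "\<dots> = (\<lambda>x. 0)" by (simp add: convex_translate_def pull_def fun_eq_iff)
    finally show "XB i (convex_translate n c y f) = (\<lambda>x. 0)" .
  qed
  also have "\<dots> = (\<Sum>i\<in>S. convex_translate n c y (XB i (XB i f)) x)"
    using S(2) f by (intro sum.cong refl) (auto simp: comm XB_B)
  also have "\<dots> = convex_translate n c y (A f) x"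
  proof -
    have AS: "A f z = (\<Sum>i\<in>S. XB i (XB i f) z)" for z by (rule A_eq[OF S])
    show ?thesis unfolding convex_translate_eq[OF x] AS by (subst sum.swap) (simp add: sum_distrib_left)
  qed
  finally show ?thesis .
qed

text \<open>Averaging \<open>f\<close> over left translations approximates the mean of \<open>f\<close> uniformly, and hence
  \<open>XB i f\<close> becomes nearly constant, while the energy of the averages is nearly the mean of \<open>A f\<close>, which is \<open>0\<close>.\<close>

lemma integral_XB:
  assumes i: "i \<in> I" and f: "f \<in> B" shows "(\<integral>x. XB i f x \<partial>\<nu>) = 0"
proof -
  interpret prob_space \<nu> by (rule prob_haar)
  have int: "integrable \<nu> g" if "g \<in> B" for g by (rule integrable_bounded_borel[OF B_bounded[OF that]])
  define m where "m = (\<integral>x. XB i f x \<partial>\<nu>)"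
  obtain r where r: "r \<ge> 0" "\<And>x. x \<in> space \<nu> \<Longrightarrow> \<bar>f x\<bar> \<le> r" using bounded_borelE[OF B_bounded[OF f]] by blast
  have mean: "(\<integral>z. g (z \<otimes> x) \<partial>\<nu>) = (\<integral>z. g z \<partial>\<nu>)" if "g \<in> B" "x \<in> space \<nu>" for g x
    using that by (intro integral_right_translation continuous_measurable B_continuous) (simp_all add: space_haar)
  have main: "m\<^sup>2 \<le> 2 * e\<^sup>2 + 2 * (r * e)" if e: "e > 0" for e
  proof -
    \<comment> \<open>The averaging measure is Haar measure itself, so the limit of the averages is
      a mean value, independent of the point.\<close>
    have "\<exists>n c y. convex_translate n c y \<in> mixing_ops \<nu> B I XB \<and>
      (\<forall>\<phi>\<in>{XB i f, A f}. \<forall>x\<in>space \<nu>. \<bar>convex_translate n c y \<phi> x - (\<integral>z. \<phi> (z \<otimes> x) \<partial>\<nu>)\<bar> \<le> e)"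
      by (rule B_mixing_approx[OF sets_haar prob_haar _ _ e]) (use XB_B[OF i f] A_B[OF f] in auto)
    then obtain n c y where mix: "convex_translate n c y \<in> mixing_ops \<nu> B I XB"
      and near: "\<And>\<phi> x. \<phi> \<in> {XB i f, A f} \<Longrightarrow> x \<in> space \<nu> \<Longrightarrow> \<bar>convex_translate n c y \<phi> x - (\<integral>z. \<phi> (z \<otimes> x) \<partial>\<nu>)\<bar> \<le> e"
      by blast
    define g where "g = convex_translate n c y f"
    have gB: "g \<in> B" using mix f by (simp add: g_def mixing_ops_def)
    have Xg: "XB i g = convex_translate n c y (XB i f)" using mix f i by (simp add: g_def mixing_ops_def)
    have Xm: "\<bar>XB i g x - m\<bar> \<le> e" if "x \<in> space \<nu>" for x
      using near[of "XB i f" x] that mean[OF XB_B[OF i f] that] by (simp add: Xg m_def)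
    have Ag: "\<bar>A g x\<bar> \<le> e" if "x \<in> space \<nu>" for x
      using near[of "A f" x] that mean[OF A_B[OF f] that] convex_translate_A[OF mix f, of x] integral_A[OF f]
      by (simp add: g_def space_haar)
    have gr: "\<bar>g x\<bar> \<le> r" if "x \<in> space \<nu>" for x
      using mix f r(2) that by (simp add: g_def mixing_ops_def)
    define S where "S = insert i {j \<in> I. XB j g \<noteq> (\<lambda>x. 0)}"
    have S: "finite S" "S \<subseteq> I" "\<And>j. j \<in> I - S \<Longrightarrow> XB j g = (\<lambda>x. 0)" using XB_finite[OF gB] i by (auto simp: S_def)
    have "(\<integral>x. (XB i g x)\<^sup>2 \<partial>\<nu>) \<le> (\<Sum>j\<in>S. \<integral>x. (XB j g x)\<^sup>2 \<partial>\<nu>)"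
      by (rule member_le_sum[OF _ _ S(1)]) (auto simp: S_def)
    also have "\<dots> \<le> \<bar>\<integral>x. g x * A g x \<partial>\<nu>\<bar>" using energy_identity[OF gB S] by simp
    also have "\<dots> \<le> (\<integral>x. \<bar>g x * A g x\<bar> \<partial>\<nu>)" by (rule integral_abs_bound)
    also have "\<dots> \<le> (\<integral>x. r * e \<partial>\<nu>)"
    proof (rule integral_mono)
      show "integrable \<nu> (\<lambda>x. \<bar>g x * A g x\<bar>)" by (intro integrable_abs int B_mult A_B gB)
    qed (use Ag gr r(1) in \<open>auto simp: abs_mult intro!: mult_mono\<close>)
    finally have E: "(\<integral>x. (XB i g x)\<^sup>2 \<partial>\<nu>) \<le> r * e" by (simp add: prob_space)
    have i2: "integrable \<nu> (\<lambda>x. (XB i g x)\<^sup>2)" unfolding power2_eq_square by (intro int B_mult XB_B i gB)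
    have "m\<^sup>2 = (\<integral>x. m\<^sup>2 \<partial>\<nu>)" by (simp add: prob_space)
    also have "\<dots> \<le> (\<integral>x. 2 * e\<^sup>2 + 2 * (XB i g x)\<^sup>2 \<partial>\<nu>)"
    proof (rule integral_mono)
      fix x assume x: "x \<in> space \<nu>"
      have "(m - XB i g x)\<^sup>2 \<le> e\<^sup>2" using Xm[OF x] by (simp add: abs_le_square_iff[symmetric] abs_minus_commute)
      moreover have "m\<^sup>2 + (m - 2 * XB i g x)\<^sup>2 = 2 * (m - XB i g x)\<^sup>2 + 2 * (XB i g x)\<^sup>2"
        by (simp add: power2_eq_square algebra_simps)
      moreover have "0 \<le> (m - 2 * XB i g x)\<^sup>2" by simp
      ultimately show "m\<^sup>2 \<le> 2 * e\<^sup>2 + 2 * (XB i g x)\<^sup>2" by linarith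
    qed (use i2 in auto)
    also have "\<dots> = 2 * e\<^sup>2 + 2 * (\<integral>x. (XB i g x)\<^sup>2 \<partial>\<nu>)" using i2 by (simp add: prob_space)
    finally show ?thesis using E by simp
  qed
  have "((\<lambda>e. 2 * e\<^sup>2 + 2 * (r * e)) \<longlongrightarrow> 2 * 0\<^sup>2 + 2 * (r * 0)) (at_right 0)" by (intro tendsto_intros)
  then have "m\<^sup>2 \<le> 2 * 0\<^sup>2 + 2 * (r * 0)"
    by (rule tendsto_lowerbound) (use main in \<open>auto simp: eventually_at_right_field intro: exI[of _ 1]\<close>)
  then show ?thesis by (simp add: m_def)
qed

lemma derivation_semigroup: "derivation_semigroup \<nu> B I XB heat_op"
proof -
  interpret prob_space \<nu> by (rule prob_haar)
  show ?thesis
  proof unfold_locales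
    fix f assume f: "f \<in> B" and z: "(\<integral>x. f x * f x \<partial>\<nu>) = 0"
    \<comment> \<open>A continuous function that vanishes almost everywhere is 0 on the group, and
      off the group test functions vanish by normalisation; hence equality of functions on the whole
      type.\<close>
    have c: "continuous_map T euclideanreal (\<lambda>x. f x * f x)" by (rule B_continuous[OF B_mult[OF f f]])
    have "AE x in \<nu>. f x * f x = 0"
      using z integrable_bounded_borel[OF B_bounded[OF B_mult[OF f f]]]
      by (subst (asm) integral_nonneg_eq_0_iff_AE) auto
    then have "AE x in \<nu>. f x * f x \<le> 0" by eventually_elim simp
    from continuous_AE_le[OF c this] have "f x = 0" if "x \<in> carrier G" for x
      using that by (metis mult_eq_0_iff order_antisym zero_le_square)
    then show "f = (\<lambda>x. 0)" using B_vanish[OF f] by blast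
  next
    fix f :: "'g \<Rightarrow> real" and t c :: real and x
    assume f: "f \<in> bounded_borel \<nu>" and t: "0 \<le> t" and c: "\<And>x. x \<in> space \<nu> \<Longrightarrow> \<bar>f x\<bar> \<le> c" and x: "x \<in> space \<nu>"
    show "\<bar>heat_op t f x\<bar> \<le> c" using heat_abs_le[OF _ f c x] c[OF x] by (simp add: heat_op_def)
  next
    fix f g :: "'g \<Rightarrow> real" and t :: real
    assume "f \<in> bounded_borel \<nu>" "g \<in> bounded_borel \<nu>"
    then show "(\<integral>x. heat_op t f x * g x \<partial>\<nu>) = (\<integral>x. f x * heat_op t g x \<partial>\<nu>)"
      by (simp add: heat_op_def heat_symmetric)
  next
    fix p t :: real and f g assume "1 < p" "f \<in> Lp \<nu> p" "g \<in> Lp \<nu> p"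
    then show "AE x in \<nu>. heat_op t (\<lambda>x. f x - g x) x = heat_op t f x - heat_op t g x"
      by (simp add: heat_op_def heat_Lp_diff)
  next
    fix \<Phi> and t :: real assume \<Phi>: "finite \<Phi>" "\<Phi> \<subseteq> B" and t: "t \<ge> 0"
    show "\<exists>C. (\<forall>n::nat. C n \<in> mixing_ops \<nu> B I XB) \<and> (\<forall>\<phi>\<in>\<Phi>. \<forall>x\<in>space \<nu>. (\<lambda>n. C n \<phi> x) \<longlonglongrightarrow> heat_op t \<phi> x)"
    proof (cases "t = 0")
      case True
      \<comment> \<open>At time 0 the identity is itself a mixing operator.\<close>
      then show ?thesis by (intro exI[of _ "\<lambda>n f. f"]) (auto simp: mixing_ops_def heat_op_def)
    next
      case False
      then have t: "t > 0" using t by simp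
      have "\<exists>C. C \<in> mixing_ops \<nu> B I XB \<and> (\<forall>\<phi>\<in>\<Phi>. \<forall>x\<in>space \<nu>. \<bar>C \<phi> x - heat_op t \<phi> x\<bar> \<le> inverse (real (Suc n)))" for n
      proof -
        obtain k c y where *: "convex_translate k c y \<in> mixing_ops \<nu> B I XB"
          "\<forall>\<phi>\<in>\<Phi>. \<forall>x\<in>space \<nu>. \<bar>convex_translate k c y \<phi> x - (\<integral>z. \<phi> (z \<otimes> x) \<partial>\<mu> t)\<bar> \<le> inverse (real (Suc n))"
          using B_mixing_approx[OF sets_eq[OF t] prob[OF t] \<Phi>, of "inverse (real (Suc n))"] by auto
        moreover have "heat_op t \<phi> x = (\<integral>z. \<phi> (z \<otimes> x) \<partial>\<mu> t)" if "\<phi> \<in> \<Phi>" "x \<in> space \<nu>" for \<phi> x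
          using heat_central[OF t continuous_measurable[OF B_continuous]] that \<Phi>(2) t
          by (auto simp: heat_op_def space_haar)
        ultimately show ?thesis by (intro exI[of _ "convex_translate k c y"]) auto
      qed
      then obtain C where C: "\<And>n. C n \<in> mixing_ops \<nu> B I XB"
        "\<And>n \<phi> x. \<phi> \<in> \<Phi> \<Longrightarrow> x \<in> space \<nu> \<Longrightarrow> \<bar>C n \<phi> x - heat_op t \<phi> x\<bar> \<le> inverse (real (Suc n))" by metis
      have "(\<lambda>n. C n \<phi> x) \<longlonglongrightarrow> heat_op t \<phi> x" if "\<phi> \<in> \<Phi>" "x \<in> space \<nu>" for \<phi> x
        by (rule Lim_transform2[OF tendsto_const], rule Lim_null_comparison[OF _ LIMSEQ_inverse_real_of_nat])
           (use C(2)[OF that] in \<open>auto simp: abs_minus_commute\<close>)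
      then show ?thesis using C(1) by blast
    qed
  next
    fix f r e x
    assume "f \<in> B" "0 \<le> r" "\<And>s x. 0 \<le> s \<Longrightarrow> s \<le> r \<Longrightarrow> x \<in> space \<nu> \<Longrightarrow> \<bar>heat_op s (A f) x - A f x\<bar> \<le> e" "x \<in> space \<nu>"
    then show "\<bar>heat_op r f x - f x - r * A f x\<bar> \<le> r * e"
      by (intro heat_op_generator[OF B_continuous B_continuous[OF A_B] L2_laplacian_A])
  qed (use B_one in \<open>auto simp: B_bounded space_haar B_add B_cmult B_mult XB_B XB_add XB_cmult XB_mult XB_finite integral_XB
        heat_op_bounded heat_op_linear heat_op_0 heat_op_semigroup heat_op_Lp\<close>)
qed

lemma L2_laplacian_unique:
  assumes g: "L2_laplacian G \<nu> \<mu> f g" and h: "L2_laplacian G \<nu> \<mu> f h"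
  shows "AE x in \<nu>. g x = h x"
proof -
  have fg: "f \<in> Lp \<nu> 2" "g \<in> Lp \<nu> 2" "h \<in> Lp \<nu> 2" using g h by (auto simp: L2_laplacian_def)
  define q where "q t x = (heat G \<mu> t f x - f x) / t" for t x
  have qL: "q t \<in> Lp \<nu> 2" if "t > 0" for t
  proof -
    have "(\<lambda>x. 1 / t * (heat G \<mu> t f x - f x)) \<in> Lp \<nu> 2" by (intro Lp_cmult Lp_diff heat_Lp that fg) auto
    then show ?thesis by (simp add: q_def[abs_def])
  qed
  have lim: "((\<lambda>t. pnorm \<nu> 2 (\<lambda>x. q t x - - k x)) \<longlongrightarrow> 0) (at_right 0)" if k: "L2_laplacian G \<nu> \<mu> f k" for k
  proof (rule tendsto_pnorm)
    have kL: "k \<in> Lp \<nu> 2" using k by (simp add: L2_laplacian_def)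
    have "(\<lambda>x. q t x - - k x) \<in> Lp \<nu> 2" if "0 < t" for t by (intro Lp_diff qL Lp_minus kL that) simp
    then show "\<forall>\<^sub>F t in at_right 0. (\<lambda>x. q t x - - k x) \<in> Lp \<nu> 2" by (rule eventually_at_rightI[OF _ zero_less_one]) simp
    show "((\<lambda>t. Lp_norm \<nu> 2 (\<lambda>x. q t x - - k x)) \<longlongrightarrow> 0) (at_right 0)" using k by (simp add: L2_laplacian_def q_def)
  qed
  have "pnorm \<nu> 2 (\<lambda>x. - g x - - h x) \<le> 0 + 0"
  proof (rule tendsto_lowerbound[OF tendsto_add[OF lim[OF g] lim[OF h]]])
    show "\<forall>\<^sub>F t in at_right 0. pnorm \<nu> 2 (\<lambda>x. - g x - - h x)
        \<le> pnorm \<nu> 2 (\<lambda>x. q t x - - g x) + pnorm \<nu> 2 (\<lambda>x. q t x - - h x)"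
      using eventually_at_right_less
    proof eventually_elim
      fix t :: real assume t: "0 < t"
      have "pnorm \<nu> 2 (\<lambda>x. - g x - - h x) \<le> pnorm \<nu> 2 (\<lambda>x. - g x - q t x) + pnorm \<nu> 2 (\<lambda>x. q t x - - h x)"
        by (intro pnorm_triangle_diff Lp_minus fg qL t) simp
      then show "pnorm \<nu> 2 (\<lambda>x. - g x - - h x) \<le> pnorm \<nu> 2 (\<lambda>x. q t x - - g x) + pnorm \<nu> 2 (\<lambda>x. q t x - - h x)"
        by (simp only: pnorm_diff_commute[of \<nu> 2 "\<lambda>x. - g x" "q t"])
    qed
  qed simp
  then have "pnorm \<nu> 2 (\<lambda>x. - g x - - h x) = 0"
    using pnorm_nonneg[of \<nu> 2 "\<lambda>x. - g x - - h x"] by (simp only: add_0 order_antisym)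
  moreover have "(\<lambda>x. - g x - - h x) \<in> Lp \<nu> 2" by (intro Lp_diff Lp_minus fg) simp
  ultimately have "AE x in \<nu>. - g x - - h x = 0" by (intro pnorm_eq_0_AE[where p = 2]) auto
  then show ?thesis by eventually_elim simp
qed

text \<open>The Laplacians in the approximating sequence are determined up to null sets only, so
  they are traded for the values of \<open>- A\<close>, which are test functions. The sign in the
  conclusion reflects that \<open>A\<close> is minus L.\<close>

lemma Lp_laplacian_closure:
  assumes p: "1 < p" and Lu: "Lp_laplacian G \<nu> \<mu> B p u f"
  shows "derivation_semigroup.graph_closure \<nu> B p A u (\<lambda>x. - f x)"
proof -
  interpret D: derivation_semigroup \<nu> B I XB heat_op by (rule derivation_semigroup)
  obtain \<phi> g where \<phi>: "\<And>k::nat. \<phi> k \<in> B" "\<And>k. L2_laplacian G \<nu> \<mu> (\<phi> k) (g k)"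
    "(\<lambda>k. Lp_norm \<nu> p (\<lambda>x. \<phi> k x - u x)) \<longlonglongrightarrow> 0" "(\<lambda>k. Lp_norm \<nu> p (\<lambda>x. g k x - f x)) \<longlonglongrightarrow> 0"
    and uf: "u \<in> Lp \<nu> p" "f \<in> Lp \<nu> p"
    using Lu unfolding Lp_laplacian_def by blast
  have BL: "h \<in> Lp \<nu> p" if "h \<in> B" for h using p by (intro D.Lp_bounded_borel B_bounded that) simp
  have g: "g k \<in> Lp \<nu> p" "pnorm \<nu> p (\<lambda>x. g k x - f x) = pnorm \<nu> p (\<lambda>x. A (\<phi> k) x - - f x)" for k
  proof -
    have ae: "AE x in \<nu>. - A (\<phi> k) x = g k x" by (rule L2_laplacian_unique[OF L2_laplacian_A[OF \<phi>(1)] \<phi>(2)])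
    have gm: "g k \<in> borel_measurable \<nu>" using \<phi>(2)[of k] Lp_measurable by (auto simp: L2_laplacian_def)
    show "g k \<in> Lp \<nu> p" by (rule Lp_cong_AE(1)[OF _ gm ae]) (intro Lp_minus BL A_B \<phi>)
    have d: "(\<lambda>x. - A (\<phi> k) x - f x) \<in> Lp \<nu> p" using p by (intro Lp_diff Lp_minus BL A_B \<phi> uf) simp
    have "pnorm \<nu> p (\<lambda>x. g k x - f x) = pnorm \<nu> p (\<lambda>x. - A (\<phi> k) x - f x)"
      by (rule Lp_cong_AE(2)[OF d]) (use gm Lp_measurable[OF uf(2)] ae in auto)
    also have "\<dots> = pnorm \<nu> p (\<lambda>x. - (- A (\<phi> k) x - f x))" by (rule Lp_minus(2)[OF d, symmetric])
    also have "(\<lambda>x. - (- A (\<phi> k) x - f x)) = (\<lambda>x. A (\<phi> k) x - - f x)" by auto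
    finally show "pnorm \<nu> p (\<lambda>x. g k x - f x) = pnorm \<nu> p (\<lambda>x. A (\<phi> k) x - - f x)" .
  qed
  note conv = tendsto_pnorm[OF always_eventually[OF allI[OF Lp_diff(1)[OF _ _ p]]]]
  have "(\<lambda>k. pnorm \<nu> p (\<lambda>x. A (\<phi> k) x - - f x)) \<longlonglongrightarrow> 0"
    using conv[OF g(1) uf(2) \<phi>(4)] by (simp only: g(2))
  moreover have "(\<lambda>k. pnorm \<nu> p (\<lambda>x. \<phi> k x - u x)) \<longlonglongrightarrow> 0" by (rule conv[OF BL[OF \<phi>(1)] uf(1) \<phi>(3)])
  ultimately show ?thesis
    unfolding D.graph_closure_def using uf Lp_minus(1)[OF uf(2)] \<phi>(1) by blast
qed

end

theorem theorem6p8: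
  fixes G :: "('g, 'm) monoid_scheme" and T :: "'g topology"
    and \<A> :: "'i set" and K :: "'i \<Rightarrow> 'g set" and M :: "'i \<Rightarrow> 'g set mfd"
    and \<nu> :: "'g measure" and \<mu> :: "real \<Rightarrow> 'g measure"
    and I :: "nat set" and X :: "nat \<Rightarrow> 'i \<Rightarrow> 'g set operator"
    and B :: "('g \<Rightarrow> real) set" and XB :: "nat \<Rightarrow> 'g operator"
    and \<theta> p :: real and u f :: "'g \<Rightarrow> real"
  defines "B \<equiv> test_functions G \<A> K M"
    and "XB \<equiv> \<lambda>i. lie_action G \<A> K M (X i)"
  assumes system: "lie_projective_system G T \<A> K M"
    and haar: "normalized_haar_measure G T \<nu>"
    and semigroup: "symmetric_central_gaussian_semigroup G T \<mu>"
    and index: "I = {1..} \<or> (\<exists>N. I = {1..N})"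
    and basis: "projective_basis G \<A> K M I X"
    and sum_of_squares: "\<And>\<phi>. \<phi> \<in> B \<Longrightarrow>
          L2_laplacian G \<nu> \<mu> \<phi> (\<lambda>x. - (\<Sum>\<^sub>\<infinity>i\<in>I. XB i (XB i \<phi>) x))"
    and "\<theta> > 0" and "1 < p"
    and Lu: "Lp_laplacian G \<nu> \<mu> B p u f"
    and f: "f \<in> lipschitz_space G \<nu> \<mu> B p \<theta>"
  shows "lipschitz_seminorm G \<nu> \<mu> p (\<theta> + 2) u < \<infinity> \<and>
         (\<forall>i\<in>I. lipschitz_seminorm_distr G \<nu> \<mu> B p (\<theta> + 1)
                  (distr_deriv (XB i) (regular_distr \<nu> u)) < \<infinity>) \<and>
         (\<forall>i\<in>I. \<forall>j\<in>I. lipschitz_seminorm_distr G \<nu> \<mu> B p \<theta>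
                  (distr_deriv (XB i) (distr_deriv (XB j) (regular_distr \<nu> u))) < \<infinity>) \<and>
         (\<lambda>m. lipschitz_seminorm_distr G \<nu> \<mu> B p \<theta>
            (\<lambda>\<phi>. regular_distr \<nu> f \<phi> +
               (\<Sum>i\<in>{i\<in>I. i \<le> m}. distr_deriv (XB i) (distr_deriv (XB i) (regular_distr \<nu> u)) \<phi>)))
          \<longlonglongrightarrow> 0"
proof -
  interpret S: lie_projective_system G T \<A> K M by (rule system)
  interpret symmetric_central_gaussian_semigroup G T \<mu> by (rule semigroup)
  interpret L: lie_gaussian G T \<A> K M \<nu> \<mu> I X
    by unfold_locales
       (use S.compact S.metrizable haar basis sum_of_squares in \<open>simp_all add: B_def XB_def\<close>)
  interpret D: derivation_semigroup \<nu> B I XB L.heat_op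
    unfolding B_def XB_def by (rule L.derivation_semigroup)
  have "D.graph_closure p (sum_of_squares_op I XB) u (\<lambda>x. - f x)"
    using L.Lp_laplacian_closure[OF \<open>1 < p\<close>] Lu unfolding B_def XB_def by blast
  note reg = D.regularity[OF L.heat_op_pos \<open>1 < p\<close> \<open>\<theta> > 0\<close> this f]
  show ?thesis by (intro conjI ballI reg)
qed

end
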